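(* Let $K$ be a field of characteristic zero, let $(A,d,\pi_n,* )$ be an involutive $A_\infty$-algebra over $K$ and let $\varrho\in\{1,-1\}$. Then the dihedral homology ${}^{\varrho}HD(A)$ is isomorphic to the homology of the chain complex $(M(\overline{{}^{\varrho}\mathcal{M}(A)}),b)$, where, writing $X={}^{\varrho}\mathcal{M}(A)$, $$M(\overline{X})_n=\overline{X}_n\big/\left(\mathrm{Im}(1-\overline{T}_n)+\mathrm{Im}(1-\overline{R}_n)\right),\quad n\geqslant 0,$$ with differential induced by $b:\overline{X}_n\to\overline{X}_{n-1}$.
   Context: All modules and maps are $K$-modules and $K$-linear maps; $|a|=q$ means $a\in A_q$; tensor products of maps are evaluated with the Koszul sign $(f\otimes g)(x\otimes y)=(-1)^{|g||x|}f(x)\otimes g(y)$. **$A_\infty$-algebras.** An $A_\infty$-algebra $(A,d,\pi_n)$ is a differential module $A=\{A_n\}_{n\geqslant0}$, $d:A_\bullet\to A_{\bullet-1}$, with maps $\pi_n:(A^{\otimes(n+2)})_\bullet\to A_{\bullet+n}$, $n\geqslant0$, such that for all $n\geqslant1$ $$d(\pi_{n-1})=\sum_{m=1}^{n-1}\sum_{t=1}^{m+1}(-1)^{t(n-m)+n+1}\pi_{m-1}(\underbrace{1\otimes\dots\otimes1}_{t-1}\otimes\pi_{n-m-1}\otimes\underbrace{1\otimes\dots\otimes1}_{m-t+1}),$$ where $d(\pi_{n-1})=d\pi_{n-1}+(-1)^n\pi_{n-1}d$. An involutive $A_\infty$-algebra $(A,d,\pi_n,* )$ is an $A_\infty$-algebra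 with an automorphism of graded modules $*:A_\bullet\to A_\bullet$, $a\mapsto a^*$, such that $a^{**}=a$, $d(a^* )=d(a)^*$ and, for $n\geqslant0$, $$\pi_n(a_0\otimes\dots\otimes a_{n+1})^*=(-1)^{\varepsilon}\pi_n(a_{n+1}^*\otimes a_n^*\otimes\dots\otimes a_0^* ),\quad\varepsilon=\frac{n(n+1)}2+\sum_{0\leqslant i<j\leqslant n+1}|a_i||a_j|.$$ **The dihedral module with $\infty$-simplicial faces $X={}^{\varrho}\mathcal{M}(A)$.** Put $X_{n,m}=(A^{\otimes(n+1)})_m$, $n,m\geqslant0$, with the usual tensor differential $d(a_0\otimes\dots\otimes a_n)=\sum_{i=0}^n(-1)^{|a_0|+\dots+|a_{i-1}|}a_0\otimes\dots\otimes d(a_i)\otimes\dots\otimes a_n$, and $$t_n(a_0\otimes\dots\otimes a_n)=(-1)^{|a_n|(|a_0|+\dots+|a_{n-1}|)}a_n\otimes a_0\otimes\dots\otimes a_{n-1},$$ $$r_n(a_0\otimes\dots\otimes a_n)=\varrho(-1)^{\sum_{0<i<j\leqslant n}|a_i||a_j|}a_0^*\otimes a_n^*\otimes a_{n-1}^*\otimes\dots\otimes a_1^*.$$ For $1\leqslant k\leqslant n$ and $0\leqslant i_1<\dots<i_k\leqslant n$ define $\partial_{(i_1,\dots,i_k)}:X_{n,p}\to X_{n-k,p+k-1}$ by: $(-1)^{k(p-1)}1^{\otimes j}\otimes\pi_{k-1}\otimes1^{\otimes(n-k-j)}$ if $(i_1,\dots,i_k)=(j,j+1,\dots,j+k-1)$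 with $0\leqslant j\leqslant n-k$; $(-1)^{q(k-1)}\partial_{(0,1,\dots,k-1)}t_n^q$ if $(i_1,\dots,i_k)=(0,1,\dots,k-q-1,n-q+1,n-q+2,\dots,n)$ with $1\leqslant q\leqslant k$; and $0$ otherwise. **Associated complexes.** For $q=0,1$ put $d_q^{\,0}=d$, $d_q^{\,k}=\sum_{0\leqslant i_1<\dots<i_k\leqslant n-q}(-1)^{i_1+\dots+i_k}\partial_{(i_1,\dots,i_k)}:X_{n,\bullet}\to X_{n-k,\bullet+k-1}$ for $1\leqslant k\leqslant n$, and $d_q^{\,k}=0$ on $X_{n,\bullet}$ for $k>n$. Put $\overline{X}_n=\bigoplus_{k=0}^nX_{k,n-k}$, $b=\sum_{i\geqslant 0} d_0^{\,i}$, $b'=\sum_{i\geqslant 0} d_1^{\,i}:\overline{X}_n\to\overline{X}_{n-1}$ (both are differentials). Let $T_n=(-1)^nt_n$, $N_n=1+T_n+\dots+T_n^n$, $R_n=(-1)^{n(n+1)/2}r_n$ on $X_{n,\bullet}$, and let $\overline{T}_n,\overline{N}_n,\overline{R}_n:\overline{X}_n\to\overline{X}_n$ act on the summand $X_{k,n-k}$ as $T_k,N_k,R_k$ respectively. One has $b(1-\overline{T}_n)=(1-\overline{T}_{n-1})b'$ and $b\overline{R}_n=\overline{R}_{n-1}b$, so $(M(\overline X),b)$ is well defined. **Dihedral homology.** Let $C(\overline{X})_{n,m}=\overline{X}_n$, $n,m\geqslant0$, be the chain bicomplex with $\delta_1:C_{n,m}\to C_{n-1,m}$ equal to $b$ for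 $m$ even and $-b'$ for $m$ odd, and $\delta_2:C_{n,m}\to C_{n,m-1}$ equal to $1-\overline{T}_n$ for $m$ odd and $\overline{N}_n$ for $m$ even ($m>0$). The group $\mathbb{Z}_2=\{1,\vartheta\mid\vartheta^2=1\}$ acts on it by $\vartheta(x)=(-1)^k\overline{R}_n(x)$ if $x\in C(\overline X)_{n,2k}$ and $\vartheta(x)=(-1)^{k+1}\overline{R}_n\overline{T}_n(x)$ if $x\in C(\overline X)_{n,2k+1}$. The dihedral homology ${}^{\varrho}HD(A)$ is the hyperhomology $H(\mathbb{Z}_2;(C(\overline{X}),\delta_1,\delta_2))$, i.e. the homology of the total complex of the triple complex $\mathcal{P}(\mathbb{Z}_2)\otimes_{K[\mathbb{Z}_2]}C(\overline{X})$ with differentials $\delta_1,\delta_2$ and $\delta_3=(-1)^{n+m}d\otimes1$ on $\mathcal{P}(\mathbb{Z}_2)_l\otimes_{K[\mathbb{Z}_2]} C(\overline X)_{n,m}$, where $(\mathcal{P}(\mathbb{Z}_2),d)$ is any projective resolution of the trivial $K[\mathbb{Z}_2]$-module $K$ (for instance $K[\mathbb{Z}_2]\xleftarrow{1-\vartheta}K[\mathbb{Z}_2]\xleftarrow{1+\vartheta}K[\mathbb{Z}_2]\xleftarrow{1-\vartheta}\cdots$). *)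

theory Defs
  imports "HOL-Algebra.Module" "HOL-Algebra.AbelCoset"
begin

section \<open>Modules\<close>

text \<open>
  The record type of modules inherits the multiplication and unit fields of rings. They play no
  role for modules and are left undefined below.
\<close>

definition mod_hom ::
  "('r, 'c) ring_scheme \<Rightarrow> ('r, 'm, 'e) module_scheme \<Rightarrow> ('r, 'n, 'f) module_scheme \<Rightarrow> ('m \<Rightarrow> 'n) set"
  where "mod_hom R M N =
    {f \<in> carrier M \<rightarrow> carrier N.
      (\<forall>x\<in>carrier M. \<forall>y\<in>carrier M. f (x \<oplus>\<^bsub>M\<^esub> y) = f x \<oplus>\<^bsub>N\<^esub> f y) \<and>
      (\<forall>a\<in>carrier R. \<forall>x\<in>carrier M. f (a \<odot>\<^bsub>M\<^esub> x) = a \<odot>\<^bsub>N\<^esub> f x)}"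

definition mod_isomorphic ::
  "('r, 'c) ring_scheme \<Rightarrow> ('r, 'm, 'e) module_scheme \<Rightarrow> ('r, 'n, 'f) module_scheme \<Rightarrow> bool"
  where "mod_isomorphic R M N \<longleftrightarrow> (\<exists>f\<in>mod_hom R M N. bij_betw f (carrier M) (carrier N))"

text \<open>\<open>msign M e x\<close> is \<open>(-1)\<^sup>e x\<close>.\<close>

definition msign :: "('r, 'm, 'e) module_scheme \<Rightarrow> int \<Rightarrow> 'm \<Rightarrow> 'm"
  where "msign M e x = (if even e then x else \<ominus>\<^bsub>M\<^esub> x)"

definition quot_module :: "('r, 'm, 'e) module_scheme \<Rightarrow> 'm set \<Rightarrow> ('r, 'm set) module"
  where "quot_module M N =
    \<lparr>carrier = a_rcosets\<^bsub>M\<^esub> N, monoid.mult = undefined, one = undefined,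
     zero = N, add = set_add M, smult = (\<lambda>a C. \<Union>x\<in>C. N +>\<^bsub>M\<^esub> (a \<odot>\<^bsub>M\<^esub> x))\<rparr>"

text \<open>The map out of a quotient induced by \<open>f\<close>, with values in the quotient of \<open>M'\<close> by \<open>N'\<close>.\<close>

definition quot_map ::
  "('r, 'n, 'e) module_scheme \<Rightarrow> 'n set \<Rightarrow> ('m \<Rightarrow> 'n) \<Rightarrow> 'm set \<Rightarrow> 'n set"
  where "quot_map M' N' f C = (\<Union>x\<in>C. N' +>\<^bsub>M'\<^esub> f x)"

definition mod_span :: "('r, 'c) ring_scheme \<Rightarrow> ('r, 'm, 'e) module_scheme \<Rightarrow> 'm set \<Rightarrow> 'm set"
  where "mod_span R M S = \<Inter>{N. submodule N R M \<and> S \<subseteq> N}"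

text \<open>Only used for finite index sets, where the direct product is the direct sum.\<close>

definition dsum_module :: "'i set \<Rightarrow> ('i \<Rightarrow> ('r, 'm, 'e) module_scheme) \<Rightarrow> ('r, 'i \<Rightarrow> 'm) module"
  where "dsum_module I M =
    \<lparr>carrier = (\<Pi>\<^sub>E i\<in>I. carrier (M i)), monoid.mult = undefined, one = undefined,
     zero = (\<lambda>i\<in>I. \<zero>\<^bsub>M i\<^esub>), add = (\<lambda>x y. \<lambda>i\<in>I. x i \<oplus>\<^bsub>M i\<^esub> y i),
     smult = (\<lambda>a x. \<lambda>i\<in>I. a \<odot>\<^bsub>M i\<^esub> x i)\<rparr>"

definition free_module :: "('r, 'c) ring_scheme \<Rightarrow> 's set \<Rightarrow> ('r, 's \<Rightarrow> 'r) module"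
  where "free_module R S =
    \<lparr>carrier = {f. (\<forall>s\<in>S. f s \<in> carrier R) \<and> (\<forall>s. s \<notin> S \<longrightarrow> f s = \<zero>\<^bsub>R\<^esub>) \<and> finite {s. f s \<noteq> \<zero>\<^bsub>R\<^esub>}},
     monoid.mult = undefined, one = undefined,
     zero = (\<lambda>s. \<zero>\<^bsub>R\<^esub>), add = (\<lambda>f g s. f s \<oplus>\<^bsub>R\<^esub> g s), smult = (\<lambda>a f s. a \<otimes>\<^bsub>R\<^esub> f s)\<rparr>"

definition free_gen :: "('r, 'c) ring_scheme \<Rightarrow> 's \<Rightarrow> 's \<Rightarrow> 'r"
  where "free_gen R s = (\<lambda>x. if x = s then \<one>\<^bsub>R\<^esub> else \<zero>\<^bsub>R\<^esub>)"

text \<open>Modules given by generators \<open>S\<close> and relations \<open>Q\<close>, and linear maps given on generators.\<close>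

definition pres_module ::
  "('r, 'c) ring_scheme \<Rightarrow> 's set \<Rightarrow> ('s \<Rightarrow> 'r) set \<Rightarrow> ('r, ('s \<Rightarrow> 'r) set) module"
  where "pres_module R S Q = quot_module (free_module R S) (mod_span R (free_module R S) Q)"

definition pres_gen :: "('r, 'c) ring_scheme \<Rightarrow> 's set \<Rightarrow> ('s \<Rightarrow> 'r) set \<Rightarrow> 's \<Rightarrow> ('s \<Rightarrow> 'r) set"
  where "pres_gen R S Q s = mod_span R (free_module R S) Q +>\<^bsub>free_module R S\<^esub> free_gen R s"

definition pres_lift ::
  "('r, 'c) ring_scheme \<Rightarrow> 's set \<Rightarrow> ('s \<Rightarrow> 'r) set \<Rightarrow> ('r, 'n, 'e) module_scheme \<Rightarrow> ('s \<Rightarrow> 'n)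
    \<Rightarrow> ('s \<Rightarrow> 'r) set \<Rightarrow> 'n"
  where "pres_lift R S Q N \<phi> =
    (THE f. f \<in> mod_hom R (pres_module R S Q) N \<and> f \<in> extensional (carrier (pres_module R S Q)) \<and>
            (\<forall>s\<in>S. f (pres_gen R S Q s) = \<phi> s))"

text \<open>Tensor product of two modules over a commutative ring.\<close>

definition tensor_rels ::
  "('r, 'c) ring_scheme \<Rightarrow> ('r, 'm, 'e) module_scheme \<Rightarrow> ('r, 'n, 'f) module_scheme \<Rightarrow> ('m \<times> 'n \<Rightarrow> 'r) set"
  where "tensor_rels R M N =
    (let F = free_module R (carrier M \<times> carrier N); g = free_gen R in
      {g (x \<oplus>\<^bsub>M\<^esub> x', y) \<ominus>\<^bsub>F\<^esub> (g (x, y) \<oplus>\<^bsub>F\<^esub> g (x', y)) | x x' y.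
         x \<in> carrier M \<and> x' \<in> carrier M \<and> y \<in> carrier N} \<union>
      {g (x, y \<oplus>\<^bsub>N\<^esub> y') \<ominus>\<^bsub>F\<^esub> (g (x, y) \<oplus>\<^bsub>F\<^esub> g (x, y')) | x y y'.
         x \<in> carrier M \<and> y \<in> carrier N \<and> y' \<in> carrier N} \<union>
      {g (a \<odot>\<^bsub>M\<^esub> x, y) \<ominus>\<^bsub>F\<^esub> (a \<odot>\<^bsub>F\<^esub> g (x, y)) | a x y.
         a \<in> carrier R \<and> x \<in> carrier M \<and> y \<in> carrier N} \<union>
      {g (x, a \<odot>\<^bsub>N\<^esub> y) \<ominus>\<^bsub>F\<^esub> (a \<odot>\<^bsub>F\<^esub> g (x, y)) | a x y.
         a \<in> carrier R \<and> x \<in> carrier M \<and> y \<in> carrier N})"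

definition tensor_module ::
  "('r, 'c) ring_scheme \<Rightarrow> ('r, 'm, 'e) module_scheme \<Rightarrow> ('r, 'n, 'f) module_scheme
    \<Rightarrow> ('r, ('m \<times> 'n \<Rightarrow> 'r) set) module"
  where "tensor_module R M N = pres_module R (carrier M \<times> carrier N) (tensor_rels R M N)"

text \<open>\<open>tensor_map R M N M' N' f g\<close> is the map \<open>f \<otimes> g\<close> from \<open>M \<otimes> N\<close> to \<open>M' \<otimes> N'\<close>.\<close>

definition tensor_map ::
  "('r, 'c) ring_scheme \<Rightarrow> ('r, 'm) module \<Rightarrow> ('r, 'n) module \<Rightarrow> ('r, 'm') module \<Rightarrow> ('r, 'n') module
    \<Rightarrow> ('m \<Rightarrow> 'm') \<Rightarrow> ('n \<Rightarrow> 'n') \<Rightarrow> ('m \<times> 'n \<Rightarrow> 'r) set \<Rightarrow> ('m' \<times> 'n' \<Rightarrow> 'r) set"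
  where "tensor_map R M N M' N' f g =
    pres_lift R (carrier M \<times> carrier N) (tensor_rels R M N) (tensor_module R M' N')
      (\<lambda>(x, y). pres_gen R (carrier M' \<times> carrier N') (tensor_rels R M' N') (f x, g y))"

text \<open>
  Projective means direct summand of a free module. Bases in the type of elements of \<open>P\<close> suffice,
  since \<open>P\<close> is a quotient of the free module on its own elements.
\<close>

definition projective_module :: "('r, 'c) ring_scheme \<Rightarrow> ('r, 'p) module \<Rightarrow> bool"
  where "projective_module R P \<longleftrightarrow> module R P \<and>
    (\<exists>S :: 'p set. \<exists>i\<in>mod_hom R P (free_module R S). \<exists>p\<in>mod_hom R (free_module R S) P.
       \<forall>x\<in>carrier P. p (i x) = x)"

definition projective_resolution ::
  "('r, 'c) ring_scheme \<Rightarrow> ('r, 'm) module \<Rightarrow> (nat \<Rightarrow> ('r, 'p) module) \<Rightarrow> (nat \<Rightarrow> 'p \<Rightarrow> 'p) \<Rightarrow> bool"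
  where "projective_resolution R M P dP \<longleftrightarrow>
    (\<forall>l. projective_module R (P l)) \<and>
    (\<forall>l. dP (Suc l) \<in> mod_hom R (P (Suc l)) (P l)) \<and>
    (\<exists>\<epsilon>\<in>mod_hom R (P 0) M.
       \<epsilon> ` carrier (P 0) = carrier M \<and>
       dP 1 ` carrier (P 1) = {x \<in> carrier (P 0). \<epsilon> x = \<zero>\<^bsub>M\<^esub>}) \<and>
    (\<forall>l. dP (Suc (Suc l)) ` carrier (P (Suc (Suc l))) =
       {x \<in> carrier (P (Suc l)). dP (Suc l) x = \<zero>\<^bsub>P l\<^esub>})"

text \<open>
  Homology of a nonnegatively graded complex with differentials \<open>D n : C n \<rightarrow> C (n - 1)\<close> for
  \<open>n > 0\<close>; the differential on \<open>C 0\<close> is zero, whatever \<open>D 0\<close> is.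
\<close>

definition homology :: "(nat \<Rightarrow> ('r, 'm) module) \<Rightarrow> (nat \<Rightarrow> 'm \<Rightarrow> 'm) \<Rightarrow> nat \<Rightarrow> ('r, 'm set) module"
  where "homology C D n =
    quot_module ((C n)\<lparr>carrier := {x \<in> carrier (C n). n > 0 \<longrightarrow> D n x = \<zero>\<^bsub>C (n - 1)\<^esub>}\<rparr>)
      (D (Suc n) ` carrier (C (Suc n)))"


section \<open>Hyperhomology of the group of order two\<close>

text \<open>The group ring of \<open>{1, \<theta>}\<close>: the pair \<open>(a, b)\<close> stands for \<open>a + b \<theta>\<close>.\<close>

definition Z2_ring :: "'k ring \<Rightarrow> ('k \<times> 'k) ring"
  where "Z2_ring K =
    \<lparr>carrier = carrier K \<times> carrier K,
     monoid.mult = (\<lambda>(a, b) (a', b'). ((a \<otimes>\<^bsub>K\<^esub> a') \<oplus>\<^bsub>K\<^esub> (b \<otimes>\<^bsub>K\<^esub> b'), (a \<otimes>\<^bsub>K\<^esub> b') \<oplus>\<^bsub>K\<^esub> (b \<otimes>\<^bsub>K\<^esub> a'))),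
     one = (\<one>\<^bsub>K\<^esub>, \<zero>\<^bsub>K\<^esub>), zero = (\<zero>\<^bsub>K\<^esub>, \<zero>\<^bsub>K\<^esub>),
     add = (\<lambda>(a, b) (a', b'). (a \<oplus>\<^bsub>K\<^esub> a', b \<oplus>\<^bsub>K\<^esub> b'))\<rparr>"

text \<open>The \<open>K\<close>-module \<open>M\<close> as a module over the group ring, where \<open>\<theta>\<close> acts by the given involution.\<close>

definition Z2_module :: "('k, 'm) module \<Rightarrow> ('m \<Rightarrow> 'm) \<Rightarrow> ('k \<times> 'k, 'm) module"
  where "Z2_module M \<theta> =
    \<lparr>carrier = carrier M, monoid.mult = undefined, one = undefined, zero = \<zero>\<^bsub>M\<^esub>, add = add M,
     smult = (\<lambda>(a, b) x. (a \<odot>\<^bsub>M\<^esub> x) \<oplus>\<^bsub>M\<^esub> (b \<odot>\<^bsub>M\<^esub> \<theta> x))\<rparr>"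

definition Z2_trivial :: "'k ring \<Rightarrow> ('k \<times> 'k, 'k) module"
  where "Z2_trivial K =
    Z2_module \<lparr>carrier = carrier K, monoid.mult = monoid.mult K, one = one K, zero = zero K,
               add = add K, smult = monoid.mult K\<rparr> (\<lambda>x. x)"

definition Z2_restrict :: "'k ring \<Rightarrow> ('k \<times> 'k, 'm) module \<Rightarrow> ('k, 'm) module"
  where "Z2_restrict K M =
    \<lparr>carrier = carrier M, monoid.mult = undefined, one = undefined, zero = \<zero>\<^bsub>M\<^esub>, add = add M,
     smult = (\<lambda>a x. (a, \<zero>\<^bsub>K\<^esub>) \<odot>\<^bsub>M\<^esub> x)\<rparr>"

text \<open>
  \<open>C n m\<close> is a first quadrant bicomplex of modules over the group ring, with
  \<open>\<delta>1 n m : C n m \<rightarrow> C (n - 1) m\<close> and \<open>\<delta>2 n m : C n m \<rightarrow> C n (m - 1)\<close>.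
\<close>

definition triple_cx ::
  "'k ring \<Rightarrow> (nat \<Rightarrow> ('k \<times> 'k, 'p) module) \<Rightarrow> (nat \<Rightarrow> nat \<Rightarrow> ('k \<times> 'k, 'c) module)
    \<Rightarrow> nat \<times> nat \<times> nat \<Rightarrow> ('k, ('p \<times> 'c \<Rightarrow> 'k \<times> 'k) set) module"
  where "triple_cx K P C = (\<lambda>(l, n, m). Z2_restrict K (tensor_module (Z2_ring K) (P l) (C n m)))"

definition total_cx ::
  "'k ring \<Rightarrow> (nat \<Rightarrow> ('k \<times> 'k, 'p) module) \<Rightarrow> (nat \<Rightarrow> nat \<Rightarrow> ('k \<times> 'k, 'c) module)
    \<Rightarrow> nat \<Rightarrow> ('k, nat \<times> nat \<times> nat \<Rightarrow> ('p \<times> 'c \<Rightarrow> 'k \<times> 'k) set) module"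
  where "total_cx K P C N = dsum_module {(l, n, m). l + n + m = N} (triple_cx K P C)"

definition total_diff ::
  "'k ring \<Rightarrow> (nat \<Rightarrow> ('k \<times> 'k, 'p) module) \<Rightarrow> (nat \<Rightarrow> 'p \<Rightarrow> 'p)
    \<Rightarrow> (nat \<Rightarrow> nat \<Rightarrow> ('k \<times> 'k, 'c) module) \<Rightarrow> (nat \<Rightarrow> nat \<Rightarrow> 'c \<Rightarrow> 'c) \<Rightarrow> (nat \<Rightarrow> nat \<Rightarrow> 'c \<Rightarrow> 'c)
    \<Rightarrow> nat \<Rightarrow> (nat \<times> nat \<times> nat \<Rightarrow> ('p \<times> 'c \<Rightarrow> 'k \<times> 'k) set)
    \<Rightarrow> nat \<times> nat \<times> nat \<Rightarrow> ('p \<times> 'c \<Rightarrow> 'k \<times> 'k) set"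
  where "total_diff K P dP C \<delta>1 \<delta>2 N x =
    (\<lambda>(l, n, m) \<in> {(l, n, m). l + n + m = N - 1}.
      let R = Z2_ring K; E = triple_cx K P C (l, n, m) in
        tensor_map R (P l) (C (Suc n) m) (P l) (C n m) (\<lambda>p. p) (\<delta>1 (Suc n) m) (x (l, Suc n, m))
        \<oplus>\<^bsub>E\<^esub>
        tensor_map R (P l) (C n (Suc m)) (P l) (C n m) (\<lambda>p. p) (\<delta>2 n (Suc m)) (x (l, n, Suc m))
        \<oplus>\<^bsub>E\<^esub>
        msign E (int n + int m)
          (tensor_map R (P (Suc l)) (C n m) (P l) (C n m) (dP (Suc l)) (\<lambda>c. c) (x (Suc l, n, m))))"

definition hyperhomology ::
  "'k ring \<Rightarrow> (nat \<Rightarrow> ('k \<times> 'k, 'p) module) \<Rightarrow> (nat \<Rightarrow> 'p \<Rightarrow> 'p)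
    \<Rightarrow> (nat \<Rightarrow> nat \<Rightarrow> ('k \<times> 'k, 'c) module) \<Rightarrow> (nat \<Rightarrow> nat \<Rightarrow> 'c \<Rightarrow> 'c) \<Rightarrow> (nat \<Rightarrow> nat \<Rightarrow> 'c \<Rightarrow> 'c)
    \<Rightarrow> nat \<Rightarrow> ('k, (nat \<times> nat \<times> nat \<Rightarrow> ('p \<times> 'c \<Rightarrow> 'k \<times> 'k) set) set) module"
  where "hyperhomology K P dP C \<delta>1 \<delta>2 =
    homology (total_cx K P C) (total_diff K P dP C \<delta>1 \<delta>2)"


section \<open>Differential modules and their tensor powers\<close>

text \<open>
  The grading is indexed by the integers, with zero modules in negative degrees. The homogeneous
  components \<open>A q\<close> may overlap as sets, so a homogeneous element is written together with its degree,
  as a pair \<open>(q, a)\<close>.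
\<close>

type_synonym ('k, 'a) tens = "((int \<times> 'a) list \<Rightarrow> 'k) set"

locale dg_module = K?: cring K
  for K :: "'k ring" (structure) +
  fixes A :: "int \<Rightarrow> ('k, 'a) module" and d :: "int \<Rightarrow> 'a \<Rightarrow> 'a"
  assumes A_module: "module K (A q)"
    and A_neg: "q < 0 \<Longrightarrow> carrier (A q) = {\<zero>\<^bsub>A q\<^esub>}"
    and d_hom: "d q \<in> mod_hom K (A q) (A (q - 1))"
    and d_d: "a \<in> carrier (A q) \<Longrightarrow> d (q - 1) (d q a) = \<zero>\<^bsub>A (q - 2)\<^esub>"
begin

definition wdeg :: "(int \<times> 'a) list \<Rightarrow> int"
  where "wdeg w = sum_list (map fst w)"

definition words :: "nat \<Rightarrow> int \<Rightarrow> (int \<times> 'a) list set"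
  where "words l m = {w. length w = l \<and> wdeg w = m \<and> (\<forall>(q, a)\<in>set w. a \<in> carrier (A q))}"

definition multilinear_rels :: "nat \<Rightarrow> int \<Rightarrow> ((int \<times> 'a) list \<Rightarrow> 'k) set"
  where "multilinear_rels l m =
    (let F = free_module K (words l m); g = free_gen K in
      {g (u @ (q, x \<oplus>\<^bsub>A q\<^esub> y) # v) \<ominus>\<^bsub>F\<^esub> (g (u @ (q, x) # v) \<oplus>\<^bsub>F\<^esub> g (u @ (q, y) # v)) | u q x y v.
         u @ (q, x) # v \<in> words l m \<and> u @ (q, y) # v \<in> words l m} \<union>
      {g (u @ (q, c \<odot>\<^bsub>A q\<^esub> x) # v) \<ominus>\<^bsub>F\<^esub> (c \<odot>\<^bsub>F\<^esub> g (u @ (q, x) # v)) | u q c x v.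
         c \<in> carrier K \<and> u @ (q, x) # v \<in> words l m})"

text \<open>The component of degree \<open>m\<close> of the \<open>l\<close>-fold tensor power of \<open>A\<close>.\<close>

definition tpow :: "nat \<Rightarrow> int \<Rightarrow> ('k, ('k, 'a) tens) module"
  where "tpow l m = pres_module K (words l m) (multilinear_rels l m)"

text \<open>The pure tensor \<open>a\<^sub>0 \<otimes> \<dots> \<otimes> a\<^sub>n\<close> of a word of homogeneous elements.\<close>

definition pure :: "(int \<times> 'a) list \<Rightarrow> ('k, 'a) tens"
  where "pure w =
    pres_gen K (words (length w) (wdeg w)) (multilinear_rels (length w) (wdeg w)) w"

text \<open>The linear map on \<open>tpow l m\<close> with the given values on pure tensors.\<close>

definition tpow_lift ::
  "nat \<Rightarrow> int \<Rightarrow> ('k, 'n, 'e) module_scheme \<Rightarrow> ((int \<times> 'a) list \<Rightarrow> 'n) \<Rightarrow> ('k, 'a) tens \<Rightarrow> 'n"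
  where "tpow_lift l m N \<phi> = pres_lift K (words l m) (multilinear_rels l m) N \<phi>"

definition X :: "nat \<Rightarrow> int \<Rightarrow> ('k, ('k, 'a) tens) module"
  where "X n m = tpow (n + 1) m"

definition dX :: "nat \<Rightarrow> int \<Rightarrow> ('k, 'a) tens \<Rightarrow> ('k, 'a) tens"
  where "dX n m = tpow_lift (n + 1) m (X n (m - 1))
    (\<lambda>w. \<Oplus>\<^bsub>X n (m - 1)\<^esub>i\<in>{0..n}. msign (X n (m - 1)) (wdeg (take i w))
      (pure (w[i := (fst (w ! i) - 1, d (fst (w ! i)) (snd (w ! i)))])))"

end


section \<open>Involutive A-infinity algebras\<close>

text \<open>\<open>pi n m\<close> is the restriction of the operation \<open>\<pi>\<^sub>n\<close> to the tensors of degree \<open>m\<close>.\<close>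

locale A_infinity_operations = dg_module K A d
  for K :: "'k ring" (structure) and A :: "int \<Rightarrow> ('k, 'a) module" and d :: "int \<Rightarrow> 'a \<Rightarrow> 'a" +
  fixes pi :: "nat \<Rightarrow> int \<Rightarrow> ('k, 'a) tens \<Rightarrow> 'a"
  assumes pi_hom: "pi n m \<in> mod_hom K (tpow (n + 2) m) (A (m + int n))"
begin

text \<open>
  For \<open>1 \<le> k\<close> and \<open>j + k \<le> n\<close>, this is \<open>1 \<otimes> \<dots> \<otimes> 1 \<otimes> \<pi>\<^sub>k\<^sub>-\<^sub>1 \<otimes> 1 \<otimes> \<dots> \<otimes> 1\<close> from \<open>X n m\<close> to
  \<open>X (n - k) (m + k - 1)\<close>, with \<open>j\<close> factors \<open>1\<close> on the left and \<open>n - k - j\<close> on the right. Moving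
  \<open>\<pi>\<^sub>k\<^sub>-\<^sub>1\<close>, which has degree \<open>k - 1\<close>, past the first \<open>j\<close> factors produces the Koszul sign.
\<close>

definition one_pi_one :: "nat \<Rightarrow> nat \<Rightarrow> nat \<Rightarrow> int \<Rightarrow> ('k, 'a) tens \<Rightarrow> ('k, 'a) tens"
  where "one_pi_one k j n m = tpow_lift (n + 1) m (X (n - k) (m + int k - 1))
    (\<lambda>w. let u = take (k + 1) (drop j w) in
      msign (X (n - k) (m + int k - 1)) ((int k - 1) * wdeg (take j w))
        (pure (take j w @ (wdeg u + int k - 1, pi (k - 1) (wdeg u) (pure u)) # drop (j + k + 1) w)))"

end

locale A_infinity_algebra = A_infinity_operations +
  assumes A_infinity_relation:
    "\<lbrakk>n \<ge> 1; x \<in> carrier (X n p)\<rbrakk> \<Longrightarrow>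
      d (p + int n - 1) (pi (n - 1) p x)
        \<oplus>\<^bsub>A (p + int n - 2)\<^esub> msign (A (p + int n - 2)) (int n) (pi (n - 1) (p - 1) (dX n p x))
      = (\<Oplus>\<^bsub>A (p + int n - 2)\<^esub>m\<in>{1..n - 1}. \<Oplus>\<^bsub>A (p + int n - 2)\<^esub>t\<in>{1..m + 1}.
          msign (A (p + int n - 2)) (int t * (int n - int m) + int n + 1)
            (pi (m - 1) (p + int (n - m) - 1) (one_pi_one (n - m) (t - 1) n p x)))"

locale involutive_A_infinity_algebra = A_infinity_algebra K A d pi
  for K :: "'k ring" (structure) and A :: "int \<Rightarrow> ('k, 'a) module" and d :: "int \<Rightarrow> 'a \<Rightarrow> 'a"
    and pi :: "nat \<Rightarrow> int \<Rightarrow> ('k, 'a) tens \<Rightarrow> 'a" +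
  fixes star :: "int \<Rightarrow> 'a \<Rightarrow> 'a"
  assumes star_hom: "star q \<in> mod_hom K (A q) (A q)"
    and star_star: "a \<in> carrier (A q) \<Longrightarrow> star q (star q a) = a"
    and d_star: "a \<in> carrier (A q) \<Longrightarrow> d q (star q a) = star (q - 1) (d q a)"
    and pi_star: "w \<in> words (n + 2) m \<Longrightarrow>
      star (m + int n) (pi n m (pure w)) =
        msign (A (m + int n))
          (int (n * (n + 1) div 2) + (\<Sum>j\<in>{0..n + 1}. \<Sum>i\<in>{0..<j}. fst (w ! i) * fst (w ! j)))
          (pi n m (pure (rev (map (\<lambda>(q, a). (q, star q a)) w))))"
begin


section \<open>The dihedral module with infinity-simplicial faces\<close>

definition t :: "nat \<Rightarrow> int \<Rightarrow> ('k, 'a) tens \<Rightarrow> ('k, 'a) tens"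
  where "t n m = tpow_lift (n + 1) m (X n m)
    (\<lambda>w. msign (X n m) (fst (last w) * wdeg (butlast w)) (pure (last w # butlast w)))"

definition r :: "'k \<Rightarrow> nat \<Rightarrow> int \<Rightarrow> ('k, 'a) tens \<Rightarrow> ('k, 'a) tens"
  where "r \<rho> n m = tpow_lift (n + 1) m (X n m)
    (\<lambda>w. let w' = map (\<lambda>(q, a). (q, star q a)) w in
      \<rho> \<odot>\<^bsub>X n m\<^esub> msign (X n m) (\<Sum>j\<in>{1..n}. \<Sum>i\<in>{1..<j}. fst (w ! i) * fst (w ! j))
        (pure (hd w' # rev (tl w'))))"

text \<open>
  The index tuple \<open>(i\<^sub>1 < \<dots> < i\<^sub>k)\<close> is given as the set \<open>I\<close> of its entries. For \<open>1 \<le> k \<le> n\<close> the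
  two shapes of \<open>I\<close> exclude each other and determine \<open>j\<close> and \<open>q\<close>.
\<close>

definition face :: "nat \<Rightarrow> int \<Rightarrow> nat set \<Rightarrow> ('k, 'a) tens \<Rightarrow> ('k, 'a) tens"
  where "face n p I x =
    (let k = card I; Y = X (n - k) (p + int k - 1);
         block = (\<lambda>j y. msign Y (int k * (p - 1)) (one_pi_one k j n p y));
         consecutive = (\<lambda>j. j + k \<le> n \<and> I = {j..<j + k});
         cyclic = (\<lambda>q. 1 \<le> q \<and> q \<le> k \<and> I = {0..<k - q} \<union> {n - q + 1..n})
     in if \<exists>j. consecutive j then block (THE j. consecutive j) x
        else if \<exists>q. cyclic q then
          (let q = (THE q. cyclic q) in msign Y (int q * (int k - 1)) (block 0 ((t n p ^^ q) x)))
        else \<zero>\<^bsub>Y\<^esub>)"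

definition dk :: "nat \<Rightarrow> nat \<Rightarrow> nat \<Rightarrow> int \<Rightarrow> ('k, 'a) tens \<Rightarrow> ('k, 'a) tens"
  where "dk q k n p x =
    (if k = 0 then dX n p x
     else if k \<le> n then
       (\<Oplus>\<^bsub>X (n - k) (p + int k - 1)\<^esub>I\<in>{I. card I = k \<and> I \<subseteq> {i. i + q \<le> n}}.
          msign (X (n - k) (p + int k - 1)) (int (\<Sum>I)) (face n p I x))
     else \<zero>\<^bsub>X (n - k) (p + int k - 1)\<^esub>)"

definition T :: "nat \<Rightarrow> int \<Rightarrow> ('k, 'a) tens \<Rightarrow> ('k, 'a) tens"
  where "T n m x = msign (X n m) (int n) (t n m x)"

definition N :: "nat \<Rightarrow> int \<Rightarrow> ('k, 'a) tens \<Rightarrow> ('k, 'a) tens"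
  where "N n m x = (\<Oplus>\<^bsub>X n m\<^esub>i\<in>{0..n}. (T n m ^^ i) x)"

definition R :: "'k \<Rightarrow> nat \<Rightarrow> int \<Rightarrow> ('k, 'a) tens \<Rightarrow> ('k, 'a) tens"
  where "R \<rho> n m x = msign (X n m) (int (n * (n + 1) div 2)) (r \<rho> n m x)"


section \<open>Associated complexes and dihedral homology\<close>

definition Xbar :: "nat \<Rightarrow> ('k, nat \<Rightarrow> ('k, 'a) tens) module"
  where "Xbar n = dsum_module {0..n} (\<lambda>k. X k (int n - int k))"

text \<open>
  \<open>b_diff 0\<close> is the differential \<open>b\<close> and \<open>b_diff 1\<close> is \<open>b'\<close>, from \<open>Xbar n\<close> to \<open>Xbar (n - 1)\<close> for
  \<open>n > 0\<close>. The component in \<open>X j (n - 1 - j)\<close> collects the contributions of \<open>d\<^sub>q\<^sup>i\<close> from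
  \<open>X (j + i) (n - j - i)\<close>.
\<close>

definition b_diff :: "nat \<Rightarrow> nat \<Rightarrow> (nat \<Rightarrow> ('k, 'a) tens) \<Rightarrow> nat \<Rightarrow> ('k, 'a) tens"
  where "b_diff q n x =
    (\<lambda>j\<in>{0..n - 1}. \<Oplus>\<^bsub>X j (int n - 1 - int j)\<^esub>i\<in>{0..n - j}.
       dk q i (j + i) (int n - int (j + i)) (x (j + i)))"

definition Tbar :: "nat \<Rightarrow> (nat \<Rightarrow> ('k, 'a) tens) \<Rightarrow> nat \<Rightarrow> ('k, 'a) tens"
  where "Tbar n x = (\<lambda>k\<in>{0..n}. T k (int n - int k) (x k))"

definition Nbar :: "nat \<Rightarrow> (nat \<Rightarrow> ('k, 'a) tens) \<Rightarrow> nat \<Rightarrow> ('k, 'a) tens"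
  where "Nbar n x = (\<lambda>k\<in>{0..n}. N k (int n - int k) (x k))"

definition Rbar :: "'k \<Rightarrow> nat \<Rightarrow> (nat \<Rightarrow> ('k, 'a) tens) \<Rightarrow> nat \<Rightarrow> ('k, 'a) tens"
  where "Rbar \<rho> n x = (\<lambda>k\<in>{0..n}. R \<rho> k (int n - int k) (x k))"

definition delta1 :: "nat \<Rightarrow> nat \<Rightarrow> (nat \<Rightarrow> ('k, 'a) tens) \<Rightarrow> nat \<Rightarrow> ('k, 'a) tens"
  where "delta1 n m x = (if even m then b_diff 0 n x else \<ominus>\<^bsub>Xbar (n - 1)\<^esub> b_diff 1 n x)"

definition delta2 :: "nat \<Rightarrow> nat \<Rightarrow> (nat \<Rightarrow> ('k, 'a) tens) \<Rightarrow> nat \<Rightarrow> ('k, 'a) tens"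
  where "delta2 n m x = (if odd m then x \<ominus>\<^bsub>Xbar n\<^esub> Tbar n x else Nbar n x)"

definition theta :: "'k \<Rightarrow> nat \<Rightarrow> nat \<Rightarrow> (nat \<Rightarrow> ('k, 'a) tens) \<Rightarrow> nat \<Rightarrow> ('k, 'a) tens"
  where "theta \<rho> n m x =
    (if even m then msign (Xbar n) (int (m div 2)) (Rbar \<rho> n x)
     else msign (Xbar n) (int (m div 2) + 1) (Rbar \<rho> n (Tbar n x)))"

definition C :: "'k \<Rightarrow> nat \<Rightarrow> nat \<Rightarrow> ('k \<times> 'k, nat \<Rightarrow> ('k, 'a) tens) module"
  where "C \<rho> n m = Z2_module (Xbar n) (theta \<rho> n m)"

text \<open>Dihedral homology computed with the resolution \<open>(P, dP)\<close> of the trivial module.\<close>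

definition HD ::
  "'k \<Rightarrow> (nat \<Rightarrow> ('k \<times> 'k, 'p) module) \<Rightarrow> (nat \<Rightarrow> 'p \<Rightarrow> 'p) \<Rightarrow> nat \<Rightarrow>
    ('k, (nat \<times> nat \<times> nat \<Rightarrow> ('p \<times> (nat \<Rightarrow> ('k, 'a) tens) \<Rightarrow> 'k \<times> 'k) set) set) module"
  where "HD \<rho> P dP = hyperhomology K P dP (C \<rho>) delta1 delta2"

definition M_denom :: "'k \<Rightarrow> nat \<Rightarrow> (nat \<Rightarrow> ('k, 'a) tens) set"
  where "M_denom \<rho> n =
    ((\<lambda>x. x \<ominus>\<^bsub>Xbar n\<^esub> Tbar n x) ` carrier (Xbar n))
      <+>\<^bsub>Xbar n\<^esub> ((\<lambda>x. x \<ominus>\<^bsub>Xbar n\<^esub> Rbar \<rho> n x) ` carrier (Xbar n))"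

definition M :: "'k \<Rightarrow> nat \<Rightarrow> ('k, (nat \<Rightarrow> ('k, 'a) tens) set) module"
  where "M \<rho> n = quot_module (Xbar n) (M_denom \<rho> n)"

definition M_diff :: "'k \<Rightarrow> nat \<Rightarrow> (nat \<Rightarrow> ('k, 'a) tens) set \<Rightarrow> (nat \<Rightarrow> ('k, 'a) tens) set"
  where "M_diff \<rho> n = quot_map (Xbar (n - 1)) (M_denom \<rho> (n - 1)) (b_diff 0 n)"

end

end

theory Submission imports Defs begin

text \<open>
  Two facts make the statement true, one homological and one combinatorial.

  In characteristic zero the sequence of the maps \<open>1 - T\<close>, \<open>N\<close>, \<open>1 - T\<close>, \<open>N\<close>, \<dots> on a
  module with an action of a finite cyclic group is exact: a fixed point is the norm of a multiple of
  itself, and an element of norm zero is a combination of the elements \<open>x - T\<^sup>i x\<close>. So, for fixed \<open>n\<close>,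
  the part of the bicomplex in \<open>X n\<close> is a resolution of the coinvariants of \<open>T\<close>. As two is invertible,
  passing to the coinvariants of the group of order two is exact as well, and the complexes of fixed
  \<open>n\<close> in the triple complex resolve the quotient \<open>M n\<close> by the images of \<open>1 - T\<close> and \<open>1 - R\<close>. The
  projection of the total complex onto \<open>M\<close> is therefore surjective with acyclic kernel, and it
  induces an isomorphism in homology. In a cycle of the kernel the
  component of the highest rank is removed by a boundary, and the rank decreases
  (\<open>kernel_acyclic_below\<close>, \<open>total_homology_iso\<close>).

  The projective resolution of the trivial module is arbitrary, but it always splits: the element \<open>(1 + \<vartheta>) / 2\<close> makes the trivial module a direct summand of the
  group ring, so the resolution has a contraction (\<open>split_projective_resolution\<close>), and a contraction
  survives tensoring with any module. The outcome is \<open>hyperhomology_iso\<close>, for every bicomplex with an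
  involution which is exact in the direction of fixed \<open>n\<close>.

  It remains to see that the modules \<open>Xbar n\<close> do form such a bicomplex: \<open>b\<close> and \<open>b'\<close>
  are differentials, \<open>b (1 - T) = (1 - T) b'\<close>, \<open>b' N = N b\<close>, \<open>b R = R b\<close> and \<open>b' R T = R T b'\<close>. Let
  \<open>D\<^sub>k\<close> be the operation on the first \<open>k + 1\<close> letters of a word. Rotating the word before and after
  \<open>D\<^sub>k\<close> gives operations on arcs of \<open>k + 1\<close> consecutive letters of the cyclic word; \<open>b\<close> is the sum over
  all arcs, and \<open>b'\<close> is the sum over those arcs which do not contain the last letter followed by the
  first one. All identities are reindexings of sums over arcs, and they follow from a handful of
  relations: \<open>T\<close> has order \<open>n + 1\<close>, \<open>T R T = R\<close>, \<open>R D\<^sub>k = D\<^sub>k T\<^sup>k R\<close>, operations on disjoint arcs anticommute,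
  and the sum over all ways to nest one operation in another one vanishes, which is the defining
  relation of an \<open>A\<^sub>\<infinity>\<close>-algebra. In \<open>b \<circ> b\<close> pairs of disjoint arcs occur twice with opposite
  signs and nested pairs add up to zero (\<open>arcs_arcs\<close>).

  The signs become tractable after a change of normalisation. The element \<open>ps w\<close> is the pure tensor of
  the word \<open>w\<close> with the sign that comes from raising the degree of each letter by one. On these elements
  \<open>T\<close>, \<open>R\<close> and \<open>D\<^sub>k\<close> are given by Koszul signs for the raised degrees, each \<open>D\<^sub>k\<close> having degree \<open>-1\<close>, up to
  a factor \<open>\<rho> (-1)\<^sup>n\<close> in \<open>R\<close>.
\<close>

section \<open>Modules, quotients and linear maps\<close>

lemma module_abelian_group: "module R M \<Longrightarrow> abelian_group M"
  by (simp add: module_def)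

lemma module_cring: "module R M \<Longrightarrow> cring R"
  by (simp add: module_def)

lemma mod_homI:
  assumes "\<And>x. x \<in> carrier M \<Longrightarrow> f x \<in> carrier N"
    and "\<And>x y. \<lbrakk>x \<in> carrier M; y \<in> carrier M\<rbrakk> \<Longrightarrow> f (x \<oplus>\<^bsub>M\<^esub> y) = f x \<oplus>\<^bsub>N\<^esub> f y"
    and "\<And>a x. \<lbrakk>a \<in> carrier R; x \<in> carrier M\<rbrakk> \<Longrightarrow> f (a \<odot>\<^bsub>M\<^esub> x) = a \<odot>\<^bsub>N\<^esub> f x"
  shows "f \<in> mod_hom R M N"
  using assms by (auto simp: mod_hom_def)

lemma mod_hom_closed: "\<lbrakk>f \<in> mod_hom R M N; x \<in> carrier M\<rbrakk> \<Longrightarrow> f x \<in> carrier N"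
  by (auto simp: mod_hom_def)

lemma mod_hom_add:
  "\<lbrakk>f \<in> mod_hom R M N; x \<in> carrier M; y \<in> carrier M\<rbrakk> \<Longrightarrow> f (x \<oplus>\<^bsub>M\<^esub> y) = f x \<oplus>\<^bsub>N\<^esub> f y"
  by (auto simp: mod_hom_def)

lemma mod_hom_smult:
  "\<lbrakk>f \<in> mod_hom R M N; a \<in> carrier R; x \<in> carrier M\<rbrakk> \<Longrightarrow> f (a \<odot>\<^bsub>M\<^esub> x) = a \<odot>\<^bsub>N\<^esub> f x"
  by (auto simp: mod_hom_def)

lemma mod_hom_cong:
  assumes "f \<in> mod_hom R M N" "\<And>x. x \<in> carrier M \<Longrightarrow> g x = f x" "module R M"
  shows "g \<in> mod_hom R M N"
proof -
  interpret M: module R M by fact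
  show ?thesis using assms by (auto simp: mod_hom_def)
qed

lemma mod_hom_comp:
  "\<lbrakk>f \<in> mod_hom R M N; g \<in> mod_hom R N L\<rbrakk> \<Longrightarrow> (\<lambda>x. g (f x)) \<in> mod_hom R M L"
  by (auto simp: mod_hom_def Pi_def)

lemma mod_hom_ident: "(\<lambda>x. x) \<in> mod_hom R M M"
  by (auto simp: mod_hom_def)

lemma mod_hom_zero:
  assumes "module R M" "module R N" "f \<in> mod_hom R M N"
  shows "f \<zero>\<^bsub>M\<^esub> = \<zero>\<^bsub>N\<^esub>"
proof -
  interpret M: module R M by fact
  interpret N: module R N by fact
  have "f (\<zero>\<^bsub>R\<^esub> \<odot>\<^bsub>M\<^esub> \<zero>\<^bsub>M\<^esub>) = \<zero>\<^bsub>R\<^esub> \<odot>\<^bsub>N\<^esub> f \<zero>\<^bsub>M\<^esub>"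
    using assms(3) by (intro mod_hom_smult[OF assms(3)]) auto
  then show ?thesis using mod_hom_closed[OF assms(3)] by simp
qed

lemma mod_hom_uminus:
  assumes "module R M" "module R N" "f \<in> mod_hom R M N" "x \<in> carrier M"
  shows "f (\<ominus>\<^bsub>M\<^esub> x) = \<ominus>\<^bsub>N\<^esub> f x"
proof -
  interpret M: module R M by fact
  interpret N: module R N by fact
  have "f x \<oplus>\<^bsub>N\<^esub> f (\<ominus>\<^bsub>M\<^esub> x) = \<zero>\<^bsub>N\<^esub>"
    using assms mod_hom_add[OF assms(3), of x "\<ominus>\<^bsub>M\<^esub> x"] by (simp add: M.M.r_neg mod_hom_zero)
  then show ?thesis
    using assms mod_hom_closed[OF assms(3)]
    by (metis M.M.a_inv_closed N.M.add.inv_equality N.M.a_comm)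
qed

lemma mod_hom_diff:
  assumes "module R M" "module R N" "f \<in> mod_hom R M N" "x \<in> carrier M" "y \<in> carrier M"
  shows "f (x \<ominus>\<^bsub>M\<^esub> y) = f x \<ominus>\<^bsub>N\<^esub> f y"
proof -
  interpret M: module R M by fact
  show ?thesis using assms by (simp add: a_minus_def mod_hom_add mod_hom_uminus)
qed

lemma mod_hom_finsum:
  assumes "module R M" "module R N" "f \<in> mod_hom R M N"
    and "\<And>i. i \<in> I \<Longrightarrow> g i \<in> carrier M"
  shows "f (\<Oplus>\<^bsub>M\<^esub>i\<in>I. g i) = (\<Oplus>\<^bsub>N\<^esub>i\<in>I. f (g i))"
proof -
  interpret M: module R M by fact
  interpret N: module R N by fact
  show ?thesis
  proof (cases "finite I")
    case True
    then show ?thesis using assms(4)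
    proof (induction I rule: finite_induct)
      case empty
      then show ?case using mod_hom_zero[OF assms(1-3)] by simp
    next
      case (insert i I)
      then show ?case
        using mod_hom_closed[OF assms(3)]
        by (subst M.M.finsum_insert, auto simp: mod_hom_add[OF assms(3)])
    qed
  next
    case False
    then show ?thesis
      by (simp add: mod_hom_zero[OF assms(1-3)] M.M.finsum_infinite N.M.finsum_infinite)
  qed
qed

lemma mod_hom_plus:
  assumes "module R N" "f \<in> mod_hom R M N" "g \<in> mod_hom R M N"
  shows "(\<lambda>x. f x \<oplus>\<^bsub>N\<^esub> g x) \<in> mod_hom R M N"
proof -
  interpret N: module R N by fact
  show ?thesis
    using mod_hom_closed[OF assms(2)] mod_hom_closed[OF assms(3)]
    by (intro mod_homI)
      (auto simp: mod_hom_add[OF assms(2)] mod_hom_add[OF assms(3)] mod_hom_smult[OF assms(2)]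
        mod_hom_smult[OF assms(3)] N.smult_r_distr N.M.a_ac)
qed

lemma mod_hom_neg:
  assumes "module R N" "f \<in> mod_hom R M N"
  shows "(\<lambda>x. \<ominus>\<^bsub>N\<^esub> f x) \<in> mod_hom R M N"
proof -
  interpret N: module R N by fact
  show ?thesis
    using mod_hom_closed[OF assms(2)]
    by (intro mod_homI)
      (auto simp: mod_hom_add[OF assms(2)] mod_hom_smult[OF assms(2)]
        N.smult_r_minus N.M.minus_add)
qed

lemma mod_hom_minus:
  assumes "module R N" "f \<in> mod_hom R M N" "g \<in> mod_hom R M N"
  shows "(\<lambda>x. f x \<ominus>\<^bsub>N\<^esub> g x) \<in> mod_hom R M N"
  unfolding a_minus_def by (intro mod_hom_plus mod_hom_neg assms)

lemma mod_hom_const_zero: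
  assumes "module R N"
  shows "(\<lambda>x. \<zero>\<^bsub>N\<^esub>) \<in> mod_hom R M N"
proof -
  interpret N: module R N by fact
  show ?thesis by (intro mod_homI) auto
qed

lemma mod_hom_sum:
  assumes "module R M" "module R N" "\<And>i. i \<in> I \<Longrightarrow> f i \<in> mod_hom R M N"
  shows "(\<lambda>x. \<Oplus>\<^bsub>N\<^esub>i\<in>I. f i x) \<in> mod_hom R M N"
proof -
  interpret M: module R M by fact
  interpret N: module R N by fact
  show ?thesis
  proof (cases "finite I")
    case True
    then show ?thesis using assms(3)
    proof (induction I rule: finite_induct)
      case empty
      then show ?case by (simp add: mod_hom_const_zero assms)
    next
      case (insert i I)
      have cl: "f j x \<in> carrier N" if "j \<in> insert i I" "x \<in> carrier M" for j x
        by (rule mod_hom_closed[OF insert.prems[OF that(1)] that(2)])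
      have "(\<lambda>x. f i x \<oplus>\<^bsub>N\<^esub> (\<Oplus>\<^bsub>N\<^esub>i\<in>I. f i x)) \<in> mod_hom R M N"
        by (intro mod_hom_plus insert assms) auto
      then show ?case
      proof (rule mod_hom_cong[OF _ _ assms(1)])
        fix x assume x: "x \<in> carrier M"
        show "(\<Oplus>\<^bsub>N\<^esub>j\<in>insert i I. f j x) = f i x \<oplus>\<^bsub>N\<^esub> (\<Oplus>\<^bsub>N\<^esub>i\<in>I. f i x)"
          by (rule N.M.finsum_insert[OF insert.hyps]) (use cl[OF _ x] in auto)
      qed
    qed
  next
    case False
    then show ?thesis by (simp add: N.M.finsum_infinite mod_hom_const_zero assms)
  qed
qed

lemma msign_even [simp]: "even e \<Longrightarrow> msign M e x = x"
  by (simp add: msign_def)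

lemma msign_cong: "even (e - f) \<Longrightarrow> msign M e x = msign M f x"
  by (simp add: msign_def)

lemma msign_closed [simp]: "\<lbrakk>module R M; x \<in> carrier M\<rbrakk> \<Longrightarrow> msign M e x \<in> carrier M"
  by (simp add: msign_def module_def abelian_group.a_inv_closed)

lemma msign_msign:
  "\<lbrakk>module R M; x \<in> carrier M\<rbrakk> \<Longrightarrow> msign M e (msign M f x) = msign M (e + f) x"
  by (simp add: msign_def module_def abelian_group.minus_minus)

lemma msign_odd_add:
  assumes "module R M" "x \<in> carrier M" "odd (e + f)"
  shows "msign M e x \<oplus>\<^bsub>M\<^esub> msign M f x = \<zero>\<^bsub>M\<^esub>"
proof -
  interpret M: module R M by fact
  show ?thesis using assms by (auto simp: msign_def M.M.r_neg M.M.l_neg)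
qed

lemma mod_hom_msign:
  "\<lbrakk>module R M; module R N; f \<in> mod_hom R M N; x \<in> carrier M\<rbrakk>
    \<Longrightarrow> f (msign M e x) = msign N e (f x)"
  by (simp add: msign_def mod_hom_uminus)

lemma mod_hom_msign_comp:
  "\<lbrakk>module R N; f \<in> mod_hom R M N\<rbrakk> \<Longrightarrow> (\<lambda>x. msign N e (f x)) \<in> mod_hom R M N"
  by (cases "even e") (auto simp: msign_def mod_hom_neg)

lemma msign_add:
  assumes "module R M" "x \<in> carrier M" "y \<in> carrier M"
  shows "msign M e (x \<oplus>\<^bsub>M\<^esub> y) = msign M e x \<oplus>\<^bsub>M\<^esub> msign M e y"
  using mod_hom_add[OF mod_hom_msign_comp[OF assms(1) mod_hom_ident]] assms by auto

lemma msign_smult: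
  assumes "module R M" "x \<in> carrier M" "a \<in> carrier R"
  shows "msign M e (a \<odot>\<^bsub>M\<^esub> x) = a \<odot>\<^bsub>M\<^esub> msign M e x"
  using mod_hom_smult[OF mod_hom_msign_comp[OF assms(1) mod_hom_ident]] assms by auto

lemma msign_zero: "module R M \<Longrightarrow> msign M e \<zero>\<^bsub>M\<^esub> = \<zero>\<^bsub>M\<^esub>"
  using mod_hom_zero[OF _ _ mod_hom_msign_comp[OF _ mod_hom_ident]] by blast

lemma mod_hom_scale:
  assumes "module R N" "f \<in> mod_hom R M N" "c \<in> carrier R"
  shows "(\<lambda>x. c \<odot>\<^bsub>N\<^esub> f x) \<in> mod_hom R M N"
proof -
  interpret N: module R N by fact
  show ?thesis
    using assms mod_hom_closed[OF assms(2)]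
    by (intro mod_homI)
      (auto simp: mod_hom_add mod_hom_smult N.smult_r_distr N.smult_assoc1[symmetric] N.m_comm)
qed

lemma coset_eq_iff:
  assumes "module R M" "submodule N R M" "x \<in> carrier M" "y \<in> carrier M"
  shows "N +>\<^bsub>M\<^esub> x = N +>\<^bsub>M\<^esub> y \<longleftrightarrow> x \<ominus>\<^bsub>M\<^esub> y \<in> N"
proof -
  interpret M: module R M by fact
  note sub = M.submoduleE[OF assms(2)]
  have z: "\<zero>\<^bsub>M\<^esub> \<in> N" using assms(2) unfolding submodule_def by (metis subgroup.one_closed monoid.select_convs(2) partial_object.select_convs(1) ring_record_simps(11))
  show ?thesis
  proof
    assume "N +>\<^bsub>M\<^esub> x = N +>\<^bsub>M\<^esub> y"
    moreover have "x \<in> N +>\<^bsub>M\<^esub> x" using z assms by (auto simp: a_r_coset_def' intro!: bexI[of _ "\<zero>\<^bsub>M\<^esub>"])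
    ultimately obtain h where h: "h \<in> N" "x = h \<oplus>\<^bsub>M\<^esub> y" by (auto simp: a_r_coset_def')
    then have "x \<ominus>\<^bsub>M\<^esub> y = h" using sub(1) assms by (auto simp: a_minus_def M.M.a_assoc M.M.r_neg)
    then show "x \<ominus>\<^bsub>M\<^esub> y \<in> N" using h by simp
  next
    assume d: "x \<ominus>\<^bsub>M\<^esub> y \<in> N"
    have *: "N +>\<^bsub>M\<^esub> u \<subseteq> N +>\<^bsub>M\<^esub> v" if "u \<in> carrier M" "v \<in> carrier M" "u \<ominus>\<^bsub>M\<^esub> v \<in> N" for u v
    proof
      fix w assume "w \<in> N +>\<^bsub>M\<^esub> u"
      then obtain h where h: "h \<in> N" "w = h \<oplus>\<^bsub>M\<^esub> u" by (auto simp: a_r_coset_def')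
      have "w = (h \<oplus>\<^bsub>M\<^esub> (u \<ominus>\<^bsub>M\<^esub> v)) \<oplus>\<^bsub>M\<^esub> v"
        using that h sub(1) by (auto simp: a_minus_def M.M.a_assoc M.M.l_neg)
      then show "w \<in> N +>\<^bsub>M\<^esub> v" using sub(5)[OF h(1) that(3)] by (auto simp: a_r_coset_def')
    qed
    have "y \<ominus>\<^bsub>M\<^esub> x = \<ominus>\<^bsub>M\<^esub> (x \<ominus>\<^bsub>M\<^esub> y)" using assms by (simp add: a_minus_def M.M.minus_add M.M.a_comm)
    then have "y \<ominus>\<^bsub>M\<^esub> x \<in> N" using sub(3)[OF d] by simp
    then show "N +>\<^bsub>M\<^esub> x = N +>\<^bsub>M\<^esub> y" using * assms d by blast
  qed
qed

lemma (in module) minus_zero_module [simp]: "\<ominus>\<^bsub>M\<^esub> \<zero>\<^bsub>M\<^esub> = \<zero>\<^bsub>M\<^esub>"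
  by (metis M.a_inv_closed M.l_zero M.r_neg M.zero_closed)

locale quotient = module R M for R and M (structure) +
  fixes N assumes sub: "submodule N R M"
begin

lemma additive: "abelian_subgroup N M"
  using sub a_comm_group unfolding submodule_def by (intro abelian_subgroupI3 additive_subgroupI) (auto intro: abelian_group_axioms)

lemma zero_mem: "\<zero>\<^bsub>M\<^esub> \<in> N"
  using additive by (simp add: abelian_subgroup_def additive_subgroup.zero_closed)

lemma subset: "N \<subseteq> carrier M"
  using submoduleE(1)[OF sub] .

lemma carrier_quot: "carrier (quot_module M N) = (\<lambda>x. N +> x) ` carrier M"
  by (auto simp: quot_module_def A_RCOSETS_def RCOSETS_def a_r_coset_def)

lemma add_quot:
  "\<lbrakk>x \<in> carrier M; y \<in> carrier M\<rbrakk> \<Longrightarrow> (N +> x) \<oplus>\<^bsub>quot_module M N\<^esub> (N +> y) = N +> (x \<oplus> y)"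
  using abelian_subgroup.a_rcos_sum[OF additive] by (simp add: quot_module_def)

lemma coset_eq: "\<lbrakk>x \<in> carrier M; y \<in> carrier M\<rbrakk> \<Longrightarrow> N +> x = N +> y \<longleftrightarrow> x \<ominus> y \<in> N"
  by (rule coset_eq_iff[OF _ sub]) (unfold_locales)

lemma mem_coset: "x \<in> carrier M \<Longrightarrow> y \<in> N +> x \<longleftrightarrow> y \<in> carrier M \<and> y \<ominus> x \<in> N"
proof -
  assume x: "x \<in> carrier M"
  show ?thesis
  proof
    assume "y \<in> N +> x"
    then obtain h where h: "h \<in> N" "y = h \<oplus> x" by (auto simp: a_r_coset_def')
    then show "y \<in> carrier M \<and> y \<ominus> x \<in> N"
      using subset x by (auto simp: a_minus_def M.a_assoc M.r_neg)
  next
    assume y: "y \<in> carrier M \<and> y \<ominus> x \<in> N"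
    then have "y = (y \<ominus> x) \<oplus> x" using x by (auto simp: a_minus_def M.a_assoc M.l_neg)
    then show "y \<in> N +> x" using y by (auto simp: a_r_coset_def')
  qed
qed

lemma union_cosets:
  assumes "x \<in> carrier M" "\<And>y. \<lbrakk>y \<in> carrier M; y \<ominus> x \<in> N\<rbrakk> \<Longrightarrow> g y = g x"
  shows "(\<Union>y\<in>N +> x. g y) = g x"
proof -
  have "x \<in> N +> x" using assms zero_mem by (simp add: mem_coset a_minus_def M.r_neg)
  moreover have "g y = g x" if "y \<in> N +> x" for y using that assms by (simp add: mem_coset)
  ultimately show ?thesis by blast
qed

lemma smult_quot:
  assumes "a \<in> carrier R" "x \<in> carrier M"
  shows "a \<odot>\<^bsub>quot_module M N\<^esub> (N +> x) = N +> (a \<odot> x)"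
proof -
  have "(\<Union>y\<in>N +> x. N +> (a \<odot> y)) = N +> (a \<odot> x)"
  proof (rule union_cosets)
    fix y assume y: "y \<in> carrier M" "y \<ominus> x \<in> N"
    have "a \<odot> y \<ominus> a \<odot> x = a \<odot> (y \<ominus> x)"
      using y assms by (simp add: a_minus_def smult_r_distr smult_r_minus)
    then show "N +> (a \<odot> y) = N +> (a \<odot> x)"
      using y assms submoduleE(4)[OF sub] by (simp add: coset_eq)
  qed (use assms in auto)
  then show ?thesis by (simp add: quot_module_def)
qed

lemma zero_quot: "\<zero>\<^bsub>quot_module M N\<^esub> = N +> \<zero>"
  using subset by (simp add: quot_module_def)

lemma module_quot: "module R (quot_module M N)"
proof (rule moduleI)
  show "cring R" by unfold_locales
  show "abelian_group (quot_module M N)"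
  proof (rule abelian_groupI; (unfold carrier_quot)?)
    fix x assume "x \<in> (\<lambda>x. N +> x) ` carrier M"
    then obtain x0 where x: "x0 \<in> carrier M" "x = N +> x0" by auto
    show "\<exists>y\<in>(\<lambda>x. N +> x) ` carrier M. y \<oplus>\<^bsub>quot_module M N\<^esub> x = \<zero>\<^bsub>quot_module M N\<^esub>"
      by (rule bexI[of _ "N +> (\<ominus> x0)"]) (use x in \<open>auto simp: add_quot zero_quot M.l_neg\<close>)
  qed (auto simp: add_quot zero_quot M.a_ac)
qed (auto simp: carrier_quot add_quot smult_quot smult_l_distr smult_r_distr smult_assoc1)

lemma proj_hom: "(\<lambda>x. N +> x) \<in> mod_hom R M (quot_module M N)"
  by (rule mod_homI) (auto simp: carrier_quot add_quot smult_quot)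

lemma coset_zero_iff: "x \<in> carrier M \<Longrightarrow> N +> x = \<zero>\<^bsub>quot_module M N\<^esub> \<longleftrightarrow> x \<in> N"
  using minus_zero_module by (simp add: zero_quot coset_eq a_minus_def)

end

lemma quotientI: "\<lbrakk>module R M; submodule N R M\<rbrakk> \<Longrightarrow> quotient R M N"
  by (simp add: quotient_def quotient_axioms_def)

lemma submodule_image:
  assumes "module R M" "module R N" "f \<in> mod_hom R M N"
  shows "submodule (f ` carrier M) R N"
proof -
  interpret M: module R M by fact
  interpret N: module R N by fact
  show ?thesis
  proof (rule N.submoduleI)
    show "\<zero>\<^bsub>N\<^esub> \<in> f ` carrier M"
      using mod_hom_zero[OF assms] by (metis M.M.zero_closed image_eqI)
    show "\<ominus>\<^bsub>N\<^esub> a \<in> f ` carrier M" if "a \<in> f ` carrier M" for a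
      using that mod_hom_uminus[OF assms] by (metis (no_types, lifting) M.M.a_inv_closed imageE imageI)
    show "a \<oplus>\<^bsub>N\<^esub> b \<in> f ` carrier M" if "a \<in> f ` carrier M" "b \<in> f ` carrier M" for a b
      using that mod_hom_add[OF assms(3)] by (metis (no_types, lifting) M.M.a_closed imageE imageI)
    show "a \<odot>\<^bsub>N\<^esub> x \<in> f ` carrier M" if "a \<in> carrier R" "x \<in> f ` carrier M" for a x
      using that mod_hom_smult[OF assms(3)] by (metis (no_types, lifting) M.smult_closed imageE imageI)
  qed (use mod_hom_closed[OF assms(3)] in auto)
qed

lemma submodule_kernel:
  assumes "module R M" "module R N" "f \<in> mod_hom R M N"
  shows "submodule {x \<in> carrier M. f x = \<zero>\<^bsub>N\<^esub>} R M"
proof -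
  interpret M: module R M by fact
  interpret N: module R N by fact
  show ?thesis
    by (rule M.submoduleI)
      (use assms in \<open>auto simp: mod_hom_zero mod_hom_uminus mod_hom_add mod_hom_smult\<close>)
qed

lemma submodule_set_add:
  assumes "module R L" "submodule H R L" "submodule J R L"
  shows "submodule (H <+>\<^bsub>L\<^esub> J) R L"
proof -
  interpret L: module R L by fact
  interpret H: quotient R L H by (intro quotientI assms)
  interpret J: quotient R L J by (intro quotientI assms)
  have SI: "h \<oplus>\<^bsub>L\<^esub> j \<in> H <+>\<^bsub>L\<^esub> J" if "h \<in> H" "j \<in> J" for h j
    using that by (auto simp: set_add_def')
  have SE: "\<exists>h\<in>H. \<exists>j\<in>J. u = h \<oplus>\<^bsub>L\<^esub> j" if "u \<in> H <+>\<^bsub>L\<^esub> J" for u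
    using that by (auto simp: set_add_def')
  note sH = L.submoduleE[OF assms(2)] and sJ = L.submoduleE[OF assms(3)]
  note car = subsetD[OF sH(1)] subsetD[OF sJ(1)]
  show ?thesis
  proof (rule L.submoduleI)
    show "H <+>\<^bsub>L\<^esub> J \<subseteq> carrier L"
    proof
      fix u assume "u \<in> H <+>\<^bsub>L\<^esub> J"
      from SE[OF this] obtain h j where "h \<in> H" "j \<in> J" "u = h \<oplus>\<^bsub>L\<^esub> j" by (elim bexE)
      then show "u \<in> carrier L" using car by simp
    qed
    show "\<zero>\<^bsub>L\<^esub> \<in> H <+>\<^bsub>L\<^esub> J"
      using SI[OF H.zero_mem J.zero_mem] by simp
  next
    fix a assume "a \<in> H <+>\<^bsub>L\<^esub> J"
    from SE[OF this] obtain h j where a: "h \<in> H" "j \<in> J" "a = h \<oplus>\<^bsub>L\<^esub> j" by (elim bexE)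
    then show "\<ominus>\<^bsub>L\<^esub> a \<in> H <+>\<^bsub>L\<^esub> J"
      using SI[OF sH(3)[OF a(1)] sJ(3)[OF a(2)]] car by (simp add: L.M.minus_add)
  next
    fix a b assume "a \<in> H <+>\<^bsub>L\<^esub> J" "b \<in> H <+>\<^bsub>L\<^esub> J"
    from SE[OF this(1)] SE[OF this(2)] obtain h j h' j' where
      a: "h \<in> H" "j \<in> J" "a = h \<oplus>\<^bsub>L\<^esub> j" "h' \<in> H" "j' \<in> J" "b = h' \<oplus>\<^bsub>L\<^esub> j'" by (elim bexE)
    then have "a \<oplus>\<^bsub>L\<^esub> b = (h \<oplus>\<^bsub>L\<^esub> h') \<oplus>\<^bsub>L\<^esub> (j \<oplus>\<^bsub>L\<^esub> j')"
      using car by (simp add: L.M.a_ac)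
    then show "a \<oplus>\<^bsub>L\<^esub> b \<in> H <+>\<^bsub>L\<^esub> J"
      using SI[OF sH(5) sJ(5)] a by simp
  next
    fix c a assume c: "c \<in> carrier R" and "a \<in> H <+>\<^bsub>L\<^esub> J"
    from SE[OF this(2)] obtain h j where a: "h \<in> H" "j \<in> J" "a = h \<oplus>\<^bsub>L\<^esub> j" by (elim bexE)
    then have "c \<odot>\<^bsub>L\<^esub> a = c \<odot>\<^bsub>L\<^esub> h \<oplus>\<^bsub>L\<^esub> c \<odot>\<^bsub>L\<^esub> j"
      using car c by (simp add: L.smult_r_distr)
    then show "c \<odot>\<^bsub>L\<^esub> a \<in> H <+>\<^bsub>L\<^esub> J"
      using SI[OF sH(4)[OF c a(1)] sJ(4)[OF c a(2)]] by simp
  qed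
qed

lemma (in module) diff_zero_imp_eq:
  assumes "x \<ominus>\<^bsub>M\<^esub> y = \<zero>\<^bsub>M\<^esub>" "x \<in> carrier M" "y \<in> carrier M"
  shows "x = y"
proof -
  have "x = (x \<ominus>\<^bsub>M\<^esub> y) \<oplus>\<^bsub>M\<^esub> y" using assms(2,3) by (simp add: a_minus_def M.a_assoc M.l_neg)
  then show ?thesis using assms by simp
qed

section \<open>Free modules and presentations\<close>

lemma free_simps:
  "\<zero>\<^bsub>free_module R S\<^esub> = (\<lambda>s. \<zero>\<^bsub>R\<^esub>)"
  "f \<oplus>\<^bsub>free_module R S\<^esub> g = (\<lambda>s. f s \<oplus>\<^bsub>R\<^esub> g s)"
  "a \<odot>\<^bsub>free_module R S\<^esub> f = (\<lambda>s. a \<otimes>\<^bsub>R\<^esub> f s)"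
  by (simp_all add: free_module_def)

lemma free_carrier:
  "f \<in> carrier (free_module R S) \<longleftrightarrow>
    (\<forall>s\<in>S. f s \<in> carrier R) \<and> (\<forall>s. s \<notin> S \<longrightarrow> f s = \<zero>\<^bsub>R\<^esub>) \<and> finite {s. f s \<noteq> \<zero>\<^bsub>R\<^esub>}"
  by (simp add: free_module_def)

context cring
begin

lemma free_value: "f \<in> carrier (free_module R S) \<Longrightarrow> f s \<in> carrier R"
  unfolding free_carrier by (cases "s \<in> S") auto

lemma module_free: "module R (free_module R S)"
proof (rule moduleI)
  have fin: "finite {s. f s \<oplus> g s \<noteq> \<zero>}" if "finite {s. f s \<noteq> \<zero>}" "finite {s. g s \<noteq> \<zero>}" for f g :: "'c \<Rightarrow> 'a"
    by (rule finite_subset[OF _ finite_UnI[OF that]]) auto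
  have closed: "f \<oplus>\<^bsub>free_module R S\<^esub> g \<in> carrier (free_module R S)"
    if "f \<in> carrier (free_module R S)" "g \<in> carrier (free_module R S)" for f g
    using that fin[of f g] unfolding free_carrier free_simps by auto
  show "abelian_group (free_module R S)"
  proof (rule abelian_groupI)
    fix f assume f: "f \<in> carrier (free_module R S)"
    have "{s. \<ominus> f s \<noteq> \<zero>} = {s. f s \<noteq> \<zero>}"
      using free_value[OF f] by (metis minus_minus minus_zero)
    then have "(\<lambda>s. \<ominus> f s) \<in> carrier (free_module R S)"
      using f unfolding free_carrier by auto
    moreover have "(\<lambda>s. \<ominus> f s) \<oplus>\<^bsub>free_module R S\<^esub> f = \<zero>\<^bsub>free_module R S\<^esub>"
      using free_value[OF f] by (simp add: free_simps l_neg)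
    ultimately show "\<exists>g\<in>carrier (free_module R S). g \<oplus>\<^bsub>free_module R S\<^esub> f = \<zero>\<^bsub>free_module R S\<^esub>" by blast
  next
    fix f g assume "f \<in> carrier (free_module R S)" "g \<in> carrier (free_module R S)"
    then show "f \<oplus>\<^bsub>free_module R S\<^esub> g = g \<oplus>\<^bsub>free_module R S\<^esub> f"
      using free_value[of f S] free_value[of g S] by (simp add: free_simps a_comm)
  next
    fix f g h assume "f \<in> carrier (free_module R S)" "g \<in> carrier (free_module R S)" "h \<in> carrier (free_module R S)"
    then show "f \<oplus>\<^bsub>free_module R S\<^esub> g \<oplus>\<^bsub>free_module R S\<^esub> h = f \<oplus>\<^bsub>free_module R S\<^esub> (g \<oplus>\<^bsub>free_module R S\<^esub> h)"
      using free_value[of f S] free_value[of g S] free_value[of h S] by (simp add: free_simps a_assoc)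
  next
    show "\<zero>\<^bsub>free_module R S\<^esub> \<in> carrier (free_module R S)" by (auto simp: free_carrier free_simps)
  next
    fix f assume "f \<in> carrier (free_module R S)"
    then show "\<zero>\<^bsub>free_module R S\<^esub> \<oplus>\<^bsub>free_module R S\<^esub> f = f"
      using free_value[of f S] by (simp add: free_simps)
  qed (rule closed)
next
  fix a f assume a: "a \<in> carrier R" and f: "f \<in> carrier (free_module R S)"
  have "finite {s. a \<otimes> f s \<noteq> \<zero>}"
    by (rule finite_subset[of _ "{s. f s \<noteq> \<zero>}"]) (use a f in \<open>auto simp: free_carrier\<close>)
  then show "a \<odot>\<^bsub>free_module R S\<^esub> f \<in> carrier (free_module R S)"
    using a f by (auto simp: free_carrier free_simps)
next
  fix a b f assume a: "a \<in> carrier R" and b: "b \<in> carrier R" and f: "f \<in> carrier (free_module R S)"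
  note [simp] = free_value[OF f]
  show "(a \<oplus> b) \<odot>\<^bsub>free_module R S\<^esub> f = a \<odot>\<^bsub>free_module R S\<^esub> f \<oplus>\<^bsub>free_module R S\<^esub> b \<odot>\<^bsub>free_module R S\<^esub> f"
    "a \<otimes> b \<odot>\<^bsub>free_module R S\<^esub> f = a \<odot>\<^bsub>free_module R S\<^esub> (b \<odot>\<^bsub>free_module R S\<^esub> f)"
    using a b by (simp_all add: free_simps l_distr m_assoc)
next
  fix a f g assume a: "a \<in> carrier R" and f: "f \<in> carrier (free_module R S)" and g: "g \<in> carrier (free_module R S)"
  show "a \<odot>\<^bsub>free_module R S\<^esub> (f \<oplus>\<^bsub>free_module R S\<^esub> g) = a \<odot>\<^bsub>free_module R S\<^esub> f \<oplus>\<^bsub>free_module R S\<^esub> a \<odot>\<^bsub>free_module R S\<^esub> g"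
    using a free_value[OF f] free_value[OF g] by (simp add: free_simps r_distr)
next
  fix f assume f: "f \<in> carrier (free_module R S)"
  show "\<one> \<odot>\<^bsub>free_module R S\<^esub> f = f"
    using free_value[OF f] by (simp add: free_simps)
qed (rule is_cring)

lemma free_gen_closed: "s \<in> S \<Longrightarrow> free_gen R s \<in> carrier (free_module R S)"
proof -
  assume "s \<in> S"
  have "finite {x. free_gen R s x \<noteq> \<zero>}"
    by (rule finite_subset[of _ "{s}"]) (auto simp: free_gen_def)
  then show ?thesis using \<open>s \<in> S\<close> by (auto simp: free_carrier free_gen_def)
qed

text \<open>The linear map out of a free module with prescribed values on the generators.\<close>

definition free_lift :: "('a, 'n, 'e) module_scheme \<Rightarrow> ('s \<Rightarrow> 'n) \<Rightarrow> ('s \<Rightarrow> 'a) \<Rightarrow> 'n"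
  where "free_lift N \<phi> f = (\<Oplus>\<^bsub>N\<^esub>s\<in>{s. f s \<noteq> \<zero>}. f s \<odot>\<^bsub>N\<^esub> \<phi> s)"

lemma free_lift_superset:
  assumes "module R N" "\<phi> \<in> S \<rightarrow> carrier N" "f \<in> carrier (free_module R S)"
    "finite U" "{s. f s \<noteq> \<zero>} \<subseteq> U" "U \<subseteq> S"
  shows "free_lift N \<phi> f = (\<Oplus>\<^bsub>N\<^esub>s\<in>U. f s \<odot>\<^bsub>N\<^esub> \<phi> s)"
proof -
  interpret N: module R N by fact
  have v: "\<And>s. s \<in> U \<Longrightarrow> \<phi> s \<in> carrier N" using assms by auto
  show ?thesis unfolding free_lift_def
    by (rule N.M.add.finprod_mono_neutral_cong_left[OF assms(4,5)])
      (use free_value[OF assms(3)] v assms(5) in \<open>auto simp: Pi_def\<close>)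
qed

lemma free_lift_hom:
  assumes "module R N" "\<phi> \<in> S \<rightarrow> carrier N"
  shows "free_lift N \<phi> \<in> mod_hom R (free_module R S) N"
proof -
  interpret N: module R N by fact
  interpret F: module R "free_module R S" by (rule module_free)
  have fin: "finite {s. f s \<noteq> \<zero>}" "{s. f s \<noteq> \<zero>} \<subseteq> S" if "f \<in> carrier (free_module R S)" for f
    using that by (auto simp: free_carrier)
  have v: "\<And>s. s \<in> S \<Longrightarrow> \<phi> s \<in> carrier N" using assms by auto
  show ?thesis
  proof (rule mod_homI)
    fix f assume f: "f \<in> carrier (free_module R S)"
    show "free_lift N \<phi> f \<in> carrier N"
      unfolding free_lift_def
      by (rule N.M.finsum_closed) (use fin(2)[OF f] v free_value[OF f] in auto)
  next
    fix f g assume f: "f \<in> carrier (free_module R S)" and g: "g \<in> carrier (free_module R S)"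
    let ?U = "{s. f s \<noteq> \<zero>} \<union> {s. g s \<noteq> \<zero>}"
    have U: "finite ?U" "?U \<subseteq> S" "{s. f s \<noteq> \<zero>} \<subseteq> ?U" "{s. g s \<noteq> \<zero>} \<subseteq> ?U"
      "{s. (f \<oplus>\<^bsub>free_module R S\<^esub> g) s \<noteq> \<zero>} \<subseteq> ?U"
      using fin f g by (auto simp: free_simps)
    show "free_lift N \<phi> (f \<oplus>\<^bsub>free_module R S\<^esub> g) = free_lift N \<phi> f \<oplus>\<^bsub>N\<^esub> free_lift N \<phi> g"
      unfolding free_lift_superset[OF assms f U(1,3,2)] free_lift_superset[OF assms g U(1,4,2)]
        free_lift_superset[OF assms F.M.a_closed[OF f g] U(1,5,2)]
      apply (subst N.M.finsum_addf[symmetric])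
      using U(2) v free_value[OF f] free_value[OF g]
        apply (auto simp: Pi_def)[2]
      apply (rule N.M.finsum_cong')
      using U(2) v free_value[OF f] free_value[OF g]
        apply (auto simp: Pi_def free_simps N.smult_l_distr)
      done
  next
    fix a f assume a: "a \<in> carrier R" and f: "f \<in> carrier (free_module R S)"
    let ?U = "{s. f s \<noteq> \<zero>}"
    have U: "?U \<subseteq> S" "finite ?U" using fin f by auto
    have s: "{s. (a \<odot>\<^bsub>free_module R S\<^esub> f) s \<noteq> \<zero>} \<subseteq> ?U"
      using a by (auto simp: free_simps)
    show "free_lift N \<phi> (a \<odot>\<^bsub>free_module R S\<^esub> f) = a \<odot>\<^bsub>N\<^esub> free_lift N \<phi> f"
      unfolding free_lift_superset[OF assms f U(2) order_refl U(1)]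
        free_lift_superset[OF assms F.smult_closed[OF a f] U(2) s U(1)]
      apply (subst N.finsum_smult_ldistr[OF U(2) a])
      using U(1) v free_value[OF f]
       apply (auto simp: Pi_def)[1]
      apply (rule N.M.finsum_cong')
      using U(1) v free_value[OF f] a
        apply (auto simp: Pi_def free_simps N.smult_assoc1)
      done
  qed
qed

lemma free_lift_gen:
  assumes "module R N" "\<phi> \<in> S \<rightarrow> carrier N" "s \<in> S"
  shows "free_lift N \<phi> (free_gen R s) = \<phi> s"
proof -
  interpret N: module R N by fact
  have v: "\<phi> s \<in> carrier N" using assms by auto
  have "free_lift N \<phi> (free_gen R s) = (\<Oplus>\<^bsub>N\<^esub>x\<in>{s}. free_gen R s x \<odot>\<^bsub>N\<^esub> \<phi> x)"
    by (rule free_lift_superset[OF assms(1,2) free_gen_closed[OF assms(3)]])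
      (use assms(3) in \<open>auto simp: free_gen_def\<close>)
  also have "\<dots> = \<phi> s"
    using v by (subst N.M.finsum_insert) (auto simp: free_gen_def)
  finally show ?thesis .
qed

lemma free_hom_eq_lift:
  assumes "module R N" "h \<in> mod_hom R (free_module R S) N" "f \<in> carrier (free_module R S)"
  shows "h f = free_lift N (\<lambda>s. h (free_gen R s)) f"
proof -
  interpret N: module R N by fact
  interpret F: module R "free_module R S" by (rule module_free)
  let ?\<phi> = "\<lambda>s. h (free_gen R s)"
  have \<phi>: "?\<phi> \<in> S \<rightarrow> carrier N"
    using mod_hom_closed[OF assms(2) free_gen_closed] by auto
  note L = free_lift_hom[OF assms(1) \<phi>]
  have "h f = free_lift N ?\<phi> f" if "finite U" "U \<subseteq> S" "f \<in> carrier (free_module R S)" "{s. f s \<noteq> \<zero>} \<subseteq> U" for U f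
    using that
  proof (induction U arbitrary: f rule: finite_induct)
    case empty
    then have "f = \<zero>\<^bsub>free_module R S\<^esub>" by (auto simp: free_simps)
    then show ?case
      using mod_hom_zero[OF module_free assms(1) assms(2)] mod_hom_zero[OF module_free assms(1) L] by simp
  next
    case (insert u U)
    define g where "g = f(u := \<zero>)"
    have fv: "f s \<in> carrier R" for s using free_value insert.prems(2) .
    have g: "g \<in> carrier (free_module R S)" "{s. g s \<noteq> \<zero>} \<subseteq> U"
      using insert.prems unfolding g_def free_carrier
      by (auto elim: rev_finite_subset)
    have u: "u \<in> S" using insert.prems by auto
    have f: "f = g \<oplus>\<^bsub>free_module R S\<^esub> (f u \<odot>\<^bsub>free_module R S\<^esub> free_gen R u)"
      using fv by (auto simp: g_def free_simps free_gen_def fun_eq_iff)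
    have "h g = free_lift N ?\<phi> g" using insert g by auto
    then show ?case
      using g(1) free_gen_closed[OF u] fv mod_hom_add[OF L] mod_hom_add[OF assms(2)]
        mod_hom_smult[OF L] mod_hom_smult[OF assms(2)] free_lift_gen[OF assms(1) \<phi> u]
      by (subst (1 2) f) auto
  qed
  moreover have "finite {s. f s \<noteq> \<zero>}" "{s. f s \<noteq> \<zero>} \<subseteq> S"
    using assms(3) by (auto simp: free_carrier)
  ultimately show ?thesis using assms(3) by blast
qed

lemma free_hom_eqI:
  assumes "module R N" "h \<in> mod_hom R (free_module R S) N" "h' \<in> mod_hom R (free_module R S) N"
    and "\<And>s. s \<in> S \<Longrightarrow> h (free_gen R s) = h' (free_gen R s)"
    and f: "f \<in> carrier (free_module R S)"
  shows "h f = h' f"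
proof -
  interpret N: module R N by fact
  have s: "{s. f s \<noteq> \<zero>} \<subseteq> S" using f by (auto simp: free_carrier)
  have "free_lift N (\<lambda>s. h (free_gen R s)) f = free_lift N (\<lambda>s. h' (free_gen R s)) f"
    unfolding free_lift_def
    by (rule N.M.finsum_cong')
      (use s assms(4) free_value[OF f] mod_hom_closed[OF assms(3) free_gen_closed] in auto)
  then show ?thesis using free_hom_eq_lift assms by metis
qed

end

lemma mod_span_submodule:
  assumes "module R M" "S \<subseteq> carrier M"
  shows "submodule (mod_span R M S) R M" "S \<subseteq> mod_span R M S"
    "\<And>H. \<lbrakk>submodule H R M; S \<subseteq> H\<rbrakk> \<Longrightarrow> mod_span R M S \<subseteq> H"
proof -
  interpret M: module R M by fact
  let ?I = "{N. submodule N R M \<and> S \<subseteq> N}"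
  have car: "carrier M \<in> ?I" using M.carrier_is_submodule assms by auto
  show "submodule (mod_span R M S) R M" unfolding mod_span_def
  proof (rule M.submoduleI)
    show "\<Inter> ?I \<subseteq> carrier M" using car by auto
    show "\<zero>\<^bsub>M\<^esub> \<in> \<Inter> ?I" using quotient.zero_mem[OF quotientI[OF assms(1)]] by blast
    show "\<ominus>\<^bsub>M\<^esub> a \<in> \<Inter> ?I" if "a \<in> \<Inter> ?I" for a
      using that M.submoduleE(3) by auto
    show "a \<oplus>\<^bsub>M\<^esub> b \<in> \<Inter> ?I" if "a \<in> \<Inter> ?I" "b \<in> \<Inter> ?I" for a b
      using that M.submoduleE(5) by auto
    show "a \<odot>\<^bsub>M\<^esub> b \<in> \<Inter> ?I" if "a \<in> carrier R" "b \<in> \<Inter> ?I" for a b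
      using that M.submoduleE(4) by auto
  qed
qed (auto simp: mod_span_def)

locale presentation = cring R for R (structure) +
  fixes S and Q
  assumes rels: "Q \<subseteq> carrier (free_module R S)"
begin

abbreviation "F \<equiv> free_module R S"
abbreviation "V \<equiv> mod_span R F Q"

sublocale Q: quotient R F V
  by (intro quotientI module_free mod_span_submodule rels)

lemma module_pres: "module R (pres_module R S Q)"
  unfolding pres_module_def by (rule Q.module_quot)

lemma pres_gen_closed: "s \<in> S \<Longrightarrow> pres_gen R S Q s \<in> carrier (pres_module R S Q)"
  by (auto simp: pres_module_def pres_gen_def Q.carrier_quot free_gen_closed)

lemma pres_hom_eqI:
  assumes N: "module R N" and h: "h \<in> mod_hom R (pres_module R S Q) N" "h' \<in> mod_hom R (pres_module R S Q) N"
    and eq: "\<And>s. s \<in> S \<Longrightarrow> h (pres_gen R S Q s) = h' (pres_gen R S Q s)"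
    and x: "x \<in> carrier (pres_module R S Q)"
  shows "h x = h' x"
proof -
  obtain f where f: "f \<in> carrier F" "x = V +>\<^bsub>F\<^esub> f"
    using x by (auto simp: pres_module_def Q.carrier_quot)
  note comp = mod_hom_comp[OF Q.proj_hom[folded pres_module_def]]
  show ?thesis
    using free_hom_eqI[OF N comp[OF h(1)] comp[OF h(2)] _ f(1)] eq f(2)
    by (auto simp: pres_gen_def)
qed

text \<open>
  A map out of a presented module exists as soon as the relations are killed by every linear extension
  of the given values; the free extension is unique, so this can be checked without constructing it.
\<close>

lemma pres_lift:
  assumes N: "module R N" and \<phi>: "\<phi> \<in> S \<rightarrow> carrier N"
    and resp: "\<And>h q. \<lbrakk>h \<in> mod_hom R F N; \<And>s. s \<in> S \<Longrightarrow> h (free_gen R s) = \<phi> s; q \<in> Q\<rbrakk> \<Longrightarrow> h q = \<zero>\<^bsub>N\<^esub>"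
  shows pres_lift_hom: "pres_lift R S Q N \<phi> \<in> mod_hom R (pres_module R S Q) N"
    and pres_lift_gen: "\<And>s. s \<in> S \<Longrightarrow> pres_lift R S Q N \<phi> (pres_gen R S Q s) = \<phi> s"
proof -
  interpret N: module R N by fact
  let ?P = "\<lambda>f. f \<in> mod_hom R (pres_module R S Q) N \<and> f \<in> extensional (carrier (pres_module R S Q)) \<and>
    (\<forall>s\<in>S. f (pres_gen R S Q s) = \<phi> s)"
  let ?h = "free_lift N \<phi>"
  have h: "?h \<in> mod_hom R F N" by (rule free_lift_hom[OF N \<phi>])
  have "Q \<subseteq> {x \<in> carrier F. ?h x = \<zero>\<^bsub>N\<^esub>}"
    using resp[OF h free_lift_gen[OF N \<phi>]] rels by auto
  then have ker: "V \<subseteq> {x \<in> carrier F. ?h x = \<zero>\<^bsub>N\<^esub>}"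
    by (intro mod_span_submodule(3) module_free rels submodule_kernel N h)
  have h_eq: "?h f = ?h g" if "f \<in> carrier F" "g \<in> carrier F" "V +>\<^bsub>F\<^esub> f = V +>\<^bsub>F\<^esub> g" for f g
  proof -
    have "f \<ominus>\<^bsub>F\<^esub> g \<in> V" using that Q.coset_eq by simp
    then have "?h f \<ominus>\<^bsub>N\<^esub> ?h g = \<zero>\<^bsub>N\<^esub>"
      using ker mod_hom_diff[OF module_free N h that(1,2)] by auto
    then show ?thesis using N.diff_zero_imp_eq mod_hom_closed[OF h that(1)] mod_hom_closed[OF h that(2)] by blast
  qed
  define k where "k = (\<lambda>C\<in>carrier (pres_module R S Q). ?h (SOME f. f \<in> carrier F \<and> C = V +>\<^bsub>F\<^esub> f))"
  have k: "k (V +>\<^bsub>F\<^esub> f) = ?h f" if "f \<in> carrier F" for f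
  proof -
    let ?f = "SOME g. g \<in> carrier F \<and> V +>\<^bsub>F\<^esub> f = V +>\<^bsub>F\<^esub> g"
    have f: "?f \<in> carrier F \<and> V +>\<^bsub>F\<^esub> f = V +>\<^bsub>F\<^esub> ?f"
      by (rule someI[of _ f]) (use that in auto)
    have "V +>\<^bsub>F\<^esub> f \<in> carrier (pres_module R S Q)"
      using that by (simp add: pres_module_def Q.carrier_quot)
    then have "k (V +>\<^bsub>F\<^esub> f) = ?h ?f" unfolding k_def by (rule restrict_apply')
    also have "\<dots> = ?h f" using h_eq[of ?f f] f that by metis
    finally show ?thesis .
  qed
  have ex: "?P k"
  proof (intro conjI ballI)
    show "k \<in> mod_hom R (pres_module R S Q) N"
      by (rule mod_homI)
        (auto simp: pres_module_def Q.carrier_quot Q.add_quot Q.smult_quot k mod_hom_closed[OF h]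
          mod_hom_add[OF h] mod_hom_smult[OF h])
    show "k \<in> extensional (carrier (pres_module R S Q))" by (simp add: k_def)
    show "k (pres_gen R S Q s) = \<phi> s" if "s \<in> S" for s
      using that by (simp add: pres_gen_def k free_gen_closed free_lift_gen[OF N \<phi>])
  qed
  have "pres_lift R S Q N \<phi> = k" unfolding pres_lift_def
  proof (rule the_equality)
    show "?P k" by (rule ex)
    show "f = k" if "?P f" for f
    proof (rule extensionalityI[of _ "carrier (pres_module R S Q)"])
      fix x assume x: "x \<in> carrier (pres_module R S Q)"
      show "f x = k x"
        by (rule pres_hom_eqI[OF N _ _ _ x]) (use that ex in auto)
    qed (use that ex in auto)
  qed
  then show "pres_lift R S Q N \<phi> \<in> mod_hom R (pres_module R S Q) N"
    "\<And>s. s \<in> S \<Longrightarrow> pres_lift R S Q N \<phi> (pres_gen R S Q s) = \<phi> s" using ex by simp_all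
qed

end

section \<open>Direct sums\<close>

lemma dsum_simps:
  "carrier (dsum_module I M) = (\<Pi>\<^sub>E i\<in>I. carrier (M i))"
  "\<zero>\<^bsub>dsum_module I M\<^esub> = (\<lambda>i\<in>I. \<zero>\<^bsub>M i\<^esub>)"
  "x \<oplus>\<^bsub>dsum_module I M\<^esub> y = (\<lambda>i\<in>I. x i \<oplus>\<^bsub>M i\<^esub> y i)"
  "a \<odot>\<^bsub>dsum_module I M\<^esub> x = (\<lambda>i\<in>I. a \<odot>\<^bsub>M i\<^esub> x i)"
  by (simp_all add: dsum_module_def)

lemma dsum_eqI:
  "\<lbrakk>x \<in> carrier (dsum_module I M); y \<in> carrier (dsum_module I M); \<And>i. i \<in> I \<Longrightarrow> x i = y i\<rbrakk> \<Longrightarrow> x = y"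
  unfolding dsum_simps by (rule PiE_ext) auto

lemma dsum_component: "\<lbrakk>x \<in> carrier (dsum_module I M); i \<in> I\<rbrakk> \<Longrightarrow> x i \<in> carrier (M i)"
  unfolding dsum_simps by auto

lemma module_dsum:
  assumes "cring R" "\<And>i. i \<in> I \<Longrightarrow> module R (M i)"
  shows "module R (dsum_module I M)"
proof (rule moduleI)
  have ag: "abelian_group (M i)" if "i \<in> I" for i using assms(2)[OF that] by (rule module_abelian_group)
  note am = abelian_group.axioms(1)[OF ag]
  show "abelian_group (dsum_module I M)"
  proof (rule abelian_groupI; (unfold dsum_simps)?)
    fix x assume x: "x \<in> (\<Pi>\<^sub>E i\<in>I. carrier (M i))"
    then have xm: "\<And>i. i \<in> I \<Longrightarrow> x i \<in> carrier (M i)" by auto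
    show "\<exists>y\<in>\<Pi>\<^sub>E i\<in>I. carrier (M i). (\<lambda>i\<in>I. y i \<oplus>\<^bsub>M i\<^esub> x i) = (\<lambda>i\<in>I. \<zero>\<^bsub>M i\<^esub>)"
      by (rule bexI[of _ "\<lambda>i\<in>I. \<ominus>\<^bsub>M i\<^esub> x i"])
        (simp_all add: abelian_group.l_neg[OF ag] xm abelian_group.a_inv_closed[OF ag] cong: restrict_cong)
    show "(\<lambda>i\<in>I. (\<lambda>i\<in>I. \<zero>\<^bsub>M i\<^esub>) i \<oplus>\<^bsub>M i\<^esub> x i) = x"
      by (rule PiE_ext[OF _ x]) (simp_all add: abelian_monoid.l_zero[OF am] xm)
  next
    fix x y assume "x \<in> (\<Pi>\<^sub>E i\<in>I. carrier (M i))" "y \<in> (\<Pi>\<^sub>E i\<in>I. carrier (M i))"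
    then have m: "\<And>i. i \<in> I \<Longrightarrow> x i \<in> carrier (M i)" "\<And>i. i \<in> I \<Longrightarrow> y i \<in> carrier (M i)" by auto
    show "(\<lambda>i\<in>I. x i \<oplus>\<^bsub>M i\<^esub> y i) \<in> (\<Pi>\<^sub>E i\<in>I. carrier (M i))"
      by (simp add: m abelian_monoid.a_closed[OF am])
    show "(\<lambda>i\<in>I. x i \<oplus>\<^bsub>M i\<^esub> y i) = (\<lambda>i\<in>I. y i \<oplus>\<^bsub>M i\<^esub> x i)"
      by (rule restrict_ext) (simp add: m abelian_monoid.a_comm[OF am])
    fix z assume "z \<in> (\<Pi>\<^sub>E i\<in>I. carrier (M i))"
    then have mz: "\<And>i. i \<in> I \<Longrightarrow> z i \<in> carrier (M i)" by auto
    show "(\<lambda>i\<in>I. (\<lambda>i\<in>I. x i \<oplus>\<^bsub>M i\<^esub> y i) i \<oplus>\<^bsub>M i\<^esub> z i) = (\<lambda>i\<in>I. x i \<oplus>\<^bsub>M i\<^esub> (\<lambda>i\<in>I. y i \<oplus>\<^bsub>M i\<^esub> z i) i)"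
      by (rule restrict_ext) (simp add: m mz abelian_monoid.a_assoc[OF am])
  next
    show "(\<lambda>i\<in>I. \<zero>\<^bsub>M i\<^esub>) \<in> (\<Pi>\<^sub>E i\<in>I. carrier (M i))"
      by (simp add: abelian_monoid.zero_closed[OF am])
  qed
next
  fix x assume x: "x \<in> carrier (dsum_module I M)"
  note xm = dsum_component[OF x]
  show "\<one>\<^bsub>R\<^esub> \<odot>\<^bsub>dsum_module I M\<^esub> x = x"
    unfolding dsum_simps
    by (rule PiE_ext[OF _ x[unfolded dsum_simps]]) (simp_all add: xm module.smult_one[OF assms(2)])
  fix a assume a: "a \<in> carrier R"
  show "a \<odot>\<^bsub>dsum_module I M\<^esub> x \<in> carrier (dsum_module I M)"
    by (simp add: dsum_simps xm a module.smult_closed[OF assms(2)])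
  fix b assume b: "b \<in> carrier R"
  show "(a \<oplus>\<^bsub>R\<^esub> b) \<odot>\<^bsub>dsum_module I M\<^esub> x = a \<odot>\<^bsub>dsum_module I M\<^esub> x \<oplus>\<^bsub>dsum_module I M\<^esub> b \<odot>\<^bsub>dsum_module I M\<^esub> x"
    "(a \<otimes>\<^bsub>R\<^esub> b) \<odot>\<^bsub>dsum_module I M\<^esub> x = a \<odot>\<^bsub>dsum_module I M\<^esub> (b \<odot>\<^bsub>dsum_module I M\<^esub> x)"
    by (simp_all add: dsum_simps xm a b module.smult_l_distr[OF assms(2)] module.smult_assoc1[OF assms(2)]
        cong: restrict_cong)
next
  fix a x y assume a: "a \<in> carrier R" and x: "x \<in> carrier (dsum_module I M)" and y: "y \<in> carrier (dsum_module I M)"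
  show "a \<odot>\<^bsub>dsum_module I M\<^esub> (x \<oplus>\<^bsub>dsum_module I M\<^esub> y) = a \<odot>\<^bsub>dsum_module I M\<^esub> x \<oplus>\<^bsub>dsum_module I M\<^esub> a \<odot>\<^bsub>dsum_module I M\<^esub> y"
    using dsum_component[OF x] dsum_component[OF y]
    by (simp add: dsum_simps a module.smult_r_distr[OF assms(2)] cong: restrict_cong)
qed (rule assms)

lemma dsum_uminus:
  assumes "cring R" "\<And>i. i \<in> I \<Longrightarrow> module R (M i)" "x \<in> carrier (dsum_module I M)"
  shows "\<ominus>\<^bsub>dsum_module I M\<^esub> x = (\<lambda>i\<in>I. \<ominus>\<^bsub>M i\<^esub> x i)"
proof -
  interpret D: module R "dsum_module I M" by (rule module_dsum[OF assms(1,2)])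
  have ag: "abelian_group (M i)" if "i \<in> I" for i using assms(2)[OF that] by (rule module_abelian_group)
  let ?y = "\<lambda>i\<in>I. \<ominus>\<^bsub>M i\<^esub> x i"
  have y: "?y \<in> carrier (dsum_module I M)"
    using dsum_component[OF assms(3)] by (auto simp: dsum_simps abelian_group.a_inv_closed[OF ag])
  have "?y \<oplus>\<^bsub>dsum_module I M\<^esub> x = \<zero>\<^bsub>dsum_module I M\<^esub>"
    using dsum_component[OF assms(3)]
    by (auto simp: dsum_simps abelian_group.l_neg[OF ag] intro!: restrict_ext)
  then show ?thesis by (rule D.M.minus_equality[OF _ assms(3) y])
qed

lemma dsum_minus:
  assumes "cring R" "\<And>i. i \<in> I \<Longrightarrow> module R (M i)"
    "x \<in> carrier (dsum_module I M)" "y \<in> carrier (dsum_module I M)"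
  shows "x \<ominus>\<^bsub>dsum_module I M\<^esub> y = (\<lambda>i\<in>I. x i \<ominus>\<^bsub>M i\<^esub> y i)"
  by (simp add: a_minus_def dsum_uminus[OF assms(1,2,4)]) (auto simp: dsum_simps intro!: restrict_ext)

lemma dsum_component_hom: "i \<in> I \<Longrightarrow> (\<lambda>x. x i) \<in> mod_hom R (dsum_module I M) (M i)"
  by (rule mod_homI) (auto simp: dsum_simps PiE_mem)

lemma dsum_hom:
  assumes "module R L" "\<And>i. i \<in> I \<Longrightarrow> f i \<in> mod_hom R L (M i)"
  shows "(\<lambda>x. \<lambda>i\<in>I. f i x) \<in> mod_hom R L (dsum_module I M)"
  by (rule mod_homI)
    (auto simp: dsum_simps mod_hom_closed[OF assms(2)] mod_hom_add[OF assms(2)] mod_hom_smult[OF assms(2)]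
      intro!: restrict_ext)

section \<open>Tensor products\<close>

definition tens :: "('r, 'c) ring_scheme \<Rightarrow> ('r, 'm, 'e) module_scheme \<Rightarrow> ('r, 'n, 'f) module_scheme
    \<Rightarrow> 'm \<Rightarrow> 'n \<Rightarrow> ('m \<times> 'n \<Rightarrow> 'r) set"
  where "tens R M N x y = pres_gen R (carrier M \<times> carrier N) (tensor_rels R M N) (x, y)"

locale tensor = M: module R M + N: module R N for R (structure) and M and N
begin

sublocale T: presentation R "carrier M \<times> carrier N" "tensor_rels R M N"
proof
  interpret F: module R "free_module R (carrier M \<times> carrier N)" by (rule M.R.module_free)
  show "tensor_rels R M N \<subseteq> carrier (free_module R (carrier M \<times> carrier N))"
    unfolding tensor_rels_def Let_def a_minus_def
    by (auto intro!: F.M.a_closed F.M.a_inv_closed F.smult_closed M.R.free_gen_closed)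
qed

abbreviation "MN \<equiv> tensor_module R M N"

lemma module_tensor: "module R MN"
  unfolding tensor_module_def by (rule T.module_pres)

sublocale MN: module R MN by (rule module_tensor)

lemma tens_closed [simp]: "\<lbrakk>x \<in> carrier M; y \<in> carrier N\<rbrakk> \<Longrightarrow> tens R M N x y \<in> carrier MN"
  unfolding tens_def tensor_module_def by (rule T.pres_gen_closed) auto

lemma tens_rel_iff:
  assumes "f \<in> carrier T.F" "g \<in> carrier T.F" "f \<ominus>\<^bsub>T.F\<^esub> g \<in> tensor_rels R M N"
  shows "T.V +>\<^bsub>T.F\<^esub> f = T.V +>\<^bsub>T.F\<^esub> g"
  using assms mod_span_submodule(2)[OF M.R.module_free T.rels] by (auto simp: T.Q.coset_eq)

lemma quot_hom: "(\<lambda>f. T.V +>\<^bsub>T.F\<^esub> f) \<in> mod_hom R T.F MN"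
  unfolding tensor_module_def pres_module_def by (rule T.Q.proj_hom)

lemma gen_closed [simp]: "\<lbrakk>x \<in> carrier M; y \<in> carrier N\<rbrakk> \<Longrightarrow> free_gen R (x, y) \<in> carrier T.F"
  by (rule M.R.free_gen_closed) auto

lemma tens_add_left:
  assumes "x \<in> carrier M" "x' \<in> carrier M" "y \<in> carrier N"
  shows "tens R M N (x \<oplus>\<^bsub>M\<^esub> x') y = tens R M N x y \<oplus>\<^bsub>MN\<^esub> tens R M N x' y"
proof -
  have "T.V +>\<^bsub>T.F\<^esub> free_gen R (x \<oplus>\<^bsub>M\<^esub> x', y) = T.V +>\<^bsub>T.F\<^esub> (free_gen R (x, y) \<oplus>\<^bsub>T.F\<^esub> free_gen R (x', y))"
    by (rule tens_rel_iff) (use assms in \<open>auto simp: tensor_rels_def Let_def\<close>)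
  then show ?thesis using assms by (simp add: tens_def pres_gen_def mod_hom_add[OF quot_hom])
qed

lemma tens_add_right:
  assumes "x \<in> carrier M" "y \<in> carrier N" "y' \<in> carrier N"
  shows "tens R M N x (y \<oplus>\<^bsub>N\<^esub> y') = tens R M N x y \<oplus>\<^bsub>MN\<^esub> tens R M N x y'"
proof -
  have "T.V +>\<^bsub>T.F\<^esub> free_gen R (x, y \<oplus>\<^bsub>N\<^esub> y') = T.V +>\<^bsub>T.F\<^esub> (free_gen R (x, y) \<oplus>\<^bsub>T.F\<^esub> free_gen R (x, y'))"
    by (rule tens_rel_iff) (use assms in \<open>auto simp: tensor_rels_def Let_def\<close>)
  then show ?thesis using assms by (simp add: tens_def pres_gen_def mod_hom_add[OF quot_hom])
qed

lemma tens_smult_left: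
  assumes "a \<in> carrier R" "x \<in> carrier M" "y \<in> carrier N"
  shows "tens R M N (a \<odot>\<^bsub>M\<^esub> x) y = a \<odot>\<^bsub>MN\<^esub> tens R M N x y"
proof -
  have "T.V +>\<^bsub>T.F\<^esub> free_gen R (a \<odot>\<^bsub>M\<^esub> x, y) = T.V +>\<^bsub>T.F\<^esub> (a \<odot>\<^bsub>T.F\<^esub> free_gen R (x, y))"
    by (rule tens_rel_iff) (use assms in \<open>auto simp: tensor_rels_def Let_def\<close>)
  then show ?thesis using assms by (simp add: tens_def pres_gen_def mod_hom_smult[OF quot_hom])
qed

lemma tens_smult_right:
  assumes "a \<in> carrier R" "x \<in> carrier M" "y \<in> carrier N"
  shows "tens R M N x (a \<odot>\<^bsub>N\<^esub> y) = a \<odot>\<^bsub>MN\<^esub> tens R M N x y"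
proof -
  have "T.V +>\<^bsub>T.F\<^esub> free_gen R (x, a \<odot>\<^bsub>N\<^esub> y) = T.V +>\<^bsub>T.F\<^esub> (a \<odot>\<^bsub>T.F\<^esub> free_gen R (x, y))"
    by (rule tens_rel_iff) (use assms in \<open>auto simp: tensor_rels_def Let_def\<close>)
  then show ?thesis using assms by (simp add: tens_def pres_gen_def mod_hom_smult[OF quot_hom])
qed

lemma tensor_hom_eqI:
  assumes "module R L" "h \<in> mod_hom R MN L" "h' \<in> mod_hom R MN L"
    "\<And>x y. \<lbrakk>x \<in> carrier M; y \<in> carrier N\<rbrakk> \<Longrightarrow> h (tens R M N x y) = h' (tens R M N x y)"
    "z \<in> carrier MN"
  shows "h z = h' z"
  using assms unfolding tensor_module_def tens_def
  by (intro T.pres_hom_eqI[of L h h' z]) auto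

lemma tensor_lift:
  assumes L: "module R L"
    and r: "\<And>x. x \<in> carrier M \<Longrightarrow> (\<lambda>y. \<phi> (x, y)) \<in> mod_hom R N L"
    and l: "\<And>y. y \<in> carrier N \<Longrightarrow> (\<lambda>x. \<phi> (x, y)) \<in> mod_hom R M L"
  shows tensor_lift_hom: "pres_lift R (carrier M \<times> carrier N) (tensor_rels R M N) L \<phi> \<in> mod_hom R MN L"
    and tensor_lift_tens: "\<And>x y. \<lbrakk>x \<in> carrier M; y \<in> carrier N\<rbrakk> \<Longrightarrow>
      pres_lift R (carrier M \<times> carrier N) (tensor_rels R M N) L \<phi> (tens R M N x y) = \<phi> (x, y)"
proof -
  interpret L: module R L by fact
  interpret F: module R T.F by (rule M.R.module_free)
  have cl: "\<phi> (x, y) \<in> carrier L" if "x \<in> carrier M" "y \<in> carrier N" for x y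
    using mod_hom_closed[OF r[OF that(1)] that(2)] .
  have \<phi>: "\<phi> \<in> carrier M \<times> carrier N \<rightarrow> carrier L" using cl by auto
  have resp: "h q = \<zero>\<^bsub>L\<^esub>" if h: "h \<in> mod_hom R T.F L"
      and g: "\<And>s. s \<in> carrier M \<times> carrier N \<Longrightarrow> h (free_gen R s) = \<phi> s" and q: "q \<in> tensor_rels R M N" for h q
  proof -
    note diff = mod_hom_diff[OF M.R.module_free L h]
    note [simp] = diff g cl mod_hom_add[OF h] mod_hom_smult[OF h] mod_hom_add[OF r] mod_hom_add[OF l]
      mod_hom_smult[OF r] mod_hom_smult[OF l] L.M.r_neg
    show ?thesis using q unfolding tensor_rels_def Let_def
      by (elim UnE CollectE exE conjE) (simp_all add: a_minus_def[of L])
  qed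
  show "pres_lift R (carrier M \<times> carrier N) (tensor_rels R M N) L \<phi> \<in> mod_hom R MN L"
    unfolding tensor_module_def by (rule T.pres_lift_hom[OF L \<phi>]) (rule resp)
  show "pres_lift R (carrier M \<times> carrier N) (tensor_rels R M N) L \<phi> (tens R M N x y) = \<phi> (x, y)"
    if "x \<in> carrier M" "y \<in> carrier N" for x y
    unfolding tens_def by (rule T.pres_lift_gen[OF L \<phi>], rule resp) (use that in auto)
qed

end

lemma tensorI: "\<lbrakk>module R M; module R N\<rbrakk> \<Longrightarrow> tensor R M N"
  by (simp add: tensor_def)

lemma tensor_map:
  assumes "module R M" "module R N" "module R M'" "module R N'" "f \<in> mod_hom R M M'" "g \<in> mod_hom R N N'"
  shows tensor_map_hom: "tensor_map R M N M' N' f g \<in> mod_hom R (tensor_module R M N) (tensor_module R M' N')"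
    and tensor_map_tens: "\<lbrakk>x \<in> carrier M; y \<in> carrier N\<rbrakk> \<Longrightarrow>
      tensor_map R M N M' N' f g (tens R M N x y) = tens R M' N' (f x) (g y)"
proof -
  interpret T: tensor R M N by (intro tensorI assms)
  interpret T': tensor R M' N' by (intro tensorI assms)
  let ?\<phi> = "\<lambda>(x, y). tens R M' N' (f x) (g y)"
  have eq: "tensor_map R M N M' N' f g =
      pres_lift R (carrier M \<times> carrier N) (tensor_rels R M N) (tensor_module R M' N') ?\<phi>"
    by (simp add: tensor_map_def tens_def)
  note [simp] = mod_hom_closed[OF assms(5)] mod_hom_closed[OF assms(6)] mod_hom_add[OF assms(5)] mod_hom_add[OF assms(6)]
    mod_hom_smult[OF assms(5)] mod_hom_smult[OF assms(6)]
    T'.tens_add_left T'.tens_add_right T'.tens_smult_left T'.tens_smult_right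
  have r: "(\<lambda>y. ?\<phi> (x, y)) \<in> mod_hom R N T'.MN" if "x \<in> carrier M" for x
    by (rule mod_homI) (use that in auto)
  have l: "(\<lambda>x. ?\<phi> (x, y)) \<in> mod_hom R M T'.MN" if "y \<in> carrier N" for y
    by (rule mod_homI) (use that in auto)
  show "tensor_map R M N M' N' f g \<in> mod_hom R (tensor_module R M N) (tensor_module R M' N')"
    unfolding eq by (rule T.tensor_lift_hom[OF T'.module_tensor r l])
  show "tensor_map R M N M' N' f g (tens R M N x y) = tens R M' N' (f x) (g y)"
    if "x \<in> carrier M" "y \<in> carrier N"
    unfolding eq by (subst T.tensor_lift_tens[OF T'.module_tensor r l]) (use that in auto)
qed

section \<open>Projective modules\<close>

text \<open>
  The lift exists for free modules by choosing preimages of the generators; a projective module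
  inherits it as a retract of a free one. Only the image of \<open>f\<close> has to be reached, as in the
  construction of a contraction.
\<close>

lemma projective_lift:
  assumes "projective_module R P" "module R M" "module R N" "f \<in> mod_hom R P N" "g \<in> mod_hom R M N"
    and im: "\<And>x. x \<in> carrier P \<Longrightarrow> f x \<in> g ` carrier M"
  obtains h where "h \<in> mod_hom R P M" "\<And>x. x \<in> carrier P \<Longrightarrow> g (h x) = f x"
proof -
  interpret P: module R P using assms(1) by (simp add: projective_module_def)
  obtain S :: "'c set" and i p where ip: "i \<in> mod_hom R P (free_module R S)" "p \<in> mod_hom R (free_module R S) P"
    "\<And>x. x \<in> carrier P \<Longrightarrow> p (i x) = x"
    using assms(1) unfolding projective_module_def by blast
  define \<phi> where "\<phi> s = (SOME m. m \<in> carrier M \<and> g m = f (p (free_gen R s)))" for s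
  have \<phi>: "\<phi> s \<in> carrier M \<and> g (\<phi> s) = f (p (free_gen R s))" if "s \<in> S" for s
  proof -
    have "f (p (free_gen R s)) \<in> g ` carrier M"
      by (rule im) (rule mod_hom_closed[OF ip(2) P.R.free_gen_closed[OF that]])
    then show ?thesis unfolding \<phi>_def by (intro someI_ex[of "\<lambda>m. m \<in> carrier M \<and> g m = f (p (free_gen R s))"]) auto
  qed
  then have \<phi>S: "\<phi> \<in> S \<rightarrow> carrier M" by auto
  let ?L = "P.R.free_lift M \<phi>"
  have L: "?L \<in> mod_hom R (free_module R S) M" by (rule P.R.free_lift_hom[OF assms(2) \<phi>S])
  show thesis
  proof
    show "(\<lambda>x. ?L (i x)) \<in> mod_hom R P M" by (rule mod_hom_comp[OF ip(1) L])
    show "g (?L (i x)) = f x" if "x \<in> carrier P" for x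
    proof -
      have "g (?L (i x)) = f (p (i x))"
        by (rule P.R.free_hom_eqI[OF assms(3) mod_hom_comp[OF L assms(5)] mod_hom_comp[OF ip(2) assms(4)] _
            mod_hom_closed[OF ip(1) that]])
          (simp add: P.R.free_lift_gen[OF assms(2) \<phi>S] \<phi>)
      then show ?thesis using ip(3)[OF that] by simp
    qed
  qed
qed

section \<open>Comparing the homology of two complexes\<close>

lemma quot_module_iso:
  assumes M: "module R M" "submodule N R M" and M': "module R M'" "submodule N' R M'"
    and h: "h \<in> mod_hom R M M'" and surj: "h ` carrier M = carrier M'"
    and ker: "\<And>x. x \<in> carrier M \<Longrightarrow> h x \<in> N' \<longleftrightarrow> x \<in> N"
  shows "mod_isomorphic R (quot_module M N) (quot_module M' N')"
proof -
  interpret Q: quotient R M N by (intro quotientI M)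
  interpret Q': quotient R M' N' by (intro quotientI M')
  define f where "f C = N' +>\<^bsub>M'\<^esub> h (SOME x. x \<in> carrier M \<and> C = N +>\<^bsub>M\<^esub> x)" for C
  have eq: "N' +>\<^bsub>M'\<^esub> h x = N' +>\<^bsub>M'\<^esub> h y \<longleftrightarrow> N +>\<^bsub>M\<^esub> x = N +>\<^bsub>M\<^esub> y"
    if xy: "x \<in> carrier M" "y \<in> carrier M" for x y
    using Q.coset_eq[OF xy] Q'.coset_eq[OF mod_hom_closed[OF h xy(1)] mod_hom_closed[OF h xy(2)]]
      mod_hom_diff[OF M(1) M'(1) h xy] ker[of "x \<ominus>\<^bsub>M\<^esub> y"] xy
    by (simp add: Q.M.minus_closed)
  have f: "f (N +>\<^bsub>M\<^esub> x) = N' +>\<^bsub>M'\<^esub> h x" if "x \<in> carrier M" for x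
  proof -
    let ?y = "SOME y. y \<in> carrier M \<and> N +>\<^bsub>M\<^esub> x = N +>\<^bsub>M\<^esub> y"
    have "?y \<in> carrier M \<and> N +>\<^bsub>M\<^esub> x = N +>\<^bsub>M\<^esub> ?y"
      by (rule someI[of _ x]) (use that in auto)
    then show ?thesis unfolding f_def using eq[of ?y x] that by metis
  qed
  show ?thesis unfolding mod_isomorphic_def
  proof
    show "f \<in> mod_hom R (quot_module M N) (quot_module M' N')"
    proof (rule mod_homI)
      fix x assume "x \<in> carrier (quot_module M N)"
      then obtain x0 where x: "x0 \<in> carrier M" "x = N +>\<^bsub>M\<^esub> x0" by (auto simp: Q.carrier_quot)
      then show "f x \<in> carrier (quot_module M' N')"
        using mod_hom_closed[OF h x(1)] by (simp add: f Q'.carrier_quot)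
      fix a assume "a \<in> carrier R"
      then show "f (a \<odot>\<^bsub>quot_module M N\<^esub> x) = a \<odot>\<^bsub>quot_module M' N'\<^esub> f x"
        using x mod_hom_closed[OF h x(1)] by (simp add: f Q.smult_quot Q'.smult_quot mod_hom_smult[OF h])
    next
      fix x y assume "x \<in> carrier (quot_module M N)" "y \<in> carrier (quot_module M N)"
      then obtain x0 y0 where x: "x0 \<in> carrier M" "x = N +>\<^bsub>M\<^esub> x0" "y0 \<in> carrier M" "y = N +>\<^bsub>M\<^esub> y0"
        by (auto simp: Q.carrier_quot)
      then show "f (x \<oplus>\<^bsub>quot_module M N\<^esub> y) = f x \<oplus>\<^bsub>quot_module M' N'\<^esub> f y"
        using mod_hom_closed[OF h x(1)] mod_hom_closed[OF h x(3)]
        by (simp add: f Q.add_quot Q'.add_quot mod_hom_add[OF h])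
    qed
    show "bij_betw f (carrier (quot_module M N)) (carrier (quot_module M' N'))"
      unfolding bij_betw_def
    proof
      show "inj_on f (carrier (quot_module M N))"
        unfolding inj_on_def Q.carrier_quot using f eq by auto
      show "f ` carrier (quot_module M N) = carrier (quot_module M' N')"
        unfolding Q.carrier_quot Q'.carrier_quot image_image surj[symmetric] using f by (auto intro!: image_eqI)
    qed
  qed
qed

text \<open>
  The long exact homology sequence for a surjective chain map with acyclic kernel. A cycle downstairs is lifted to a chain whose boundary lies in the kernel and is therefore
  the boundary of a chain of the kernel, by which the lift is corrected.
\<close>

lemma homology_iso:
  fixes G :: "nat \<Rightarrow> ('r, 'g) module" and Q :: "nat \<Rightarrow> ('r, 'q) module"
  assumes G: "\<And>n. module R (G n)" and Q: "\<And>n. module R (Q n)"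
    and D: "\<And>n. D (Suc n) \<in> mod_hom R (G (Suc n)) (G n)"
    and q: "\<And>n. q (Suc n) \<in> mod_hom R (Q (Suc n)) (Q n)"
    and h: "\<And>n. h n \<in> mod_hom R (G n) (Q n)"
    and surj: "\<And>n. h n ` carrier (G n) = carrier (Q n)"
    and comm: "\<And>n x. x \<in> carrier (G (Suc n)) \<Longrightarrow> h n (D (Suc n) x) = q (Suc n) (h (Suc n) x)"
    and DD: "\<And>n x. x \<in> carrier (G (Suc (Suc n))) \<Longrightarrow> D (Suc n) (D (Suc (Suc n)) x) = \<zero>\<^bsub>G n\<^esub>"
    and acyc: "\<And>n x. \<lbrakk>x \<in> carrier (G n); h n x = \<zero>\<^bsub>Q n\<^esub>; \<And>k. n = Suc k \<Longrightarrow> D n x = \<zero>\<^bsub>G k\<^esub>\<rbrakk>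
      \<Longrightarrow> \<exists>y\<in>carrier (G (Suc n)). h (Suc n) y = \<zero>\<^bsub>Q (Suc n)\<^esub> \<and> D (Suc n) y = x"
  shows "mod_isomorphic R (homology G D n) (homology Q q n)"
proof -
  interpret G: module R "G i" for i by (rule G)
  interpret Q: module R "Q i" for i by (rule Q)
  define Z where "Z = {x \<in> carrier (G n). n > 0 \<longrightarrow> D n x = \<zero>\<^bsub>G (n - 1)\<^esub>}"
  define W where "W = {x \<in> carrier (Q n). n > 0 \<longrightarrow> q n x = \<zero>\<^bsub>Q (n - 1)\<^esub>}"
  have subZ: "submodule Z R (G n)"
  proof (cases n)
    case 0
    then show ?thesis using G.carrier_is_submodule by (simp add: Z_def)
  next
    case (Suc k)
    then show ?thesis using submodule_kernel[OF G G D[of k]] by (simp add: Z_def)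
  qed
  have subW: "submodule W R (Q n)"
  proof (cases n)
    case 0
    then show ?thesis using Q.carrier_is_submodule by (simp add: W_def)
  next
    case (Suc k)
    then show ?thesis using submodule_kernel[OF Q Q q[of k]] by (simp add: W_def)
  qed
  have hZ: "h n x \<in> W" if "x \<in> Z" for x
  proof (cases n)
    case 0
    then show ?thesis using that mod_hom_closed[OF h[of n]] by (auto simp: Z_def W_def)
  next
    case (Suc k)
    have x: "x \<in> carrier (G (Suc k))" "D (Suc k) x = \<zero>\<^bsub>G k\<^esub>" using that Suc by (auto simp: Z_def)
    show ?thesis
      using comm[OF x(1)] x(2) mod_hom_zero[OF G Q h] mod_hom_closed[OF h x(1)] Suc by (simp add: W_def)
  qed
  have DZ: "D (Suc n) y \<in> Z" if "y \<in> carrier (G (Suc n))" for y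
  proof (cases n)
    case 0
    then show ?thesis using mod_hom_closed[OF D that] by (simp add: Z_def)
  next
    case (Suc k)
    then show ?thesis using mod_hom_closed[OF D that] DD[of y k] that by (simp add: Z_def)
  qed
  have lift: "\<exists>x\<in>carrier (G m). h m x = z" if "z \<in> carrier (Q m)" for m z
    using surj[of m] that by (metis imageE)
  have hsurj: "\<exists>x\<in>Z. h n x = z" if z: "z \<in> W" for z
  proof -
    obtain x where x: "x \<in> carrier (G n)" "h n x = z" using lift z by (auto simp: W_def)
    show ?thesis
    proof (cases n)
      case 0
      then show ?thesis using x by (auto simp: Z_def)
    next
      case (Suc k)
      have x': "x \<in> carrier (G (Suc k))" using x Suc by simp
      have Dx: "D (Suc k) x \<in> carrier (G k)" using mod_hom_closed[OF D x'] .
      have "h k (D (Suc k) x) = \<zero>\<^bsub>Q k\<^esub>" using comm[OF x'] x(2) z Suc by (simp add: W_def)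
      moreover have "D k (D (Suc k) x) = \<zero>\<^bsub>G j\<^esub>" if "k = Suc j" for j
        using DD[of x j] x' that by simp
      ultimately obtain y where y: "y \<in> carrier (G (Suc k))" "h (Suc k) y = \<zero>\<^bsub>Q (Suc k)\<^esub>" "D (Suc k) y = D (Suc k) x"
        using acyc[OF Dx] by blast
      have "x \<ominus>\<^bsub>G n\<^esub> y \<in> Z"
        using mod_hom_diff[OF G G D x' y(1)] y(3) x' y(1) Dx Suc
        by (simp add: Z_def G.M.minus_closed a_minus_def G.M.r_neg)
      moreover have "h n (x \<ominus>\<^bsub>G n\<^esub> y) = z"
        using mod_hom_diff[OF G Q h x' y(1)] y(2) x Suc mod_hom_closed[OF h x']
        by (simp add: a_minus_def)
      ultimately show ?thesis by blast
    qed
  qed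
  have inj: "x \<in> D (Suc n) ` carrier (G (Suc n))"
    if x: "x \<in> Z" and hx: "h n x \<in> q (Suc n) ` carrier (Q (Suc n))" for x
  proof -
    obtain w where w: "w \<in> carrier (Q (Suc n))" "h n x = q (Suc n) w" using hx by auto
    obtain y where y: "y \<in> carrier (G (Suc n))" "h (Suc n) y = w" using lift[OF w(1)] by blast
    have xc: "x \<in> carrier (G n)" using x by (simp add: Z_def)
    have Dy: "D (Suc n) y \<in> carrier (G n)" using mod_hom_closed[OF D y(1)] .
    let ?v = "x \<ominus>\<^bsub>G n\<^esub> D (Suc n) y"
    have "h n ?v = \<zero>\<^bsub>Q n\<^esub>"
      using mod_hom_diff[OF G Q h xc Dy] comm[OF y(1)] y(2) w mod_hom_closed[OF q w(1)]
      by (simp add: a_minus_def Q.M.r_neg)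
    moreover have "D n ?v = \<zero>\<^bsub>G k\<^esub>" if "n = Suc k" for k
      using mod_hom_diff[OF G G D[of k], of x "D (Suc n) y"] that xc Dy x DD[of y k] y(1)
      by (simp add: Z_def a_minus_def)
    ultimately obtain y' where y': "y' \<in> carrier (G (Suc n))" "D (Suc n) y' = ?v"
      using acyc[of ?v n] xc Dy by (auto simp: G.M.minus_closed)
    have "D (Suc n) (y' \<oplus>\<^bsub>G (Suc n)\<^esub> y) = ?v \<oplus>\<^bsub>G n\<^esub> D (Suc n) y"
      using mod_hom_add[OF D y'(1) y(1)] y'(2) by simp
    also have "\<dots> = x" using xc Dy by (simp add: a_minus_def G.M.a_assoc G.M.l_neg)
    finally show ?thesis using y' y by (metis G.M.a_closed imageI)
  qed
  have hB: "h n x \<in> q (Suc n) ` carrier (Q (Suc n))" if "x \<in> D (Suc n) ` carrier (G (Suc n))" for x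
    using that comm mod_hom_closed[OF h] by auto
  let ?G = "(G n)\<lparr>carrier := Z\<rparr>" and ?Q = "(Q n)\<lparr>carrier := W\<rparr>"
  have mG: "module R ?G" by (rule submodule.submodule_is_module[OF subZ G])
  have mQ: "module R ?Q" by (rule submodule.submodule_is_module[OF subW Q])
  have Dh: "D (Suc n) \<in> mod_hom R (G (Suc n)) ?G"
    by (rule mod_homI) (auto simp: DZ mod_hom_add[OF D] mod_hom_smult[OF D])
  have qW: "q (Suc n) w \<in> W" if "w \<in> carrier (Q (Suc n))" for w
    using lift[OF that] comm DZ hZ by metis
  have qh: "q (Suc n) \<in> mod_hom R (Q (Suc n)) ?Q"
    by (rule mod_homI) (auto simp: qW mod_hom_add[OF q] mod_hom_smult[OF q])
  have "mod_isomorphic R (quot_module ?G (D (Suc n) ` carrier (G (Suc n)))) (quot_module ?Q (q (Suc n) ` carrier (Q (Suc n))))"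
  proof (rule quot_module_iso[where h = "h n"])
    show "submodule (D (Suc n) ` carrier (G (Suc n))) R ?G" by (rule submodule_image[OF G mG Dh])
    show "submodule (q (Suc n) ` carrier (Q (Suc n))) R ?Q" by (rule submodule_image[OF Q mQ qh])
    show "h n \<in> mod_hom R ?G ?Q"
      by (rule mod_homI) (auto simp: hZ Z_def mod_hom_add[OF h] mod_hom_smult[OF h])
    show "h n ` carrier ?G = carrier ?Q" using hZ hsurj by (auto simp: image_iff)
    show "h n x \<in> q (Suc n) ` carrier (Q (Suc n)) \<longleftrightarrow> x \<in> D (Suc n) ` carrier (G (Suc n))"
      if "x \<in> carrier ?G" for x
      using that inj hB by auto
  qed (rule mG mQ)+
  then show ?thesis by (simp add: homology_def Z_def W_def)
qed

section \<open>Triple complexes\<close>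

text \<open>
  The three differentials anticommute, so their sum is a differential on the total complex.
\<close>

locale triple_complex = cring K for K :: "'k ring" (structure) +
  fixes E :: "nat \<times> nat \<times> nat \<Rightarrow> ('k, 'e) module"
    and d1 d2 d3 :: "nat \<Rightarrow> nat \<Rightarrow> nat \<Rightarrow> 'e \<Rightarrow> 'e"
  assumes E: "module K (E i)"
    and d1: "d1 l n m \<in> mod_hom K (E (l, Suc n, m)) (E (l, n, m))"
    and d2: "d2 l n m \<in> mod_hom K (E (l, n, Suc m)) (E (l, n, m))"
    and d3: "d3 l n m \<in> mod_hom K (E (Suc l, n, m)) (E (l, n, m))"
    and d11: "x \<in> carrier (E (l, Suc (Suc n), m)) \<Longrightarrow> d1 l n m (d1 l (Suc n) m x) = \<zero>\<^bsub>E (l, n, m)\<^esub>"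
    and d22: "x \<in> carrier (E (l, n, Suc (Suc m))) \<Longrightarrow> d2 l n m (d2 l n (Suc m) x) = \<zero>\<^bsub>E (l, n, m)\<^esub>"
    and d33: "x \<in> carrier (E (Suc (Suc l), n, m)) \<Longrightarrow> d3 l n m (d3 (Suc l) n m x) = \<zero>\<^bsub>E (l, n, m)\<^esub>"
    and d21: "x \<in> carrier (E (l, Suc n, Suc m)) \<Longrightarrow>
      d2 l n m (d1 l n (Suc m) x) = \<ominus>\<^bsub>E (l, n, m)\<^esub> d1 l n m (d2 l (Suc n) m x)"
    and d31: "x \<in> carrier (E (Suc l, Suc n, m)) \<Longrightarrow>
      d3 l n m (d1 (Suc l) n m x) = \<ominus>\<^bsub>E (l, n, m)\<^esub> d1 l n m (d3 l (Suc n) m x)"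
    and d32: "x \<in> carrier (E (Suc l, n, Suc m)) \<Longrightarrow>
      d3 l n m (d2 (Suc l) n m x) = \<ominus>\<^bsub>E (l, n, m)\<^esub> d2 l n m (d3 l n (Suc m) x)"
begin

definition idx :: "nat \<Rightarrow> (nat \<times> nat \<times> nat) set" where "idx N = {(l, n, m). l + n + m = N}"

abbreviation "tot N \<equiv> dsum_module (idx N) E"

definition D :: "nat \<Rightarrow> (nat \<times> nat \<times> nat \<Rightarrow> 'e) \<Rightarrow> nat \<times> nat \<times> nat \<Rightarrow> 'e"
  where "D N x = (\<lambda>(l, n, m) \<in> idx (N - 1).
    d1 l n m (x (l, Suc n, m)) \<oplus>\<^bsub>E (l, n, m)\<^esub> d2 l n m (x (l, n, Suc m))
      \<oplus>\<^bsub>E (l, n, m)\<^esub> d3 l n m (x (Suc l, n, m)))"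

sublocale E: module K "E i" for i by (rule E)

lemma module_tot: "module K (tot N)"
  by (rule module_dsum[OF is_cring E])

lemma d_closed [simp]:
  "x \<in> carrier (E (l, Suc n, m)) \<Longrightarrow> d1 l n m x \<in> carrier (E (l, n, m))"
  "x \<in> carrier (E (l, n, Suc m)) \<Longrightarrow> d2 l n m x \<in> carrier (E (l, n, m))"
  "x \<in> carrier (E (Suc l, n, m)) \<Longrightarrow> d3 l n m x \<in> carrier (E (l, n, m))"
  using mod_hom_closed[OF d1] mod_hom_closed[OF d2] mod_hom_closed[OF d3] by auto

lemma d_zero [simp]:
  "d1 l n m \<zero>\<^bsub>E (l, Suc n, m)\<^esub> = \<zero>\<^bsub>E (l, n, m)\<^esub>"
  "d2 l n m \<zero>\<^bsub>E (l, n, Suc m)\<^esub> = \<zero>\<^bsub>E (l, n, m)\<^esub>"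
  "d3 l n m \<zero>\<^bsub>E (Suc l, n, m)\<^esub> = \<zero>\<^bsub>E (l, n, m)\<^esub>"
  using mod_hom_zero[OF E E d1] mod_hom_zero[OF E E d2] mod_hom_zero[OF E E d3] by auto

lemma tot_component: "\<lbrakk>x \<in> carrier (tot N); l + n + m = N\<rbrakk> \<Longrightarrow> x (l, n, m) \<in> carrier (E (l, n, m))"
  by (rule dsum_component) (auto simp: idx_def)

lemma D_component:
  "l + n + m = N \<Longrightarrow> D (Suc N) x (l, n, m) = d1 l n m (x (l, Suc n, m)) \<oplus>\<^bsub>E (l, n, m)\<^esub> d2 l n m (x (l, n, Suc m))
      \<oplus>\<^bsub>E (l, n, m)\<^esub> d3 l n m (x (Suc l, n, m))"
  by (simp add: D_def idx_def)

lemma D_hom: "D (Suc N) \<in> mod_hom K (tot (Suc N)) (tot N)"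
proof (rule mod_homI)
  fix x assume x: "x \<in> carrier (tot (Suc N))"
  note xc [simp] = tot_component[OF x]
  show "D (Suc N) x \<in> carrier (tot N)"
    by (auto simp: D_def dsum_simps idx_def)
  fix a assume a: "a \<in> carrier K"
  show "D (Suc N) (a \<odot>\<^bsub>tot (Suc N)\<^esub> x) = a \<odot>\<^bsub>tot N\<^esub> D (Suc N) x"
    using a by (auto simp: D_def dsum_simps idx_def mod_hom_smult[OF d1] mod_hom_smult[OF d2] mod_hom_smult[OF d3]
        E.smult_r_distr intro!: restrict_ext)
next
  fix x y assume x: "x \<in> carrier (tot (Suc N))" and y: "y \<in> carrier (tot (Suc N))"
  note xc [simp] = tot_component[OF x] tot_component[OF y]
  show "D (Suc N) (x \<oplus>\<^bsub>tot (Suc N)\<^esub> y) = D (Suc N) x \<oplus>\<^bsub>tot N\<^esub> D (Suc N) y"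
    by (auto simp: D_def dsum_simps idx_def mod_hom_add[OF d1] mod_hom_add[OF d2] mod_hom_add[OF d3]
        E.M.a_ac intro!: restrict_ext)
qed

lemma DD:
  assumes x: "x \<in> carrier (tot (Suc (Suc N)))"
  shows "D (Suc N) (D (Suc (Suc N)) x) = \<zero>\<^bsub>tot N\<^esub>"
proof (rule dsum_eqI)
  show "D (Suc N) (D (Suc (Suc N)) x) \<in> carrier (tot N)"
    by (intro mod_hom_closed[OF D_hom] x)
  show "\<zero>\<^bsub>tot N\<^esub> \<in> carrier (tot N)" using module_tot[of N] by (simp add: module_def abelian_group_def abelian_monoid.zero_closed)
  fix i assume "i \<in> idx N"
  then obtain l n m where i: "i = (l, n, m)" "l + n + m = N" by (auto simp: idx_def)
  note xc [simp] = tot_component[OF x]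
  define p q r where "p = d1 l n m (d2 l (Suc n) m (x (l, Suc n, Suc m)))"
    and "q = d1 l n m (d3 l (Suc n) m (x (Suc l, Suc n, m)))"
    and "r = d2 l n m (d3 l n (Suc m) (x (Suc l, n, Suc m)))"
  have [simp]: "p \<in> carrier (E (l, n, m))" "q \<in> carrier (E (l, n, m))" "r \<in> carrier (E (l, n, m))"
    using i by (auto simp: p_def q_def r_def)
  have "D (Suc N) (D (Suc (Suc N)) x) i =
    (p \<oplus>\<^bsub>E (l, n, m)\<^esub> q) \<oplus>\<^bsub>E (l, n, m)\<^esub> (\<ominus>\<^bsub>E (l, n, m)\<^esub> p \<oplus>\<^bsub>E (l, n, m)\<^esub> r) \<oplus>\<^bsub>E (l, n, m)\<^esub>
      (\<ominus>\<^bsub>E (l, n, m)\<^esub> q \<oplus>\<^bsub>E (l, n, m)\<^esub> \<ominus>\<^bsub>E (l, n, m)\<^esub> r)"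
    using i by (simp add: D_component mod_hom_add[OF d1] mod_hom_add[OF d2] mod_hom_add[OF d3]
        d11 d22 d33 d21 d31 d32 p_def q_def r_def)
  also have "\<dots> = (p \<oplus>\<^bsub>E (l, n, m)\<^esub> \<ominus>\<^bsub>E (l, n, m)\<^esub> p) \<oplus>\<^bsub>E (l, n, m)\<^esub> (q \<oplus>\<^bsub>E (l, n, m)\<^esub> \<ominus>\<^bsub>E (l, n, m)\<^esub> q)
      \<oplus>\<^bsub>E (l, n, m)\<^esub> (r \<oplus>\<^bsub>E (l, n, m)\<^esub> \<ominus>\<^bsub>E (l, n, m)\<^esub> r)"
    by (simp add: E.M.a_ac)
  also have "\<dots> = \<zero>\<^bsub>tot N\<^esub> i" using i by (simp add: E.M.r_neg dsum_simps idx_def)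
  finally show "D (Suc N) (D (Suc (Suc N)) x) i = \<zero>\<^bsub>tot N\<^esub> i" .
qed

end

text \<open>
  Exactness of the complexes with fixed index \<open>n\<close>, augmented by \<open>aug\<close>, in the form in which it is
  used to peel off the leading component of a cycle.
\<close>

locale augmented_triple_complex = triple_complex K E d1 d2 d3
  for K :: "'k ring" (structure) and E :: "nat \<times> nat \<times> nat \<Rightarrow> ('k, 'e) module" and d1 d2 d3 +
  fixes Q :: "nat \<Rightarrow> ('k, 'q) module" and q :: "nat \<Rightarrow> 'q \<Rightarrow> 'q" and aug :: "nat \<Rightarrow> 'e \<Rightarrow> 'q"
  assumes Q: "module K (Q n)" and q: "q (Suc n) \<in> mod_hom K (Q (Suc n)) (Q n)"
    and aug: "aug n \<in> mod_hom K (E (0, n, 0)) (Q n)"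
    and aug_surj: "aug n ` carrier (E (0, n, 0)) = carrier (Q n)"
    and aug1: "x \<in> carrier (E (0, Suc n, 0)) \<Longrightarrow> aug n (d1 0 n 0 x) = q (Suc n) (aug (Suc n) x)"
    and aug2: "x \<in> carrier (E (0, n, Suc 0)) \<Longrightarrow> aug n (d2 0 n 0 x) = \<zero>\<^bsub>Q n\<^esub>"
    and aug3: "x \<in> carrier (E (Suc 0, n, 0)) \<Longrightarrow> aug n (d3 0 n 0 x) = \<zero>\<^bsub>Q n\<^esub>"
    and exact3: "\<lbrakk>z \<in> carrier (E (Suc l, n, m)); d3 l n m z = \<zero>\<^bsub>E (l, n, m)\<^esub>\<rbrakk>
      \<Longrightarrow> \<exists>y\<in>carrier (E (Suc (Suc l), n, m)). d3 (Suc l) n m y = z"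
    and exact2: "\<lbrakk>z \<in> carrier (E (0, n, Suc m)); v \<in> carrier (E (Suc 0, n, m));
        d2 0 n m z \<oplus>\<^bsub>E (0, n, m)\<^esub> d3 0 n m v = \<zero>\<^bsub>E (0, n, m)\<^esub>\<rbrakk>
      \<Longrightarrow> \<exists>w\<in>carrier (E (0, n, Suc (Suc m))). \<exists>y\<in>carrier (E (Suc 0, n, Suc m)).
          z = d2 0 n (Suc m) w \<oplus>\<^bsub>E (0, n, Suc m)\<^esub> d3 0 n (Suc m) y"
    and exact_aug: "\<lbrakk>z \<in> carrier (E (0, n, 0)); aug n z = \<zero>\<^bsub>Q n\<^esub>\<rbrakk>
      \<Longrightarrow> \<exists>w\<in>carrier (E (0, n, Suc 0)). \<exists>y\<in>carrier (E (Suc 0, n, 0)).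
          z = d2 0 n 0 w \<oplus>\<^bsub>E (0, n, 0)\<^esub> d3 0 n 0 y"
begin

definition proj :: "nat \<Rightarrow> (nat \<times> nat \<times> nat \<Rightarrow> 'e) \<Rightarrow> 'q"
  where "proj N x = aug N (x (0, N, 0))"

sublocale Q: module K "Q n" for n by (rule Q)

lemma proj_hom: "proj N \<in> mod_hom K (tot N) (Q N)"
  unfolding proj_def by (rule mod_hom_comp[OF dsum_component_hom[where i = "(0, N, 0)" and I = "idx N" and M = E] aug[of N]]) (simp add: idx_def)

lemma proj_D: "x \<in> carrier (tot (Suc N)) \<Longrightarrow> proj N (D (Suc N) x) = q (Suc N) (proj (Suc N) x)"
  using tot_component[of x "Suc N"] mod_hom_closed[OF q mod_hom_closed[OF aug]]
  by (simp add: proj_def D_component mod_hom_add[OF aug] aug1 aug2 aug3)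

text \<open>
  The position \<open>(l, n, m)\<close> gets the rank \<open>n * (N + 1) + m\<close>. The leading component of a cycle in
  the kernel of the projection is hit by a chain all of whose other boundary components have
  smaller rank.
\<close>

lemma kernel_acyclic_below:
  assumes "x \<in> carrier (tot N)" "proj N x = \<zero>\<^bsub>Q N\<^esub>" "\<And>k. N = Suc k \<Longrightarrow> D N x = \<zero>\<^bsub>tot k\<^esub>"
    and "\<And>l n m. \<lbrakk>l + n + m = N; n * (N + 1) + m \<ge> r\<rbrakk> \<Longrightarrow> x (l, n, m) = \<zero>\<^bsub>E (l, n, m)\<^esub>"
  shows "\<exists>y\<in>carrier (tot (Suc N)). proj (Suc N) y = \<zero>\<^bsub>Q (Suc N)\<^esub> \<and> D (Suc N) y = x"
  using assms
proof (induction r arbitrary: x)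
  case 0
  interpret T: module K "tot i" for i by (rule module_tot)
  have "x = \<zero>\<^bsub>tot N\<^esub>"
  proof (rule dsum_eqI[OF 0(1)])
    show "\<zero>\<^bsub>tot N\<^esub> \<in> carrier (tot N)" by simp
    show "x i = \<zero>\<^bsub>tot N\<^esub> i" if "i \<in> idx N" for i
      using that 0(4) by (auto simp: dsum_simps idx_def)
  qed
  then show ?case
    using mod_hom_zero[OF module_tot module_tot D_hom] mod_hom_zero[OF module_tot Q proj_hom]
    by (intro bexI[of _ "\<zero>\<^bsub>tot (Suc N)\<^esub>"]) auto
next
  case (Suc r)
  interpret T: module K "tot i" for i by (rule module_tot)
  note xc = tot_component[OF Suc.prems(1)]
  define n where "n = r div (N + 1)"
  define m where "m = r mod (N + 1)"
  have r: "r = n * (N + 1) + m" unfolding n_def m_def by (rule div_mult_mod_eq[symmetric])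
  have mN: "m \<le> N" using mod_less_divisor[of "N + 1" r] by (simp add: m_def)
  have rank: "n' = n \<and> m' = m" if "n' * (N + 1) + m' = r" "m' \<le> N" for n' m'
  proof -
    have "(n' * (N + 1) + m') div (N + 1) = n'" using that(2) by (subst div_mult_self3) auto
    moreover have "(n' * (N + 1) + m') mod (N + 1) = m'" using that(2) by (subst mod_mult_self3) auto
    ultimately show ?thesis using that(1) by (simp only: n_def m_def)
  qed
  show ?case
  proof (cases "n + m \<le> N")
    case False
    show ?thesis
    proof (rule Suc.IH[OF Suc.prems(1-3)])
      fix l n' m' assume i: "l + n' + m' = N" "r \<le> n' * (N + 1) + m'"
      have "n' * (N + 1) + m' \<noteq> r" using rank[of n' m'] i False by auto
      then show "x (l, n', m') = \<zero>\<^bsub>E (l, n', m')\<^esub>" using Suc.prems(4)[of l n' m'] i by auto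
    qed
  next
    case True
    define l where "l = N - n - m"
    have lnm: "l + n + m = N" using True by (simp add: l_def)
    let ?z = "x (l, n, m)"
    have z: "?z \<in> carrier (E (l, n, m))" using xc lnm .
    have higher: "x (l', n', m') = \<zero>\<^bsub>E (l', n', m')\<^esub>"
      if "l' + n' + m' = N" "n' > n \<or> n' = n \<and> m' > m" for l' n' m'
    proof (rule Suc.prems(4)[OF that(1)])
      show "Suc r \<le> n' * (N + 1) + m'"
      proof (cases "n' > n")
        case True
        then have "n' * (N + 1) \<ge> (n + 1) * (N + 1)" by (intro mult_right_mono) auto
        then show ?thesis using mN r by (simp add: algebra_simps)
      next
        case False
        then show ?thesis using that r by auto
      qed
    qed
    have Dx: "d1 l' n' m' (x (l', Suc n', m')) \<oplus>\<^bsub>E (l', n', m')\<^esub> d2 l' n' m' (x (l', n', Suc m'))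
      \<oplus>\<^bsub>E (l', n', m')\<^esub> d3 l' n' m' (x (Suc l', n', m')) = \<zero>\<^bsub>E (l', n', m')\<^esub>"
      if s: "Suc (l' + n' + m') = N" for l' n' m'
    proof -
      have "D (Suc (l' + n' + m')) x (l', n', m') = \<zero>\<^bsub>tot (l' + n' + m')\<^esub> (l', n', m')"
        using Suc.prems(3)[of "l' + n' + m'"] s by simp
      then show ?thesis by (simp add: D_component) (simp add: dsum_simps idx_def)
    qed
    have "\<exists>w\<in>carrier (E (l, n, Suc m)). \<exists>y\<in>carrier (E (Suc l, n, m)).
      (l = 0 \<or> w = \<zero>\<^bsub>E (l, n, Suc m)\<^esub>) \<and> ?z = d2 l n m w \<oplus>\<^bsub>E (l, n, m)\<^esub> d3 l n m y"
    proof (cases l)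
      case (Suc k)
      have "d3 k n m ?z = \<zero>\<^bsub>E (k, n, m)\<^esub>"
        using Dx[of k n m] higher[of k "Suc n" m] higher[of k n "Suc m"] lnm Suc z by simp
      then obtain y where y: "y \<in> carrier (E (Suc (Suc k), n, m))" "d3 (Suc k) n m y = ?z"
        using exact3 z Suc by blast
      show ?thesis
      proof (rule bexI[of _ "\<zero>\<^bsub>E (l, n, Suc m)\<^esub>"], rule bexI[of _ y])
        show "y \<in> carrier (E (Suc l, n, m))" using y(1) Suc by simp
      qed (use y(2) z Suc in simp_all)
    next
      case l0: 0
      show ?thesis
      proof (cases m)
        case 0
        then have "aug n ?z = \<zero>\<^bsub>Q n\<^esub>" using Suc.prems(2) lnm l0 by (simp add: proj_def)
        then show ?thesis using exact_aug[of ?z n] z 0 l0 by auto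
      next
        case (Suc k)
        have "d2 0 n k (x (0, n, Suc k)) \<oplus>\<^bsub>E (0, n, k)\<^esub> d3 0 n k (x (Suc 0, n, k)) = \<zero>\<^bsub>E (0, n, k)\<^esub>"
          using Dx[of 0 n k] higher[of 0 "Suc n" k] lnm l0 Suc z by simp
        then show ?thesis using exact2[of "x (0, n, Suc k)" n k "x (Suc 0, n, k)"] z xc[of "Suc 0" n k] lnm Suc l0
          by simp
      qed
    qed
    then obtain w y where w: "w \<in> carrier (E (l, n, Suc m))" and y: "y \<in> carrier (E (Suc l, n, m))"
      and lw: "l = 0 \<or> w = \<zero>\<^bsub>E (l, n, Suc m)\<^esub>"
      and zwy: "?z = d2 l n m w \<oplus>\<^bsub>E (l, n, m)\<^esub> d3 l n m y" by blast
    define Y where "Y = (\<lambda>i\<in>idx (Suc N). if i = (l, n, Suc m) then w else if i = (Suc l, n, m) then y else \<zero>\<^bsub>E i\<^esub>)"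
    have Yc: "Y \<in> carrier (tot (Suc N))" using w y by (auto simp: Y_def dsum_simps)
    have Yv: "Y (l', n', m') = (if (l', n', m') = (l, n, Suc m) then w else if (l', n', m') = (Suc l, n, m) then y
        else \<zero>\<^bsub>E (l', n', m')\<^esub>)" if "l' + n' + m' = Suc N" for l' n' m'
      using that by (simp add: Y_def idx_def)
    have projY: "proj (Suc N) Y = \<zero>\<^bsub>Q (Suc N)\<^esub>"
      using lnm mod_hom_zero[OF E Q aug] by (simp add: proj_def Yv)
    have DYc: "D (Suc N) Y \<in> carrier (tot N)" by (rule mod_hom_closed[OF D_hom Yc])
    have DYz: "D (Suc N) Y (l, n, m) = ?z"
      using lnm w y zwy by (simp add: D_component Yv)
    have DY0: "D (Suc N) Y (l', n', m') = \<zero>\<^bsub>E (l', n', m')\<^esub>"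
      if i: "l' + n' + m' = N" "n' > n \<or> n' = n \<and> m' > m" for l' n' m'
    proof -
      have w0: "d3 l' n' m' (Y (Suc l', n', m')) = \<zero>\<^bsub>E (l', n', m')\<^esub>"
        using i lnm lw by (auto simp: Yv)
      show ?thesis using i lnm w0 by (simp add: D_component Yv) auto
    qed
    let ?x = "x \<ominus>\<^bsub>tot N\<^esub> D (Suc N) Y"
    have xi: "?x i = x i \<ominus>\<^bsub>E i\<^esub> D (Suc N) Y i" if "i \<in> idx N" for i
      using dsum_minus[OF is_cring E Suc.prems(1) DYc] that by simp
    have "\<exists>y\<in>carrier (tot (Suc N)). proj (Suc N) y = \<zero>\<^bsub>Q (Suc N)\<^esub> \<and> D (Suc N) y = ?x"
    proof (rule Suc.IH)
      show "?x \<in> carrier (tot N)" using Suc.prems(1) DYc by (simp add: T.M.minus_closed)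
      show "proj N ?x = \<zero>\<^bsub>Q N\<^esub>"
        using mod_hom_diff[OF module_tot Q proj_hom Suc.prems(1) DYc] proj_D[OF Yc] projY
          mod_hom_zero[OF Q Q q] Suc.prems(2) by (simp add: a_minus_def)
      show "D N ?x = \<zero>\<^bsub>tot k\<^esub>" if "N = Suc k" for k
        using mod_hom_diff[OF module_tot module_tot D_hom[of k], of x "D (Suc N) Y"] that Suc.prems(1,3) DYc DD[of Y k] Yc
        by (simp add: a_minus_def)
      fix l' n' m' assume i: "l' + n' + m' = N" "r \<le> n' * (N + 1) + m'"
      show "?x (l', n', m') = \<zero>\<^bsub>E (l', n', m')\<^esub>"
      proof (cases "n' = n \<and> m' = m")
        case True
        then have "l' = l" using i lnm by auto
        then show ?thesis using True xi[of "(l', n', m')"] i(1) DYz z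
          by (simp add: idx_def a_minus_def E.M.r_neg)
      next
        case False
        have hi: "n' > n \<or> n' = n \<and> m' > m"
        proof (rule ccontr)
          assume "\<not> ?thesis"
          then have "n' < n \<or> n' = n \<and> m' < m" using False by auto
          then have "n' * (N + 1) + m' < r"
          proof
            assume "n' < n"
            then have "(n' + 1) * (N + 1) \<le> n * (N + 1)" by (intro mult_right_mono) auto
            then show ?thesis using r i(1) by (simp add: algebra_simps)
          qed (use r in auto)
          then show False using i(2) by simp
        qed
        then show ?thesis using xi[of "(l', n', m')"] i(1) DY0[OF i(1) hi] higher[OF i(1) hi]
          by (simp add: idx_def a_minus_def)
      qed
    qed
    then obtain V where V: "V \<in> carrier (tot (Suc N))" "proj (Suc N) V = \<zero>\<^bsub>Q (Suc N)\<^esub>" "D (Suc N) V = ?x"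
      by blast
    have "D (Suc N) (V \<oplus>\<^bsub>tot (Suc N)\<^esub> Y) = ?x \<oplus>\<^bsub>tot N\<^esub> D (Suc N) Y"
      using mod_hom_add[OF D_hom V(1) Yc] V(3) by simp
    also have "\<dots> = x" using Suc.prems(1) DYc by (simp add: a_minus_def T.M.a_assoc T.M.l_neg)
    finally have "D (Suc N) (V \<oplus>\<^bsub>tot (Suc N)\<^esub> Y) = x" .
    moreover have "proj (Suc N) (V \<oplus>\<^bsub>tot (Suc N)\<^esub> Y) = \<zero>\<^bsub>Q (Suc N)\<^esub>"
      using mod_hom_add[OF proj_hom V(1) Yc] V(2) projY by simp
    ultimately show ?thesis using V(1) Yc T.M.a_closed by blast
  qed
qed

theorem total_homology_iso: "mod_isomorphic K (homology tot D n) (homology Q q n)"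
proof (rule homology_iso[where h = proj])
  fix n
  show "proj n ` carrier (tot n) = carrier (Q n)"
  proof
    show "proj n ` carrier (tot n) \<subseteq> carrier (Q n)" using mod_hom_closed[OF proj_hom] by auto
    show "carrier (Q n) \<subseteq> proj n ` carrier (tot n)"
    proof
      fix z assume "z \<in> carrier (Q n)"
      then obtain e where e: "e \<in> carrier (E (0, n, 0))" "aug n e = z" using aug_surj[of n] by (metis imageE)
      let ?x = "\<lambda>i\<in>idx n. if i = (0, n, 0) then e else \<zero>\<^bsub>E i\<^esub>"
      have x: "?x \<in> carrier (tot n)" using e by (auto simp: dsum_simps)
      have z: "proj n ?x = z" using e by (simp add: proj_def idx_def)
      show "z \<in> proj n ` carrier (tot n)" using imageI[OF x, of "proj n"] unfolding z .
    qed
  qed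
next
  fix n x assume x: "x \<in> carrier (tot n)" "proj n x = \<zero>\<^bsub>Q n\<^esub>" "\<And>k. n = Suc k \<Longrightarrow> D n x = \<zero>\<^bsub>tot k\<^esub>"
  show "\<exists>y\<in>carrier (tot (Suc n)). proj (Suc n) y = \<zero>\<^bsub>Q (Suc n)\<^esub> \<and> D (Suc n) y = x"
  proof (rule kernel_acyclic_below[OF x, of "(n + 1) * (n + 1)"])
    fix l k m assume "l + k + m = n" "(n + 1) * (n + 1) \<le> k * (n + 1) + m"
    moreover have "k * (n + 1) \<le> n * (n + 1)" using calculation(1) by (intro mult_right_mono) auto
    ultimately have False by (simp add: algebra_simps)
    then show "x (l, k, m) = \<zero>\<^bsub>E (l, k, m)\<^esub>" ..
  qed
qed (simp_all add: module_tot Q D_hom q proj_hom proj_D DD)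

end

section \<open>Resolutions that split off the augmentation\<close>

context tensor
begin

lemma tens_right_hom: "x \<in> carrier M \<Longrightarrow> (\<lambda>y. tens R M N x y) \<in> mod_hom R N MN"
  by (rule mod_homI) (simp_all add: tens_add_right tens_smult_right)

lemma tens_left_hom: "y \<in> carrier N \<Longrightarrow> (\<lambda>x. tens R M N x y) \<in> mod_hom R M MN"
  by (rule mod_homI) (simp_all add: tens_add_left tens_smult_left)

lemma tens_zero_right: "x \<in> carrier M \<Longrightarrow> tens R M N x \<zero>\<^bsub>N\<^esub> = \<zero>\<^bsub>MN\<^esub>"
  using mod_hom_zero[OF N.module_axioms module_tensor tens_right_hom] .

lemma tens_zero_left: "y \<in> carrier N \<Longrightarrow> tens R M N \<zero>\<^bsub>M\<^esub> y = \<zero>\<^bsub>MN\<^esub>"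
  using mod_hom_zero[OF M.module_axioms module_tensor tens_left_hom] .

lemma tens_uminus_right:
  "\<lbrakk>x \<in> carrier M; y \<in> carrier N\<rbrakk> \<Longrightarrow> tens R M N x (\<ominus>\<^bsub>N\<^esub> y) = \<ominus>\<^bsub>MN\<^esub> tens R M N x y"
  using mod_hom_uminus[OF N.module_axioms module_tensor tens_right_hom] .

end

text \<open>
  A resolution contracted by \<open>s\<close> onto its augmentation, where \<open>\<kappa>\<close> stands for the augmentation
  and \<open>u\<close> for its section.
\<close>

locale split_resolution = cring R for R :: "'r ring" (structure) +
  fixes P :: "nat \<Rightarrow> ('r, 'p) module" and dP s :: "nat \<Rightarrow> 'p \<Rightarrow> 'p" and \<kappa> :: "'p \<Rightarrow> 'r" and u :: 'p
  assumes P: "module R (P l)"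
    and dP: "dP (Suc l) \<in> mod_hom R (P (Suc l)) (P l)"
    and dP_dP: "x \<in> carrier (P (Suc (Suc l))) \<Longrightarrow> dP (Suc l) (dP (Suc (Suc l)) x) = \<zero>\<^bsub>P l\<^esub>"
    and s: "s l \<in> mod_hom R (P l) (P (Suc l))"
    and \<kappa>_closed: "x \<in> carrier (P 0) \<Longrightarrow> \<kappa> x \<in> carrier R"
    and \<kappa>_add: "\<lbrakk>x \<in> carrier (P 0); y \<in> carrier (P 0)\<rbrakk> \<Longrightarrow> \<kappa> (x \<oplus>\<^bsub>P 0\<^esub> y) = \<kappa> x \<oplus> \<kappa> y"
    and \<kappa>_smult: "\<lbrakk>a \<in> carrier R; x \<in> carrier (P 0)\<rbrakk> \<Longrightarrow> \<kappa> (a \<odot>\<^bsub>P 0\<^esub> x) = a \<otimes> \<kappa> x"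
    and u: "u \<in> carrier (P 0)"
    and s_0: "x \<in> carrier (P 0) \<Longrightarrow> dP (Suc 0) (s 0 x) \<oplus>\<^bsub>P 0\<^esub> \<kappa> x \<odot>\<^bsub>P 0\<^esub> u = x"
    and s_Suc: "x \<in> carrier (P (Suc l)) \<Longrightarrow>
      dP (Suc (Suc l)) (s (Suc l) x) \<oplus>\<^bsub>P (Suc l)\<^esub> s l (dP (Suc l) x) = x"
    and \<kappa>_dP: "x \<in> carrier (P (Suc 0)) \<Longrightarrow> \<kappa> (dP (Suc 0) x) = \<zero>"
    and \<kappa>_u: "x \<in> carrier (P 0) \<Longrightarrow> \<kappa> u \<otimes> \<kappa> x = \<kappa> x"
begin

abbreviation "PC l C \<equiv> tensor_module R (P l) C"
abbreviation "dPC l C \<equiv> tensor_map R (P (Suc l)) C (P l) C (dP (Suc l)) (\<lambda>c. c)"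
abbreviation "mapC l C C' g \<equiv> tensor_map R (P l) C (P l) C' (\<lambda>p. p) g"

text \<open>
  The map \<open>\<kappa> \<otimes> 1\<close>, which augments the tensored resolution. The element \<open>u\<close> gives a section of it up
  to the idempotent \<open>\<kappa> u\<close>.
\<close>

definition \<mu> :: "('r, 'c) module \<Rightarrow> ('p \<times> 'c \<Rightarrow> 'r) set \<Rightarrow> 'c"
  where "\<mu> C = pres_lift R (carrier (P 0) \<times> carrier C) (tensor_rels R (P 0) C) C (\<lambda>(p, c). \<kappa> p \<odot>\<^bsub>C\<^esub> c)"

abbreviation "\<nu> C c \<equiv> tens R (P 0) C u c"

context
  fixes C :: "('r, 'c) module"
  assumes C: "module R C"
begin

interpretation C: module R C by (rule C)
interpretation T: tensor R "P l" C for l by (intro tensorI P C)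

lemma dPC_hom: "dPC l C \<in> mod_hom R (PC (Suc l) C) (PC l C)"
  by (rule tensor_map_hom[OF P C P C dP mod_hom_ident])

lemma dPC_tens: "\<lbrakk>p \<in> carrier (P (Suc l)); c \<in> carrier C\<rbrakk> \<Longrightarrow>
    dPC l C (tens R (P (Suc l)) C p c) = tens R (P l) C (dP (Suc l) p) c"
  by (rule tensor_map_tens[OF P C P C dP mod_hom_ident])

lemma dPC_dPC: "z \<in> carrier (PC (Suc (Suc l)) C) \<Longrightarrow> dPC l C (dPC (Suc l) C z) = \<zero>\<^bsub>PC l C\<^esub>"
  by (rule T.tensor_hom_eqI[OF T.module_tensor mod_hom_comp[OF dPC_hom dPC_hom] mod_hom_const_zero[OF T.module_tensor]])
    (simp_all add: dPC_tens mod_hom_closed[OF dP] dP_dP T.tens_zero_left)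

lemma \<kappa>_bilinear:
  "p \<in> carrier (P 0) \<Longrightarrow> (\<lambda>c. case (p, c) of (p, c) \<Rightarrow> \<kappa> p \<odot>\<^bsub>C\<^esub> c) \<in> mod_hom R C C"
  "c \<in> carrier C \<Longrightarrow> (\<lambda>p. case (p, c) of (p, c) \<Rightarrow> \<kappa> p \<odot>\<^bsub>C\<^esub> c) \<in> mod_hom R (P 0) C"
  by (rule mod_homI;
      simp add: \<kappa>_closed \<kappa>_add \<kappa>_smult C.smult_r_distr C.smult_l_distr C.smult_assoc1[symmetric] m_comm)+

lemma \<mu>_hom: "\<mu> C \<in> mod_hom R (PC 0 C) C"
  unfolding \<mu>_def by (rule T.tensor_lift_hom[OF C]) (rule \<kappa>_bilinear, assumption)+

lemma \<mu>_tens: "\<lbrakk>p \<in> carrier (P 0); c \<in> carrier C\<rbrakk> \<Longrightarrow> \<mu> C (tens R (P 0) C p c) = \<kappa> p \<odot>\<^bsub>C\<^esub> c"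
  unfolding \<mu>_def by (subst T.tensor_lift_tens[OF C]) (rule \<kappa>_bilinear, assumption | simp)+

lemma \<nu>_closed: "c \<in> carrier C \<Longrightarrow> \<nu> C c \<in> carrier (PC 0 C)"
  using u by simp

lemma \<mu>_\<nu>: "c \<in> carrier C \<Longrightarrow> \<mu> C (\<nu> C c) = \<kappa> u \<odot>\<^bsub>C\<^esub> c"
  by (rule \<mu>_tens[OF u])

lemma \<mu>_dPC: "z \<in> carrier (PC (Suc 0) C) \<Longrightarrow> \<mu> C (dPC 0 C z) = \<zero>\<^bsub>C\<^esub>"
  by (rule T.tensor_hom_eqI[OF C mod_hom_comp[OF dPC_hom \<mu>_hom] mod_hom_const_zero[OF C]])
    (simp_all add: dPC_tens mod_hom_closed[OF dP] \<mu>_tens \<kappa>_dP)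

lemma idem_\<mu>: "z \<in> carrier (PC 0 C) \<Longrightarrow> \<kappa> u \<odot>\<^bsub>C\<^esub> \<mu> C z = \<mu> C z"
  by (rule T.tensor_hom_eqI[OF C mod_hom_scale[OF C \<mu>_hom] \<mu>_hom])
    (simp_all add: \<mu>_tens \<kappa>_closed u C.smult_assoc1[symmetric] \<kappa>_u)

text \<open>
  Tensoring the contraction with the identity of \<open>C\<close> gives a contraction again, so exactness is
  preserved for every \<open>C\<close>.
\<close>

lemma exact_PC_0:
  assumes z: "z \<in> carrier (PC 0 C)" and "\<mu> C z = \<zero>\<^bsub>C\<^esub>"
  shows "\<exists>y\<in>carrier (PC (Suc 0) C). dPC 0 C y = z"
proof -
  let ?s = "tensor_map R (P 0) C (P (Suc 0)) C (s 0) (\<lambda>c. c)"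
  note sh = tensor_map_hom[OF P C P C s mod_hom_ident]
  have "dPC 0 C (?s z) \<oplus>\<^bsub>PC 0 C\<^esub> \<nu> C (\<mu> C z) = z"
  proof (rule T.tensor_hom_eqI[OF T.module_tensor mod_hom_plus[OF T.module_tensor mod_hom_comp[OF sh dPC_hom]
          mod_hom_comp[OF \<mu>_hom T.tens_right_hom[OF u]]] mod_hom_ident _ z])
    fix p c assume p: "p \<in> carrier (P 0)" and c: "c \<in> carrier C"
    have "tens R (P 0) C (dP (Suc 0) (s 0 p)) c \<oplus>\<^bsub>PC 0 C\<^esub> tens R (P 0) C u (\<kappa> p \<odot>\<^bsub>C\<^esub> c)
      = tens R (P 0) C (dP (Suc 0) (s 0 p)) c \<oplus>\<^bsub>PC 0 C\<^esub> tens R (P 0) C (\<kappa> p \<odot>\<^bsub>P 0\<^esub> u) c"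
      using p c u by (simp add: T.tens_smult_right T.tens_smult_left \<kappa>_closed)
    also have "\<dots> = tens R (P 0) C (dP (Suc 0) (s 0 p) \<oplus>\<^bsub>P 0\<^esub> \<kappa> p \<odot>\<^bsub>P 0\<^esub> u) c"
      using p c u by (subst T.tens_add_left) (auto intro!: mod_hom_closed[OF dP] mod_hom_closed[OF s] module.smult_closed[OF P] \<kappa>_closed)
    also have "\<dots> = tens R (P 0) C p c" using p by (simp add: s_0)
    finally show "dPC 0 C (?s (tens R (P 0) C p c)) \<oplus>\<^bsub>PC 0 C\<^esub> \<nu> C (\<mu> C (tens R (P 0) C p c)) = tens R (P 0) C p c"
      using p c by (simp add: tensor_map_tens[OF P C P C s mod_hom_ident] dPC_tens mod_hom_closed[OF s] \<mu>_tens)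
  qed
  then show ?thesis
    using assms mod_hom_closed[OF sh z] u mod_hom_closed[OF dPC_hom mod_hom_closed[OF sh z]]
    by (intro bexI[of _ "?s z"]) (simp_all add: T.tens_zero_right)
qed

lemma exact_PC_Suc:
  assumes z: "z \<in> carrier (PC (Suc l) C)" and "dPC l C z = \<zero>\<^bsub>PC l C\<^esub>"
  shows "\<exists>y\<in>carrier (PC (Suc (Suc l)) C). dPC (Suc l) C y = z"
proof -
  let ?s = "\<lambda>l. tensor_map R (P l) C (P (Suc l)) C (s l) (\<lambda>c. c)"
  note sh = tensor_map_hom[OF P C P C s mod_hom_ident]
  have "dPC (Suc l) C (?s (Suc l) z) \<oplus>\<^bsub>PC (Suc l) C\<^esub> ?s l (dPC l C z) = z"
  proof (rule T.tensor_hom_eqI[OF T.module_tensor mod_hom_plus[OF T.module_tensor mod_hom_comp[OF sh dPC_hom]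
          mod_hom_comp[OF dPC_hom sh]] mod_hom_ident _ z])
    fix p c assume p: "p \<in> carrier (P (Suc l))" and c: "c \<in> carrier C"
    have "tens R (P (Suc l)) C (dP (Suc (Suc l)) (s (Suc l) p)) c \<oplus>\<^bsub>PC (Suc l) C\<^esub> tens R (P (Suc l)) C (s l (dP (Suc l) p)) c
      = tens R (P (Suc l)) C p c"
      using p c by (subst T.tens_add_left[symmetric])
        (auto intro!: mod_hom_closed[OF dP] mod_hom_closed[OF s] simp: s_Suc)
    then show "dPC (Suc l) C (?s (Suc l) (tens R (P (Suc l)) C p c)) \<oplus>\<^bsub>PC (Suc l) C\<^esub>
        ?s l (dPC l C (tens R (P (Suc l)) C p c)) = tens R (P (Suc l)) C p c"
      using p c by (simp add: tensor_map_tens[OF P C P C s mod_hom_ident] dPC_tens mod_hom_closed[OF s] mod_hom_closed[OF dP])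
  qed
  then show ?thesis
    using assms mod_hom_closed[OF sh z] mod_hom_zero[OF T.module_tensor T.module_tensor sh]
      mod_hom_closed[OF dPC_hom mod_hom_closed[OF sh z]]
    by (intro bexI[of _ "?s (Suc l) z"]) simp_all
qed

end

context
  fixes C C' :: "('r, 'c) module" and g
  assumes C: "module R C" and C': "module R C'" and g: "g \<in> mod_hom R C C'"
begin

interpretation T: tensor R "P l" C for l by (intro tensorI P C)
interpretation T': tensor R "P l" C' for l by (intro tensorI P C')

lemma mapC_hom: "mapC l C C' g \<in> mod_hom R (PC l C) (PC l C')"
  by (rule tensor_map_hom[OF P C P C' mod_hom_ident g])

lemma mapC_tens: "\<lbrakk>p \<in> carrier (P l); c \<in> carrier C\<rbrakk> \<Longrightarrow>
    mapC l C C' g (tens R (P l) C p c) = tens R (P l) C' p (g c)"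
  by (rule tensor_map_tens[OF P C P C' mod_hom_ident g])

lemma \<mu>_natural: "z \<in> carrier (PC 0 C) \<Longrightarrow> \<mu> C' (mapC 0 C C' g z) = g (\<mu> C z)"
  by (rule T.tensor_hom_eqI[OF C' mod_hom_comp[OF mapC_hom \<mu>_hom[OF C']] mod_hom_comp[OF \<mu>_hom[OF C] g]])
    (simp_all add: mapC_tens \<mu>_tens[OF C] \<mu>_tens[OF C'] mod_hom_closed[OF g] mod_hom_smult[OF g] \<kappa>_closed)

lemma dPC_mapC: "z \<in> carrier (PC (Suc l) C) \<Longrightarrow>
    dPC l C' (mapC (Suc l) C C' g z) = mapC l C C' g (dPC l C z)"
  by (rule T.tensor_hom_eqI[OF T'.module_tensor mod_hom_comp[OF mapC_hom dPC_hom[OF C']] mod_hom_comp[OF dPC_hom[OF C] mapC_hom]])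
    (simp_all add: mapC_tens dPC_tens[OF C] dPC_tens[OF C'] mod_hom_closed[OF g] mod_hom_closed[OF dP])

end

lemma mapC_comp_zero:
  fixes C C' C'' :: "('r, 'c) module"
  assumes C: "module R C" "module R C'" "module R C''" and g: "g \<in> mod_hom R C C'" "g' \<in> mod_hom R C' C''"
    and 0: "\<And>c. c \<in> carrier C \<Longrightarrow> g' (g c) = \<zero>\<^bsub>C''\<^esub>" and z: "z \<in> carrier (PC l C)"
  shows "mapC l C' C'' g' (mapC l C C' g z) = \<zero>\<^bsub>PC l C''\<^esub>"
proof -
  interpret T: tensor R "P l" C by (intro tensorI P C)
  interpret T'': tensor R "P l" C'' by (intro tensorI P C)
  show ?thesis
    by (rule T.tensor_hom_eqI[OF T''.module_tensor mod_hom_comp[OF mapC_hom[OF C(1,2) g(1)] mapC_hom[OF C(2,3) g(2)]]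
          mod_hom_const_zero[OF T''.module_tensor] _ z])
      (simp add: mapC_tens[OF C(1,2) g(1)] mapC_tens[OF C(2,3) g(2)] mod_hom_closed[OF g(1)] 0 T''.tens_zero_right)
qed

lemma mapC_anticommute:
  fixes C C1 C2 C3 :: "('r, 'c) module"
  assumes C: "module R C" "module R C1" "module R C2" "module R C3"
    and g1: "g1 \<in> mod_hom R C C1" "g1' \<in> mod_hom R C1 C3" and g2: "g2 \<in> mod_hom R C C2" "g2' \<in> mod_hom R C2 C3"
    and anti: "\<And>c. c \<in> carrier C \<Longrightarrow> g1' (g1 c) = \<ominus>\<^bsub>C3\<^esub> g2' (g2 c)" and z: "z \<in> carrier (PC l C)"
  shows "mapC l C1 C3 g1' (mapC l C C1 g1 z) = \<ominus>\<^bsub>PC l C3\<^esub> mapC l C2 C3 g2' (mapC l C C2 g2 z)"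
proof -
  interpret T: tensor R "P l" C by (intro tensorI P C)
  interpret T3: tensor R "P l" C3 by (intro tensorI P C)
  show ?thesis
    by (rule T.tensor_hom_eqI[OF T3.module_tensor mod_hom_comp[OF mapC_hom[OF C(1,2) g1(1)] mapC_hom[OF C(2,4) g1(2)]]
          mod_hom_neg[OF T3.module_tensor mod_hom_comp[OF mapC_hom[OF C(1,3) g2(1)] mapC_hom[OF C(3,4) g2(2)]]] _ z])
      (simp add: mapC_tens[OF C(1,2) g1(1)] mapC_tens[OF C(2,4) g1(2)] mapC_tens[OF C(1,3) g2(1)] mapC_tens[OF C(3,4) g2(2)]
        mod_hom_closed[OF g1(1)] mod_hom_closed[OF g2(1)] mod_hom_closed[OF g2(2)] anti T3.tens_uminus_right)
qed

end

section \<open>The group ring of the group of order two\<close>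

lemma Z2_ring_simps [simp]:
  "carrier (Z2_ring K) = carrier K \<times> carrier K"
  "(a, b) \<otimes>\<^bsub>Z2_ring K\<^esub> (a', b') = ((a \<otimes>\<^bsub>K\<^esub> a') \<oplus>\<^bsub>K\<^esub> (b \<otimes>\<^bsub>K\<^esub> b'), (a \<otimes>\<^bsub>K\<^esub> b') \<oplus>\<^bsub>K\<^esub> (b \<otimes>\<^bsub>K\<^esub> a'))"
  "\<one>\<^bsub>Z2_ring K\<^esub> = (\<one>\<^bsub>K\<^esub>, \<zero>\<^bsub>K\<^esub>)" "\<zero>\<^bsub>Z2_ring K\<^esub> = (\<zero>\<^bsub>K\<^esub>, \<zero>\<^bsub>K\<^esub>)"
  "(a, b) \<oplus>\<^bsub>Z2_ring K\<^esub> (a', b') = (a \<oplus>\<^bsub>K\<^esub> a', b \<oplus>\<^bsub>K\<^esub> b')"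
  by (simp_all add: Z2_ring_def)

lemma Z2_module_simps [simp]:
  "carrier (Z2_module M \<theta>) = carrier M" "\<zero>\<^bsub>Z2_module M \<theta>\<^esub> = \<zero>\<^bsub>M\<^esub>" "x \<oplus>\<^bsub>Z2_module M \<theta>\<^esub> y = x \<oplus>\<^bsub>M\<^esub> y"
  "(a, b) \<odot>\<^bsub>Z2_module M \<theta>\<^esub> x = (a \<odot>\<^bsub>M\<^esub> x) \<oplus>\<^bsub>M\<^esub> (b \<odot>\<^bsub>M\<^esub> \<theta> x)" "\<ominus>\<^bsub>Z2_module M \<theta>\<^esub> x = \<ominus>\<^bsub>M\<^esub> x"
  by (simp_all add: Z2_module_def a_inv_def m_inv_def)

lemma Z2_restrict_simps [simp]:
  "carrier (Z2_restrict K M) = carrier M" "\<zero>\<^bsub>Z2_restrict K M\<^esub> = \<zero>\<^bsub>M\<^esub>" "x \<oplus>\<^bsub>Z2_restrict K M\<^esub> y = x \<oplus>\<^bsub>M\<^esub> y"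
  "a \<odot>\<^bsub>Z2_restrict K M\<^esub> x = (a, \<zero>\<^bsub>K\<^esub>) \<odot>\<^bsub>M\<^esub> x" "\<ominus>\<^bsub>Z2_restrict K M\<^esub> x = \<ominus>\<^bsub>M\<^esub> x"
  by (simp_all add: Z2_restrict_def a_inv_def m_inv_def)

lemma msign_restrict [simp]: "msign (Z2_restrict K M) e x = msign M e x"
  by (simp add: msign_def)

lemma cring_Z2:
  fixes K (structure)
  assumes "cring K"
  shows "cring (Z2_ring K)"
proof -
  interpret K: cring K by fact
  show ?thesis
  proof (rule cringI)
    show "abelian_group (Z2_ring K)"
    proof (rule abelian_groupI)
      fix x assume "x \<in> carrier (Z2_ring K)"
      then obtain a b where x: "x = (a, b)" "a \<in> carrier K" "b \<in> carrier K" by auto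
      then show "\<exists>y\<in>carrier (Z2_ring K). y \<oplus>\<^bsub>Z2_ring K\<^esub> x = \<zero>\<^bsub>Z2_ring K\<^esub>"
        by (intro bexI[of _ "(\<ominus> a, \<ominus> b)"]) (auto simp: K.l_neg)
    qed (auto simp: K.a_ac)
    show "comm_monoid (Z2_ring K)"
      by (rule comm_monoidI) (auto simp: K.l_distr K.r_distr K.m_ac K.a_ac)
  qed (auto simp: K.l_distr K.r_distr K.a_ac)
qed

lemma abelian_group_transfer:
  assumes "abelian_group M" "carrier N = carrier M" "\<zero>\<^bsub>N\<^esub> = \<zero>\<^bsub>M\<^esub>" "add N = add M"
  shows "abelian_group N"
proof -
  interpret M: abelian_group M by fact
  show ?thesis
    by (rule abelian_groupI; unfold assms(2-4)) (auto simp: M.a_ac intro: M.l_neg)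
qed

lemma module_Z2:
  assumes M: "module K M" and \<theta>: "\<theta> \<in> mod_hom K M M" and inv: "\<And>x. x \<in> carrier M \<Longrightarrow> \<theta> (\<theta> x) = x"
  shows "module (Z2_ring K) (Z2_module M \<theta>)"
proof -
  interpret M: module K M by fact
  note [simp] = mod_hom_closed[OF \<theta>] mod_hom_add[OF \<theta>] mod_hom_smult[OF \<theta>] inv
  show ?thesis
  proof (rule moduleI)
    show "cring (Z2_ring K)" by (rule cring_Z2[OF module_cring[OF M]])
    show "abelian_group (Z2_module M \<theta>)"
      by (rule abelian_group_transfer[OF module_abelian_group[OF M]]) (auto simp: Z2_module_def)
  qed (auto simp: M.smult_l_distr M.smult_r_distr M.M.a_ac M.smult_assoc1)
qed

lemma module_restrict:
  assumes "cring K" "module (Z2_ring K) M"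
  shows "module K (Z2_restrict K M)"
proof -
  interpret K: cring K by fact
  interpret M: module "Z2_ring K" M by fact
  show ?thesis
  proof (rule moduleI)
    show "abelian_group (Z2_restrict K M)"
      by (rule abelian_group_transfer[OF module_abelian_group[OF assms(2)]]) (auto simp: Z2_restrict_def)
    show "a \<odot>\<^bsub>Z2_restrict K M\<^esub> x \<in> carrier (Z2_restrict K M)"
      if "a \<in> carrier K" "x \<in> carrier (Z2_restrict K M)" for a x
      using that M.smult_closed[of "(a, \<zero>\<^bsub>K\<^esub>)" x] by simp
    show "(a \<oplus>\<^bsub>K\<^esub> b) \<odot>\<^bsub>Z2_restrict K M\<^esub> x = a \<odot>\<^bsub>Z2_restrict K M\<^esub> x \<oplus>\<^bsub>Z2_restrict K M\<^esub> b \<odot>\<^bsub>Z2_restrict K M\<^esub> x"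
      if "a \<in> carrier K" "b \<in> carrier K" "x \<in> carrier (Z2_restrict K M)" for a b x
      using that M.smult_l_distr[of "(a, \<zero>\<^bsub>K\<^esub>)" "(b, \<zero>\<^bsub>K\<^esub>)" x] by simp
    show "a \<odot>\<^bsub>Z2_restrict K M\<^esub> (x \<oplus>\<^bsub>Z2_restrict K M\<^esub> y) = a \<odot>\<^bsub>Z2_restrict K M\<^esub> x \<oplus>\<^bsub>Z2_restrict K M\<^esub> a \<odot>\<^bsub>Z2_restrict K M\<^esub> y"
      if "a \<in> carrier K" "x \<in> carrier (Z2_restrict K M)" "y \<in> carrier (Z2_restrict K M)" for a x y
      using that M.smult_r_distr[of "(a, \<zero>\<^bsub>K\<^esub>)" x y] by simp
    show "(a \<otimes>\<^bsub>K\<^esub> b) \<odot>\<^bsub>Z2_restrict K M\<^esub> x = a \<odot>\<^bsub>Z2_restrict K M\<^esub> (b \<odot>\<^bsub>Z2_restrict K M\<^esub> x)"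
      if "a \<in> carrier K" "b \<in> carrier K" "x \<in> carrier (Z2_restrict K M)" for a b x
      using that M.smult_assoc1[of "(a, \<zero>\<^bsub>K\<^esub>)" "(b, \<zero>\<^bsub>K\<^esub>)" x] by simp
    show "\<one>\<^bsub>K\<^esub> \<odot>\<^bsub>Z2_restrict K M\<^esub> x = x" if "x \<in> carrier (Z2_restrict K M)" for x
      using that M.smult_one[of x] by simp
  qed (rule assms)
qed

lemma Z2_equivariant_hom:
  assumes "module K M" "module K N" "f \<in> mod_hom K M N" "\<theta> \<in> mod_hom K M M"
    "\<And>x. x \<in> carrier M \<Longrightarrow> f (\<theta> x) = \<theta>' (f x)"
  shows "f \<in> mod_hom (Z2_ring K) (Z2_module M \<theta>) (Z2_module N \<theta>')"
proof -
  interpret M: module K M by fact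
  show ?thesis
    by (rule mod_homI)
      (auto simp: mod_hom_closed[OF assms(3)] mod_hom_closed[OF assms(4)] mod_hom_add[OF assms(3)]
        mod_hom_smult[OF assms(3)] assms(5))
qed

lemma restrict_hom:
  assumes "cring K" "f \<in> mod_hom (Z2_ring K) M N"
  shows "f \<in> mod_hom K (Z2_restrict K M) (Z2_restrict K N)"
proof -
  interpret K: cring K by fact
  show ?thesis
    by (rule mod_homI) (simp_all add: mod_hom_closed[OF assms(2)] mod_hom_add[OF assms(2)] mod_hom_smult[OF assms(2)])
qed

lemma restrict_hom_Z2_module:
  assumes "module K M" "\<theta> \<in> mod_hom K M M" "f \<in> mod_hom (Z2_ring K) L (Z2_module M \<theta>)"
  shows "f \<in> mod_hom K (Z2_restrict K L) M"
proof -
  interpret M: module K M by fact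
  have cl: "f x \<in> carrier M" if "x \<in> carrier L" for x using mod_hom_closed[OF assms(3) that] by simp
  show ?thesis
    using mod_hom_add[OF assms(3)] mod_hom_smult[OF assms(3)]
    by (intro mod_homI) (simp_all add: cl mod_hom_closed[OF assms(2)])
qed

text \<open>
  If two is invertible, the trivial module is a direct summand of the group ring, so every
  projective resolution of it is split.
\<close>

lemma split_projective_resolution:
  assumes K: "cring K" and h: "h \<in> carrier K" "h \<oplus>\<^bsub>K\<^esub> h = \<one>\<^bsub>K\<^esub>"
    and res: "projective_resolution (Z2_ring K) (Z2_trivial K) P dP"
  obtains s \<kappa> u where "split_resolution (Z2_ring K) P dP s \<kappa> u" "\<kappa> u = (h, h)"
proof -
  interpret K: cring K by fact
  let ?R = "Z2_ring K"
  interpret R: cring ?R by (rule cring_Z2[OF K])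
  have proj: "projective_module ?R (P l)" for l using res by (simp add: projective_resolution_def)
  then have P: "module ?R (P l)" for l by (simp add: projective_module_def)
  interpret P: module ?R "P i" for i by (rule P)
  have dP: "dP (Suc l) \<in> mod_hom ?R (P (Suc l)) (P l)" for l using res by (simp add: projective_resolution_def)
  obtain \<epsilon> where \<epsilon>: "\<epsilon> \<in> mod_hom ?R (P 0) (Z2_trivial K)"
    and \<epsilon>_surj: "\<epsilon> ` carrier (P 0) = carrier (Z2_trivial K)"
    and ex0: "dP 1 ` carrier (P 1) = {x \<in> carrier (P 0). \<epsilon> x = \<zero>\<^bsub>Z2_trivial K\<^esub>}"
    using res unfolding projective_resolution_def by blast
  have ex: "dP (Suc (Suc l)) ` carrier (P (Suc (Suc l))) = {x \<in> carrier (P (Suc l)). dP (Suc l) x = \<zero>\<^bsub>P l\<^esub>}" for l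
    using res unfolding projective_resolution_def by blast
  have triv [simp]: "carrier (Z2_trivial K) = carrier K" "\<zero>\<^bsub>Z2_trivial K\<^esub> = \<zero>\<^bsub>K\<^esub>"
    "x \<oplus>\<^bsub>Z2_trivial K\<^esub> y = x \<oplus>\<^bsub>K\<^esub> y" "(a, b) \<odot>\<^bsub>Z2_trivial K\<^esub> x = (a \<otimes>\<^bsub>K\<^esub> x) \<oplus>\<^bsub>K\<^esub> (b \<otimes>\<^bsub>K\<^esub> x)" for x y a b
    by (simp_all add: Z2_trivial_def)
  have \<epsilon>_cl [simp]: "\<epsilon> x \<in> carrier K" if "x \<in> carrier (P 0)" for x using mod_hom_closed[OF \<epsilon> that] by simp
  define \<kappa> where "\<kappa> x = (\<epsilon> x \<otimes>\<^bsub>K\<^esub> h, \<epsilon> x \<otimes>\<^bsub>K\<^esub> h)" for x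
  have "\<one>\<^bsub>K\<^esub> \<in> \<epsilon> ` carrier (P 0)" using \<epsilon>_surj by simp
  then obtain u0 where u0: "u0 \<in> carrier (P 0)" "\<epsilon> u0 = \<one>\<^bsub>K\<^esub>" by auto
  define u where "u = (h, h) \<odot>\<^bsub>P 0\<^esub> u0"
  have u: "u \<in> carrier (P 0)" using u0 h by (simp add: u_def)
  have \<epsilon>u: "\<epsilon> u = \<one>\<^bsub>K\<^esub>" using mod_hom_smult[OF \<epsilon>, of "(h, h)" u0] u0 h by (simp add: u_def)
  have hh: "(x \<otimes>\<^bsub>K\<^esub> h) \<oplus>\<^bsub>K\<^esub> (x \<otimes>\<^bsub>K\<^esub> h) = x" if "x \<in> carrier K" for x
    using that h by (simp add: K.r_distr[symmetric])
  have \<kappa>_closed: "\<kappa> x \<in> carrier ?R" if "x \<in> carrier (P 0)" for x using that h by (simp add: \<kappa>_def)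
  have \<kappa>_add: "\<kappa> (x \<oplus>\<^bsub>P 0\<^esub> y) = \<kappa> x \<oplus>\<^bsub>?R\<^esub> \<kappa> y" if "x \<in> carrier (P 0)" "y \<in> carrier (P 0)" for x y
    using that h mod_hom_add[OF \<epsilon> that] by (simp add: \<kappa>_def K.l_distr)
  have \<kappa>_smult: "\<kappa> (a \<odot>\<^bsub>P 0\<^esub> x) = a \<otimes>\<^bsub>?R\<^esub> \<kappa> x" if ax: "a \<in> carrier ?R" "x \<in> carrier (P 0)" for a x
  proof -
    obtain a1 a2 where a: "a = (a1, a2)" "a1 \<in> carrier K" "a2 \<in> carrier K" using ax by auto
    show ?thesis using a ax(2) h mod_hom_smult[OF \<epsilon> ax] by (simp add: \<kappa>_def K.l_distr K.m_assoc K.a_comm)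
  qed
  have \<epsilon>_\<kappa>u: "\<epsilon> (\<kappa> x \<odot>\<^bsub>P 0\<^esub> u) = \<epsilon> x" if "x \<in> carrier (P 0)" for x
    using mod_hom_smult[OF \<epsilon> \<kappa>_closed[OF that] u] that h \<epsilon>u hh by (simp add: \<kappa>_def)
  have idm: "(\<lambda>x. x \<ominus>\<^bsub>P 0\<^esub> \<kappa> x \<odot>\<^bsub>P 0\<^esub> u) \<in> mod_hom ?R (P 0) (P 0)"
  proof (rule mod_hom_minus[OF P mod_hom_ident], rule mod_homI)
  qed (use u \<kappa>_closed in \<open>simp_all add: \<kappa>_add \<kappa>_smult P.smult_l_distr P.smult_assoc1\<close>)
  have "x \<ominus>\<^bsub>P 0\<^esub> \<kappa> x \<odot>\<^bsub>P 0\<^esub> u \<in> dP (Suc 0) ` carrier (P (Suc 0))" if x: "x \<in> carrier (P 0)" for x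
  proof -
    have ku: "\<kappa> x \<odot>\<^bsub>P 0\<^esub> u \<in> carrier (P 0)" using u \<kappa>_closed[OF x] by simp
    have "x \<ominus>\<^bsub>P 0\<^esub> \<kappa> x \<odot>\<^bsub>P 0\<^esub> u \<oplus>\<^bsub>P 0\<^esub> \<kappa> x \<odot>\<^bsub>P 0\<^esub> u = x"
      using x ku by (simp add: a_minus_def P.M.a_assoc P.M.l_neg)
    then have "\<epsilon> (x \<ominus>\<^bsub>P 0\<^esub> \<kappa> x \<odot>\<^bsub>P 0\<^esub> u) \<oplus>\<^bsub>K\<^esub> \<epsilon> x = \<epsilon> x"
      using mod_hom_add[OF \<epsilon>, of "x \<ominus>\<^bsub>P 0\<^esub> \<kappa> x \<odot>\<^bsub>P 0\<^esub> u" "\<kappa> x \<odot>\<^bsub>P 0\<^esub> u"] ku x \<epsilon>_\<kappa>u[OF x]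
      by (simp add: P.M.minus_closed)
    then have "\<epsilon> (x \<ominus>\<^bsub>P 0\<^esub> \<kappa> x \<odot>\<^bsub>P 0\<^esub> u) = \<zero>\<^bsub>K\<^esub>"
      using x ku by (simp add: P.M.minus_closed)
    then show ?thesis using ex0 x ku by (simp add: P.M.minus_closed)
  qed
  then obtain s0 where s0: "s0 \<in> mod_hom ?R (P 0) (P (Suc 0))"
    "\<And>x. x \<in> carrier (P 0) \<Longrightarrow> dP (Suc 0) (s0 x) = x \<ominus>\<^bsub>P 0\<^esub> \<kappa> x \<odot>\<^bsub>P 0\<^esub> u"
    using projective_lift[OF proj P P idm dP] by blast
  have \<kappa>_dP: "\<kappa> (dP (Suc 0) x) = \<zero>\<^bsub>?R\<^esub>" if "x \<in> carrier (P (Suc 0))" for x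
  proof -
    have "dP (Suc 0) x \<in> {x \<in> carrier (P 0). \<epsilon> x = \<zero>\<^bsub>K\<^esub>}"
      using ex0 that by (metis One_nat_def imageI triv(2))
    then show ?thesis using h by (simp add: \<kappa>_def)
  qed
  have dP_dP: "dP (Suc l) (dP (Suc (Suc l)) x) = \<zero>\<^bsub>P l\<^esub>" if "x \<in> carrier (P (Suc (Suc l)))" for x l
    using ex[of l] that by blast
  define Good where "Good l f \<longleftrightarrow> f \<in> mod_hom ?R (P l) (P (Suc l)) \<and>
    (\<forall>x\<in>carrier (P (Suc l)). dP (Suc l) (f (dP (Suc l) x)) = dP (Suc l) x)" for l f
  define Next where "Next l f g \<longleftrightarrow> (\<forall>x\<in>carrier (P (Suc l)).
    dP (Suc (Suc l)) (g x) \<oplus>\<^bsub>P (Suc l)\<^esub> f (dP (Suc l) x) = x)" for l f g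
  have "\<exists>s. \<forall>l. (Good l (s l) \<and> (l = 0 \<longrightarrow> s l = s0)) \<and> Next l (s l) (s (Suc l))"
  proof (rule dependent_nat_choice)
    have "Good 0 s0" unfolding Good_def
    proof (intro conjI ballI)
      fix x assume x: "x \<in> carrier (P (Suc 0))"
      then have d: "dP (Suc 0) x \<in> carrier (P 0)" by (rule mod_hom_closed[OF dP])
      have "\<kappa> (dP (Suc 0) x) \<odot>\<^bsub>P 0\<^esub> u = \<zero>\<^bsub>P 0\<^esub>" unfolding \<kappa>_dP[OF x] using u by (rule P.smult_l_null)
      then show "dP (Suc 0) (s0 (dP (Suc 0) x)) = dP (Suc 0) x"
        using s0(2)[OF d] d by (simp add: a_minus_def)
    qed (rule s0)
    then show "\<exists>f. Good 0 f \<and> (0 = (0::nat) \<longrightarrow> f = s0)" by blast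
  next
    fix f l assume "Good l f \<and> (l = 0 \<longrightarrow> f = s0)"
    then have f: "f \<in> mod_hom ?R (P l) (P (Suc l))"
      "\<And>x. x \<in> carrier (P (Suc l)) \<Longrightarrow> dP (Suc l) (f (dP (Suc l) x)) = dP (Suc l) x" by (auto simp: Good_def)
    note fd = mod_hom_comp[OF dP f(1)]
    have idf: "(\<lambda>x. x \<ominus>\<^bsub>P (Suc l)\<^esub> f (dP (Suc l) x)) \<in> mod_hom ?R (P (Suc l)) (P (Suc l))"
      by (rule mod_hom_minus[OF P mod_hom_ident fd])
    have "x \<ominus>\<^bsub>P (Suc l)\<^esub> f (dP (Suc l) x) \<in> dP (Suc (Suc l)) ` carrier (P (Suc (Suc l)))"
      if x: "x \<in> carrier (P (Suc l))" for x
      using mod_hom_diff[OF P P dP x mod_hom_closed[OF fd x]] f(2)[OF x] mod_hom_closed[OF dP x]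
        mod_hom_closed[OF idf x]
      by (simp add: ex a_minus_def P.M.r_neg)
    then obtain g where g: "g \<in> mod_hom ?R (P (Suc l)) (P (Suc (Suc l)))"
      "\<And>x. x \<in> carrier (P (Suc l)) \<Longrightarrow> dP (Suc (Suc l)) (g x) = x \<ominus>\<^bsub>P (Suc l)\<^esub> f (dP (Suc l) x)"
      using projective_lift[OF proj P P idf dP] by blast
    have n: "Next l f g" unfolding Next_def
    proof
      fix x assume x: "x \<in> carrier (P (Suc l))"
      show "dP (Suc (Suc l)) (g x) \<oplus>\<^bsub>P (Suc l)\<^esub> f (dP (Suc l) x) = x"
        using g(2)[OF x] x mod_hom_closed[OF fd x] by (simp add: a_minus_def P.M.a_assoc P.M.l_neg)
    qed
    have "dP (Suc (Suc l)) (g (dP (Suc (Suc l)) x)) = dP (Suc (Suc l)) x"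
      if x: "x \<in> carrier (P (Suc (Suc l)))" for x
      using g(2)[OF mod_hom_closed[OF dP x]] dP_dP[OF x] mod_hom_zero[OF P P f(1)] mod_hom_closed[OF dP x]
      by (simp add: a_minus_def)
    then have "Good (Suc l) g" using g(1) by (simp add: Good_def)
    then show "\<exists>g. (Good (Suc l) g \<and> (Suc l = 0 \<longrightarrow> g = s0)) \<and> Next l f g" using n by blast
  qed
  then obtain s where s: "\<And>l. Good l (s l)" "\<And>l. Next l (s l) (s (Suc l))" "s 0 = s0" by blast
  have "split_resolution ?R P dP s \<kappa> u"
  proof (unfold_locales)
    show "s l \<in> mod_hom ?R (P l) (P (Suc l))" for l using s(1) by (simp add: Good_def)
    show "dP (Suc 0) (s 0 x) \<oplus>\<^bsub>P 0\<^esub> \<kappa> x \<odot>\<^bsub>P 0\<^esub> u = x" if "x \<in> carrier (P 0)" for x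
      using s0(2)[OF that] s(3) that u \<kappa>_closed[OF that] by (simp add: a_minus_def P.M.a_assoc P.M.l_neg)
    show "dP (Suc (Suc l)) (s (Suc l) x) \<oplus>\<^bsub>P (Suc l)\<^esub> s l (dP (Suc l) x) = x" if "x \<in> carrier (P (Suc l))" for l x
      using s(2)[of l] that by (simp add: Next_def)
    show "\<kappa> u \<otimes>\<^bsub>?R\<^esub> \<kappa> x = \<kappa> x" if "x \<in> carrier (P 0)" for x
    proof -
      have "h \<otimes>\<^bsub>K\<^esub> (\<epsilon> x \<otimes>\<^bsub>K\<^esub> h) \<oplus>\<^bsub>K\<^esub> h \<otimes>\<^bsub>K\<^esub> (\<epsilon> x \<otimes>\<^bsub>K\<^esub> h) = \<epsilon> x \<otimes>\<^bsub>K\<^esub> h"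
        using hh[of "\<epsilon> x \<otimes>\<^bsub>K\<^esub> h"] that h by (simp add: K.m_comm[of h])
      then show ?thesis using \<epsilon>u h by (simp add: \<kappa>_def)
    qed
  qed (fact P dP dP_dP \<kappa>_closed \<kappa>_add \<kappa>_smult u \<kappa>_dP)+
  then show thesis by (rule that) (use \<epsilon>u h in \<open>simp add: \<kappa>_def\<close>)
qed

section \<open>Hyperhomology of bicomplexes with involution\<close>

locale Z2_bicomplex = cring K for K :: "'k ring" (structure) +
  fixes X :: "nat \<Rightarrow> ('k, 'c) module" and \<delta>1 \<delta>2 \<theta> :: "nat \<Rightarrow> nat \<Rightarrow> 'c \<Rightarrow> 'c" and h :: 'k
  assumes X: "module K (X n)"
    and \<delta>1: "\<delta>1 (Suc n) m \<in> mod_hom K (X (Suc n)) (X n)"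
    and \<delta>2: "\<delta>2 n (Suc m) \<in> mod_hom K (X n) (X n)"
    and \<theta>: "\<theta> n m \<in> mod_hom K (X n) (X n)"
    and \<theta>_\<theta>: "x \<in> carrier (X n) \<Longrightarrow> \<theta> n m (\<theta> n m x) = x"
    and \<delta>1_\<theta>: "x \<in> carrier (X (Suc n)) \<Longrightarrow> \<delta>1 (Suc n) m (\<theta> (Suc n) m x) = \<theta> n m (\<delta>1 (Suc n) m x)"
    and \<delta>2_\<theta>: "x \<in> carrier (X n) \<Longrightarrow> \<delta>2 n (Suc m) (\<theta> n (Suc m) x) = \<theta> n m (\<delta>2 n (Suc m) x)"
    and \<delta>11: "x \<in> carrier (X (Suc (Suc n))) \<Longrightarrow> \<delta>1 (Suc n) m (\<delta>1 (Suc (Suc n)) m x) = \<zero>\<^bsub>X n\<^esub>"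
    and \<delta>22: "x \<in> carrier (X n) \<Longrightarrow> \<delta>2 n (Suc m) (\<delta>2 n (Suc (Suc m)) x) = \<zero>\<^bsub>X n\<^esub>"
    and \<delta>21: "x \<in> carrier (X (Suc n)) \<Longrightarrow>
      \<delta>2 n (Suc m) (\<delta>1 (Suc n) (Suc m) x) = \<ominus>\<^bsub>X n\<^esub> \<delta>1 (Suc n) m (\<delta>2 (Suc n) (Suc m) x)"
    and exact: "\<lbrakk>x \<in> carrier (X n); \<delta>2 n (Suc m) x = \<zero>\<^bsub>X n\<^esub>\<rbrakk>
      \<Longrightarrow> \<exists>w\<in>carrier (X n). \<delta>2 n (Suc (Suc m)) w = x"
    and h: "h \<in> carrier K" "h \<oplus> h = \<one>"
begin

abbreviation "C n m \<equiv> Z2_module (X n) (\<theta> n m)"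

definition den :: "nat \<Rightarrow> 'c set"
  where "den n = \<delta>2 n (Suc 0) ` carrier (X n) <+>\<^bsub>X n\<^esub> (\<lambda>x. x \<ominus>\<^bsub>X n\<^esub> \<theta> n 0 x) ` carrier (X n)"

sublocale X: module K "X i" for i by (rule X)

lemma module_C: "module (Z2_ring K) (C n m)"
  by (rule module_Z2[OF X \<theta> \<theta>_\<theta>])

lemma \<delta>1_hom: "\<delta>1 (Suc n) m \<in> mod_hom (Z2_ring K) (C (Suc n) m) (C n m)"
  by (rule Z2_equivariant_hom) (rule X \<delta>1 \<theta> | erule \<delta>1_\<theta>)+

lemma \<delta>2_hom: "\<delta>2 n (Suc m) \<in> mod_hom (Z2_ring K) (C n (Suc m)) (C n m)"
  by (rule Z2_equivariant_hom) (rule X \<delta>2 \<theta> | erule \<delta>2_\<theta>)+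

lemma one_minus_\<theta>: "(\<lambda>x. x \<ominus>\<^bsub>X n\<^esub> \<theta> n m x) \<in> mod_hom K (X n) (X n)"
  by (rule mod_hom_minus[OF X mod_hom_ident \<theta>])

lemma den_submodule: "submodule (den n) K (X n)"
  unfolding den_def
  by (intro submodule_set_add submodule_image X \<delta>2 one_minus_\<theta>)

sublocale Q: quotient K "X n" "den n" for n
  by (intro quotientI X den_submodule)

abbreviation "Q n \<equiv> quot_module (X n) (den n)"

lemma den_iff: "x \<in> den n \<longleftrightarrow>
    (\<exists>w\<in>carrier (X n). \<exists>v\<in>carrier (X n). x = \<delta>2 n (Suc 0) w \<oplus>\<^bsub>X n\<^esub> (v \<ominus>\<^bsub>X n\<^esub> \<theta> n 0 v))"
  unfolding den_def set_add_def' by auto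

lemma \<delta>2_den: "w \<in> carrier (X n) \<Longrightarrow> \<delta>2 n (Suc 0) w \<in> den n"
  unfolding den_iff
  by (rule bexI[of _ w], rule bexI[of _ "\<zero>\<^bsub>X n\<^esub>"])
    (simp_all add: mod_hom_zero[OF X X one_minus_\<theta>] mod_hom_closed[OF \<delta>2])

lemma \<theta>_den: "v \<in> carrier (X n) \<Longrightarrow> v \<ominus>\<^bsub>X n\<^esub> \<theta> n 0 v \<in> den n"
  unfolding den_iff
  by (rule bexI[of _ "\<zero>\<^bsub>X n\<^esub>"], rule bexI[of _ v])
    (simp_all add: mod_hom_zero[OF X X \<delta>2] mod_hom_closed[OF one_minus_\<theta>])

lemma \<delta>1_den: "x \<in> den (Suc n) \<Longrightarrow> \<delta>1 (Suc n) 0 x \<in> den n"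
proof -
  assume "x \<in> den (Suc n)"
  then obtain w v where w: "w \<in> carrier (X (Suc n))" and v: "v \<in> carrier (X (Suc n))"
    and x: "x = \<delta>2 (Suc n) (Suc 0) w \<oplus>\<^bsub>X (Suc n)\<^esub> (v \<ominus>\<^bsub>X (Suc n)\<^esub> \<theta> (Suc n) 0 v)"
    unfolding den_iff by (elim bexE)
  note cl = mod_hom_closed[OF \<delta>1] mod_hom_closed[OF \<delta>2] mod_hom_closed[OF \<theta>]
  have "\<delta>1 (Suc n) 0 (\<delta>2 (Suc n) (Suc 0) w) = \<ominus>\<^bsub>X n\<^esub> \<delta>2 n (Suc 0) (\<delta>1 (Suc n) (Suc 0) w)"
    using \<delta>21[OF w, of 0] w by (simp add: cl X.M.minus_minus)
  then have "\<delta>1 (Suc n) 0 (\<delta>2 (Suc n) (Suc 0) w) \<in> den n"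
    using X.submoduleE(3)[OF den_submodule] \<delta>2_den[OF mod_hom_closed[OF \<delta>1 w]] by simp
  moreover have "\<delta>1 (Suc n) 0 (v \<ominus>\<^bsub>X (Suc n)\<^esub> \<theta> (Suc n) 0 v) \<in> den n"
    using \<theta>_den[OF mod_hom_closed[OF \<delta>1 v]] mod_hom_diff[OF X X \<delta>1 v mod_hom_closed[OF \<theta> v]] \<delta>1_\<theta>[OF v]
    by simp
  ultimately show ?thesis unfolding x
    using X.submoduleE(5)[OF den_submodule] w v
    by (simp add: mod_hom_add[OF \<delta>1] cl X.M.minus_closed)
qed

definition q :: "nat \<Rightarrow> 'c set \<Rightarrow> 'c set"
  where "q n = quot_map (X (n - 1)) (den (n - 1)) (\<delta>1 n 0)"

lemma q_coset:
  assumes x: "x \<in> carrier (X (Suc n))"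
  shows "q (Suc n) (den (Suc n) +>\<^bsub>X (Suc n)\<^esub> x) = den n +>\<^bsub>X n\<^esub> \<delta>1 (Suc n) 0 x"
proof -
  have "(\<Union>y\<in>den (Suc n) +>\<^bsub>X (Suc n)\<^esub> x. den n +>\<^bsub>X n\<^esub> \<delta>1 (Suc n) 0 y) = den n +>\<^bsub>X n\<^esub> \<delta>1 (Suc n) 0 x"
  proof (rule Q.union_cosets[OF x])
    fix y assume y: "y \<in> carrier (X (Suc n))" "y \<ominus>\<^bsub>X (Suc n)\<^esub> x \<in> den (Suc n)"
    show "den n +>\<^bsub>X n\<^esub> \<delta>1 (Suc n) 0 y = den n +>\<^bsub>X n\<^esub> \<delta>1 (Suc n) 0 x"
      using \<delta>1_den[OF y(2)] mod_hom_diff[OF X X \<delta>1 y(1) x] mod_hom_closed[OF \<delta>1] x y(1)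
      by (simp add: Q.coset_eq)
  qed
  then show ?thesis by (simp add: q_def quot_map_def)
qed

lemma q_hom: "q (Suc n) \<in> mod_hom K (Q (Suc n)) (Q n)"
proof (rule mod_homI)
  note cl = mod_hom_closed[OF \<delta>1]
  fix x assume "x \<in> carrier (Q (Suc n))"
  then obtain x' where x: "x' \<in> carrier (X (Suc n))" "x = den (Suc n) +>\<^bsub>X (Suc n)\<^esub> x'" by (auto simp: Q.carrier_quot)
  then show "q (Suc n) x \<in> carrier (Q n)" by (simp add: q_coset Q.carrier_quot cl)
  fix a assume "a \<in> carrier K"
  then show "q (Suc n) (a \<odot>\<^bsub>Q (Suc n)\<^esub> x) = a \<odot>\<^bsub>Q n\<^esub> q (Suc n) x"
    using x by (simp add: q_coset Q.smult_quot cl mod_hom_smult[OF \<delta>1])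
next
  note cl = mod_hom_closed[OF \<delta>1]
  fix x y assume "x \<in> carrier (Q (Suc n))" "y \<in> carrier (Q (Suc n))"
  then obtain x' y' where x: "x' \<in> carrier (X (Suc n))" "x = den (Suc n) +>\<^bsub>X (Suc n)\<^esub> x'"
    and y: "y' \<in> carrier (X (Suc n))" "y = den (Suc n) +>\<^bsub>X (Suc n)\<^esub> y'" by (auto simp: Q.carrier_quot)
  then show "q (Suc n) (x \<oplus>\<^bsub>Q (Suc n)\<^esub> y) = q (Suc n) x \<oplus>\<^bsub>Q n\<^esub> q (Suc n) y"
    by (simp add: q_coset Q.add_quot cl mod_hom_add[OF \<delta>1])
qed

abbreviation "e n m x \<equiv> (h, h) \<odot>\<^bsub>C n m\<^esub> x"

text \<open>
  The idempotent \<open>(1 + \<theta>) / 2\<close> is the identity modulo the image of \<open>1 - \<theta>\<close> and kills that image. This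
  turns the coinvariants of \<open>\<theta>\<close> into a direct summand.
\<close>

lemma e_den:
  assumes x: "x \<in> carrier (X n)"
  shows "x \<ominus>\<^bsub>X n\<^esub> e n 0 x \<in> den n"
proof -
  have \<theta>x: "\<theta> n 0 x \<in> carrier (X n)" using mod_hom_closed[OF \<theta> x] .
  let ?v = "h \<odot>\<^bsub>X n\<^esub> x"
  have "x = (h \<oplus> h) \<odot>\<^bsub>X n\<^esub> x" using h x by simp
  also have "\<dots> = ?v \<oplus>\<^bsub>X n\<^esub> ?v" by (rule X.smult_l_distr[OF h(1) h(1) x])
  finally have "x \<ominus>\<^bsub>X n\<^esub> e n 0 x = (?v \<oplus>\<^bsub>X n\<^esub> ?v) \<ominus>\<^bsub>X n\<^esub> (?v \<oplus>\<^bsub>X n\<^esub> h \<odot>\<^bsub>X n\<^esub> \<theta> n 0 x)" by simp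
  also have "\<dots> = (?v \<oplus>\<^bsub>X n\<^esub> \<ominus>\<^bsub>X n\<^esub> ?v) \<oplus>\<^bsub>X n\<^esub> (?v \<ominus>\<^bsub>X n\<^esub> h \<odot>\<^bsub>X n\<^esub> \<theta> n 0 x)"
    using h x \<theta>x by (simp add: a_minus_def X.M.minus_add X.M.a_ac)
  also have "\<dots> = ?v \<ominus>\<^bsub>X n\<^esub> \<theta> n 0 ?v"
    using h x \<theta>x by (simp add: X.M.r_neg mod_hom_smult[OF \<theta>] X.M.minus_closed)
  finally show ?thesis using \<theta>_den[of ?v n] h x by simp
qed

lemma e_kills:
  assumes v: "v \<in> carrier (X n)"
  shows "e n 0 (v \<ominus>\<^bsub>X n\<^esub> \<theta> n 0 v) = \<zero>\<^bsub>X n\<^esub>"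
proof -
  have \<theta>v: "\<theta> n 0 v \<in> carrier (X n)" using mod_hom_closed[OF \<theta> v] .
  have "\<theta> n 0 (v \<ominus>\<^bsub>X n\<^esub> \<theta> n 0 v) = \<theta> n 0 v \<ominus>\<^bsub>X n\<^esub> v"
    using mod_hom_diff[OF X X \<theta> v \<theta>v] by (simp add: \<theta>_\<theta>[OF v])
  then have "e n 0 (v \<ominus>\<^bsub>X n\<^esub> \<theta> n 0 v) =
      (h \<odot>\<^bsub>X n\<^esub> v \<oplus>\<^bsub>X n\<^esub> \<ominus>\<^bsub>X n\<^esub> (h \<odot>\<^bsub>X n\<^esub> \<theta> n 0 v)) \<oplus>\<^bsub>X n\<^esub> (h \<odot>\<^bsub>X n\<^esub> \<theta> n 0 v \<oplus>\<^bsub>X n\<^esub> \<ominus>\<^bsub>X n\<^esub> (h \<odot>\<^bsub>X n\<^esub> v))"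
    using h v \<theta>v by (simp add: a_minus_def X.smult_r_distr X.smult_r_minus)
  also have "\<dots> = (h \<odot>\<^bsub>X n\<^esub> v \<oplus>\<^bsub>X n\<^esub> \<ominus>\<^bsub>X n\<^esub> (h \<odot>\<^bsub>X n\<^esub> v)) \<oplus>\<^bsub>X n\<^esub> (h \<odot>\<^bsub>X n\<^esub> \<theta> n 0 v \<oplus>\<^bsub>X n\<^esub> \<ominus>\<^bsub>X n\<^esub> (h \<odot>\<^bsub>X n\<^esub> \<theta> n 0 v))"
    using h v \<theta>v by (simp add: X.M.a_ac)
  finally show ?thesis using h v \<theta>v by (simp add: X.M.r_neg)
qed

text \<open>
  The tensored resolution is exact in positive degrees by contraction. In degree zero the augmentation
  \<open>\<mu>\<close> identifies its cokernel with the image of the idempotent \<open>(1 + \<theta>) / 2\<close>, on which the exactness of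
  the maps \<open>\<delta>2\<close> is inherited from the whole module.
\<close>

theorem hyperhomology_iso:
  assumes res: "projective_resolution (Z2_ring K) (Z2_trivial K) P dP"
  shows "mod_isomorphic K (hyperhomology K P dP C \<delta>1 \<delta>2 n) (homology Q q n)"
proof -
  obtain s \<kappa> u where "split_resolution (Z2_ring K) P dP s \<kappa> u" and \<kappa>u: "\<kappa> u = (h, h)"
    using split_projective_resolution[OF is_cring h res] .
  interpret S: split_resolution "Z2_ring K" P dP s \<kappa> u by fact
  let ?R = "Z2_ring K"
  define E where "E = triple_cx K P C"
  have Eeq: "E (l, n, m) = Z2_restrict K (S.PC l (C n m))" for l n m by (simp add: E_def triple_cx_def)
  define d1 where "d1 l n m = S.mapC l (C (Suc n) m) (C n m) (\<delta>1 (Suc n) m)" for l n m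
  define d2 where "d2 l n m = S.mapC l (C n (Suc m)) (C n m) (\<delta>2 n (Suc m))" for l n m
  define d3 where "d3 l n m z = msign (E (l, n, m)) (int n + int m) (S.dPC l (C n m) z)" for l n m z
  define aug where "aug n z = den n +>\<^bsub>X n\<^esub> S.\<mu> (C n 0) z" for n z
  have T: "module ?R (S.PC l (C n m))" for l n m
    using tensor.module_tensor[OF tensorI[OF S.P module_C]] .
  have E: "module K (E i)" for i
    by (cases i) (simp add: Eeq module_restrict[OF is_cring T])
  interpret T: module ?R "S.PC l (C n m)" for l n m by (rule T)
  note d1R = S.mapC_hom[OF module_C module_C \<delta>1_hom] and d2R = S.mapC_hom[OF module_C module_C \<delta>2_hom]
    and d3R = S.dPC_hom[OF module_C]
  have d1: "d1 l n m \<in> mod_hom K (E (l, Suc n, m)) (E (l, n, m))" for l n m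
    unfolding Eeq d1_def by (rule restrict_hom[OF is_cring d1R])
  have d2: "d2 l n m \<in> mod_hom K (E (l, n, Suc m)) (E (l, n, m))" for l n m
    unfolding Eeq d2_def by (rule restrict_hom[OF is_cring d2R])
  have d3: "d3 l n m \<in> mod_hom K (E (Suc l, n, m)) (E (l, n, m))" for l n m
    unfolding d3_def by (rule mod_hom_msign_comp[OF E]) (unfold Eeq, rule restrict_hom[OF is_cring d3R])
  have \<mu>R: "S.\<mu> (C n m) \<in> mod_hom ?R (S.PC 0 (C n m)) (C n m)" for n m by (rule S.\<mu>_hom[OF module_C])
  have \<mu>K: "S.\<mu> (C n m) \<in> mod_hom K (E (0, n, m)) (X n)" for n m
    unfolding Eeq by (rule restrict_hom_Z2_module[OF X \<theta> \<mu>R])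
  have \<mu>c: "S.\<mu> (C n m) z \<in> carrier (X n)" if "z \<in> carrier (E (0, n, m))" for n m z
    using mod_hom_closed[OF \<mu>K that] .
  have \<nu>c: "S.\<nu> (C n m) c \<in> carrier (E (0, n, m))" if "c \<in> carrier (X n)" for n m c
    using S.\<nu>_closed[OF module_C, of c n m] that by (simp add: Eeq)
  have \<mu>\<nu>: "S.\<mu> (C n m) (S.\<nu> (C n m) c) = e n m c" if "c \<in> carrier (X n)" for n m c
    using S.\<mu>_\<nu>[OF module_C, of c n m] that by (simp only: \<kappa>u Z2_module_simps(1))
  have idem: "e n m (S.\<mu> (C n m) z) = S.\<mu> (C n m) z" if "z \<in> carrier (E (0, n, m))" for n m z
    using S.idem_\<mu>[OF module_C, of z n m] that by (simp only: \<kappa>u Eeq Z2_restrict_simps)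
  have \<mu>1: "S.\<mu> (C n m) (d1 0 n m z) = \<delta>1 (Suc n) m (S.\<mu> (C (Suc n) m) z)" if "z \<in> carrier (E (0, Suc n, m))" for n m z
    using S.\<mu>_natural[OF module_C module_C \<delta>1_hom] that by (simp add: d1_def Eeq)
  have \<mu>2: "S.\<mu> (C n m) (d2 0 n m z) = \<delta>2 n (Suc m) (S.\<mu> (C n (Suc m)) z)" if "z \<in> carrier (E (0, n, Suc m))" for n m z
    using S.\<mu>_natural[OF module_C module_C \<delta>2_hom] that by (simp add: d2_def Eeq)
  have d3c: "S.dPC l (C n m) z \<in> carrier (E (l, n, m))" if "z \<in> carrier (E (Suc l, n, m))" for l n m z
    using mod_hom_closed[OF d3R] that by (simp add: Eeq)
  have \<mu>3: "S.\<mu> (C n m) (d3 0 n m z) = \<zero>\<^bsub>X n\<^esub>" if z: "z \<in> carrier (E (Suc 0, n, m))" for n m z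
  proof -
    have "S.\<mu> (C n m) (d3 0 n m z) = msign (X n) (int n + int m) (S.\<mu> (C n m) (S.dPC 0 (C n m) z))"
      unfolding d3_def by (rule mod_hom_msign[OF E X \<mu>K d3c[OF z]])
    also have "S.\<mu> (C n m) (S.dPC 0 (C n m) z) = \<zero>\<^bsub>X n\<^esub>" using S.\<mu>_dPC[OF module_C, of z n m] z by (simp add: Eeq)
    finally show ?thesis by (simp add: msign_zero[OF X])
  qed
  \<comment> \<open>A chain whose image under \<open>\<mu>\<close> is \<open>\<delta>2 w\<close> agrees with the image of \<open>\<nu> w\<close> up to the kernel of \<open>\<mu>\<close>.\<close>
  have peel: "\<exists>w\<in>carrier (E (0, n, Suc m)). \<exists>y\<in>carrier (E (Suc 0, n, m)).
      z = d2 0 n m w \<oplus>\<^bsub>E (0, n, m)\<^esub> d3 0 n m y"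
    if z: "z \<in> carrier (E (0, n, m))" and w: "w \<in> carrier (X n)"
      and zw: "S.\<mu> (C n m) z = e n m (\<delta>2 n (Suc m) w)" for n m z w
  proof -
    interpret En: module K "E (0, n, m)" by (rule E)
    let ?v = "d2 0 n m (S.\<nu> (C n (Suc m)) w)"
    have vc: "?v \<in> carrier (E (0, n, m))" by (rule mod_hom_closed[OF d2 \<nu>c[OF w]])
    have "S.\<mu> (C n m) ?v = \<delta>2 n (Suc m) (e n (Suc m) w)"
      by (simp only: \<mu>2[OF \<nu>c[OF w]] \<mu>\<nu>[OF w])
    also have "\<dots> = e n m (\<delta>2 n (Suc m) w)"
      by (rule mod_hom_smult[OF \<delta>2_hom]) (use h w in auto)
    finally have "S.\<mu> (C n m) (z \<ominus>\<^bsub>E (0, n, m)\<^esub> ?v) = \<zero>\<^bsub>X n\<^esub>"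
      using mod_hom_diff[OF E X \<mu>K z vc] zw \<mu>c[OF z] by (simp add: a_minus_def X.M.r_neg)
    then obtain y where y: "y \<in> carrier (S.PC (Suc 0) (C n m))" "S.dPC 0 (C n m) y = z \<ominus>\<^bsub>E (0, n, m)\<^esub> ?v"
      using S.exact_PC_0[OF module_C, of "z \<ominus>\<^bsub>E (0, n, m)\<^esub> ?v" n m] En.M.minus_closed[OF z vc] by (auto simp: Eeq)
    let ?y = "msign (E (Suc 0, n, m)) (int n + int m) y"
    have yc: "y \<in> carrier (E (Suc 0, n, m))" using y by (simp add: Eeq)
    have dK: "S.dPC 0 (C n m) \<in> mod_hom K (E (Suc 0, n, m)) (E (0, n, m))"
      unfolding Eeq by (rule restrict_hom[OF is_cring d3R])
    have "d3 0 n m ?y = z \<ominus>\<^bsub>E (0, n, m)\<^esub> ?v"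
      using y(2) En.M.minus_closed[OF z vc]
      by (simp add: d3_def mod_hom_msign[OF E E dK yc] msign_msign[OF E])
    then have "?v \<oplus>\<^bsub>E (0, n, m)\<^esub> d3 0 n m ?y = z"
      using z vc by (simp add: a_minus_def En.M.a_ac En.M.r_neg)
    then show ?thesis using \<nu>c[OF w] yc msign_closed[OF E yc] by metis
  qed
  interpret E: module K "E i" for i by (rule E)
  interpret QM: module K "Q i" for i by (rule Q.module_quot)
  interpret A: augmented_triple_complex K E d1 d2 d3 Q q aug
  proof unfold_locales
    fix l n m :: nat and x
    show "d1 l n m (d1 l (Suc n) m x) = \<zero>\<^bsub>E (l, n, m)\<^esub>" if "x \<in> carrier (E (l, Suc (Suc n), m))"
      using S.mapC_comp_zero[OF module_C module_C module_C \<delta>1_hom \<delta>1_hom, where z = x and l = l] that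
      by (simp add: d1_def Eeq \<delta>11)
    show "d2 l n m (d2 l n (Suc m) x) = \<zero>\<^bsub>E (l, n, m)\<^esub>" if "x \<in> carrier (E (l, n, Suc (Suc m)))"
      using S.mapC_comp_zero[OF module_C module_C module_C \<delta>2_hom \<delta>2_hom, where z = x and l = l] that
      by (simp add: d2_def Eeq \<delta>22)
    show "d3 l n m (d3 (Suc l) n m x) = \<zero>\<^bsub>E (l, n, m)\<^esub>" if x: "x \<in> carrier (E (Suc (Suc l), n, m))"
    proof -
      have dK: "S.dPC l (C n m) \<in> mod_hom K (E (Suc l, n, m)) (E (l, n, m))"
        unfolding Eeq by (rule restrict_hom[OF is_cring d3R])
      have "S.dPC l (C n m) (S.dPC (Suc l) (C n m) x) = \<zero>\<^bsub>E (l, n, m)\<^esub>"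
        using S.dPC_dPC[OF module_C, of x l n m] x by (simp add: Eeq)
      then show ?thesis
        by (simp add: d3_def mod_hom_msign[OF E E dK d3c[OF x]] msign_zero[OF E])
    qed
    show "d2 l n m (d1 l n (Suc m) x) = \<ominus>\<^bsub>E (l, n, m)\<^esub> d1 l n m (d2 l (Suc n) m x)" if "x \<in> carrier (E (l, Suc n, Suc m))"
      using S.mapC_anticommute[OF module_C module_C module_C module_C \<delta>1_hom \<delta>2_hom \<delta>2_hom \<delta>1_hom, where z = x and l = l] that
      by (simp add: d1_def d2_def Eeq \<delta>21)
    show "d3 l n m (d1 (Suc l) n m x) = \<ominus>\<^bsub>E (l, n, m)\<^esub> d1 l n m (d3 l (Suc n) m x)" if x: "x \<in> carrier (E (Suc l, Suc n, m))"
    proof -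
      have "S.dPC l (C n m) (d1 (Suc l) n m x) = d1 l n m (S.dPC l (C (Suc n) m) x)"
        unfolding d1_def using S.dPC_mapC[OF module_C module_C \<delta>1_hom, of x l] x by (simp add: Eeq)
      moreover have "d1 l n m (d3 l (Suc n) m x) = msign (E (l, n, m)) (int (Suc n) + int m) (d1 l n m (S.dPC l (C (Suc n) m) x))"
        unfolding d3_def by (rule mod_hom_msign[OF E E d1 d3c[OF x]])
      moreover have "d1 l n m (S.dPC l (C (Suc n) m) x) \<in> carrier (E (l, n, m))"
        by (rule mod_hom_closed[OF d1 d3c[OF x]])
      ultimately show ?thesis
        using abelian_group.minus_minus[OF module_abelian_group[OF E]] by (auto simp: d3_def msign_def)
    qed
    show "d3 l n m (d2 (Suc l) n m x) = \<ominus>\<^bsub>E (l, n, m)\<^esub> d2 l n m (d3 l n (Suc m) x)" if x: "x \<in> carrier (E (Suc l, n, Suc m))"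
    proof -
      have "S.dPC l (C n m) (d2 (Suc l) n m x) = d2 l n m (S.dPC l (C n (Suc m)) x)"
        unfolding d2_def using S.dPC_mapC[OF module_C module_C \<delta>2_hom, of x l] x by (simp add: Eeq)
      moreover have "d2 l n m (d3 l n (Suc m) x) = msign (E (l, n, m)) (int n + int (Suc m)) (d2 l n m (S.dPC l (C n (Suc m)) x))"
        unfolding d3_def by (rule mod_hom_msign[OF E E d2 d3c[OF x]])
      moreover have "d2 l n m (S.dPC l (C n (Suc m)) x) \<in> carrier (E (l, n, m))"
        by (rule mod_hom_closed[OF d2 d3c[OF x]])
      ultimately show ?thesis
        using abelian_group.minus_minus[OF module_abelian_group[OF E]] by (auto simp: d3_def msign_def)
    qed
    show "aug n \<in> mod_hom K (E (0, n, 0)) (Q n)"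
      unfolding aug_def by (rule mod_hom_comp[OF \<mu>K Q.proj_hom])
    show "aug n ` carrier (E (0, n, 0)) = carrier (Q n)"
    proof
      show "aug n ` carrier (E (0, n, 0)) \<subseteq> carrier (Q n)"
        using \<mu>c by (auto simp: aug_def Q.carrier_quot)
      show "carrier (Q n) \<subseteq> aug n ` carrier (E (0, n, 0))"
      proof
        fix y assume "y \<in> carrier (Q n)"
        then obtain c where c: "c \<in> carrier (X n)" "y = den n +>\<^bsub>X n\<^esub> c" by (auto simp: Q.carrier_quot)
        have ec: "e n 0 c \<in> carrier (X n)" using h c by (simp add: mod_hom_closed[OF \<theta>])
        have "den n +>\<^bsub>X n\<^esub> c = den n +>\<^bsub>X n\<^esub> e n 0 c"
          using e_den[OF c(1)] by (simp only: Q.coset_eq[OF c(1) ec])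
        then have "y = aug n (S.\<nu> (C n 0) c)" by (simp only: aug_def \<mu>\<nu>[OF c(1)] c(2))
        then show "y \<in> aug n ` carrier (E (0, n, 0))" using \<nu>c[OF c(1)] by blast
      qed
    qed
    show "aug n (d1 0 n 0 x) = q (Suc n) (aug (Suc n) x)" if "x \<in> carrier (E (0, Suc n, 0))"
      using \<mu>1[OF that] \<mu>c[OF that] by (simp add: aug_def q_coset)
    show "aug n (d2 0 n 0 x) = \<zero>\<^bsub>Q n\<^esub>" if "x \<in> carrier (E (0, n, Suc 0))"
      using \<mu>2[OF that] \<delta>2_den[OF \<mu>c[OF that]] mod_hom_closed[OF \<delta>2 \<mu>c[OF that]] by (simp add: aug_def Q.coset_zero_iff)
    show "aug n (d3 0 n 0 x) = \<zero>\<^bsub>Q n\<^esub>" if "x \<in> carrier (E (Suc 0, n, 0))"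
      using \<mu>3[OF that] by (simp add: aug_def Q.zero_quot)
    show "\<exists>y\<in>carrier (E (Suc (Suc l), n, m)). d3 (Suc l) n m y = x"
      if x: "x \<in> carrier (E (Suc l, n, m))" and dx: "d3 l n m x = \<zero>\<^bsub>E (l, n, m)\<^esub>"
    proof -
      interpret El: module K "E (l, n, m)" by (rule E)
      interpret ES: module K "E (Suc l, n, m)" by (rule E)
      have "S.dPC l (C n m) x = msign (E (l, n, m)) (int n + int m) (d3 l n m x)"
        using d3c[OF x] by (simp add: d3_def msign_msign[OF E])
      then have "S.dPC l (C n m) x = \<zero>\<^bsub>S.PC l (C n m)\<^esub>" using dx by (simp add: msign_zero[OF T] Eeq)
      then obtain y where y: "y \<in> carrier (S.PC (Suc (Suc l)) (C n m))" "S.dPC (Suc l) (C n m) y = x"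
        using S.exact_PC_Suc[OF module_C, of x l n m] x by (auto simp: Eeq)
      have yc: "y \<in> carrier (E (Suc (Suc l), n, m))" using y by (simp add: Eeq)
      have dK: "S.dPC (Suc l) (C n m) \<in> mod_hom K (E (Suc (Suc l), n, m)) (E (Suc l, n, m))"
        unfolding Eeq by (rule restrict_hom[OF is_cring d3R])
      have "d3 (Suc l) n m (msign (E (Suc (Suc l), n, m)) (int n + int m) y) = x"
        using y(2) x by (simp add: d3_def mod_hom_msign[OF E E dK yc] msign_msign[OF E])
      then show ?thesis using msign_closed[OF E yc] by blast
    qed
    show "\<exists>w\<in>carrier (E (0, n, Suc (Suc m))). \<exists>y\<in>carrier (E (Suc 0, n, Suc m)).
        x = d2 0 n (Suc m) w \<oplus>\<^bsub>E (0, n, Suc m)\<^esub> d3 0 n (Suc m) y"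
      if x: "x \<in> carrier (E (0, n, Suc m))" and v: "v \<in> carrier (E (Suc 0, n, m))"
        and 0: "d2 0 n m x \<oplus>\<^bsub>E (0, n, m)\<^esub> d3 0 n m v = \<zero>\<^bsub>E (0, n, m)\<^esub>" for v
    proof -
      have "S.\<mu> (C n m) (d2 0 n m x \<oplus>\<^bsub>E (0, n, m)\<^esub> d3 0 n m v) = \<zero>\<^bsub>X n\<^esub>"
        unfolding 0 by (rule mod_hom_zero[OF E X \<mu>K])
      then have "\<delta>2 n (Suc m) (S.\<mu> (C n (Suc m)) x) = \<zero>\<^bsub>X n\<^esub>"
        using mod_hom_add[OF \<mu>K mod_hom_closed[OF d2 x] mod_hom_closed[OF d3 v]] \<mu>2[OF x] \<mu>3[OF v]
          mod_hom_closed[OF \<delta>2 \<mu>c[OF x]] by simp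
      then obtain w where w: "w \<in> carrier (X n)" "\<delta>2 n (Suc (Suc m)) w = S.\<mu> (C n (Suc m)) x"
        using exact[OF \<mu>c[OF x]] by blast
      show ?thesis by (rule peel[OF x w(1)]) (simp only: w(2) idem[OF x])
    qed
    show "\<exists>w\<in>carrier (E (0, n, Suc 0)). \<exists>y\<in>carrier (E (Suc 0, n, 0)).
        x = d2 0 n 0 w \<oplus>\<^bsub>E (0, n, 0)\<^esub> d3 0 n 0 y"
      if x: "x \<in> carrier (E (0, n, 0))" and 0: "aug n x = \<zero>\<^bsub>Q n\<^esub>"
    proof -
      have "S.\<mu> (C n 0) x \<in> den n" using 0 \<mu>c[OF x] by (simp add: aug_def Q.coset_zero_iff)
      then obtain w v where w: "w \<in> carrier (X n)" and v: "v \<in> carrier (X n)"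
        and eq: "S.\<mu> (C n 0) x = \<delta>2 n (Suc 0) w \<oplus>\<^bsub>X n\<^esub> (v \<ominus>\<^bsub>X n\<^esub> \<theta> n 0 v)"
        unfolding den_iff by (elim bexE)
      have d2w: "\<delta>2 n (Suc 0) w \<in> carrier (X n)" by (rule mod_hom_closed[OF \<delta>2 w])
      have "S.\<mu> (C n 0) x = e n 0 (\<delta>2 n (Suc 0) w \<oplus>\<^bsub>C n 0\<^esub> (v \<ominus>\<^bsub>X n\<^esub> \<theta> n 0 v))"
        using idem[OF x] eq by (simp only: Z2_module_simps(3))
      also have "\<dots> = e n 0 (\<delta>2 n (Suc 0) w) \<oplus>\<^bsub>C n 0\<^esub> e n 0 (v \<ominus>\<^bsub>X n\<^esub> \<theta> n 0 v)"
        by (rule module.smult_r_distr[OF module_C]) (use h d2w mod_hom_closed[OF one_minus_\<theta> v] in auto)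
      also have "\<dots> = e n 0 (\<delta>2 n (Suc 0) w)"
        using d2w h mod_hom_closed[OF \<theta> d2w] using e_kills[OF v] by simp
      finally show ?thesis by (rule peel[OF x w])
    qed
  qed (fact d1 d2 d3 q_hom)+
  have tot: "total_cx K P C = A.tot"
    by (rule ext) (simp add: total_cx_def A.idx_def E_def)
  have diff: "total_diff K P dP C \<delta>1 \<delta>2 = A.D"
    by (rule ext, rule ext)
      (simp add: total_diff_def A.D_def A.idx_def Let_def d1_def d2_def d3_def flip: E_def)
  show ?thesis unfolding hyperhomology_def tot diff by (rule A.total_homology_iso)
qed

end

section \<open>Finite sums\<close>

lemma finsum_bij:
  assumes "module K G" "bij_betw h A B" "\<And>b. b \<in> B \<Longrightarrow> f b \<in> carrier G"
  shows "(\<Oplus>\<^bsub>G\<^esub>b\<in>B. f b) = (\<Oplus>\<^bsub>G\<^esub>a\<in>A. f (h a))"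
proof -
  interpret G: module K G by fact
  have "B = h ` A" "inj_on h A" using assms(2) by (auto simp: bij_betw_def)
  then show ?thesis using G.M.finsum_reindex[of f h A] assms(3) by auto
qed

lemma finsum_congr:
  assumes "module K G" "\<And>a. a \<in> A \<Longrightarrow> f a = g a" "\<And>a. a \<in> A \<Longrightarrow> g a \<in> carrier G"
  shows "(\<Oplus>\<^bsub>G\<^esub>a\<in>A. f a) = (\<Oplus>\<^bsub>G\<^esub>a\<in>A. g a)"
proof -
  interpret G: module K G by fact
  show ?thesis by (rule G.M.finsum_cong') (use assms(2,3) in auto)
qed

lemma finsum_split:
  assumes "module K G" "finite A" "finite B" "A \<inter> B = {}" "\<And>a. a \<in> A \<union> B \<Longrightarrow> f a \<in> carrier G"
  shows "(\<Oplus>\<^bsub>G\<^esub>a\<in>A \<union> B. f a) = (\<Oplus>\<^bsub>G\<^esub>a\<in>A. f a) \<oplus>\<^bsub>G\<^esub> (\<Oplus>\<^bsub>G\<^esub>a\<in>B. f a)"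
proof -
  interpret G: module K G by fact
  show ?thesis by (rule G.M.finsum_Un_disjoint[OF assms(2-4)]) (use assms(5) in auto)
qed

lemma finsum_in_carrier:
  assumes "module K G" "\<And>a. a \<in> A \<Longrightarrow> f a \<in> carrier G"
  shows "(\<Oplus>\<^bsub>G\<^esub>a\<in>A. f a) \<in> carrier G"
proof -
  interpret G: module K G by fact
  show ?thesis by (rule G.M.finsum_closed) (use assms(2) in auto)
qed

lemma finsum_zeros:
  assumes "module K G" "\<And>a. a \<in> A \<Longrightarrow> f a = \<zero>\<^bsub>G\<^esub>"
  shows "(\<Oplus>\<^bsub>G\<^esub>a\<in>A. f a) = \<zero>\<^bsub>G\<^esub>"
proof -
  interpret G: module K G by fact
  show ?thesis using G.M.add.finprod_one_eqI[of A f] assms(2) by (simp add: finsum_def)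
qed

lemma finsum_Sigma:
  assumes "module K G" "finite A" "\<And>a. a \<in> A \<Longrightarrow> finite (B a)"
    "\<And>a b. \<lbrakk>a \<in> A; b \<in> B a\<rbrakk> \<Longrightarrow> f a b \<in> carrier G"
  shows "(\<Oplus>\<^bsub>G\<^esub>a\<in>A. \<Oplus>\<^bsub>G\<^esub>b\<in>B a. f a b) = (\<Oplus>\<^bsub>G\<^esub>p\<in>Sigma A B. f (fst p) (snd p))"
  using assms(2-4)
proof (induction A rule: finite_induct)
  case empty
  interpret G: module K G by fact
  show ?case by simp
next
  case (insert a A)
  interpret G: module K G by fact
  have S: "Sigma (insert a A) B = Pair a ` B a \<union> Sigma A B" by auto
  have fin: "finite (Pair a ` B a)" "finite (Sigma A B)" using insert.hyps(1) insert.prems(1) by auto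
  have cl: "f a' b \<in> carrier G" if "a' \<in> insert a A" "b \<in> B a'" for a' b using insert.prems(2) that .
  have "(\<Oplus>\<^bsub>G\<^esub>p\<in>Sigma (insert a A) B. f (fst p) (snd p)) =
    (\<Oplus>\<^bsub>G\<^esub>p\<in>Pair a ` B a. f (fst p) (snd p)) \<oplus>\<^bsub>G\<^esub> (\<Oplus>\<^bsub>G\<^esub>p\<in>Sigma A B. f (fst p) (snd p))"
    unfolding S
    by (rule finsum_split[OF assms(1) fin]) (use insert.hyps(2) cl in auto)
  also have "(\<Oplus>\<^bsub>G\<^esub>p\<in>Pair a ` B a. f (fst p) (snd p)) = (\<Oplus>\<^bsub>G\<^esub>b\<in>B a. f a b)"
  proof -
    have "bij_betw (Pair a) (B a) (Pair a ` B a)" by (auto simp: bij_betw_def inj_on_def)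
    moreover have "f (fst p) (snd p) \<in> carrier G" if "p \<in> Pair a ` B a" for p using that cl by auto
    ultimately show ?thesis
      using finsum_bij[OF assms(1), of "Pair a" "B a" "Pair a ` B a" "\<lambda>p. f (fst p) (snd p)"] by simp
  qed
  also have "(\<Oplus>\<^bsub>G\<^esub>p\<in>Sigma A B. f (fst p) (snd p)) = (\<Oplus>\<^bsub>G\<^esub>a\<in>A. \<Oplus>\<^bsub>G\<^esub>b\<in>B a. f a b)"
    using insert.IH insert.prems by simp
  also have "(\<Oplus>\<^bsub>G\<^esub>b\<in>B a. f a b) \<oplus>\<^bsub>G\<^esub> (\<Oplus>\<^bsub>G\<^esub>a\<in>A. \<Oplus>\<^bsub>G\<^esub>b\<in>B a. f a b) =
    (\<Oplus>\<^bsub>G\<^esub>a\<in>insert a A. \<Oplus>\<^bsub>G\<^esub>b\<in>B a. f a b)"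
    using insert.hyps cl by (subst G.M.finsum_insert) (auto intro!: G.M.finsum_closed)
  finally show ?case by simp
qed

text \<open>
  The form in which signed sums vanish below: the summands of one sum are matched with the opposite
  summands of the other.
\<close>

lemma finsum_cancel:
  assumes "module K G" "bij_betw h A B" "finite A"
    "\<And>a. a \<in> A \<Longrightarrow> f a \<in> carrier G" "\<And>b. b \<in> B \<Longrightarrow> g b \<in> carrier G"
    "\<And>a. a \<in> A \<Longrightarrow> f a \<oplus>\<^bsub>G\<^esub> g (h a) = \<zero>\<^bsub>G\<^esub>"
  shows "(\<Oplus>\<^bsub>G\<^esub>a\<in>A. f a) \<oplus>\<^bsub>G\<^esub> (\<Oplus>\<^bsub>G\<^esub>b\<in>B. g b) = \<zero>\<^bsub>G\<^esub>"
proof -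
  interpret G: module K G by fact
  have hA: "h a \<in> B" if "a \<in> A" for a using assms(2) that by (auto simp: bij_betw_def)
  have "(\<Oplus>\<^bsub>G\<^esub>a\<in>A. f a) \<oplus>\<^bsub>G\<^esub> (\<Oplus>\<^bsub>G\<^esub>b\<in>B. g b) = (\<Oplus>\<^bsub>G\<^esub>a\<in>A. f a) \<oplus>\<^bsub>G\<^esub> (\<Oplus>\<^bsub>G\<^esub>a\<in>A. g (h a))"
    by (simp add: finsum_bij[OF assms(1,2,5)])
  also have "\<dots> = (\<Oplus>\<^bsub>G\<^esub>a\<in>A. f a \<oplus>\<^bsub>G\<^esub> g (h a))"
    by (rule G.M.finsum_addf[symmetric]) (use assms(4,5) hA in auto)
  also have "\<dots> = \<zero>\<^bsub>G\<^esub>" by (rule finsum_zeros[OF assms(1,6)])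
  finally show ?thesis .
qed

section \<open>Cyclic operator calculus\<close>

text \<open>
  The module \<open>Y N n\<close> stands for the words of \<open>n + 1\<close> letters of total degree \<open>N\<close> after raising degrees,
  so that \<open>D k\<close>, which merges the first \<open>k + 1\<close> letters, lowers the degree by one for every \<open>k\<close>.
\<close>

locale cyclic_operators = cring K for K :: "'k ring" (structure) +
  fixes Y :: "int \<Rightarrow> nat \<Rightarrow> ('k, 'x) module"
    and T R :: "int \<Rightarrow> nat \<Rightarrow> 'x \<Rightarrow> 'x" and D :: "nat \<Rightarrow> int \<Rightarrow> nat \<Rightarrow> 'x \<Rightarrow> 'x"
  assumes Y: "module K (Y N n)"
    and T_hom: "T N n \<in> mod_hom K (Y N n) (Y N n)"
    and R_hom: "R N n \<in> mod_hom K (Y N n) (Y N n)"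
    and D_hom: "k \<le> n \<Longrightarrow> D k N n \<in> mod_hom K (Y N n) (Y (N - 1) (n - k))"
    and T_cyclic: "x \<in> carrier (Y N n) \<Longrightarrow> (T N n ^^ (n + 1)) x = x"
    and R_R: "x \<in> carrier (Y N n) \<Longrightarrow> R N n (R N n x) = x"
    and T_R_T: "x \<in> carrier (Y N n) \<Longrightarrow> T N n (R N n (T N n x)) = R N n x"
begin

sublocale Y: module K "Y N n" for N n by (rule Y)

text \<open>
  Powers of \<open>T\<close> with integer exponents, which make reindexing of sums over arcs a matter of integer
  arithmetic.
\<close>

definition Tp :: "int \<Rightarrow> int \<Rightarrow> nat \<Rightarrow> 'x \<Rightarrow> 'x"
  where "Tp z N n x = (T N n ^^ nat (z mod (int n + 1))) x"

lemma funpow_T_hom: "(\<lambda>x. (T N n ^^ k) x) \<in> mod_hom K (Y N n) (Y N n)"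
proof (induction k)
  case 0
  then show ?case by (simp add: mod_hom_ident)
next
  case (Suc k)
  then show ?case using mod_hom_comp[OF Suc T_hom] by simp
qed

lemma Tp_hom: "(\<lambda>x. Tp z N n x) \<in> mod_hom K (Y N n) (Y N n)"
  unfolding Tp_def by (rule funpow_T_hom)

lemma Tp_closed [simp]: "x \<in> carrier (Y N n) \<Longrightarrow> Tp z N n x \<in> carrier (Y N n)"
  by (rule mod_hom_closed[OF Tp_hom])

lemma T_closed [simp]: "x \<in> carrier (Y N n) \<Longrightarrow> T N n x \<in> carrier (Y N n)"
  by (rule mod_hom_closed[OF T_hom])

lemma R_closed [simp]: "x \<in> carrier (Y N n) \<Longrightarrow> R N n x \<in> carrier (Y N n)"
  by (rule mod_hom_closed[OF R_hom])

lemma D_closed [simp]: "\<lbrakk>k \<le> n; x \<in> carrier (Y N n)\<rbrakk> \<Longrightarrow> D k N n x \<in> carrier (Y (N - 1) (n - k))"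
  by (rule mod_hom_closed[OF D_hom])

lemma funpow_T_mod:
  assumes x: "x \<in> carrier (Y N n)"
  shows "(T N n ^^ k) x = (T N n ^^ (k mod (n + 1))) x"
proof -
  have *: "(T N n ^^ ((n + 1) * j)) x = x" for j
  proof (induction j)
    case (Suc j)
    have "(T N n ^^ ((n + 1) * Suc j)) x = (T N n ^^ ((n + 1) + (n + 1) * j)) x" by (simp add: algebra_simps)
    also have "\<dots> = (T N n ^^ (n + 1)) ((T N n ^^ ((n + 1) * j)) x)" by (simp only: funpow_add o_apply)
    finally show ?case using Suc T_cyclic[OF x] by simp
  qed simp
  have "(T N n ^^ k) x = (T N n ^^ (k mod (n + 1) + (n + 1) * (k div (n + 1)))) x" by (simp only: mod_mult_div_eq)
  also have "\<dots> = (T N n ^^ (k mod (n + 1))) ((T N n ^^ ((n + 1) * (k div (n + 1)))) x)" by (simp only: funpow_add o_apply)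
  finally show ?thesis by (simp only: *)
qed

lemma funpow_T: "x \<in> carrier (Y N n) \<Longrightarrow> (T N n ^^ k) x = Tp (int k) N n x"
  unfolding Tp_def using funpow_T_mod[of x N n k] nat_int[of "k mod (n + 1)"]
  by (simp add: zmod_int add.commute)


lemma Tp_mod: "a mod (int n + 1) = b mod (int n + 1) \<Longrightarrow> Tp a N n x = Tp b N n x"
  by (simp add: Tp_def)

lemma Tp_period: "Tp (a + (int n + 1)) N n x = Tp a N n x" "Tp (a - (int n + 1)) N n x = Tp a N n x"
  by (rule Tp_mod, simp)+

lemma Tp_0 [simp]: "Tp 0 N n x = x"
  by (simp add: Tp_def)

lemma Tp_Tp [simp]:
  assumes x: "x \<in> carrier (Y N n)"
  shows "Tp a N n (Tp b N n x) = Tp (a + b) N n x"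
proof -
  let ?m = "int n + 1"
  have "Tp a N n (Tp b N n x) = (T N n ^^ (nat (a mod ?m) + nat (b mod ?m))) x"
    by (simp add: Tp_def funpow_add)
  also have "\<dots> = Tp (int (nat (a mod ?m) + nat (b mod ?m))) N n x" by (rule funpow_T[OF x])
  also have "int (nat (a mod ?m) + nat (b mod ?m)) = a mod ?m + b mod ?m" by simp
  also have "Tp \<dots> N n x = Tp (a + b) N n x" by (rule Tp_mod) (rule mod_add_eq)
  finally show ?thesis .
qed

lemma T_eq_Tp: "x \<in> carrier (Y N n) \<Longrightarrow> T N n x = Tp 1 N n x"
  using funpow_T[of x N n 1] by simp

lemma R_Tp:
  assumes "x \<in> carrier (Y N n)"
  shows "R N n (Tp z N n x) = Tp (- z) N n (R N n x)"
proof -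
  have pow: "R N n (Tp (int k) N n x) = Tp (- int k) N n (R N n x)" for k
  proof (induction k)
    case (Suc k)
    let ?y = "Tp (int k) N n x"
    have y: "?y \<in> carrier (Y N n)" using assms by simp
    have "R N n (Tp (int (Suc k)) N n x) = R N n (T N n ?y)"
      using assms by (simp add: T_eq_Tp add.commute)
    also have "\<dots> = Tp (- 1) N n (T N n (R N n (T N n ?y)))" using y by (simp add: T_eq_Tp)
    also have "\<dots> = Tp (- 1) N n (R N n ?y)" by (simp only: T_R_T[OF y])
    finally show ?case using Suc assms by simp
  qed simp
  have "R N n (Tp z N n x) = R N n (Tp (int (nat (z mod (int n + 1)))) N n x)"
    by (rule arg_cong[of _ _ "R N n"], rule Tp_mod) simp
  also have "\<dots> = Tp (- (z mod (int n + 1))) N n (R N n x)" using pow[of "nat (z mod (int n + 1))"] by simp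
  also have "\<dots> = Tp (- z) N n (R N n x)" by (rule Tp_mod) (simp add: mod_minus_eq)
  finally show ?thesis .
qed

definition norm :: "int \<Rightarrow> nat \<Rightarrow> 'x \<Rightarrow> 'x"
  where "norm N n x = (\<Oplus>\<^bsub>Y N n\<^esub>i\<in>{0..n}. (T N n ^^ i) x)"

lemma norm_hom: "norm N n \<in> mod_hom K (Y N n) (Y N n)"
  unfolding norm_def by (rule mod_hom_sum[OF Y Y funpow_T_hom])

lemma norm_interval:
  assumes x: "x \<in> carrier (Y N n)" and ab: "b = a + int n"
  shows "(\<Oplus>\<^bsub>Y N n\<^esub>i\<in>{a..b}. Tp i N n x) = norm N n x"
proof -
  let ?f = "\<lambda>i. nat (i mod (int n + 1))"
  have inj: "inj_on ?f {a..b}"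
  proof (rule inj_onI)
    fix i j assume ij: "i \<in> {a..b}" "j \<in> {a..b}" and "?f i = ?f j"
    then have "i mod (int n + 1) = j mod (int n + 1)" by (simp add: nat_eq_iff2)
    then have "(int n + 1) dvd i - j" by (rule mod_eq_dvd_iff[THEN iffD1])
    moreover have "\<bar>i - j\<bar> < int n + 1" using ij ab by auto
    ultimately show "i = j" using zdvd_not_zless[of "\<bar>i - j\<bar>" "int n + 1"] by auto
  qed
  have sub: "?f ` {a..b} \<subseteq> {0..n}"
  proof
    fix y assume "y \<in> ?f ` {a..b}"
    then obtain i where i: "y = ?f i" by auto
    have "i mod (int n + 1) < int n + 1" by (rule pos_mod_bound) simp
    then show "y \<in> {0..n}" using i by (simp add: nat_le_iff)
  qed
  have "?f ` {a..b} = {0..n}"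
    by (rule card_subset_eq[OF _ sub]) (use card_image[OF inj] ab in auto)
  then have bij: "bij_betw ?f {a..b} {0..n}" using inj by (simp add: bij_betw_def)
  have "norm N n x = (\<Oplus>\<^bsub>Y N n\<^esub>i\<in>{a..b}. (T N n ^^ ?f i) x)"
    unfolding norm_def by (rule finsum_bij[OF Y bij]) (rule mod_hom_closed[OF funpow_T_hom x])
  then show ?thesis by (simp add: Tp_def)
qed

lemma Tp_norm:
  assumes x: "x \<in> carrier (Y N n)"
  shows "Tp z N n (norm N n x) = norm N n x" "norm N n (Tp z N n x) = norm N n x"
proof -
  have eq: "(\<Oplus>\<^bsub>Y N n\<^esub>i\<in>{0..int n}. Tp (z + i) N n x) = norm N n x"
  proof -
    have "bij_betw ((+) z) {0..int n} {z..z + int n}"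
      by (rule bij_betw_byWitness[where f' = "\<lambda>i. i - z"]) auto
    from finsum_bij[OF Y this, of "\<lambda>i. Tp i N n x"] show ?thesis
      using x norm_interval[OF x, of "z + int n" z] by simp
  qed
  show "Tp z N n (norm N n x) = norm N n x"
    using x by (subst (1) norm_interval[OF x, of "int n" 0, symmetric])
      (simp_all add: mod_hom_finsum[OF Y Y Tp_hom] eq)
  have "norm N n (Tp z N n x) = (\<Oplus>\<^bsub>Y N n\<^esub>i\<in>{0..int n}. Tp i N n (Tp z N n x))"
    using x by (intro norm_interval[symmetric]) auto
  then show "norm N n (Tp z N n x) = norm N n x" using x eq by (simp add: add.commute)
qed

lemma norm_T: "x \<in> carrier (Y N n) \<Longrightarrow> norm N n (T N n x) = norm N n x"
  by (simp add: T_eq_Tp Tp_norm)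

text \<open>
  For \<open>i \<ge> 0\<close> the operation consumes the letters \<open>i, \<dots>, i + k\<close>; for \<open>i < 0\<close> it consumes the
  last \<open>-i\<close> letters and the first ones, and its value becomes the first letter.
\<close>

definition arc :: "nat \<Rightarrow> int \<Rightarrow> int \<Rightarrow> nat \<Rightarrow> 'x \<Rightarrow> 'x"
  where "arc k i N n x = Tp (max i 0) (N - 1) (n - k) (D k N n (Tp (- i) N n x))"

text \<open>
  The two differentials of the associated complex: \<open>arcs True\<close> sums over all arcs, \<open>arcs False\<close> only
  over those that do not wrap around.
\<close>

definition low :: "bool \<Rightarrow> nat \<Rightarrow> int" where "low w k = (if w then - int k else 0)"

definition arcs :: "bool \<Rightarrow> nat \<Rightarrow> int \<Rightarrow> nat \<Rightarrow> 'x \<Rightarrow> 'x"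
  where "arcs w k N n x = (\<Oplus>\<^bsub>Y (N - 1) (n - k)\<^esub>i\<in>{low w k..int n - int k}. arc k i N n x)"

lemma arc_hom: "k \<le> n \<Longrightarrow> arc k i N n \<in> mod_hom K (Y N n) (Y (N - 1) (n - k))"
  unfolding arc_def by (rule mod_hom_comp[OF mod_hom_comp[OF Tp_hom D_hom] Tp_hom])

lemma arc_closed [simp]: "\<lbrakk>k \<le> n; x \<in> carrier (Y N n)\<rbrakk> \<Longrightarrow> arc k i N n x \<in> carrier (Y (N - 1) (n - k))"
  by (rule mod_hom_closed[OF arc_hom])

lemma arcs_hom: "k \<le> n \<Longrightarrow> arcs w k N n \<in> mod_hom K (Y N n) (Y (N - 1) (n - k))"
  unfolding arcs_def by (rule mod_hom_sum[OF Y Y arc_hom])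

lemma arcs_closed [simp]: "\<lbrakk>k \<le> n; x \<in> carrier (Y N n)\<rbrakk> \<Longrightarrow> arcs w k N n x \<in> carrier (Y (N - 1) (n - k))"
  by (rule mod_hom_closed[OF arcs_hom])

text \<open>
  A rotation of the word moves an arc by one place. The arcs which wrap around cancel between the two
  summands, and the others are moved to arcs that do not wrap around, whose value is rotated as well.
\<close>

lemma arcs_one_minus_T:
  assumes k: "k \<le> n" and x: "x \<in> carrier (Y N n)"
  shows "arcs True k N n (x \<ominus>\<^bsub>Y N n\<^esub> T N n x) =
    arcs False k N n x \<ominus>\<^bsub>Y (N - 1) (n - k)\<^esub> T (N - 1) (n - k) (arcs False k N n x)"
proof -
  let ?G = "Y (N - 1) (n - k)" and ?J = "{- int k..int n - int k}"
  let ?h = "\<lambda>j. if j < 0 then arc k j N n x else T (N - 1) (n - k) (arc k j N n x)"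
  let ?S = "\<Oplus>\<^bsub>?G\<^esub>i\<in>{- int k..-1}. arc k i N n x"
  have J: "?J = {- int k..-1} \<union> {0..int n - int k}" using k by auto
  have nk: "int (n - k) = int n - int k" using k by simp
  have Sc: "?S \<in> carrier ?G" by (rule finsum_in_carrier[OF Y]) (use k x in simp)
  have "arcs True k N n (T N n x) = (\<Oplus>\<^bsub>?G\<^esub>i\<in>?J. ?h (if i = - int k then int n - int k else i - 1))"
    unfolding arcs_def low_def if_True
  proof (rule finsum_congr[OF Y])
    fix i assume i: "i \<in> ?J"
    consider "i = - int k" | "- int k < i" "i \<le> 0" | "i > 0" using i by fastforce
    then show "arc k i N n (T N n x) = ?h (if i = - int k then int n - int k else i - 1)"
    proof cases
      case 1
      have "T (N - 1) (n - k) (arc k (int n - int k) N n x) = Tp (int (n - k) + 1) (N - 1) (n - k) (D k N n (Tp (- (int n - int k)) N n x))"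
        using k x nk by (simp add: arc_def T_eq_Tp add.commute)
      also have "\<dots> = D k N n (Tp (- (int n - int k)) N n x)"
        using Tp_period(1)[of 0 "n - k" "N - 1"] by simp
      also have "Tp (- (int n - int k)) N n x = Tp (int k + 1) N n x"
        using Tp_period(2)[of "int k + 1" n N x] by (simp add: algebra_simps)
      finally show ?thesis using 1 k x by (simp add: arc_def T_eq_Tp)
    next
      case 2
      then show ?thesis using k x by (simp add: arc_def T_eq_Tp)
    next
      case 3
      then have "max (i - 1) 0 = i - 1" "max i 0 = i" by auto
      then show ?thesis using 3 k x by (simp add: arc_def T_eq_Tp)
    qed
  qed (use k x in auto)
  also have "\<dots> = (\<Oplus>\<^bsub>?G\<^esub>j\<in>?J. ?h j)"
  proof (rule finsum_bij[OF Y, symmetric])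
    show "bij_betw (\<lambda>i. if i = - int k then int n - int k else i - 1) ?J ?J"
      by (rule bij_betw_byWitness[where f' = "\<lambda>j. if j = int n - int k then - int k else j + 1"])
        (use k in \<open>auto split: if_splits\<close>)
  qed (use k x in auto)
  also have "\<dots> = (\<Oplus>\<^bsub>?G\<^esub>j\<in>{- int k..-1}. ?h j) \<oplus>\<^bsub>?G\<^esub> (\<Oplus>\<^bsub>?G\<^esub>j\<in>{0..int n - int k}. ?h j)"
    unfolding J by (rule finsum_split[OF Y]) (use k x in auto)
  also have "(\<Oplus>\<^bsub>?G\<^esub>j\<in>{- int k..-1}. ?h j) = ?S"
    by (rule finsum_congr[OF Y]) (use k x in auto)
  also have "(\<Oplus>\<^bsub>?G\<^esub>j\<in>{0..int n - int k}. ?h j) = (\<Oplus>\<^bsub>?G\<^esub>j\<in>{0..int n - int k}. T (N - 1) (n - k) (arc k j N n x))"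
    by (rule finsum_congr[OF Y]) (use k x in auto)
  also have "\<dots> = T (N - 1) (n - k) (arcs False k N n x)"
    unfolding arcs_def low_def using k x by (simp add: mod_hom_finsum[OF Y Y T_hom])
  finally have AT: "arcs True k N n (T N n x) = ?S \<oplus>\<^bsub>?G\<^esub> T (N - 1) (n - k) (arcs False k N n x)" .
  have A: "arcs True k N n x = ?S \<oplus>\<^bsub>?G\<^esub> arcs False k N n x"
    unfolding arcs_def low_def if_True if_False J by (rule finsum_split[OF Y]) (use k x in auto)
  have "arcs True k N n (x \<ominus>\<^bsub>Y N n\<^esub> T N n x) = arcs True k N n x \<ominus>\<^bsub>?G\<^esub> arcs True k N n (T N n x)"
    using mod_hom_diff[OF Y Y arcs_hom[OF k] x, of "T N n x"] x by simp
  also have "\<dots> = (?S \<oplus>\<^bsub>?G\<^esub> \<ominus>\<^bsub>?G\<^esub> ?S) \<oplus>\<^bsub>?G\<^esub> (arcs False k N n x \<ominus>\<^bsub>?G\<^esub> T (N - 1) (n - k) (arcs False k N n x))"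
    unfolding AT unfolding A using Sc k x by (simp add: a_minus_def Y.M.minus_add Y.M.a_ac)
  also have "\<dots> = arcs False k N n x \<ominus>\<^bsub>?G\<^esub> T (N - 1) (n - k) (arcs False k N n x)"
    using Sc k x by (simp add: Y.M.r_neg Y.M.minus_closed)
  finally show ?thesis .
qed

text \<open>
  Both sides are \<open>norm \<circ> D\<^sub>k \<circ> norm\<close>: on the left the rotations after \<open>D\<^sub>k\<close> run through a full turn of
  the short word, and on the right the rotations before \<open>D\<^sub>k\<close> run through a full turn of the long one.
\<close>

lemma arcs_norm:
  assumes k: "k \<le> n" and x: "x \<in> carrier (Y N n)"
  shows "arcs False k N n (norm N n x) = norm (N - 1) (n - k) (arcs True k N n x)"
proof -
  let ?G = "Y (N - 1) (n - k)"
  have nx: "norm N n x \<in> carrier (Y N n)" by (rule mod_hom_closed[OF norm_hom x])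
  have nk: "int n - int k = 0 + int (n - k)" using k by simp
  have eq: "norm N n x = (\<Oplus>\<^bsub>Y N n\<^esub>i\<in>{- int k..int n - int k}. Tp (- i) N n x)"
  proof -
    have "bij_betw uminus {- int k..int n - int k} {int k - int n..int k}"
      by (rule bij_betw_byWitness[where f' = uminus]) auto
    from finsum_bij[OF Y this, of "\<lambda>i. Tp i N n x" N n] show ?thesis
      using x norm_interval[OF x, of "int k" "int k - int n"] by simp
  qed
  have "arcs False k N n (norm N n x) = (\<Oplus>\<^bsub>?G\<^esub>i\<in>{0..int n - int k}. Tp i (N - 1) (n - k) (D k N n (norm N n x)))"
    unfolding arcs_def low_def if_False
    by (rule finsum_congr[OF Y]) (use k nx in \<open>auto simp: arc_def Tp_norm[OF x]\<close>)
  also have "\<dots> = norm (N - 1) (n - k) (D k N n (norm N n x))"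
    by (rule norm_interval[OF _ nk]) (use k nx in simp)
  also have "\<dots> =
    (\<Oplus>\<^bsub>?G\<^esub>i\<in>{- int k..int n - int k}. norm (N - 1) (n - k) (D k N n (Tp (- i) N n x)))"
    unfolding eq using k x by (simp add: mod_hom_finsum[OF Y Y D_hom[OF k]] mod_hom_finsum[OF Y Y norm_hom])
  also have "\<dots> = (\<Oplus>\<^bsub>?G\<^esub>i\<in>{- int k..int n - int k}. norm (N - 1) (n - k) (arc k i N n x))"
    by (rule finsum_congr[OF Y]) (use k x in \<open>auto simp: arc_def Tp_norm(2) mod_hom_closed[OF norm_hom]\<close>)
  also have "\<dots> = norm (N - 1) (n - k) (arcs True k N n x)"
    unfolding arcs_def low_def if_True using k x by (simp add: mod_hom_finsum[OF Y Y norm_hom])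
  finally show ?thesis .
qed

end

text \<open>Reversal exchanges the operation on the first letters with the one whose value stays first.\<close>

locale dihedral_operators = cyclic_operators +
  assumes R_D: "\<lbrakk>k \<le> n; x \<in> carrier (Y N n)\<rbrakk> \<Longrightarrow>
    R (N - 1) (n - k) (D k N n x) = D k N n ((T N n ^^ k) (R N n x))"
begin

lemma R_D_Tp: "\<lbrakk>k \<le> n; x \<in> carrier (Y N n)\<rbrakk> \<Longrightarrow>
    R (N - 1) (n - k) (D k N n (Tp z N n x)) = D k N n (Tp (int k - z) N n (R N n x))"
  by (simp add: R_D funpow_T R_Tp)

text \<open>
  Reversal permutes the arcs. It preserves the arcs that contain the first letter, because the value of
  such an arc is the first letter of the new word.
\<close>

lemma arcs_R:
  assumes k: "k \<le> n" and x: "x \<in> carrier (Y N n)"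
  shows "arcs True k N n (R N n x) = R (N - 1) (n - k) (arcs True k N n x)"
proof -
  let ?G = "Y (N - 1) (n - k)" and ?J = "{- int k..int n - int k}"
  let ?f = "\<lambda>i. if i \<le> 0 then - (int k + i) else int n - int k + 1 - i"
  have nk: "int (n - k) = int n - int k" using k by simp
  have "R (N - 1) (n - k) (arcs True k N n x) = (\<Oplus>\<^bsub>?G\<^esub>i\<in>?J. R (N - 1) (n - k) (arc k i N n x))"
    unfolding arcs_def low_def if_True using k x by (simp add: mod_hom_finsum[OF Y Y R_hom])
  also have "\<dots> = (\<Oplus>\<^bsub>?G\<^esub>i\<in>?J. arc k (?f i) N n (R N n x))"
  proof (rule finsum_congr[OF Y])
    fix i assume i: "i \<in> ?J"
    have R: "R (N - 1) (n - k) (arc k i N n x) = Tp (- max i 0) (N - 1) (n - k) (D k N n (Tp (int k + i) N n (R N n x)))"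
      using k x by (simp add: arc_def R_Tp R_D_Tp)
    show "R (N - 1) (n - k) (arc k i N n x) = arc k (?f i) N n (R N n x)"
    proof (cases "i \<le> 0")
      case True
      then show ?thesis using R i by (simp add: arc_def add.commute)
    next
      case False
      have "Tp (int n - int k + 1 - i) (N - 1) (n - k) y = Tp (- i) (N - 1) (n - k) y" for y
        using Tp_period(1)[of "- i" "n - k" "N - 1" y] nk by (simp add: algebra_simps)
      moreover have "Tp (- (int n - int k + 1 - i)) N n y = Tp (int k + i) N n y" for y
        using Tp_period(2)[of "int k + i" n N y] by (simp add: algebra_simps)
      ultimately show ?thesis using R i False by (simp add: arc_def max_def)
    qed
  qed (use k x in auto)
  also have "\<dots> = arcs True k N n (R N n x)"
    unfolding arcs_def low_def if_True
  proof (rule finsum_bij[OF Y, symmetric])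
    show "bij_betw ?f ?J ?J"
      by (rule bij_betw_byWitness[where f' = ?f]) (use k in \<open>auto split: if_splits\<close>)
  qed (use k x in auto)
  finally show ?thesis by simp
qed

text \<open>
  Up to signs and the involution on the letters, \<open>R T\<close> is the plain reversal of a word, so it permutes the
  arcs which do not wrap around.
\<close>

lemma arcs_R_T:
  assumes k: "k \<le> n" and x: "x \<in> carrier (Y N n)"
  shows "arcs False k N n (R N n (T N n x)) = R (N - 1) (n - k) (T (N - 1) (n - k) (arcs False k N n x))"
proof -
  let ?G = "Y (N - 1) (n - k)" and ?J = "{0..int n - int k}"
  let ?f = "\<lambda>i. int n - int k - i"
  have nk: "int (n - k) = int n - int k" using k by simp
  have "R (N - 1) (n - k) (T (N - 1) (n - k) (arcs False k N n x)) =
    (\<Oplus>\<^bsub>?G\<^esub>i\<in>?J. R (N - 1) (n - k) (T (N - 1) (n - k) (arc k i N n x)))"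
    unfolding arcs_def low_def if_False using k x by (simp add: mod_hom_finsum[OF Y Y T_hom] mod_hom_finsum[OF Y Y R_hom])
  also have "\<dots> = (\<Oplus>\<^bsub>?G\<^esub>i\<in>?J. arc k (?f i) N n (R N n (T N n x)))"
  proof (rule finsum_congr[OF Y])
    fix i assume i: "i \<in> ?J"
    have "R (N - 1) (n - k) (T (N - 1) (n - k) (arc k i N n x)) = Tp (- (i + 1)) (N - 1) (n - k) (D k N n (Tp (int k + i) N n (R N n x)))"
      using k x i by (simp add: arc_def R_Tp R_D_Tp T_eq_Tp add.commute)
    moreover have "Tp (int n - int k - i) (N - 1) (n - k) y = Tp (- (i + 1)) (N - 1) (n - k) y" for y
      using Tp_period(1)[of "- (i + 1)" "n - k" "N - 1" y] nk by (simp add: algebra_simps)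
    moreover have "Tp (- (int n - int k - i) - 1) N n y = Tp (int k + i) N n y" for y
      using Tp_period(2)[of "int k + i" n N y] by (simp add: algebra_simps)
    ultimately show "R (N - 1) (n - k) (T (N - 1) (n - k) (arc k i N n x)) = arc k (?f i) N n (R N n (T N n x))"
      using i k x by (simp add: arc_def T_eq_Tp R_Tp)
  qed (use k x in auto)
  also have "\<dots> = arcs False k N n (R N n (T N n x))"
    unfolding arcs_def low_def if_False
  proof (rule finsum_bij[OF Y, symmetric])
    show "bij_betw ?f ?J ?J"
      by (rule bij_betw_byWitness[where f' = ?f]) auto
  qed (use k x in auto)
  finally show ?thesis by simp
qed

end


text \<open>
  Operations on disjoint blocks of letters anticommute, and the compositions of nested ones cancel
  once all the ways to nest them are added up.
\<close>

locale square_zero_operators = cyclic_operators +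
  assumes disjoint: "\<lbrakk>int k + 1 \<le> c; c \<le> int n - int l; x \<in> carrier (Y N n)\<rbrakk> \<Longrightarrow>
      D k (N - 1) (n - l) (Tp c (N - 1) (n - l) (D l N n (Tp (- c) N n x)))
        \<oplus>\<^bsub>Y (N - 2) (n - (k + l))\<^esub>
      Tp (c - int k) (N - 2) (n - (k + l)) (D l (N - 1) (n - k) (Tp (int k - c) (N - 1) (n - k) (D k N n x)))
      = \<zero>\<^bsub>Y (N - 2) (n - (k + l))\<^esub>"
    and nested: "\<lbrakk>s \<le> n; x \<in> carrier (Y N n)\<rbrakk> \<Longrightarrow>
      (\<Oplus>\<^bsub>Y (N - 2) (n - s)\<^esub>k\<in>{0..s}. \<Oplus>\<^bsub>Y (N - 2) (n - s)\<^esub>c\<in>{0..int k}.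
        D k (N - 1) (n - (s - k)) (Tp c (N - 1) (n - (s - k)) (D (s - k) N n (Tp (- c) N n x))))
      = \<zero>\<^bsub>Y (N - 2) (n - s)\<^esub>"
begin

lemma D_closed2:
  assumes "k \<le> s" "s \<le> n" "y \<in> carrier (Y (N - 1) (n - (s - k)))"
  shows "D k (N - 1) (n - (s - k)) y \<in> carrier (Y (N - 2) (n - s))"
proof -
  have "n - (s - k) - k = n - s" "k \<le> n - (s - k)" using assms by auto
  then show ?thesis using D_closed[of k "n - (s - k)" y "N - 1"] assms(3) by simp
qed

text \<open>
  The composition of two operations on arcs contracts either two disjoint arcs or two nested ones. The
  first kind occurs in both orders with opposite signs. For the second kind, fix the place \<open>g\<close> of the
  outer arc, which covers \<open>s + 1\<close> letters in the original word: the sum over the inner arcs vanishes by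
  \<open>nested\<close>.
\<close>

lemma arcs_arcs:
  assumes s: "s \<le> n" and x: "x \<in> carrier (Y N n)"
  shows "(\<Oplus>\<^bsub>Y (N - 2) (n - s)\<^esub>k\<in>{0..s}. arcs w k (N - 1) (n - (s - k)) (arcs w (s - k) N n x))
    = \<zero>\<^bsub>Y (N - 2) (n - s)\<^esub>"
proof -
  note Nat.diff_diff_right [simp del]
  let ?G = "Y (N - 2) (n - s)"
  define F where "F k a c e = Tp a (N - 2) (n - s) (D k (N - 1) (n - (s - k)) (Tp c (N - 1) (n - (s - k)) (D (s - k) N n (Tp e N n x))))"
    for k a c e
  have Fc: "F k a c e \<in> carrier ?G" if "k \<le> s" for k a c e
    unfolding F_def by (intro Tp_closed D_closed2[OF that s] D_closed x) (use s in simp_all)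
  define W where "W k i j = F k (max i 0) (max j 0 - i) (- j)" for k i j
  define I where "I k = {low w k..int n - int s} \<times> {low w (s - k)..int n - int (s - k)}" for k
  define All where "All = Sigma {0..s} I"
  have finI: "finite (I k)" for k by (simp add: I_def)
  have finAll: "finite All" using finI by (auto simp: All_def)
  have prod: "arcs w k (N - 1) (n - (s - k)) (arcs w (s - k) N n x) = (\<Oplus>\<^bsub>?G\<^esub>p\<in>I k. W k (fst p) (snd p))"
    if k: "k \<le> s" for k
  proof -
    let ?l = "s - k"
    have e: "n - ?l - k = n - s" "int (n - ?l) - int k = int n - int s" "k \<le> n - ?l" "?l \<le> n" "N - 1 - 1 = N - 2"
      using k s by auto
    have arc_arc: "arc k i (N - 1) (n - ?l) (arc ?l j N n x) = W k i j" for i j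
      using e x by (simp add: arc_def W_def F_def)
    have "arcs w k (N - 1) (n - ?l) (arcs w ?l N n x) =
      (\<Oplus>\<^bsub>?G\<^esub>i\<in>{low w k..int n - int s}. arc k i (N - 1) (n - ?l) (\<Oplus>\<^bsub>Y (N - 1) (n - ?l)\<^esub>j\<in>{low w ?l..int n - int ?l}. arc ?l j N n x))"
      unfolding arcs_def e(1,2,5) ..
    also have "\<dots> = (\<Oplus>\<^bsub>?G\<^esub>i\<in>{low w k..int n - int s}. \<Oplus>\<^bsub>?G\<^esub>j\<in>{low w ?l..int n - int ?l}. W k i j)"
    proof (rule finsum_congr[OF Y])
      fix i
      have ah: "arc k i (N - 1) (n - ?l) \<in> mod_hom K (Y (N - 1) (n - ?l)) ?G"
        using arc_hom[OF e(3), of i "N - 1"] unfolding e(1,5) .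
      show "arc k i (N - 1) (n - ?l) (\<Oplus>\<^bsub>Y (N - 1) (n - ?l)\<^esub>j\<in>{low w ?l..int n - int ?l}. arc ?l j N n x) =
        (\<Oplus>\<^bsub>?G\<^esub>j\<in>{low w ?l..int n - int ?l}. W k i j)"
        using e(4) x by (subst mod_hom_finsum[OF Y Y ah]) (simp_all add: arc_arc)
    qed (rule finsum_in_carrier[OF Y], simp add: W_def Fc k)
    also have "\<dots> = (\<Oplus>\<^bsub>?G\<^esub>p\<in>I k. W k (fst p) (snd p))"
      unfolding I_def by (rule finsum_Sigma[OF Y]) (auto simp: W_def Fc k)
    finally show ?thesis .
  qed
  let ?W = "\<lambda>p. W (fst p) (fst (snd p)) (snd (snd p))"
  have Wc: "?W p \<in> carrier ?G" if "p \<in> All" for p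
    using that by (auto simp: All_def W_def Fc)
  have total: "(\<Oplus>\<^bsub>?G\<^esub>k\<in>{0..s}. arcs w k (N - 1) (n - (s - k)) (arcs w (s - k) N n x)) = (\<Oplus>\<^bsub>?G\<^esub>p\<in>All. ?W p)"
  proof -
    have "(\<Oplus>\<^bsub>?G\<^esub>k\<in>{0..s}. arcs w k (N - 1) (n - (s - k)) (arcs w (s - k) N n x)) =
      (\<Oplus>\<^bsub>?G\<^esub>k\<in>{0..s}. \<Oplus>\<^bsub>?G\<^esub>p\<in>I k. W k (fst p) (snd p))"
      by (rule finsum_congr[OF Y]) (auto intro!: finsum_in_carrier[OF Y] simp: prod W_def Fc)
    also have "\<dots> = (\<Oplus>\<^bsub>?G\<^esub>p\<in>All. ?W p)"
      unfolding All_def by (rule finsum_Sigma[OF Y]) (auto simp: finI W_def Fc)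
    finally show ?thesis .
  qed
  define D1 where "D1 = {(k, i, j). (k, i, j) \<in> All \<and> int k + 1 \<le> j - i \<and> j - i \<le> int n - int (s - k)}"
  define D2 where "D2 = {(k, i, j). (k, i, j) \<in> All \<and> 1 \<le> i \<and> j < i}"
  define Ns where "Ns = All - D1 - D2"
  have parts: "All = (D1 \<union> D2) \<union> Ns" "D1 \<inter> D2 = {}" "(D1 \<union> D2) \<inter> Ns = {}"
    by (auto simp: Ns_def D1_def D2_def)
  have fin: "finite D1" "finite D2" "finite Ns"
    using finAll parts(1) by (metis finite_Un)+
  \<comment> \<open>the two orders in which a pair of disjoint arcs can be contracted\<close>
  have dis: "(\<Oplus>\<^bsub>?G\<^esub>p\<in>D1. ?W p) \<oplus>\<^bsub>?G\<^esub> (\<Oplus>\<^bsub>?G\<^esub>p\<in>D2. ?W p) = \<zero>\<^bsub>?G\<^esub>"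
  proof (rule finsum_cancel[OF Y _ fin(1)])
    let ?\<phi> = "\<lambda>(k, i, j). (s - k, j - int k + max i 0 - i, i)"
    let ?\<psi> = "\<lambda>(k', i', j'). (s - k', j', i' + int (s - k') - max j' 0 + j')"
    show "bij_betw ?\<phi> D1 D2"
      by (rule bij_betw_byWitness[where f' = ?\<psi>])
        (use s in \<open>auto simp: D1_def D2_def All_def I_def low_def max_def of_nat_diff split: if_splits\<close>)
    fix p assume p: "p \<in> D1"
    obtain k i j where pk: "p = (k, i, j)" by (cases p)
    let ?l = "s - k"
    have k: "k \<le> s" and c: "int k + 1 \<le> j - i" "j - i \<le> int n - int ?l" and i: "- int k \<le> i"
      using p by (auto simp: pk D1_def All_def I_def low_def split: if_splits)
    have j: "max j 0 = j" using c i by auto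
    have kl: "k + ?l = s" "s - ?l = k" using k by auto
    have "D k (N - 1) (n - ?l) (Tp (j - i) (N - 1) (n - ?l) (D ?l N n (Tp (- (j - i)) N n (Tp (- i) N n x))))
        \<oplus>\<^bsub>?G\<^esub> Tp (j - i - int k) (N - 2) (n - s) (D ?l (N - 1) (n - k) (Tp (int k - (j - i)) (N - 1) (n - k) (D k N n (Tp (- i) N n x))))
      = \<zero>\<^bsub>?G\<^esub>" (is "?a \<oplus>\<^bsub>?G\<^esub> ?b = _")
      using disjoint[OF c, of "Tp (- i) N n x" N] x unfolding kl(1) by simp
    moreover have ab: "?a = F k 0 (j - i) (- j)" "?b = F ?l (j - i - int k) (int k - (j - i)) (- i)"
      using x kl(2) by (simp_all add: F_def)
    ultimately have fs: "F k 0 (j - i) (- j) \<oplus>\<^bsub>?G\<^esub> F ?l (j - i - int k) (int k - (j - i)) (- i) = \<zero>\<^bsub>?G\<^esub>"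
      by (simp only: ab)
    have "Tp (max i 0) (N - 2) (n - s) (F k 0 (j - i) (- j)) \<oplus>\<^bsub>?G\<^esub>
      Tp (max i 0) (N - 2) (n - s) (F ?l (j - i - int k) (int k - (j - i)) (- i)) =
      Tp (max i 0) (N - 2) (n - s) (F k 0 (j - i) (- j) \<oplus>\<^bsub>?G\<^esub> F ?l (j - i - int k) (int k - (j - i)) (- i))"
      by (rule mod_hom_add[OF Tp_hom Fc[OF k] Fc, symmetric]) simp
    also have "\<dots> = Tp (max i 0) (N - 2) (n - s) \<zero>\<^bsub>?G\<^esub>" by (simp only: fs)
    also have "\<dots> = \<zero>\<^bsub>?G\<^esub>" by (rule mod_hom_zero[OF Y Y Tp_hom])
    finally have "Tp (max i 0) (N - 2) (n - s) (F k 0 (j - i) (- j)) \<oplus>\<^bsub>?G\<^esub>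
      Tp (max i 0) (N - 2) (n - s) (F ?l (j - i - int k) (int k - (j - i)) (- i)) = \<zero>\<^bsub>?G\<^esub>" .
    moreover have F_shift: "Tp z (N - 2) (n - s) (F k' a c e) = F k' (z + a) c e" if "k' \<le> s" for z k' a c e
      unfolding F_def by (rule Tp_Tp) (intro Tp_closed D_closed2[OF that s] D_closed x, use s in simp_all)
    moreover have "max (j - int k + max i 0 - i) 0 = max i 0 + (j - i - int k)" using c by auto
    ultimately show "?W p \<oplus>\<^bsub>?G\<^esub> ?W (?\<phi> p) = \<zero>\<^bsub>?G\<^esub>"
      using k j by (simp add: pk W_def algebra_simps)
  qed (use Wc parts(1) in auto)
  define V where "V k g c = F k (max g 0) c (- c - g)" for k g c
  define J where "J k = {low w s..int n - int s} \<times> {0..int k}" for k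
  have nes: "(\<Oplus>\<^bsub>?G\<^esub>p\<in>Ns. ?W p) = (\<Oplus>\<^bsub>?G\<^esub>p\<in>Sigma {0..s} J. V (fst p) (fst (snd p)) (snd (snd p)))"
  proof -
    \<comment> \<open>\<open>c\<close> is the place of the inner arc inside the outer one, up to a full turn of the word\<close>
    let ?to = "\<lambda>(k, g, c). if 0 \<le> c + g then (k, g, c + g)
      else if - int (s - k) \<le> c + g then (k, - c, c + g)
      else (k, g + int (s - k), c + g + int n + 1)"
    let ?from = "\<lambda>(k, i, j). if j < 0 then (k, i + j, - i)
      else if j - i \<le> int k then (k, i, j - i)
      else (k, i - int (s - k), j - i - (int n - int (s - k) + 1))"
    have bij: "bij_betw ?to (Sigma {0..s} J) Ns"
      by (rule bij_betw_byWitness[where f' = ?from])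
        (use s in \<open>auto simp: Ns_def D1_def D2_def All_def I_def J_def low_def of_nat_diff split: if_splits\<close>)
    have "(\<Oplus>\<^bsub>?G\<^esub>p\<in>Ns. ?W p) = (\<Oplus>\<^bsub>?G\<^esub>p\<in>Sigma {0..s} J. ?W (?to p))"
      by (rule finsum_bij[OF Y bij]) (use Wc parts(1) in auto)
    also have "\<dots> = (\<Oplus>\<^bsub>?G\<^esub>p\<in>Sigma {0..s} J. V (fst p) (fst (snd p)) (snd (snd p)))"
    proof (rule finsum_congr[OF Y])
      fix p assume p: "p \<in> Sigma {0..s} J"
      obtain k g c where pk: "p = (k, g, c)" by (cases p)
      have k: "k \<le> s" and gc: "0 \<le> c" "c \<le> int k" "- int s \<le> g"
        using p by (auto simp: pk J_def low_def split: if_splits)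
      consider "0 \<le> c + g" | "c + g < 0" "- int (s - k) \<le> c + g" | "c + g < - int (s - k)" by linarith
      then show "?W (?to p) = V (fst p) (fst (snd p)) (snd (snd p))"
      proof cases
        case 1
        then show ?thesis by (simp add: pk W_def V_def)
      next
        case 2
        then have "max g 0 = 0" using gc by auto
        moreover have "?to p = (k, - c, c + g)" using 2 by (simp add: pk)
        moreover have "max (- c) 0 = 0" "max (c + g) 0 = 0" "0 - (- c) = c" "- (c + g) = - c - g" using gc 2 by auto
        ultimately show ?thesis by (simp add: pk W_def V_def)
      next
        case 3
        have l: "int (n - (s - k)) = int n - int (s - k)" using k s by auto
        have z: "max g 0 = 0" "max (g + int (s - k)) 0 = 0" "max (c + g + int n + 1) 0 = c + g + int n + 1"
          using 3 gc s k by auto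
        have p1: "Tp (- (c + g + int n + 1)) N n x = Tp (- c - g) N n x"
          unfolding Tp_period(2)[of "- c - g" n N x, symmetric] by (rule arg_cong[of _ _ "\<lambda>z. Tp z N n x"]) simp
        have p2: "Tp (c + g + int n + 1 - (g + int (s - k))) (N - 1) (n - (s - k)) y = Tp c (N - 1) (n - (s - k)) y" for y
          unfolding Tp_period(1)[of c "n - (s - k)" "N - 1" y, symmetric] l
          by (rule arg_cong[of _ _ "\<lambda>z. Tp z (N - 1) (n - (s - k)) y"]) simp
        have "\<not> 0 \<le> c + g" "\<not> - int (s - k) \<le> c + g" using 3 by auto
        then have "?to p = (k, g + int (s - k), c + g + int n + 1)" by (simp add: pk)
        then have "?W (?to p) = W k (g + int (s - k)) (c + g + int n + 1)" by simp
        also have "\<dots> = V k g c" unfolding W_def V_def F_def z p1 p2 ..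
        finally show ?thesis by (simp add: pk)
      qed
    qed (auto simp: J_def V_def Fc)
    finally show ?thesis .
  qed
  have "(\<Oplus>\<^bsub>?G\<^esub>p\<in>Sigma {0..s} J. V (fst p) (fst (snd p)) (snd (snd p))) = \<zero>\<^bsub>?G\<^esub>"
  proof -
    let ?Z = "Sigma {low w s..int n - int s} (\<lambda>g. Sigma {0..s} (\<lambda>k. {0..int k}))"
    have bij: "bij_betw (\<lambda>(g, k, c). (k, g, c)) ?Z (Sigma {0..s} J)"
      by (rule bij_betw_byWitness[where f' = "\<lambda>(k, g, c). (g, k, c)"]) (auto simp: J_def)
    have Vc: "V k g c \<in> carrier ?G" if "k \<le> s" for k g c using that by (simp add: V_def Fc)
    have "(\<Oplus>\<^bsub>?G\<^esub>p\<in>Sigma {0..s} J. V (fst p) (fst (snd p)) (snd (snd p))) =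
      (\<Oplus>\<^bsub>?G\<^esub>p\<in>?Z. V (fst (snd p)) (fst p) (snd (snd p)))"
      by (subst finsum_bij[OF Y bij]) (auto simp: Vc J_def case_prod_unfold)
    also have "\<dots> = (\<Oplus>\<^bsub>?G\<^esub>g\<in>{low w s..int n - int s}. \<Oplus>\<^bsub>?G\<^esub>p\<in>Sigma {0..s} (\<lambda>k. {0..int k}). V (fst p) g (snd p))"
      by (rule finsum_Sigma[OF Y, symmetric]) (auto simp: Vc)
    also have "\<dots> = \<zero>\<^bsub>?G\<^esub>"
    proof (rule finsum_zeros[OF Y])
      fix g
      let ?y = "Tp (- g) N n x"
      have y: "?y \<in> carrier (Y N n)" using x by simp
      let ?n = "\<lambda>k c. D k (N - 1) (n - (s - k)) (Tp c (N - 1) (n - (s - k)) (D (s - k) N n (Tp (- c) N n ?y)))"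
      have nc: "?n k c \<in> carrier ?G" if "k \<le> s" for k c
        by (intro Tp_closed D_closed2[OF that s] D_closed y) (use s in simp_all)
      have "(\<Oplus>\<^bsub>?G\<^esub>p\<in>Sigma {0..s} (\<lambda>k. {0..int k}). V (fst p) g (snd p)) =
        (\<Oplus>\<^bsub>?G\<^esub>k\<in>{0..s}. \<Oplus>\<^bsub>?G\<^esub>c\<in>{0..int k}. V k g c)"
        by (rule finsum_Sigma[OF Y, symmetric]) (auto simp: Vc)
      also have "\<dots> = (\<Oplus>\<^bsub>?G\<^esub>k\<in>{0..s}. Tp (max g 0) (N - 2) (n - s) (\<Oplus>\<^bsub>?G\<^esub>c\<in>{0..int k}. ?n k c))"
      proof (rule finsum_congr[OF Y])
        fix k assume "k \<in> {0..s}"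
        then have k: "k \<le> s" by simp
        show "(\<Oplus>\<^bsub>?G\<^esub>c\<in>{0..int k}. V k g c) = Tp (max g 0) (N - 2) (n - s) (\<Oplus>\<^bsub>?G\<^esub>c\<in>{0..int k}. ?n k c)"
        proof -
          have eq: "V k g c = Tp (max g 0) (N - 2) (n - s) (?n k c)" for c
            using x by (simp add: V_def F_def)
          have "(\<Oplus>\<^bsub>?G\<^esub>c\<in>{0..int k}. V k g c) = (\<Oplus>\<^bsub>?G\<^esub>c\<in>{0..int k}. Tp (max g 0) (N - 2) (n - s) (?n k c))"
            by (rule finsum_congr[OF Y eq]) (rule Tp_closed[OF nc[OF k]])
          also have "\<dots> = Tp (max g 0) (N - 2) (n - s) (\<Oplus>\<^bsub>?G\<^esub>c\<in>{0..int k}. ?n k c)"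
            by (rule mod_hom_finsum[OF Y Y Tp_hom, symmetric]) (rule nc[OF k])
          finally show ?thesis .
        qed
        show "Tp (max g 0) (N - 2) (n - s) (\<Oplus>\<^bsub>?G\<^esub>c\<in>{0..int k}. ?n k c) \<in> carrier ?G"
          by (rule Tp_closed, rule finsum_in_carrier[OF Y]) (rule nc[OF k])
      qed
      also have "\<dots> = Tp (max g 0) (N - 2) (n - s) (\<Oplus>\<^bsub>?G\<^esub>k\<in>{0..s}. \<Oplus>\<^bsub>?G\<^esub>c\<in>{0..int k}. ?n k c)"
        by (rule mod_hom_finsum[OF Y Y Tp_hom, symmetric]) (rule finsum_in_carrier[OF Y], rule nc, simp)
      also have "\<dots> = Tp (max g 0) (N - 2) (n - s) \<zero>\<^bsub>?G\<^esub>" by (simp only: nested[OF s y])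
      also have "\<dots> = \<zero>\<^bsub>?G\<^esub>" by (rule mod_hom_zero[OF Y Y Tp_hom])
      finally show "(\<Oplus>\<^bsub>?G\<^esub>p\<in>Sigma {0..s} (\<lambda>k. {0..int k}). V (fst p) g (snd p)) = \<zero>\<^bsub>?G\<^esub>" .
    qed
    finally show ?thesis .
  qed
  then have nz: "(\<Oplus>\<^bsub>?G\<^esub>p\<in>Ns. ?W p) = \<zero>\<^bsub>?G\<^esub>" by (simp only: nes)
  have "(\<Oplus>\<^bsub>?G\<^esub>p\<in>All. ?W p) = ((\<Oplus>\<^bsub>?G\<^esub>p\<in>D1. ?W p) \<oplus>\<^bsub>?G\<^esub> (\<Oplus>\<^bsub>?G\<^esub>p\<in>D2. ?W p)) \<oplus>\<^bsub>?G\<^esub> (\<Oplus>\<^bsub>?G\<^esub>p\<in>Ns. ?W p)"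
  proof -
    have "(\<Oplus>\<^bsub>?G\<^esub>p\<in>(D1 \<union> D2) \<union> Ns. ?W p) = (\<Oplus>\<^bsub>?G\<^esub>p\<in>D1 \<union> D2. ?W p) \<oplus>\<^bsub>?G\<^esub> (\<Oplus>\<^bsub>?G\<^esub>p\<in>Ns. ?W p)"
      by (rule finsum_split[OF Y _ fin(3) parts(3)]) (use fin Wc parts(1) in auto)
    moreover have "(\<Oplus>\<^bsub>?G\<^esub>p\<in>D1 \<union> D2. ?W p) = (\<Oplus>\<^bsub>?G\<^esub>p\<in>D1. ?W p) \<oplus>\<^bsub>?G\<^esub> (\<Oplus>\<^bsub>?G\<^esub>p\<in>D2. ?W p)"
      by (rule finsum_split[OF Y fin(1,2) parts(2)]) (use Wc parts(1) in auto)
    ultimately show ?thesis using parts(1) by simp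
  qed
  then show ?thesis using total dis nz by simp
qed

end

text \<open>
  In characteristic zero the complex of the maps \<open>1 - T\<close> and \<open>norm\<close> is exact: a fixed point is the
  norm of a multiple of itself, and \<open>(n + 1) x - norm x\<close> is the sum of the \<open>x - T\<^sup>i x\<close>.
\<close>

context cyclic_operators
begin

lemma fixed_point_norm:
  assumes x: "x \<in> carrier (Y N n)" and Tx: "T N n x = x"
    and r: "r \<in> carrier K" "r \<otimes> ([(Suc n)] \<cdot>\<^bsub>K\<^esub> \<one>) = \<one>"
  shows "norm N n (r \<odot>\<^bsub>Y N n\<^esub> x) = x"
proof -
  have Ti: "(T N n ^^ i) x = x" for i by (induction i) (simp_all add: Tx)
  have sum: "(\<Oplus>\<^bsub>Y N n\<^esub>i\<in>{0..m}. x) = ([(Suc m)] \<cdot>\<^bsub>K\<^esub> \<one>) \<odot>\<^bsub>Y N n\<^esub> x" for m :: nat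
  proof (induction m)
    case 0
    then show ?case using x by (simp add: Y.M.finsum_insert)
  next
    case (Suc m)
    have "{0..Suc m} = insert (Suc m) {0..m}" by auto
    then have "(\<Oplus>\<^bsub>Y N n\<^esub>i\<in>{0..Suc m}. x) = x \<oplus>\<^bsub>Y N n\<^esub> ([(Suc m)] \<cdot>\<^bsub>K\<^esub> \<one>) \<odot>\<^bsub>Y N n\<^esub> x"
      using x Suc by (simp add: Y.M.finsum_insert)
    also have "\<dots> = (\<one> \<oplus> [(Suc m)] \<cdot>\<^bsub>K\<^esub> \<one>) \<odot>\<^bsub>Y N n\<^esub> x" using x by (subst Y.smult_l_distr) auto
    also have "\<one> \<oplus> [(Suc m)] \<cdot>\<^bsub>K\<^esub> \<one> = [(Suc (Suc m))] \<cdot>\<^bsub>K\<^esub> \<one>" by (simp add: a_ac)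
    finally show ?case .
  qed
  have "norm N n (r \<odot>\<^bsub>Y N n\<^esub> x) = r \<odot>\<^bsub>Y N n\<^esub> norm N n x"
    by (rule mod_hom_smult[OF norm_hom r(1) x])
  also have "norm N n x = ([(Suc n)] \<cdot>\<^bsub>K\<^esub> \<one>) \<odot>\<^bsub>Y N n\<^esub> x" by (simp only: norm_def Ti sum)
  also have "r \<odot>\<^bsub>Y N n\<^esub> \<dots> = x" using x r by (subst Y.smult_assoc1[symmetric]) auto
  finally show ?thesis .
qed

lemma one_minus_T_hom: "(\<lambda>x. x \<ominus>\<^bsub>Y N n\<^esub> T N n x) \<in> mod_hom K (Y N n) (Y N n)"
  by (rule mod_hom_minus[OF Y mod_hom_ident T_hom])

lemma norm_zero_preimage:
  assumes x: "x \<in> carrier (Y N n)" and nx: "norm N n x = \<zero>\<^bsub>Y N n\<^esub>"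
    and r: "r \<in> carrier K" "r \<otimes> ([(Suc n)] \<cdot>\<^bsub>K\<^esub> \<one>) = \<one>"
  shows "\<exists>y\<in>carrier (Y N n). y \<ominus>\<^bsub>Y N n\<^esub> T N n y = x"
proof -
  let ?Im = "(\<lambda>x. x \<ominus>\<^bsub>Y N n\<^esub> T N n x) ` carrier (Y N n)"
  have sub: "submodule ?Im K (Y N n)" by (rule submodule_image[OF Y Y one_minus_T_hom])
  note Im = Y.submoduleE[OF sub]
  have Tc: "(T N n ^^ i) x \<in> carrier (Y N n)" for i by (rule mod_hom_closed[OF funpow_T_hom x])
  have step: "x \<ominus>\<^bsub>Y N n\<^esub> (T N n ^^ i) x \<in> ?Im" for i
  proof (induction i)
    case 0
    have "\<zero>\<^bsub>Y N n\<^esub> \<in> ?Im" using quotient.zero_mem[OF quotientI[OF Y sub]] .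
    then show ?case using x by (simp add: a_minus_def Y.M.r_neg)
  next
    case (Suc i)
    let ?y = "(T N n ^^ i) x"
    have "?y \<ominus>\<^bsub>Y N n\<^esub> T N n ?y \<in> ?Im" using Tc by (rule imageI)
    moreover have "x \<ominus>\<^bsub>Y N n\<^esub> (T N n ^^ Suc i) x = (x \<ominus>\<^bsub>Y N n\<^esub> ?y) \<oplus>\<^bsub>Y N n\<^esub> (?y \<ominus>\<^bsub>Y N n\<^esub> T N n ?y)"
      using x Tc[of i] by (simp add: a_minus_def Y.M.a_assoc Y.M.r_neg1)
    ultimately show ?case using Suc Im(5) by simp
  qed
  have "(([(Suc m)] \<cdot>\<^bsub>K\<^esub> \<one>) \<odot>\<^bsub>Y N n\<^esub> x) \<ominus>\<^bsub>Y N n\<^esub> (\<Oplus>\<^bsub>Y N n\<^esub>i\<in>{0..m}. (T N n ^^ i) x) \<in> ?Im" for m :: nat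
  proof (induction m)
    case 0
    have "\<zero>\<^bsub>Y N n\<^esub> \<in> ?Im" using quotient.zero_mem[OF quotientI[OF Y sub]] .
    then show ?case using x by (simp add: Y.M.finsum_insert a_minus_def Y.M.r_neg)
  next
    case (Suc m)
    let ?S = "\<Oplus>\<^bsub>Y N n\<^esub>i\<in>{0..m}. (T N n ^^ i) x" and ?u = "([(Suc m)] \<cdot>\<^bsub>K\<^esub> \<one>) \<odot>\<^bsub>Y N n\<^esub> x"
      and ?y = "(T N n ^^ Suc m) x"
    have cl: "?S \<in> carrier (Y N n)" "?u \<in> carrier (Y N n)" "?y \<in> carrier (Y N n)"
      using finsum_in_carrier[OF Y Tc] x Tc[of "Suc m"] by auto
    have "{0..Suc m} = insert (Suc m) {0..m}" by auto
    then have sum: "(\<Oplus>\<^bsub>Y N n\<^esub>i\<in>{0..Suc m}. (T N n ^^ i) x) = ?y \<oplus>\<^bsub>Y N n\<^esub> ?S"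
      using Tc by (simp only: Y.M.finsum_insert) (subst Y.M.finsum_insert, auto)
    have "([(Suc (Suc m))] \<cdot>\<^bsub>K\<^esub> \<one>) \<odot>\<^bsub>Y N n\<^esub> x = (\<one> \<oplus> [(Suc m)] \<cdot>\<^bsub>K\<^esub> \<one>) \<odot>\<^bsub>Y N n\<^esub> x" by (simp add: a_ac)
    also have "\<dots> = x \<oplus>\<^bsub>Y N n\<^esub> ?u" using x by (subst Y.smult_l_distr) auto
    finally have u: "([(Suc (Suc m))] \<cdot>\<^bsub>K\<^esub> \<one>) \<odot>\<^bsub>Y N n\<^esub> x = x \<oplus>\<^bsub>Y N n\<^esub> ?u" .
    have "([(Suc (Suc m))] \<cdot>\<^bsub>K\<^esub> \<one>) \<odot>\<^bsub>Y N n\<^esub> x \<ominus>\<^bsub>Y N n\<^esub> (\<Oplus>\<^bsub>Y N n\<^esub>i\<in>{0..Suc m}. (T N n ^^ i) x) =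
      (?u \<ominus>\<^bsub>Y N n\<^esub> ?S) \<oplus>\<^bsub>Y N n\<^esub> (x \<ominus>\<^bsub>Y N n\<^esub> ?y)"
      unfolding u sum using cl x by (simp add: a_minus_def Y.M.minus_add Y.M.a_ac del: funpow.simps)
    then show ?case using Im(5)[OF Suc step[of "Suc m"]] by simp
  qed
  from this[of n] have "([(Suc n)] \<cdot>\<^bsub>K\<^esub> \<one>) \<odot>\<^bsub>Y N n\<^esub> x \<in> ?Im"
    using nx x by (simp add: norm_def a_minus_def)
  then have "r \<odot>\<^bsub>Y N n\<^esub> (([(Suc n)] \<cdot>\<^bsub>K\<^esub> \<one>) \<odot>\<^bsub>Y N n\<^esub> x) \<in> ?Im" by (rule Im(4)[OF r(1)])
  moreover have "r \<odot>\<^bsub>Y N n\<^esub> (([(Suc n)] \<cdot>\<^bsub>K\<^esub> \<one>) \<odot>\<^bsub>Y N n\<^esub> x) = x" using x r by (subst Y.smult_assoc1[symmetric]) auto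
  ultimately show ?thesis by auto
qed

end

section \<open>Multilinear maps on words\<close>

context dg_module
begin

definition word :: "(int \<times> 'a) list \<Rightarrow> bool"
  where "word w \<longleftrightarrow> (\<forall>(q, a)\<in>set w. a \<in> carrier (A q))"

lemma word_simps [simp]:
  "word []" "word ((q, a) # w) \<longleftrightarrow> a \<in> carrier (A q) \<and> word w" "word (u @ v) \<longleftrightarrow> word u \<and> word v"
  "word (rev w) \<longleftrightarrow> word w"
  by (auto simp: word_def)

lemma word_Cons: "word (c # w) \<longleftrightarrow> snd c \<in> carrier (A (fst c)) \<and> word w"
  by (cases c) simp

lemma word_take [simp]: "word w \<Longrightarrow> word (take j w)"
  by (auto simp: word_def dest!: in_set_takeD)

lemma word_drop [simp]: "word w \<Longrightarrow> word (drop j w)"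
  by (auto simp: word_def dest!: in_set_dropD)

lemma wdeg_simps [simp]:
  "wdeg [] = 0" "wdeg ((q, a) # w) = q + wdeg w" "wdeg (u @ v) = wdeg u + wdeg v"
  "wdeg (rev w) = wdeg w"
  by (simp_all add: wdeg_def rev_map[symmetric])

lemma wdeg_Cons: "wdeg (c # w) = fst c + wdeg w"
  by (simp add: wdeg_def)

lemma words_iff: "w \<in> words l m \<longleftrightarrow> length w = l \<and> wdeg w = m \<and> word w"
  by (simp add: words_def word_def)

interpretation A: module K "A q" for q by (rule A_module)

lemma rels_closed: "multilinear_rels l m \<subseteq> carrier (free_module K (words l m))"
proof -
  interpret F: module K "free_module K (words l m)" by (rule K.module_free)
  show ?thesis
  proof
    fix z assume "z \<in> multilinear_rels l m"
    then show "z \<in> carrier (free_module K (words l m))"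
      unfolding multilinear_rels_def Let_def
      by (elim UnE CollectE exE conjE; hypsubst; intro F.M.minus_closed F.M.a_closed F.smult_closed K.free_gen_closed)
        (auto simp: words_iff)
  qed
qed

sublocale tpow: presentation K "words l m" "multilinear_rels l m" for l m
  by (unfold_locales) (rule rels_closed)

lemma module_tpow: "module K (tpow l m)"
  unfolding tpow_def by (rule tpow.module_pres)

sublocale tp: module K "tpow l m" for l m by (rule module_tpow)

lemma module_X: "module K (X n m)"
  unfolding X_def by (rule module_tpow)

lemma pure_eq: "w \<in> words l m \<Longrightarrow> pure w = pres_gen K (words l m) (multilinear_rels l m) w"
  by (simp add: pure_def words_iff)

lemma pure_closed [simp]: "w \<in> words l m \<Longrightarrow> pure w \<in> carrier (tpow l m)"
  using tpow.pres_gen_closed[of w l m] by (simp add: pure_eq tpow_def)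

lemma coset_hom: "(\<lambda>f. tpow.V l m +>\<^bsub>tpow.F l m\<^esub> f) \<in> mod_hom K (tpow.F l m) (tpow l m)"
  unfolding tpow_def pres_module_def by (rule tpow.Q.proj_hom)

lemma pure_add:
  assumes "u @ (q, x) # v \<in> words l m" "u @ (q, y) # v \<in> words l m"
  shows "pure (u @ (q, x \<oplus>\<^bsub>A q\<^esub> y) # v) = pure (u @ (q, x) # v) \<oplus>\<^bsub>tpow l m\<^esub> pure (u @ (q, y) # v)"
proof -
  interpret F: module K "tpow.F l m" by (rule K.module_free)
  let ?g = "free_gen K"
  have w: "u @ (q, x \<oplus>\<^bsub>A q\<^esub> y) # v \<in> words l m" using assms by (auto simp: words_iff)
  note g = K.free_gen_closed[OF w] K.free_gen_closed[OF assms(1)] K.free_gen_closed[OF assms(2)]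
  have "?g (u @ (q, x \<oplus>\<^bsub>A q\<^esub> y) # v) \<ominus>\<^bsub>tpow.F l m\<^esub> (?g (u @ (q, x) # v) \<oplus>\<^bsub>tpow.F l m\<^esub> ?g (u @ (q, y) # v)) \<in> multilinear_rels l m"
    using assms unfolding multilinear_rels_def Let_def by blast
  then have "tpow.V l m +>\<^bsub>tpow.F l m\<^esub> ?g (u @ (q, x \<oplus>\<^bsub>A q\<^esub> y) # v) =
      tpow.V l m +>\<^bsub>tpow.F l m\<^esub> (?g (u @ (q, x) # v) \<oplus>\<^bsub>tpow.F l m\<^esub> ?g (u @ (q, y) # v))"
    using g mod_span_submodule(2)[OF K.module_free rels_closed]
    by (subst tpow.Q.coset_eq) auto
  then show ?thesis
    using g w assms by (simp add: pure_eq pres_gen_def mod_hom_add[OF coset_hom])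
qed

lemma pure_smult:
  assumes "c \<in> carrier K" "u @ (q, x) # v \<in> words l m"
  shows "pure (u @ (q, c \<odot>\<^bsub>A q\<^esub> x) # v) = c \<odot>\<^bsub>tpow l m\<^esub> pure (u @ (q, x) # v)"
proof -
  interpret F: module K "tpow.F l m" by (rule K.module_free)
  let ?g = "free_gen K"
  have w: "u @ (q, c \<odot>\<^bsub>A q\<^esub> x) # v \<in> words l m" using assms by (auto simp: words_iff)
  note g = K.free_gen_closed[OF w] K.free_gen_closed[OF assms(2)]
  have "?g (u @ (q, c \<odot>\<^bsub>A q\<^esub> x) # v) \<ominus>\<^bsub>tpow.F l m\<^esub> (c \<odot>\<^bsub>tpow.F l m\<^esub> ?g (u @ (q, x) # v)) \<in> multilinear_rels l m"
    using assms unfolding multilinear_rels_def Let_def by blast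
  then have "tpow.V l m +>\<^bsub>tpow.F l m\<^esub> ?g (u @ (q, c \<odot>\<^bsub>A q\<^esub> x) # v) =
      tpow.V l m +>\<^bsub>tpow.F l m\<^esub> (c \<odot>\<^bsub>tpow.F l m\<^esub> ?g (u @ (q, x) # v))"
    using g assms(1) mod_span_submodule(2)[OF K.module_free rels_closed]
    by (subst tpow.Q.coset_eq) auto
  then show ?thesis
    using g w assms by (simp add: pure_eq pres_gen_def mod_hom_smult[OF coset_hom])
qed

lemma tpow_hom_eqI:
  assumes "module K N" "h \<in> mod_hom K (tpow l m) N" "h' \<in> mod_hom K (tpow l m) N"
    and "\<And>w. w \<in> words l m \<Longrightarrow> h (pure w) = h' (pure w)" and "x \<in> carrier (tpow l m)"
  shows "h x = h' x"
  using assms unfolding tpow_def by (intro tpow.pres_hom_eqI[of N h l m h' x]) (auto simp: pure_eq)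

text \<open>The maps on words that factor through the tensor power.\<close>

definition multilinear :: "nat \<Rightarrow> int \<Rightarrow> ('k, 'n, 'e) module_scheme \<Rightarrow> ((int \<times> 'a) list \<Rightarrow> 'n) \<Rightarrow> bool"
  where "multilinear l m N \<phi> \<longleftrightarrow> \<phi> \<in> words l m \<rightarrow> carrier N \<and>
    (\<forall>u q x y v. u @ (q, x) # v \<in> words l m \<longrightarrow> u @ (q, y) # v \<in> words l m \<longrightarrow>
      \<phi> (u @ (q, x \<oplus>\<^bsub>A q\<^esub> y) # v) = \<phi> (u @ (q, x) # v) \<oplus>\<^bsub>N\<^esub> \<phi> (u @ (q, y) # v)) \<and>
    (\<forall>u q c x v. c \<in> carrier K \<longrightarrow> u @ (q, x) # v \<in> words l m \<longrightarrow>
      \<phi> (u @ (q, c \<odot>\<^bsub>A q\<^esub> x) # v) = c \<odot>\<^bsub>N\<^esub> \<phi> (u @ (q, x) # v))"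

lemma multilinearI:
  assumes "\<And>w. w \<in> words l m \<Longrightarrow> \<phi> w \<in> carrier N"
    and "\<And>u q x y v. \<lbrakk>u @ (q, x) # v \<in> words l m; u @ (q, y) # v \<in> words l m\<rbrakk> \<Longrightarrow>
      \<phi> (u @ (q, x \<oplus>\<^bsub>A q\<^esub> y) # v) = \<phi> (u @ (q, x) # v) \<oplus>\<^bsub>N\<^esub> \<phi> (u @ (q, y) # v)"
    and "\<And>u q c x v. \<lbrakk>c \<in> carrier K; u @ (q, x) # v \<in> words l m\<rbrakk> \<Longrightarrow>
      \<phi> (u @ (q, c \<odot>\<^bsub>A q\<^esub> x) # v) = c \<odot>\<^bsub>N\<^esub> \<phi> (u @ (q, x) # v)"
  shows "multilinear l m N \<phi>"
  using assms by (simp add: multilinear_def)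

lemma multilinearD:
  assumes "multilinear l m N \<phi>"
  shows "w \<in> words l m \<Longrightarrow> \<phi> w \<in> carrier N"
    and "\<lbrakk>u @ (q, x) # v \<in> words l m; u @ (q, y) # v \<in> words l m\<rbrakk> \<Longrightarrow>
      \<phi> (u @ (q, x \<oplus>\<^bsub>A q\<^esub> y) # v) = \<phi> (u @ (q, x) # v) \<oplus>\<^bsub>N\<^esub> \<phi> (u @ (q, y) # v)"
    and "\<lbrakk>c \<in> carrier K; u @ (q, x) # v \<in> words l m\<rbrakk> \<Longrightarrow>
      \<phi> (u @ (q, c \<odot>\<^bsub>A q\<^esub> x) # v) = c \<odot>\<^bsub>N\<^esub> \<phi> (u @ (q, x) # v)"
  using assms unfolding multilinear_def by blast+

lemma slot_words_add: "\<lbrakk>u @ (q, x) # v \<in> words l m; u @ (q, y) # v \<in> words l m\<rbrakk> \<Longrightarrow> u @ (q, x \<oplus>\<^bsub>A q\<^esub> y) # v \<in> words l m"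
  by (auto simp: words_iff)

lemma slot_words_smult: "\<lbrakk>c \<in> carrier K; u @ (q, x) # v \<in> words l m\<rbrakk> \<Longrightarrow> u @ (q, c \<odot>\<^bsub>A q\<^esub> x) # v \<in> words l m"
  by (auto simp: words_iff)

lemma tpow_lift_multilinear:
  assumes N: "module K N" and \<phi>: "multilinear l m N \<phi>"
  shows tpow_lift_hom: "tpow_lift l m N \<phi> \<in> mod_hom K (tpow l m) N"
    and tpow_lift_pure: "\<And>w. w \<in> words l m \<Longrightarrow> tpow_lift l m N \<phi> (pure w) = \<phi> w"
proof -
  interpret N: module K N by fact
  note \<phi>D = multilinearD[OF \<phi>]
  have \<phi>c: "\<phi> \<in> words l m \<rightarrow> carrier N" using \<phi>D(1) by auto
  have resp: "h q = \<zero>\<^bsub>N\<^esub>" if h: "h \<in> mod_hom K (tpow.F l m) N"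
      and g: "\<And>w. w \<in> words l m \<Longrightarrow> h (free_gen K w) = \<phi> w" and q: "q \<in> multilinear_rels l m" for h q
  proof -
    interpret F: module K "tpow.F l m" by (rule K.module_free)
    note [simp] = K.free_gen_closed mod_hom_diff[OF K.module_free N h] mod_hom_add[OF h] mod_hom_smult[OF h]
      g \<phi>D slot_words_add slot_words_smult N.M.r_neg
    from q show ?thesis
      unfolding multilinear_rels_def Let_def
      by (elim UnE CollectE exE conjE; hypsubst) (simp_all add: a_minus_def[of N])
  qed
  show "tpow_lift l m N \<phi> \<in> mod_hom K (tpow l m) N"
    unfolding tpow_lift_def tpow_def by (rule tpow.pres_lift_hom[OF N \<phi>c]) (rule resp)
  show "tpow_lift l m N \<phi> (pure w) = \<phi> w" if "w \<in> words l m" for w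
    unfolding tpow_lift_def pure_eq[OF that] by (rule tpow.pres_lift_gen[OF N \<phi>c], rule resp) (use that in auto)
qed

lemma multilinear_pure: "multilinear l m (tpow l m) pure"
  by (rule multilinearI) (auto simp: pure_add pure_smult)

lemma multilinear_comp:
  assumes "multilinear l m N \<phi>" "h \<in> mod_hom K N N'"
  shows "multilinear l m N' (\<lambda>w. h (\<phi> w))"
  by (rule multilinearI)
    (simp_all add: multilinearD[OF assms(1)] mod_hom_closed[OF assms(2)] mod_hom_add[OF assms(2)] mod_hom_smult[OF assms(2)])

lemma multilinear_msign:
  assumes N: "module K N" and \<phi>: "multilinear l m N \<phi>"
    and e: "\<And>w w'. \<lbrakk>w \<in> words l m; w' \<in> words l m; map fst w = map fst w'\<rbrakk> \<Longrightarrow> e w = e w'"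
  shows "multilinear l m N (\<lambda>w. msign N (e w) (\<phi> w))"
proof (rule multilinearI)
  note \<phi>D = multilinearD[OF \<phi>]
  show "msign N (e w) (\<phi> w) \<in> carrier N" if "w \<in> words l m" for w
    using that N by (simp add: \<phi>D)
  fix u q x v assume w: "u @ (q, x) # v \<in> words l m"
  {
    fix y assume w': "u @ (q, y) # v \<in> words l m"
    have "e (u @ (q, x \<oplus>\<^bsub>A q\<^esub> y) # v) = e (u @ (q, x) # v)" "e (u @ (q, y) # v) = e (u @ (q, x) # v)"
      by (rule e; use w w' slot_words_add in simp)+
    then show "msign N (e (u @ (q, x \<oplus>\<^bsub>A q\<^esub> y) # v)) (\<phi> (u @ (q, x \<oplus>\<^bsub>A q\<^esub> y) # v)) =
      msign N (e (u @ (q, x) # v)) (\<phi> (u @ (q, x) # v)) \<oplus>\<^bsub>N\<^esub> msign N (e (u @ (q, y) # v)) (\<phi> (u @ (q, y) # v))"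
      using w w' N by (simp add: \<phi>D msign_add)
  next
    fix c assume c: "c \<in> carrier K"
    have "e (u @ (q, c \<odot>\<^bsub>A q\<^esub> x) # v) = e (u @ (q, x) # v)"
      by (rule e; use w c slot_words_smult in simp)
    then show "msign N (e (u @ (q, c \<odot>\<^bsub>A q\<^esub> x) # v)) (\<phi> (u @ (q, c \<odot>\<^bsub>A q\<^esub> x) # v)) =
      c \<odot>\<^bsub>N\<^esub> msign N (e (u @ (q, x) # v)) (\<phi> (u @ (q, x) # v))"
      using w c N by (simp add: \<phi>D msign_smult)
  }
qed

lemma multilinear_cong:
  assumes "multilinear l m N \<phi>" "\<And>w. w \<in> words l m \<Longrightarrow> \<phi>' w = \<phi> w"
  shows "multilinear l m N \<phi>'"
  by (rule multilinearI) (simp_all add: assms(2) slot_words_add slot_words_smult multilinearD[OF assms(1)])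

lemma slot_hom:
  "(\<lambda>x. pure (u @ (q, x) # v)) \<in> mod_hom K (A q) (tpow (length u + 1 + length v) (wdeg u + q + wdeg v))"
  if "word u" "word v"
  by (rule mod_homI) (use that in \<open>auto simp: words_iff intro!: pure_closed pure_add pure_smult\<close>)

lemma multilinear_rotate: "multilinear (n + 1) m (tpow (n + 1) m) (\<lambda>w. pure (last w # butlast w))"
proof (rule multilinearI)
  show "pure (last w # butlast w) \<in> carrier (tpow (n + 1) m)" if "w \<in> words (n + 1) m" for w
    using that by (cases w rule: rev_cases) (auto simp: words_iff word_Cons wdeg_Cons intro!: pure_closed)
  fix u q x v assume w: "u @ (q, x) # v \<in> words (n + 1) m"
  {
    fix y assume w': "u @ (q, y) # v \<in> words (n + 1) m"
    show "pure (last (u @ (q, x \<oplus>\<^bsub>A q\<^esub> y) # v) # butlast (u @ (q, x \<oplus>\<^bsub>A q\<^esub> y) # v)) =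
       pure (last (u @ (q, x) # v) # butlast (u @ (q, x) # v)) \<oplus>\<^bsub>tpow (n + 1) m\<^esub>
       pure (last (u @ (q, y) # v) # butlast (u @ (q, y) # v))"
    proof (cases v rule: rev_cases)
      case Nil
      then show ?thesis using pure_add[of "[]" q x u "n + 1" m y] w w' by (simp add: butlast_append words_iff)
    next
      case (snoc v' b)
      then show ?thesis using pure_add[of "b # u" q x v' "n + 1" m y] w w'
        by (simp add: butlast_append words_iff word_Cons wdeg_Cons)
    qed
  next
    fix c assume c: "c \<in> carrier K"
    show "pure (last (u @ (q, c \<odot>\<^bsub>A q\<^esub> x) # v) # butlast (u @ (q, c \<odot>\<^bsub>A q\<^esub> x) # v)) =
       c \<odot>\<^bsub>tpow (n + 1) m\<^esub> pure (last (u @ (q, x) # v) # butlast (u @ (q, x) # v))"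
    proof (cases v rule: rev_cases)
      case Nil
      then show ?thesis using pure_smult[of c "[]" q x u "n + 1" m] w c by (simp add: butlast_append words_iff)
    next
      case (snoc v' b)
      then show ?thesis using pure_smult[of c "b # u" q x v' "n + 1" m] w c
        by (simp add: butlast_append words_iff word_Cons wdeg_Cons)
    qed
  }
qed

lemma multilinear_block:
  assumes op: "\<And>q. multilinear (k + 1) q (A (q + e)) op" and jk: "j + k + 1 \<le> l"
  shows "multilinear l m (tpow (l - k) (m + e))
    (\<lambda>w. pure (take j w @ (wdeg (take (k + 1) (drop j w)) + e, op (take (k + 1) (drop j w))) # drop (j + k + 1) w))"
    (is "multilinear l m ?N (\<lambda>w. pure (?f w))")
proof (rule multilinearI)
  have split: "\<exists>w1 B w2. w = w1 @ B @ w2 \<and> length w1 = j \<and> length B = k + 1" if "w \<in> words l m" for w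
    by (rule exI[of _ "take j w"], rule exI[of _ "take (k + 1) (drop j w)"], rule exI[of _ "drop (k + 1) (drop j w)"])
      (use that jk in \<open>auto simp: words_iff append_take_drop_id min_def simp del: drop_drop\<close>)
  have f: "?f (w1 @ B @ w2) = w1 @ (wdeg B + e, op B) # w2" if "length w1 = j" "length B = k + 1" for w1 B w2
    using that by simp
  show "pure (?f w) \<in> carrier ?N" if w: "w \<in> words l m" for w
  proof -
    from split[OF w] obtain w1 B w2 where s: "w = w1 @ B @ w2" "length w1 = j" "length B = k + 1" by blast
    have "op B \<in> carrier (A (wdeg B + e))"
      by (rule multilinearD(1)[OF op]) (use w s in \<open>auto simp: words_iff\<close>)
    then show ?thesis unfolding s(1) f[OF s(2,3)]
      using w s by (intro pure_closed) (auto simp: words_iff)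
  qed
  fix u q x v assume w: "u @ (q, x) # v \<in> words l m"
  have x: "x \<in> carrier (A q)" and uv: "word u" "word v" "length u + length v + 1 = l" "wdeg u + q + wdeg v = m"
    using w by (auto simp: words_iff)
  consider (left) v1 B w2 where "v = v1 @ B @ w2" "length u + 1 + length v1 = j" "length B = k + 1"
    | (block) w1 u2 v1 w2 where "u = w1 @ u2" "v = v1 @ w2" "length w1 = j" "length u2 + 1 + length v1 = k + 1"
    | (right) w1 B u3 where "u = w1 @ B @ u3" "length w1 = j" "length B = k + 1"
  proof -
    consider "length u < j" | "j \<le> length u" "length u < j + k + 1" | "j + k + 1 \<le> length u" by linarith
    then show thesis
    proof cases
      case 1
      let ?v1 = "take (j - length u - 1) v" and ?r = "drop (j - length u - 1) v"
      show thesis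
        by (rule left[of ?v1 "take (k + 1) ?r" "drop (k + 1) ?r"]) (use 1 jk uv in \<open>auto simp: append_take_drop_id simp del: drop_drop\<close>)
    next
      case 2
      let ?i = "j + k - length u"
      show thesis
        by (rule block[of "take j u" "drop j u" "take ?i v" "drop ?i v"]) (use 2 jk uv in \<open>auto simp: append_take_drop_id\<close>)
    next
      case 3
      let ?r = "drop j u"
      show thesis
        by (rule right[of "take j u" "take (k + 1) ?r" "drop (k + 1) ?r"]) (use 3 jk uv in \<open>auto simp: append_take_drop_id simp del: drop_drop\<close>)
    qed
  qed
  note cases = this
  {
    fix y assume w': "u @ (q, y) # v \<in> words l m"
    then have y: "y \<in> carrier (A q)" by (auto simp: words_iff)
    from cases show "pure (?f (u @ (q, x \<oplus>\<^bsub>A q\<^esub> y) # v)) = pure (?f (u @ (q, x) # v)) \<oplus>\<^bsub>?N\<^esub> pure (?f (u @ (q, y) # v))"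
    proof cases
      case left
      have B: "op B \<in> carrier (A (wdeg B + e))"
        by (rule multilinearD(1)[OF op]) (use uv left in \<open>auto simp: words_iff\<close>)
      have F: "?f (u @ (q, z) # v) = u @ (q, z) # v1 @ (wdeg B + e, op B) # w2" for z
        using f[of "u @ (q, z) # v1" B w2] left by simp
      show ?thesis
        unfolding F by (rule pure_add) (use uv left x y B in \<open>auto simp: words_iff\<close>)
    next
      case block
      have F: "?f (u @ (q, z) # v) = w1 @ (wdeg u2 + q + wdeg v1 + e, op (u2 @ (q, z) # v1)) # w2" for z
        using f[of w1 "u2 @ (q, z) # v1" w2] block by simp
      have "op (u2 @ (q, x \<oplus>\<^bsub>A q\<^esub> y) # v1) = op (u2 @ (q, x) # v1) \<oplus>\<^bsub>A (wdeg u2 + q + wdeg v1 + e)\<^esub> op (u2 @ (q, y) # v1)"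
        by (rule multilinearD(2)[OF op]) (use uv block x y in \<open>auto simp: words_iff\<close>)
      moreover have "op (u2 @ (q, z) # v1) \<in> carrier (A (wdeg u2 + q + wdeg v1 + e))" if "z \<in> carrier (A q)" for z
        by (rule multilinearD(1)[OF op]) (use uv block that in \<open>auto simp: words_iff\<close>)
      ultimately show ?thesis unfolding F
        by (simp only:) (rule pure_add, use uv block x y in \<open>auto simp: words_iff\<close>)
    next
      case right
      have B: "op B \<in> carrier (A (wdeg B + e))"
        by (rule multilinearD(1)[OF op]) (use uv right in \<open>auto simp: words_iff\<close>)
      have F: "?f (u @ (q, z) # v) = (w1 @ (wdeg B + e, op B) # u3) @ (q, z) # v" for z
        using f[of w1 B "u3 @ (q, z) # v"] right by simp
      show ?thesis
        unfolding F by (rule pure_add) (use uv right x y B in \<open>auto simp: words_iff\<close>)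
    qed
  next
    fix c assume c: "c \<in> carrier K"
    from cases show "pure (?f (u @ (q, c \<odot>\<^bsub>A q\<^esub> x) # v)) = c \<odot>\<^bsub>?N\<^esub> pure (?f (u @ (q, x) # v))"
    proof cases
      case left
      have B: "op B \<in> carrier (A (wdeg B + e))"
        by (rule multilinearD(1)[OF op]) (use uv left in \<open>auto simp: words_iff\<close>)
      have F: "?f (u @ (q, z) # v) = u @ (q, z) # v1 @ (wdeg B + e, op B) # w2" for z
        using f[of "u @ (q, z) # v1" B w2] left by simp
      show ?thesis
        unfolding F by (rule pure_smult) (use uv left x c B in \<open>auto simp: words_iff\<close>)
    next
      case block
      have F: "?f (u @ (q, z) # v) = w1 @ (wdeg u2 + q + wdeg v1 + e, op (u2 @ (q, z) # v1)) # w2" for z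
        using f[of w1 "u2 @ (q, z) # v1" w2] block by simp
      have "op (u2 @ (q, c \<odot>\<^bsub>A q\<^esub> x) # v1) = c \<odot>\<^bsub>A (wdeg u2 + q + wdeg v1 + e)\<^esub> op (u2 @ (q, x) # v1)"
        by (rule multilinearD(3)[OF op]) (use uv block x c in \<open>auto simp: words_iff\<close>)
      moreover have "op (u2 @ (q, z) # v1) \<in> carrier (A (wdeg u2 + q + wdeg v1 + e))" if "z \<in> carrier (A q)" for z
        by (rule multilinearD(1)[OF op]) (use uv block that in \<open>auto simp: words_iff\<close>)
      ultimately show ?thesis unfolding F
        by (simp only:) (rule pure_smult, use uv block x c in \<open>auto simp: words_iff\<close>)
    next
      case right
      have B: "op B \<in> carrier (A (wdeg B + e))"
        by (rule multilinearD(1)[OF op]) (use uv right in \<open>auto simp: words_iff\<close>)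
      have F: "?f (u @ (q, z) # v) = (w1 @ (wdeg B + e, op B) # u3) @ (q, z) # v" for z
        using f[of w1 B "u3 @ (q, z) # v"] right by simp
      show ?thesis
        unfolding F by (rule pure_smult) (use uv right x c B in \<open>auto simp: words_iff\<close>)
    qed
  }
qed

end

section \<open>Operations on words in suspended degrees\<close>

definition tri :: "nat \<Rightarrow> int" where "tri k = int (k * (k - 1) div 2)"

lemma tri_Suc: "tri (Suc k) = tri k + int k"
proof -
  have "Suc k * (Suc k - 1) = k * (k - 1) + 2 * k" by (cases k) auto
  then have "Suc k * (Suc k - 1) div 2 = k * (k - 1) div 2 + k" by simp
  then show ?thesis by (simp add: tri_def del: mult_Suc)
qed

lemma tri_0 [simp]: "tri 0 = 0" by (simp add: tri_def)

lemma tri_add: "tri (k + l) = tri k + tri l + int k * int l"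
  by (induction k) (simp_all add: tri_Suc algebra_simps)

lemma tri_eq: "int (k * (k + 1) div 2) = tri (Suc k)"
  by (simp add: tri_def mult.commute)

context dg_module
begin

text \<open>
  The number \<open>\<Sum>\<^sub>j j |a\<^sub>j|\<close>, the exponent of the sign between a word and the tensor product of its letters
  with degrees raised by one.
\<close>

fun iota :: "(int \<times> 'a) list \<Rightarrow> int"
  where "iota [] = 0" | "iota (c # w) = iota w + wdeg w"

lemma iota_append [simp]: "iota (u @ v) = iota u + iota v + int (length u) * wdeg v"
  by (induction u) (auto simp: wdeg_def algebra_simps)

definition sdeg :: "(int \<times> 'a) list \<Rightarrow> int" where "sdeg w = wdeg w + int (length w)"

lemma sdeg_simps [simp]:
  "sdeg [] = 0" "sdeg ((q, a) # w) = q + 1 + sdeg w" "sdeg (u @ v) = sdeg u + sdeg v" "sdeg (rev w) = sdeg w"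
  by (simp_all add: sdeg_def)

text \<open>
  The summand \<open>length w + 1\<close> absorbs the sign \<open>(-1)\<^sup>k\<close> by which an operation on \<open>k + 1\<close>
  letters would differ from a Koszul sign.
\<close>

definition ps :: "(int \<times> 'a) list \<Rightarrow> ('k, 'a) tens"
  where "ps w = msign (tpow (length w) (wdeg w)) (iota w + int (length w) + 1) (pure w)"

lemma ps_eq: "w \<in> words l m \<Longrightarrow> ps w = msign (tpow l m) (iota w + int l + 1) (pure w)"
  by (simp add: ps_def words_iff)

lemmas msign_tpow_closed [simp] = msign_closed[OF module_tpow]
lemmas msign_A_closed [simp] = msign_closed[OF A_module]

lemma ps_closed [simp]: "w \<in> words l m \<Longrightarrow> ps w \<in> carrier (tpow l m)"
  by (simp add: ps_eq module_tpow)

lemma pure_ps: "w \<in> words l m \<Longrightarrow> pure w = msign (tpow l m) (iota w + int l + 1) (ps w)"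
  by (simp add: ps_eq msign_msign[OF module_tpow])

lemma ps_hom_eqI:
  assumes "module K G" "h \<in> mod_hom K (tpow l m) G" "h' \<in> mod_hom K (tpow l m) G"
    and "\<And>w. w \<in> words l m \<Longrightarrow> h (ps w) = h' (ps w)" and "x \<in> carrier (tpow l m)"
  shows "h x = h' x"
proof (rule tpow_hom_eqI[OF assms(1-3) _ assms(5)])
  fix w assume w: "w \<in> words l m"
  show "h (pure w) = h' (pure w)"
    unfolding pure_ps[OF w]
    using w assms(4)[OF w] mod_hom_msign[OF module_tpow assms(1,2)] mod_hom_msign[OF module_tpow assms(1,3)] by simp
qed

lemma ps_slot_hom:
  assumes "word u" "word v"
  shows "(\<lambda>x. ps (u @ (q, x) # v)) \<in> mod_hom K (A q) (tpow (length u + 1 + length v) (wdeg u + q + wdeg v))"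
  by (rule mod_hom_cong[OF mod_hom_msign_comp[OF module_tpow slot_hom[OF assms]]])
    (use assms in \<open>simp_all add: ps_def A_module add_ac\<close>)

lemma ps_slot_msign:
  assumes "word u" "word v" "a \<in> carrier (A q)"
  shows "ps (u @ (q, msign (A q) e a) # v) =
    msign (tpow (length u + 1 + length v) (wdeg u + q + wdeg v)) e (ps (u @ (q, a) # v))"
  using mod_hom_msign[OF A_module module_tpow ps_slot_hom[OF assms(1,2)] assms(3)] .

end

context A_infinity_operations
begin

text \<open>
  The differential is treated as the operation on one letter, so that \<open>op k\<close> always consumes \<open>k + 1\<close>
  letters and raises the degree by \<open>k - 1\<close>.
\<close>

definition op :: "nat \<Rightarrow> (int \<times> 'a) list \<Rightarrow> 'a"
  where "op k B = (if k = 0 then d (fst (hd B)) (snd (hd B)) else pi (k - 1) (wdeg B) (pure B))"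

lemma multilinear_op: "multilinear (k + 1) q (A (q + (int k - 1))) (op k)"
proof (cases k)
  case 0
  show ?thesis
  proof (rule multilinearI)
    fix w assume w: "w \<in> words (k + 1) q"
    then obtain x where "w = [(q, x)]" "x \<in> carrier (A q)"
      using 0 by (cases w) (auto simp: words_iff word_Cons wdeg_Cons)
    then show "op k w \<in> carrier (A (q + (int k - 1)))"
      using mod_hom_closed[OF d_hom[of q]] 0 by (simp add: op_def)
  qed (use 0 in \<open>auto simp: words_iff op_def mod_hom_add[OF d_hom] mod_hom_smult[OF d_hom]\<close>)
next
  case (Suc k')
  have "multilinear (k + 1) q (A (q + (int k - 1))) (\<lambda>w. pi k' q (pure w))"
    using multilinear_comp[OF multilinear_pure pi_hom[of k' q]] Suc by simp
  then show ?thesis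
    by (rule multilinear_cong) (simp add: op_def Suc words_iff)
qed

lemma op_closed: "B \<in> words (k + 1) q \<Longrightarrow> op k B \<in> carrier (A (q + (int k - 1)))"
  by (rule multilinearD(1)[OF multilinear_op])

text \<open>
  For \<open>k > 0\<close> this is the face of the indices \<open>j, \<dots>, j + k - 1\<close> with the sign of the associated complex,
  \<open>k j + k (k - 1) / 2\<close> being the sum of these indices; for \<open>k = 0\<close> it is one summand of the tensor
  differential.
\<close>

definition Dk :: "nat \<Rightarrow> nat \<Rightarrow> nat \<Rightarrow> int \<Rightarrow> ('k, 'a) tens \<Rightarrow> ('k, 'a) tens"
  where "Dk k j n p = tpow_lift (n + 1) p (tpow (n + 1 - k) (p + (int k - 1)))
    (\<lambda>w. msign (tpow (n + 1 - k) (p + (int k - 1)))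
      (int k * int j + tri k + int k * (p - 1) + (int k - 1) * wdeg (take j w))
      (pure (take j w @ (wdeg (take (k + 1) (drop j w)) + (int k - 1), op k (take (k + 1) (drop j w))) # drop (j + k + 1) w)))"

lemma wdeg_take_cong: "map fst w = map fst w' \<Longrightarrow> wdeg (take j w) = wdeg (take j w')"
  by (metis wdeg_def take_map)

lemma multilinear_Dk:
  assumes "j + k \<le> n"
  shows "multilinear (n + 1) p (tpow (n + 1 - k) (p + (int k - 1)))
    (\<lambda>w. msign (tpow (n + 1 - k) (p + (int k - 1)))
      (int k * int j + tri k + int k * (p - 1) + (int k - 1) * wdeg (take j w))
      (pure (take j w @ (wdeg (take (k + 1) (drop j w)) + (int k - 1), op k (take (k + 1) (drop j w))) # drop (j + k + 1) w)))"
  by (rule multilinear_msign[OF module_tpow multilinear_block[OF multilinear_op]])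
    (use assms in \<open>auto dest: wdeg_take_cong[of _ _ j]\<close>)

lemma Dk_hom: "j + k \<le> n \<Longrightarrow> Dk k j n p \<in> mod_hom K (tpow (n + 1) p) (tpow (n + 1 - k) (p + (int k - 1)))"
  unfolding Dk_def by (rule tpow_lift_hom[OF module_tpow multilinear_Dk])

lemma Dk_pure:
  assumes w: "u @ B @ v \<in> words (n + 1) p" and j: "length u = j" and k: "length B = k + 1"
  shows "Dk k j n p (pure (u @ B @ v)) = msign (tpow (n + 1 - k) (p + (int k - 1)))
      (int k * int j + tri k + int k * (p - 1) + (int k - 1) * wdeg u) (pure (u @ (wdeg B + (int k - 1), op k B) # v))"
proof -
  have "j + k \<le> n" using w j k by (simp add: words_iff)
  from tpow_lift_pure[OF module_tpow multilinear_Dk[OF this] w] show ?thesis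
    using j k by (simp add: Dk_def)
qed

text \<open>The operation \<open>op k\<close> conjugated by the raising of degrees.\<close>

definition mop :: "nat \<Rightarrow> (int \<times> 'a) list \<Rightarrow> 'a"
  where "mop k B = msign (A (wdeg B + (int k - 1))) (iota B + int k * wdeg B + tri k) (op k B)"

lemma mop_closed: "B \<in> words (k + 1) q \<Longrightarrow> mop k B \<in> carrier (A (q + (int k - 1)))"
  using op_closed[of B k q] by (simp add: mop_def words_iff A_module)

text \<open>
  After renormalisation only the Koszul sign remains, of an operator of degree \<open>-1\<close> that passes the
  letters in front of the block.
\<close>

lemma Dk_ps:
  assumes w: "u @ B @ v \<in> words (n + 1) p" and j: "length u = j" and k: "length B = k + 1"
  shows "Dk k j n p (ps (u @ B @ v)) = msign (tpow (n + 1 - k) (p + (int k - 1))) (sdeg u)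
      (ps (u @ (wdeg B + (int k - 1), mop k B) # v))"
proof -
  let ?q = "wdeg B + (int k - 1)" and ?G = "tpow (n + 1 - k) (p + (int k - 1))"
  have jk: "j + k \<le> n" using w j k by (simp add: words_iff)
  have uv: "word u" "word v" and B: "B \<in> words (k + 1) (wdeg B)" using w k by (auto simp: words_iff)
  have p: "p = wdeg u + wdeg B + wdeg v" and n: "n = j + k + length v" using w j k by (auto simp: words_iff)
  note oB = op_closed[OF B]
  have w': "u @ (?q, op k B) # v \<in> words (n + 1 - k) (p + (int k - 1))"
    using uv oB by (simp add: words_iff n p j)
  let ?e1 = "iota (u @ B @ v) + int (n + 1) + 1"
  let ?e2 = "int k * int j + tri k + int k * (p - 1) + (int k - 1) * wdeg u"
  let ?e3 = "iota (u @ (?q, op k B) # v) + int (n + 1 - k) + 1"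
  let ?e4 = "iota B + int k * wdeg B + tri k"
  have "Dk k j n p (ps (u @ B @ v)) = msign ?G (?e1 + ?e2) (pure (u @ (?q, op k B) # v))"
    using w w' by (simp only: ps_eq[OF w] mod_hom_msign[OF module_tpow module_tpow Dk_hom[OF jk] pure_closed[OF w]]
        Dk_pure[OF w j k] msign_msign[OF module_tpow pure_closed[OF w']])
  also have "\<dots> = msign ?G (sdeg u + ?e4 + ?e3) (pure (u @ (?q, op k B) # v))"
  proof (rule msign_cong)
    have "?e1 + ?e2 - (sdeg u + ?e4 + ?e3) =
      2 * (int k * wdeg v + int k * wdeg u - wdeg u)"
      using j k by (simp add: p n sdeg_def wdeg_Cons algebra_simps)
    then show "even (?e1 + ?e2 - (sdeg u + ?e4 + ?e3))" by simp
  qed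
  also have "\<dots> = msign ?G (sdeg u) (msign ?G ?e4 (ps (u @ (?q, op k B) # v)))"
    using w' by (simp add: ps_eq[OF w'] msign_msign[OF module_tpow] add.assoc)
  also have "msign ?G ?e4 (ps (u @ (?q, op k B) # v)) = ps (u @ (?q, mop k B) # v)"
  proof -
    have e: "length u + 1 + length v = n + 1 - k" "wdeg u + ?q + wdeg v = p + (int k - 1)"
      by (simp_all add: n p j)
    show ?thesis using ps_slot_msign[OF uv oB, of ?e4] unfolding e mop_def by simp
  qed
  finally show ?thesis .
qed

lemma one_pi_one_eq:
  assumes k: "k \<ge> 1" "j + k \<le> n" and x: "x \<in> carrier (X n p)"
  shows "msign (X (n - k) (p + int k - 1)) (int k * int j + tri k + int k * (p - 1)) (one_pi_one k j n p x) = Dk k j n p x"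
    and "one_pi_one k j n p \<in> mod_hom K (X n p) (X (n - k) (p + int k - 1))"
    and "\<And>u B v. \<lbrakk>u @ B @ v \<in> words (n + 1) p; length u = j; length B = k + 1\<rbrakk> \<Longrightarrow>
      one_pi_one k j n p (pure (u @ B @ v)) =
        msign (X (n - k) (p + int k - 1)) ((int k - 1) * wdeg u) (pure (u @ (wdeg B + (int k - 1), op k B) # v))"
proof -
  let ?G = "tpow (n + 1 - k) (p + (int k - 1))"
  have G: "X (n - k) (p + int k - 1) = ?G" using k by (simp add: X_def Suc_diff_le algebra_simps)
  let ?\<phi> = "\<lambda>w. msign ?G ((int k - 1) * wdeg (take j w))
    (pure (take j w @ (wdeg (take (k + 1) (drop j w)) + (int k - 1), op k (take (k + 1) (drop j w))) # drop (j + k + 1) w))"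
  have ml: "multilinear (n + 1) p ?G ?\<phi>"
    by (rule multilinear_msign[OF module_tpow multilinear_block[OF multilinear_op]])
      (use k in \<open>auto dest: wdeg_take_cong[of _ _ j]\<close>)
  have opo: "one_pi_one k j n p = tpow_lift (n + 1) p ?G ?\<phi>"
    using k unfolding one_pi_one_def G by (simp add: op_def Let_def algebra_simps)
  show hom: "one_pi_one k j n p \<in> mod_hom K (X n p) (X (n - k) (p + int k - 1))"
    unfolding opo G X_def[of n] by (rule tpow_lift_hom[OF module_tpow ml])
  show pure: "one_pi_one k j n p (pure (u @ B @ v)) =
        msign (X (n - k) (p + int k - 1)) ((int k - 1) * wdeg u) (pure (u @ (wdeg B + (int k - 1), op k B) # v))"
    if "u @ B @ v \<in> words (n + 1) p" "length u = j" "length B = k + 1" for u B v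
    unfolding opo G using tpow_lift_pure[OF module_tpow ml that(1)] that(2,3) by simp
  show "msign (X (n - k) (p + int k - 1)) (int k * int j + tri k + int k * (p - 1)) (one_pi_one k j n p x) = Dk k j n p x"
  proof (rule tpow_hom_eqI[OF module_tpow _ Dk_hom[OF k(2)]])
    show "(\<lambda>x. msign (X (n - k) (p + int k - 1)) (int k * int j + tri k + int k * (p - 1)) (one_pi_one k j n p x))
      \<in> mod_hom K (tpow (n + 1) p) ?G"
      using mod_hom_msign_comp[OF module_X hom] unfolding G X_def[of n] .
    show "x \<in> carrier (tpow (n + 1) p)" using x by (simp add: X_def)
    fix w assume w: "w \<in> words (n + 1) p"
    then obtain u B v where s: "w = u @ B @ v" "length u = j" "length B = k + 1"
      using k by (intro that[of "take j w" "take (k + 1) (drop j w)" "drop (k + 1) (drop j w)"])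
        (auto simp: words_iff append_take_drop_id simp del: drop_drop)
    have "u @ (wdeg B + (int k - 1), op k B) # v \<in> words (n + 1 - k) (p + (int k - 1))"
      using w s op_closed[of B k "wdeg B"] by (auto simp: words_iff)
    then show "msign (X (n - k) (p + int k - 1)) (int k * int j + tri k + int k * (p - 1)) (one_pi_one k j n p (pure w)) =
      Dk k j n p (pure w)"
      using w s by (simp add: pure Dk_pure) (simp add: G msign_msign[OF module_tpow])
  qed
qed

lemma dX_eq:
  assumes x: "x \<in> carrier (X n p)"
  shows "dX n p x = (\<Oplus>\<^bsub>X n (p - 1)\<^esub>i\<in>{0..n}. Dk 0 i n p x)"
    and "dX n p \<in> mod_hom K (X n p) (X n (p - 1))"
    and "\<And>w. w \<in> words (n + 1) p \<Longrightarrow> dX n p (pure w) = (\<Oplus>\<^bsub>X n (p - 1)\<^esub>i\<in>{0..n}. Dk 0 i n p (pure w))"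
proof -
  let ?G = "tpow (n + 1) (p - 1)"
  have G: "X n (p - 1) = ?G" by (simp add: X_def)
  have Dh: "Dk 0 i n p \<in> mod_hom K (tpow (n + 1) p) ?G" if "i \<in> {0..n}" for i
    using Dk_hom[of i 0 n p] that by simp
  have Sh: "(\<lambda>x. \<Oplus>\<^bsub>?G\<^esub>i\<in>{0..n}. Dk 0 i n p x) \<in> mod_hom K (tpow (n + 1) p) ?G"
    by (rule mod_hom_sum[OF module_tpow module_tpow Dh])
  let ?\<phi> = "\<lambda>w. \<Oplus>\<^bsub>?G\<^esub>i\<in>{0..n}. msign ?G (wdeg (take i w))
      (pure (w[i := (fst (w ! i) - 1, d (fst (w ! i)) (snd (w ! i)))]))"
  have trm: "Dk 0 i n p (pure w) = msign ?G (wdeg (take i w)) (pure (w[i := (fst (w ! i) - 1, d (fst (w ! i)) (snd (w ! i)))]))"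
    if w: "w \<in> words (n + 1) p" and i: "i \<in> {0..n}" for w i
  proof -
    have il: "i < length w" using w i by (auto simp: words_iff)
    let ?u = "take i w" and ?v = "drop (Suc i) w"
    have s: "w = ?u @ [w ! i] @ ?v" using id_take_nth_drop[OF il] by simp
    have lu: "length ?u = i" using il by simp
    have upd: "w[i := c] = ?u @ c # ?v" for c using upd_conv_take_nth_drop[OF il] by simp
    have "Dk 0 i n p (pure (?u @ [w ! i] @ ?v)) = msign ?G (- wdeg ?u)
      (pure (?u @ (fst (w ! i) - 1, d (fst (w ! i)) (snd (w ! i))) # ?v))"
      using Dk_pure[of ?u "[w ! i]" ?v n p i 0] w lu s by (simp add: op_def wdeg_Cons)
    then show ?thesis unfolding upd using s by (simp add: msign_def)
  qed
  have \<phi>: "?\<phi> w = (\<Oplus>\<^bsub>?G\<^esub>i\<in>{0..n}. Dk 0 i n p (pure w))" if w: "w \<in> words (n + 1) p" for w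
    by (rule finsum_congr[OF module_tpow], rule trm[OF w, symmetric], assumption, rule mod_hom_closed[OF Dh pure_closed[OF w]])
  have ml: "multilinear (n + 1) p ?G ?\<phi>"
    by (rule multilinear_cong[OF multilinear_comp[OF multilinear_pure Sh] \<phi>])
  have dX: "dX n p = tpow_lift (n + 1) p ?G ?\<phi>" by (simp add: dX_def G)
  have h: "dX n p \<in> mod_hom K (tpow (n + 1) p) ?G" unfolding dX by (rule tpow_lift_hom[OF module_tpow ml])
  then show "dX n p \<in> mod_hom K (X n p) (X n (p - 1))" by (simp add: X_def)
  show pure: "dX n p (pure w) = (\<Oplus>\<^bsub>X n (p - 1)\<^esub>i\<in>{0..n}. Dk 0 i n p (pure w))" if "w \<in> words (n + 1) p" for w
    unfolding dX G using that by (simp only: tpow_lift_pure[OF module_tpow ml] \<phi>)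
  show "dX n p x = (\<Oplus>\<^bsub>X n (p - 1)\<^esub>i\<in>{0..n}. Dk 0 i n p x)"
    unfolding G by (rule tpow_hom_eqI[OF module_tpow h Sh]) (use x pure in \<open>auto simp: X_def\<close>)
qed

end

section \<open>The relation of an A-infinity algebra in suspended degrees\<close>

context dg_module
begin

lemma multilinear_slot_hom:
  assumes "multilinear l m G \<phi>" "word u" "word v" "length u + 1 + length v = l" "wdeg u + q + wdeg v = m"
  shows "(\<lambda>x. \<phi> (u @ (q, x) # v)) \<in> mod_hom K (A q) G"
  by (rule mod_homI; rule multilinearD[OF assms(1)]) (use assms(2-) in \<open>auto simp: words_iff\<close>)

end

context A_infinity_algebra
begin

text \<open>
  The raising of degrees turns the signs of the relation into Koszul signs. Both terms with the
  differential of \<open>A\<close> become the cases \<open>k = 0\<close> and \<open>k = s\<close> of one double sum over the nested operations.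
\<close>

lemma A_infinity_suspended:
  assumes W: "W \<in> words (s + 1) q"
  shows "(\<Oplus>\<^bsub>A (q + int s - 2)\<^esub>k\<in>{0..s}. \<Oplus>\<^bsub>A (q + int s - 2)\<^esub>c\<in>{0..k}.
      msign (A (q + int s - 2)) (sdeg (take c W))
        (mop k (take c W @ (wdeg (take (s - k + 1) (drop c W)) + (int (s - k) - 1), mop (s - k) (take (s - k + 1) (drop c W)))
          # drop (c + (s - k) + 1) W))) = \<zero>\<^bsub>A (q + int s - 2)\<^esub>"
proof -
  note of_nat_diff [simp del]
  let ?G = "A (q + int s - 2)"
  have G: "module K ?G" by (rule A_module)
  interpret G: module K ?G by (rule G)
  define u B v where "u c = take c W" and "B k c = take (s - k + 1) (drop c W)" and "v k c = drop (c + (s - k) + 1) W" for k c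
  define y where "y k c = op k (u c @ (wdeg (B k c) + (int (s - k) - 1), op (s - k) (B k c)) # v k c)" for k c
  define e where "e k c = iota W + (int (s - k) + 1) * wdeg (u c) + int c * int (s - k) + int s * q + tri s + int k" for k c
  have dec: "W = u c @ B k c @ v k c" "length (u c) = c" "length (B k c) = s - k + 1" "length (v k c) = k - c"
    if "c \<le> k" "k \<le> s" for k c
  proof -
    have "v k c = drop (s - k + 1) (drop c W)" by (simp add: v_def add.commute)
    then show "W = u c @ B k c @ v k c" by (simp add: u_def B_def append_take_drop_id del: drop_drop)
  qed (use that W in \<open>auto simp: u_def B_def v_def words_iff\<close>)
  have inner: "B k c \<in> words (s - k + 1) (wdeg (B k c))" "word (u c)" "word (v k c)"
    "wdeg (u c) + wdeg (B k c) + wdeg (v k c) = q" if "c \<le> k" "k \<le> s" for k c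
    using W dec[OF that] by (auto simp: words_iff)
  have outer: "u c @ (wdeg (B k c) + (int (s - k) - 1), a) # v k c \<in> words (k + 1) (q + (int (s - k) - 1))"
    if "a \<in> carrier (A (wdeg (B k c) + (int (s - k) - 1)))" "c \<le> k" "k \<le> s" for a k c
    using that inner[OF that(2,3)] dec(2,4)[OF that(2,3)] by (auto simp: words_iff)
  have yc: "y k c \<in> carrier ?G" if "c \<le> k" "k \<le> s" for k c
  proof -
    have deg: "q + (int (s - k) - 1) + (int k - 1) = q + int s - 2" using that by (simp add: of_nat_diff)
    show ?thesis
      using op_closed[OF outer[OF op_closed[OF inner(1)[OF that]] that]] unfolding deg y_def .
  qed
  have main: "msign ?G (sdeg (u c)) (mop k (u c @ (wdeg (B k c) + (int (s - k) - 1), mop (s - k) (B k c)) # v k c)) =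
      msign ?G (e k c) (y k c)" if ck: "c \<le> k" "k \<le> s" for k c
  proof -
    let ?l = "s - k" let ?r = "wdeg (B k c) + (int ?l - 1)"
    let ?eB = "iota (B k c) + int ?l * wdeg (B k c) + tri ?l"
    have deg: "q + (int ?l - 1) + (int k - 1) = q + int s - 2" using ck by (simp add: of_nat_diff)
    note oB = op_closed[OF inner(1)[OF ck]]
    have slot: "(\<lambda>x. op k (u c @ (?r, x) # v k c)) \<in> mod_hom K (A ?r) ?G"
      using multilinear_slot_hom[OF multilinear_op[of k "q + (int ?l - 1)"] inner(2,3)[OF ck], of ?r]
        dec(2,4)[OF ck] ck inner(4)[OF ck] unfolding deg by simp
    have "mop k (u c @ (?r, mop ?l (B k c)) # v k c) =
      msign ?G (iota (u c @ (?r, mop ?l (B k c)) # v k c) + int k * (q + (int ?l - 1)) + tri k)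
        (op k (u c @ (?r, msign (A ?r) ?eB (op ?l (B k c))) # v k c))"
    proof -
      have wd: "wdeg (u c @ (?r, a) # v k c) = q + (int ?l - 1)" for a using inner(4)[OF ck] by simp
      show ?thesis unfolding mop_def[of k] wd deg unfolding mop_def[of ?l] ..
    qed
    also have "op k (u c @ (?r, msign (A ?r) ?eB (op ?l (B k c))) # v k c) = msign ?G ?eB (y k c)"
      unfolding y_def by (rule mod_hom_msign[OF A_module G slot oB])
    finally have "msign ?G (sdeg (u c)) (mop k (u c @ (?r, mop ?l (B k c)) # v k c)) =
      msign ?G (sdeg (u c) + (iota (u c @ (?r, mop ?l (B k c)) # v k c) + int k * (q + (int ?l - 1)) + tri k + ?eB)) (y k c)"
      using yc[OF ck] by (simp add: msign_msign[OF G])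
    also have "\<dots> = msign ?G (e k c) (y k c)"
    proof (rule msign_cong)
      have kl: "int s = int k + int ?l" "s = k + ?l" using ck by (auto simp: of_nat_diff)
      have iW: "iota W = iota (u c) + iota (B k c) + iota (v k c) + (int ?l + 1) * wdeg (v k c) + int c * (wdeg (B k c) + wdeg (v k c))"
        using arg_cong[OF dec(1)[OF ck], of iota] dec(2,3)[OF ck] by (simp add: algebra_simps)
      have "sdeg (u c) + (iota (u c @ (?r, mop ?l (B k c)) # v k c) + int k * (q + (int ?l - 1)) + tri k + ?eB) - e k c =
        2 * (- (int ?l * wdeg (u c)) - int ?l * wdeg (v k c) - int k)"
        using dec(2)[OF ck] unfolding e_def iW inner(4)[OF ck, symmetric] kl(1)
        by (subst (2) kl(2)) (simp add: sdeg_def tri_add algebra_simps)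
      then show "even (sdeg (u c) + (iota (u c @ (?r, mop ?l (B k c)) # v k c) + int k * (q + (int ?l - 1)) + tri k + ?eB) - e k c)"
        by simp
    qed
    finally show ?thesis .
  qed
  have sumeq: "(\<Oplus>\<^bsub>?G\<^esub>k\<in>{0..s}. \<Oplus>\<^bsub>?G\<^esub>c\<in>{0..k}.
      msign ?G (sdeg (u c)) (mop k (u c @ (wdeg (B k c) + (int (s - k) - 1), mop (s - k) (B k c)) # v k c))) =
    (\<Oplus>\<^bsub>?G\<^esub>k\<in>{0..s}. \<Oplus>\<^bsub>?G\<^esub>c\<in>{0..k}. msign ?G (e k c) (y k c))"
    by (intro finsum_congr[OF G] main finsum_in_carrier[OF G] msign_A_closed yc) auto
  have "(\<Oplus>\<^bsub>?G\<^esub>k\<in>{0..s}. \<Oplus>\<^bsub>?G\<^esub>c\<in>{0..k}. msign ?G (e k c) (y k c)) = \<zero>\<^bsub>?G\<^esub>"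
  proof (cases "s = 0")
    case True
    then obtain a where "W = [(q, a)]" "a \<in> carrier (A q)"
      using W by (cases W) (auto simp: words_iff word_Cons wdeg_Cons)
    then have "y 0 0 = \<zero>\<^bsub>?G\<^esub>" using True d_d[of a q] by (simp add: y_def u_def B_def v_def op_def)
    then have "y k c = \<zero>\<^bsub>?G\<^esub>" if "k \<in> {0..s}" "c \<in> {0..k}" for k c using that True by simp
    then have "msign ?G (e k c) (y k c) = \<zero>\<^bsub>?G\<^esub>" if "k \<in> {0..s}" "c \<in> {0..k}" for k c
      using that by (simp only: msign_zero[OF G])
    then show ?thesis by (intro finsum_zeros[OF G])
  next
    case False
    let ?s0 = "iota W + tri s + int s * q"
    have pW: "pure W \<in> carrier (X s q)" using W by (simp add: X_def)
    have piG: "pi (s - 1) (q - 1) \<in> mod_hom K (X s (q - 1)) ?G"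
      using pi_hom[of "s - 1" "q - 1"] False by (simp add: X_def algebra_simps of_nat_diff)
    let ?dpi = "d (q + int s - 1) (pi (s - 1) q (pure W))" and ?pid = "pi (s - 1) (q - 1) (dX s q (pure W))"
    have pidc: "?pid \<in> carrier ?G" by (rule mod_hom_closed[OF piG mod_hom_closed[OF dX_eq(2)[OF pW] pW]])
    have y0: "y 0 0 = ?dpi"
      using False W by (simp add: y_def u_def B_def v_def op_def words_iff algebra_simps)
    have dpic: "?dpi \<in> carrier ?G" using yc[of 0 0] unfolding y0 by simp
    have f0: "(\<Oplus>\<^bsub>?G\<^esub>c\<in>{0..0}. msign ?G (e 0 c) (y 0 c)) = msign ?G ?s0 ?dpi"
    proof -
      have "msign ?G (e 0 0) (y 0 0) = msign ?G ?s0 (y 0 0)" by (rule msign_cong) (simp add: e_def u_def)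
      then show ?thesis using yc[of 0 0] by (simp add: G.M.finsum_insert y0)
    qed
    have fs: "(\<Oplus>\<^bsub>?G\<^esub>c\<in>{0..s}. msign ?G (e s c) (y s c)) = msign ?G ?s0 (msign ?G (int s) ?pid)"
    proof -
      have D0: "Dk 0 c s q (pure W) \<in> carrier (X s (q - 1))" if "c \<le> s" for c
        using mod_hom_closed[OF Dk_hom[of c 0 s q]] that pW by (simp add: X_def)
      have pid: "?pid = (\<Oplus>\<^bsub>?G\<^esub>c\<in>{0..s}. pi (s - 1) (q - 1) (Dk 0 c s q (pure W)))"
        unfolding dX_eq(1)[OF pW] by (rule mod_hom_finsum[OF module_X G piG]) (simp add: D0)
      have "msign ?G ?s0 (msign ?G (int s) ?pid) = msign ?G (?s0 + int s) ?pid"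
        by (rule msign_msign[OF G pidc])
      also have "\<dots> = (\<Oplus>\<^bsub>?G\<^esub>c\<in>{0..s}. msign ?G (?s0 + int s) (pi (s - 1) (q - 1) (Dk 0 c s q (pure W))))"
        unfolding pid by (rule mod_hom_finsum[OF G G mod_hom_msign_comp[OF G mod_hom_ident]])
          (rule mod_hom_closed[OF piG D0], simp)
      also have "\<dots> = (\<Oplus>\<^bsub>?G\<^esub>c\<in>{0..s}. msign ?G (e s c) (y s c))"
      proof (rule finsum_congr[OF G])
        fix c assume c: "c \<in> {0..s}"
        then have cs: "c \<le> s" "s \<le> s" by auto
        have w: "u c @ (wdeg (B s c) - 1, op 0 (B s c)) # v s c \<in> words (s + 1) (q - 1)"
          using outer[OF op_closed[OF inner(1)[OF cs]] cs] by simp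
        have "Dk 0 c s q (pure W) = msign (X s (q - 1)) (- wdeg (u c)) (pure (u c @ (wdeg (B s c) - 1, op 0 (B s c)) # v s c))"
          using Dk_pure[of "u c" "B s c" "v s c" s q c 0] W dec[OF cs] by (simp add: X_def)
        moreover have "y s c = pi (s - 1) (q - 1) (pure (u c @ (wdeg (B s c) - 1, op 0 (B s c)) # v s c))"
        proof -
          have "wdeg (u c @ (wdeg (B s c) - 1, op 0 (B s c)) # v s c) = q - 1" using w unfolding words_iff by blast
          then show ?thesis using False by (simp add: y_def op_def[of s] del: wdeg_simps)
        qed
        ultimately have "pi (s - 1) (q - 1) (Dk 0 c s q (pure W)) = msign ?G (- wdeg (u c)) (y s c)"
          using w False mod_hom_msign[OF module_X G piG, of "pure (u c @ (wdeg (B s c) - 1, op 0 (B s c)) # v s c)"]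
          by (simp add: X_def)
        then have "msign ?G (?s0 + int s) (pi (s - 1) (q - 1) (Dk 0 c s q (pure W))) = msign ?G (?s0 + int s - wdeg (u c)) (y s c)"
          using yc[OF cs] by (simp add: msign_msign[OF G])
        also have "\<dots> = msign ?G (e s c) (y s c)" by (rule msign_cong) (simp add: e_def)
        finally show "msign ?G (?s0 + int s) (pi (s - 1) (q - 1) (Dk 0 c s q (pure W))) = msign ?G (e s c) (y s c)" .
      qed (simp add: yc)
      finally show ?thesis by simp
    qed
    define z where "z m c = msign ?G (int (c + 1) * (int s - int m) + int s + 1)
            (pi (m - 1) (q + int (s - m) - 1) (one_pi_one (s - m) c s q (pure W)))" for m c
    have mid: "msign ?G (e k c) (y k c) = msign ?G (?s0 + 1) (z k c) \<and> z k c \<in> carrier ?G"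
      if k: "k \<in> {1..s - 1}" and c: "c \<in> {0..k}" for k c
    proof -
      let ?l = "s - k"
      have ck: "c \<le> k" "k \<le> s" "?l \<ge> 1" "c + ?l \<le> s" "k \<ge> 1" using k c False by auto
      let ?w = "u c @ (wdeg (B k c) + (int ?l - 1), op ?l (B k c)) # v k c"
      have w: "?w \<in> words (k + 1) (q + (int ?l - 1))" by (rule outer[OF op_closed[OF inner(1)[OF ck(1,2)]] ck(1,2)])
      have tm: "X (s - ?l) (q + int ?l - 1) = tpow (k + 1) (q + (int ?l - 1))" using ck by (simp add: X_def algebra_simps)
      have opo: "one_pi_one ?l c s q (pure W) = msign (tpow (k + 1) (q + (int ?l - 1))) ((int ?l - 1) * wdeg (u c)) (pure ?w)"
        using one_pi_one_eq(3)[OF ck(3,4) pW, of "u c" "B k c" "v k c"] W dec[OF ck(1,2)] unfolding tm by simp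
      have piG': "pi (k - 1) (q + int ?l - 1) \<in> mod_hom K (tpow (k + 1) (q + (int ?l - 1))) ?G"
        using pi_hom[of "k - 1" "q + int ?l - 1"] ck by (simp add: algebra_simps of_nat_diff)
      have "pi (k - 1) (q + int ?l - 1) (pure ?w) = y k c"
      proof -
        have "wdeg ?w = q + int ?l - 1" using w unfolding words_iff by simp
        then show ?thesis using ck by (simp add: y_def op_def[of k] del: wdeg_simps)
      qed
      then have "pi (k - 1) (q + int ?l - 1) (one_pi_one ?l c s q (pure W)) = msign ?G ((int ?l - 1) * wdeg (u c)) (y k c)"
        unfolding opo using mod_hom_msign[OF module_tpow G piG' pure_closed[OF w]] by simp
      then have z: "z k c = msign ?G (int (c + 1) * (int s - int k) + int s + 1 + (int ?l - 1) * wdeg (u c)) (y k c)"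
        unfolding z_def using yc[OF ck(1,2)] by (simp add: msign_msign[OF G])
      have zc: "z k c \<in> carrier ?G" unfolding z using yc[OF ck(1,2)] by simp
      have "msign ?G (?s0 + 1) (z k c) = msign ?G (?s0 + 1 + (int (c + 1) * (int s - int k) + int s + 1 + (int ?l - 1) * wdeg (u c))) (y k c)"
        unfolding z using yc[OF ck(1,2)] by (simp add: msign_msign[OF G])
      also have "\<dots> = msign ?G (e k c) (y k c)"
      proof (rule msign_cong)
        have ev: "?s0 + 1 + (int (c + 1) * (int s - int k) + int s + 1 + (int ?l - 1) * wdeg (u c)) - e k c =
          2 * (1 + int ?l - wdeg (u c))"
          using ck by (simp add: e_def of_nat_diff algebra_simps)
        show "even (?s0 + 1 + (int (c + 1) * (int s - int k) + int s + 1 + (int ?l - 1) * wdeg (u c)) - e k c)"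
          unfolding ev by simp
      qed
      finally show ?thesis using zc by simp
    qed
    let ?rhs = "\<Oplus>\<^bsub>?G\<^esub>m\<in>{1..s - 1}. \<Oplus>\<^bsub>?G\<^esub>c\<in>{0..m}. z m c"
    have rc: "(\<Oplus>\<^bsub>?G\<^esub>c\<in>{0..m}. z m c) \<in> carrier ?G" if "m \<in> {1..s - 1}" for m
      by (rule finsum_in_carrier[OF G]) (use mid[OF that] in blast)
    have rhsc: "?rhs \<in> carrier ?G" by (rule finsum_in_carrier[OF G rc])
    have rel: "?dpi \<oplus>\<^bsub>?G\<^esub> msign ?G (int s) ?pid = ?rhs"
    proof -
      have "?dpi \<oplus>\<^bsub>?G\<^esub> msign ?G (int s) ?pid =
        (\<Oplus>\<^bsub>?G\<^esub>m\<in>{1..s - 1}. \<Oplus>\<^bsub>?G\<^esub>t\<in>{1..m + 1}. z m (t - 1))"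
      proof -
        have "(\<Oplus>\<^bsub>?G\<^esub>m\<in>{1..s - 1}. \<Oplus>\<^bsub>?G\<^esub>t\<in>{1..m + 1}. msign ?G (int t * (int s - int m) + int s + 1)
          (pi (m - 1) (q + int (s - m) - 1) (one_pi_one (s - m) (t - 1) s q (pure W)))) =
          (\<Oplus>\<^bsub>?G\<^esub>m\<in>{1..s - 1}. \<Oplus>\<^bsub>?G\<^esub>t\<in>{1..m + 1}. z m (t - 1))"
        proof (intro finsum_congr[OF G])
          fix m t assume mt: "m \<in> {1..s - 1}" "t \<in> {1..m + 1}"
          then show "msign ?G (int t * (int s - int m) + int s + 1)
            (pi (m - 1) (q + int (s - m) - 1) (one_pi_one (s - m) (t - 1) s q (pure W))) = z m (t - 1)"
            by (simp add: z_def)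
          show "z m (t - 1) \<in> carrier ?G" using mid[OF mt(1), of "t - 1"] mt(2) by auto
        next
          fix m assume m: "m \<in> {1..s - 1}"
          show "(\<Oplus>\<^bsub>?G\<^esub>t\<in>{1..m + 1}. z m (t - 1)) \<in> carrier ?G"
            by (rule finsum_in_carrier[OF G]) (use mid[OF m] in auto)
        qed
        then show ?thesis using A_infinity_relation[of s "pure W" q] pW False by simp
      qed
      also have "\<dots> = ?rhs"
      proof (rule finsum_congr[OF G _ rc])
        fix m assume m: "m \<in> {1..s - 1}"
        have "bij_betw Suc {0..m} {1..m + 1}" by (rule bij_betw_byWitness[where f' = "\<lambda>t. t - 1"]) auto
        then have "(\<Oplus>\<^bsub>?G\<^esub>t\<in>{1..m + 1}. z m (t - 1)) = (\<Oplus>\<^bsub>?G\<^esub>c\<in>{0..m}. z m (Suc c - 1))"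
        proof (rule finsum_bij[OF G])
          show "z m (t - 1) \<in> carrier ?G" if "t \<in> {1..m + 1}" for t
            using mid[OF m, of "t - 1"] that by auto
        qed
        then show "(\<Oplus>\<^bsub>?G\<^esub>t\<in>{1..m + 1}. z m (t - 1)) = (\<Oplus>\<^bsub>?G\<^esub>c\<in>{0..m}. z m c)" by simp
      qed
      finally show ?thesis .
    qed
    have fm: "(\<Oplus>\<^bsub>?G\<^esub>k\<in>{1..s - 1}. \<Oplus>\<^bsub>?G\<^esub>c\<in>{0..k}. msign ?G (e k c) (y k c)) = msign ?G (?s0 + 1) ?rhs"
    proof -
      have "(\<Oplus>\<^bsub>?G\<^esub>k\<in>{1..s - 1}. \<Oplus>\<^bsub>?G\<^esub>c\<in>{0..k}. msign ?G (e k c) (y k c)) =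
        (\<Oplus>\<^bsub>?G\<^esub>k\<in>{1..s - 1}. msign ?G (?s0 + 1) (\<Oplus>\<^bsub>?G\<^esub>c\<in>{0..k}. z k c))"
      proof (rule finsum_congr[OF G])
        fix k assume k: "k \<in> {1..s - 1}"
        have "(\<Oplus>\<^bsub>?G\<^esub>c\<in>{0..k}. msign ?G (e k c) (y k c)) = (\<Oplus>\<^bsub>?G\<^esub>c\<in>{0..k}. msign ?G (?s0 + 1) (z k c))"
          by (rule finsum_congr[OF G]) (use mid[OF k] in auto)
        also have "\<dots> = msign ?G (?s0 + 1) (\<Oplus>\<^bsub>?G\<^esub>c\<in>{0..k}. z k c)"
          by (rule mod_hom_finsum[OF G G mod_hom_msign_comp[OF G mod_hom_ident], symmetric]) (use mid[OF k] in blast)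
        finally show "(\<Oplus>\<^bsub>?G\<^esub>c\<in>{0..k}. msign ?G (e k c) (y k c)) = msign ?G (?s0 + 1) (\<Oplus>\<^bsub>?G\<^esub>c\<in>{0..k}. z k c)" .
        show "msign ?G (?s0 + 1) (\<Oplus>\<^bsub>?G\<^esub>c\<in>{0..k}. z k c) \<in> carrier ?G" using rc[OF k] by simp
      qed
      also have "\<dots> = msign ?G (?s0 + 1) ?rhs"
        by (rule mod_hom_finsum[OF G G mod_hom_msign_comp[OF G mod_hom_ident], symmetric]) (rule rc)
      finally show ?thesis .
    qed
    let ?F = "\<lambda>k. \<Oplus>\<^bsub>?G\<^esub>c\<in>{0..k}. msign ?G (e k c) (y k c)"
    have Fc: "?F k \<in> carrier ?G" if "k \<le> s" for k
      by (rule finsum_in_carrier[OF G]) (use yc that in auto)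
    have set: "{0..s} = insert 0 (insert s {1..s - 1})" using False by auto
    have "(\<Oplus>\<^bsub>?G\<^esub>k\<in>{0..s}. ?F k) = ?F 0 \<oplus>\<^bsub>?G\<^esub> (?F s \<oplus>\<^bsub>?G\<^esub> (\<Oplus>\<^bsub>?G\<^esub>k\<in>{1..s - 1}. ?F k))"
    proof -
      have "(\<Oplus>\<^bsub>?G\<^esub>k\<in>insert s {1..s - 1}. ?F k) = ?F s \<oplus>\<^bsub>?G\<^esub> (\<Oplus>\<^bsub>?G\<^esub>k\<in>{1..s - 1}. ?F k)"
        by (rule G.M.finsum_insert, simp, use False in simp, rule Pi_I, rule Fc, use False in fastforce, rule Fc, simp)
      moreover have "(\<Oplus>\<^bsub>?G\<^esub>k\<in>insert 0 (insert s {1..s - 1}). ?F k) = ?F 0 \<oplus>\<^bsub>?G\<^esub> (\<Oplus>\<^bsub>?G\<^esub>k\<in>insert s {1..s - 1}. ?F k)"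
        by (rule G.M.finsum_insert, simp, use False in simp, rule Pi_I, rule Fc, use False in fastforce, rule Fc, simp)
      ultimately show ?thesis unfolding set by simp
    qed
    also have "\<dots> = (msign ?G ?s0 ?dpi \<oplus>\<^bsub>?G\<^esub> msign ?G ?s0 (msign ?G (int s) ?pid)) \<oplus>\<^bsub>?G\<^esub> msign ?G (?s0 + 1) ?rhs"
      unfolding f0 fs fm using dpic pidc rhsc by (simp add: G.M.a_assoc)
    also have "msign ?G ?s0 ?dpi \<oplus>\<^bsub>?G\<^esub> msign ?G ?s0 (msign ?G (int s) ?pid) = msign ?G ?s0 ?rhs"
      using dpic pidc by (simp only: rel[symmetric] msign_add[OF G] msign_A_closed)
    also have "msign ?G ?s0 ?rhs \<oplus>\<^bsub>?G\<^esub> msign ?G (?s0 + 1) ?rhs = \<zero>\<^bsub>?G\<^esub>"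
      by (rule msign_odd_add[OF G rhsc]) simp
    finally show ?thesis .
  qed
  then show ?thesis using sumeq unfolding u_def B_def v_def by simp
qed

end

section \<open>Rotation and reflection of words\<close>

context dg_module
begin

lemma iota_cong: "map fst w = map fst w' \<Longrightarrow> iota w = iota w'"
proof (induction w arbitrary: w')
  case (Cons c w)
  then obtain c' w'' where "w' = c' # w''" "map fst w = map fst w''" by (cases w') auto
  then show ?case using Cons.IH[of w''] by (simp add: wdeg_def)
qed simp

lemma iota_rev: "iota (rev w) = (int (length w) - 1) * wdeg w - iota w"
  by (induction w) (simp_all add: wdeg_Cons algebra_simps)

text \<open>
  The sum of \<open>|a\<^sub>i| |a\<^sub>j|\<close> over \<open>i < j\<close>, the exponent of the Koszul sign of the reversal; \<open>e2s\<close> below is the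
  same for raised degrees.
\<close>

fun e2 :: "(int \<times> 'a) list \<Rightarrow> int"
  where "e2 [] = 0" | "e2 (c # w) = e2 w + fst c * wdeg w"

lemma e2_sum: "(\<Sum>j<length w. \<Sum>i<j. fst (w ! i) * fst (w ! j)) = e2 w"
proof (induction w)
  case (Cons c w)
  have "(\<Sum>j<length (c # w). \<Sum>i<j. fst ((c # w) ! i) * fst ((c # w) ! j)) =
    (\<Sum>j<length w. fst c * fst (w ! j) + (\<Sum>i<j. fst (w ! i) * fst (w ! j)))"
    by (simp add: sum.lessThan_Suc_shift del: sum.lessThan_Suc)
  also have "\<dots> = fst c * (\<Sum>j<length w. fst (w ! j)) + e2 w"
    using Cons by (simp add: sum.distrib sum_distrib_left)
  also have "(\<Sum>j<length w. fst (w ! j)) = wdeg w"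
    by (simp add: wdeg_def sum_list_sum_nth atLeast0LessThan)
  finally show ?case by simp
qed simp

fun e2s :: "(int \<times> 'a) list \<Rightarrow> int"
  where "e2s [] = 0" | "e2s (c # w) = e2s w + (fst c + 1) * sdeg w"

lemma e2s_append: "e2s (u @ v) = e2s u + e2s v + sdeg u * sdeg v"
  by (induction u) (simp_all add: sdeg_def wdeg_Cons algebra_simps)

lemma e2s_rev [simp]: "e2s (rev w) = e2s w"
  by (induction w) (simp_all add: e2s_append sdeg_def wdeg_Cons algebra_simps)

lemma e2s_e2: "e2s w = e2 w + (int (length w) - 1) * wdeg w + tri (length w)"
  by (induction w) (simp_all add: sdeg_def wdeg_Cons tri_Suc algebra_simps)

lemma ps_hom_value:
  assumes h: "h \<in> mod_hom K (tpow l m) (tpow l' m')" and w: "w \<in> words l m" "w' \<in> words l' m'"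
    and hw: "h (pure w) = msign (tpow l' m') e (pure w')"
    and ev: "even (iota w + int l + e + iota w' + int l' - f)"
  shows "h (ps w) = msign (tpow l' m') f (ps w')"
proof -
  have "h (ps w) = msign (tpow l' m') (iota w + int l + 1 + e) (pure w')"
    using w hw by (simp add: ps_eq mod_hom_msign[OF module_tpow module_tpow h] msign_msign[OF module_tpow])
  also have "\<dots> = msign (tpow l' m') (f + (iota w' + int l' + 1)) (pure w')"
    by (rule msign_cong) (use ev in auto)
  also have "\<dots> = msign (tpow l' m') f (ps w')"
    using w by (simp add: ps_eq msign_msign[OF module_tpow])
  finally show ?thesis .
qed

end

context involutive_A_infinity_algebra
begin

lemma multilinear_t: "multilinear (n + 1) m (tpow (n + 1) m)
    (\<lambda>w. msign (tpow (n + 1) m) (fst (last w) * wdeg (butlast w)) (pure (last w # butlast w)))"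
proof (rule multilinear_msign[OF module_tpow multilinear_rotate])
  fix w w' assume w: "w \<in> words (n + 1) m" "w' \<in> words (n + 1) m" and eq: "map fst w = map fst w'"
  have ne: "w \<noteq> []" "w' \<noteq> []" using w by (auto simp: words_iff)
  have "fst (last w) = fst (last w')" using eq ne by (metis last_map)
  moreover have "wdeg (butlast w) = wdeg (butlast w')" using eq by (metis wdeg_def map_butlast)
  ultimately show "fst (last w) * wdeg (butlast w) = fst (last w') * wdeg (butlast w')" by simp
qed

lemma t_hom: "t n m \<in> mod_hom K (tpow (n + 1) m) (tpow (n + 1) m)"
  unfolding t_def X_def by (rule tpow_lift_hom[OF module_tpow multilinear_t])

lemma T_hom: "T n m \<in> mod_hom K (tpow (n + 1) m) (tpow (n + 1) m)"
  unfolding T_def[abs_def] X_def by (rule mod_hom_msign_comp[OF module_tpow t_hom])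

lemma T_closed: "x \<in> carrier (tpow (n + 1) m) \<Longrightarrow> T n m x \<in> carrier (tpow (n + 1) m)"
  by (rule mod_hom_closed[OF T_hom])

lemma T_ps:
  assumes w: "v @ [(q, a)] \<in> words (n + 1) m"
  shows "T n m (ps (v @ [(q, a)])) = msign (tpow (n + 1) m) ((q + 1) * sdeg v) (ps ((q, a) # v))"
proof (rule ps_hom_value[OF T_hom w])
  show w': "(q, a) # v \<in> words (n + 1) m" using w by (auto simp: words_iff)
  have "t n m (pure (v @ [(q, a)])) = msign (tpow (n + 1) m) (q * wdeg v) (pure ((q, a) # v))"
    using tpow_lift_pure[OF module_tpow multilinear_t w] by (simp add: t_def X_def)
  then show "T n m (pure (v @ [(q, a)])) = msign (tpow (n + 1) m) (int n + q * wdeg v) (pure ((q, a) # v))"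
    using w' by (simp add: T_def X_def msign_msign[OF module_tpow] del: One_nat_def)
  have n: "n = length v" using w by (simp add: words_iff)
  have "iota (v @ [(q, a)]) + int (n + 1) + (int n + q * wdeg v) + iota ((q, a) # v) + int (n + 1) - (q + 1) * sdeg v
    = 2 * (iota v + int n + 1)"
    by (simp add: n sdeg_def algebra_simps)
  then show "even (iota (v @ [(q, a)]) + int (n + 1) + (int n + q * wdeg v) + iota ((q, a) # v) + int (n + 1) - (q + 1) * sdeg v)"
    by (metis dvd_triv_left)
qed

text \<open>
  Rotating the letters of \<open>v\<close> one by one to the front moves the block as a whole, with the Koszul sign
  of the exchange of two blocks.
\<close>

lemma T_block:
  "u @ v \<in> words (n + 1) m \<Longrightarrow> (T n m ^^ length v) (ps (u @ v)) = msign (tpow (n + 1) m) (sdeg u * sdeg v) (ps (v @ u))"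
proof (induction v arbitrary: u rule: rev_induct)
  case Nil
  then show ?case by simp
next
  case (snoc c v)
  obtain q a where c: "c = (q, a)" by (cases c)
  have w: "(u @ v) @ [(q, a)] \<in> words (n + 1) m" and w': "(c # u) @ v \<in> words (n + 1) m"
    and w'': "v @ c # u \<in> words (n + 1) m"
    using snoc.prems by (auto simp: c words_iff)
  let ?G = "tpow (n + 1) m"
  have pc: "ps ((c # u) @ v) \<in> carrier ?G" "ps (v @ c # u) \<in> carrier ?G" using w' w'' by (metis ps_closed)+
  have Th: "(\<lambda>x. (T n m ^^ k) x) \<in> mod_hom K ?G ?G" for k
  proof (induction k)
    case 0
    then show ?case by (simp add: mod_hom_ident)
  next
    case (Suc k)
    then show ?case using mod_hom_comp[OF Suc T_hom] by simp
  qed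
  have "(T n m ^^ length (v @ [c])) (ps (u @ v @ [c])) = (T n m ^^ length v) (T n m (ps ((u @ v) @ [(q, a)])))"
    by (simp add: c funpow_swap1)
  also have "\<dots> = msign ?G ((q + 1) * sdeg (u @ v)) ((T n m ^^ length v) (ps ((c # u) @ v)))"
    unfolding T_ps[OF w] using mod_hom_msign[OF module_tpow module_tpow Th pc(1)] by (simp add: c)
  also have "\<dots> = msign ?G ((q + 1) * sdeg (u @ v) + sdeg (c # u) * sdeg v) (ps (v @ c # u))"
    unfolding snoc.IH[OF w'] by (rule msign_msign[OF module_tpow pc(2)])
  also have "\<dots> = msign ?G (sdeg u * sdeg (v @ [c])) (ps (v @ c # u))"
  proof (rule msign_cong)
    have "(q + 1) * sdeg (u @ v) + sdeg (c # u) * sdeg v - sdeg u * sdeg (v @ [c]) = 2 * ((q + 1) * sdeg v)"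
      by (simp add: c algebra_simps)
    then show "even ((q + 1) * sdeg (u @ v) + sdeg (c # u) * sdeg v - sdeg u * sdeg (v @ [c]))" by (metis dvd_triv_left)
  qed
  finally show ?case by simp
qed

definition starw :: "(int \<times> 'a) list \<Rightarrow> (int \<times> 'a) list" where "starw w = map (\<lambda>(q, a). (q, star q a)) w"

lemma star_closed: "a \<in> carrier (A q) \<Longrightarrow> star q a \<in> carrier (A q)"
  by (rule mod_hom_closed[OF star_hom])

lemma starw_simps [simp]:
  "starw [] = []" "starw ((q, a) # w) = (q, star q a) # starw w" "starw (u @ v) = starw u @ starw v"
  "starw (rev w) = rev (starw w)" "length (starw w) = length w"
  by (simp_all add: starw_def rev_map)

lemma fst_starw: "map fst (starw w) = map fst w"
  by (simp add: starw_def case_prod_unfold)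

lemma starw_deg [simp]: "wdeg (starw w) = wdeg w" "sdeg (starw w) = sdeg w" "iota (starw w) = iota w" "e2s (starw w) = e2s w"
proof -
  show d: "wdeg (starw w) = wdeg w" for w :: "(int \<times> 'a) list" by (simp add: wdeg_def fst_starw)
  then show s: "sdeg (starw w) = sdeg w" for w :: "(int \<times> 'a) list" by (simp add: sdeg_def)
  show "iota (starw w) = iota w" by (rule iota_cong[OF fst_starw])
  show "e2s (starw w) = e2s w" by (induction w) (auto simp: s)
qed

lemma word_starw [simp]: "word w \<Longrightarrow> word (starw w)"
  by (induction w) (auto simp: star_closed word_Cons)

lemma starw_starw [simp]: "word w \<Longrightarrow> starw (starw w) = w"
  by (induction w) (auto simp: star_star word_Cons)

lemma multilinear_reflect: "multilinear (n + 1) m (tpow (n + 1) m) (\<lambda>w. pure (hd (starw w) # rev (tl (starw w))))"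
proof (rule multilinearI)
  show "pure (hd (starw w) # rev (tl (starw w))) \<in> carrier (tpow (n + 1) m)" if "w \<in> words (n + 1) m" for w
    using that by (cases w) (auto simp: words_iff star_closed intro!: pure_closed)
  fix u q x v assume w: "u @ (q, x) # v \<in> words (n + 1) m"
  {
    fix y assume w': "u @ (q, y) # v \<in> words (n + 1) m"
    have st: "star q (x \<oplus>\<^bsub>A q\<^esub> y) = star q x \<oplus>\<^bsub>A q\<^esub> star q y"
      using w w' by (intro mod_hom_add[OF star_hom]) (auto simp: words_iff)
    show "pure (hd (starw (u @ (q, x \<oplus>\<^bsub>A q\<^esub> y) # v)) # rev (tl (starw (u @ (q, x \<oplus>\<^bsub>A q\<^esub> y) # v)))) =
       pure (hd (starw (u @ (q, x) # v)) # rev (tl (starw (u @ (q, x) # v)))) \<oplus>\<^bsub>tpow (n + 1) m\<^esub>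
       pure (hd (starw (u @ (q, y) # v)) # rev (tl (starw (u @ (q, y) # v))))"
    proof (cases u)
      case Nil
      then show ?thesis using pure_add[of "[]" q "star q x" "rev (starw v)" "n + 1" m "star q y"] w w' st
        by (simp add: words_iff star_closed)
    next
      case (Cons c u')
      obtain q' a where c: "c = (q', a)" by (cases c)
      show ?thesis using pure_add[of "(q', star q' a) # rev (starw v)" q "star q x" "rev (starw u')" "n + 1" m "star q y"] w w' st
        by (simp add: Cons c words_iff star_closed)
    qed
  next
    fix e assume e: "e \<in> carrier K"
    have st: "star q (e \<odot>\<^bsub>A q\<^esub> x) = e \<odot>\<^bsub>A q\<^esub> star q x"
      using w e by (intro mod_hom_smult[OF star_hom]) (auto simp: words_iff)
    show "pure (hd (starw (u @ (q, e \<odot>\<^bsub>A q\<^esub> x) # v)) # rev (tl (starw (u @ (q, e \<odot>\<^bsub>A q\<^esub> x) # v)))) =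
       e \<odot>\<^bsub>tpow (n + 1) m\<^esub> pure (hd (starw (u @ (q, x) # v)) # rev (tl (starw (u @ (q, x) # v))))"
    proof (cases u)
      case Nil
      then show ?thesis using pure_smult[of e "[]" q "star q x" "rev (starw v)" "n + 1" m] w e st
        by (simp add: words_iff star_closed)
    next
      case (Cons c u')
      obtain q' a where c: "c = (q', a)" by (cases c)
      show ?thesis using pure_smult[of e "(q', star q' a) # rev (starw v)" q "star q x" "rev (starw u')" "n + 1" m] w e st
        by (simp add: Cons c words_iff star_closed)
    qed
  }
qed

lemma tail_sum:
  assumes "length w = n + 1"
  shows "(\<Sum>j\<in>{1..n}. \<Sum>i\<in>{1..<j}. fst (w ! i) * fst (w ! j)) = e2 (tl w)"
proof -
  obtain c v where w: "w = c # v" "length v = n" using assms by (cases w) auto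
  have "(\<Sum>j\<in>{1..n}. \<Sum>i\<in>{1..<j}. fst (w ! i) * fst (w ! j)) = (\<Sum>j<n. \<Sum>i\<in>{1..<Suc j}. fst (w ! i) * fst (w ! Suc j))"
    by (simp add: sum.atLeast1_atMost_eq)
  also have "\<dots> = (\<Sum>j<n. \<Sum>i<j. fst (w ! Suc i) * fst (w ! Suc j))"
    by (simp add: sum.atLeast_Suc_lessThan_Suc_shift atLeast0LessThan del: sum.op_ivl_Suc)
  also have "\<dots> = e2 (tl w)" using e2_sum[of v] w by simp
  finally show ?thesis .
qed

text \<open>
  For raised degrees the sign \<open>n (n + 1) / 2\<close> of the involution reduces to \<open>(-1)\<^sup>k\<close> and the Koszul sign of
  the reversal.
\<close>

lemma star_mop:
  assumes B: "B \<in> words (k + 1) q"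
  shows "star (q + (int k - 1)) (mop k B) = msign (A (q + (int k - 1))) (int k + e2s B) (mop k (rev (starw B)))"
proof (cases k)
  case 0
  then obtain a where a: "B = [(q, a)]" "a \<in> carrier (A q)"
    using B by (cases B) (auto simp: words_iff word_Cons wdeg_Cons)
  show ?thesis using d_star[OF a(2)] by (simp add: a(1) 0 mop_def op_def)
next
  case (Suc k')
  let ?G = "A (q + (int k - 1))" and ?B = "rev (starw B)"
  have len: "length B = k + 1" and deg: "wdeg B = q" and wB: "word B" using B by (auto simp: words_iff)
  have B': "?B \<in> words (k + 1) q" using len deg wB by (simp add: words_iff)
  have G: "q + int k' = q + (int k - 1)" by (simp add: Suc)
  have set: "{0..k' + 1} = {..<length B}" using len Suc by auto
  have sum: "(\<Sum>j\<in>{0..k' + 1}. \<Sum>i\<in>{0..<j}. fst (B ! i) * fst (B ! j)) = e2 B"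
    unfolding set atLeast0LessThan by (rule e2_sum)
  have BW: "B \<in> words (k' + 2) q" using B Suc by simp
  have ops: "op k B = pi k' q (pure B)" "op k ?B = pi k' q (pure ?B)" by (simp_all add: op_def Suc deg)
  have "star (q + (int k - 1)) (op k B) = msign ?G (tri k + e2 B) (op k ?B)"
    using pi_star[OF BW] unfolding sum tri_eq starw_def[symmetric] G ops Suc[symmetric] .
  then have "star (q + (int k - 1)) (mop k B) = msign ?G (iota B + int k * q + tri k + (tri k + e2 B)) (op k ?B)"
    using op_closed[OF B] op_closed[OF B'] by (simp add: mop_def deg mod_hom_msign[OF A_module A_module star_hom] msign_msign[OF A_module])
  also have "\<dots> = msign ?G (int k + e2s B + (iota ?B + int k * q + tri k)) (op k ?B)"
  proof (rule msign_cong)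
    have "iota B + int k * q + tri k + (tri k + e2 B) - (int k + e2s B + (iota ?B + int k * q + tri k)) =
      2 * (iota B - int k * q - int k)"
      by (simp add: e2s_e2 iota_rev len deg tri_Suc algebra_simps)
    then show "even (iota B + int k * q + tri k + (tri k + e2 B) - (int k + e2s B + (iota ?B + int k * q + tri k)))"
      by (metis dvd_triv_left)
  qed
  also have "\<dots> = msign ?G (int k + e2s B) (mop k ?B)"
    using op_closed[OF B'] by (simp add: mop_def deg msign_msign[OF A_module])
  finally show ?thesis .
qed

end

text \<open>The two signs are treated together, as a scalar of square one.\<close>

locale dihedral_sign = involutive_A_infinity_algebra K A d pi star
  for K :: "'k ring" (structure) and A :: "int \<Rightarrow> ('k, 'a) module" and d :: "int \<Rightarrow> 'a \<Rightarrow> 'a"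
    and pi :: "nat \<Rightarrow> int \<Rightarrow> ('k, 'a) tens \<Rightarrow> 'a" and star :: "int \<Rightarrow> 'a \<Rightarrow> 'a" +
  fixes \<rho> :: 'k
  assumes \<rho>: "\<rho> \<in> carrier K" "\<rho> \<otimes> \<rho> = \<one>"
begin

lemma multilinear_r: "multilinear (n + 1) m (tpow (n + 1) m)
    (\<lambda>w. \<rho> \<odot>\<^bsub>tpow (n + 1) m\<^esub> msign (tpow (n + 1) m) (\<Sum>j\<in>{1..n}. \<Sum>i\<in>{1..<j}. fst (w ! i) * fst (w ! j))
      (pure (hd (starw w) # rev (tl (starw w)))))"
proof (rule multilinear_comp[OF multilinear_msign[OF module_tpow multilinear_reflect]])
  show "(\<lambda>x. \<rho> \<odot>\<^bsub>tpow (n + 1) m\<^esub> x) \<in> mod_hom K (tpow (n + 1) m) (tpow (n + 1) m)"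
    by (rule mod_hom_scale[OF module_tpow mod_hom_ident \<rho>(1)])
  fix w w' assume w: "w \<in> words (n + 1) m" "w' \<in> words (n + 1) m" and eq: "map fst w = map fst w'"
  have "fst (w ! i) = fst (w' ! i)" if "i < n + 1" for i
    using w eq that by (metis nth_map words_iff)
  then show "(\<Sum>j\<in>{1..n}. \<Sum>i\<in>{1..<j}. fst (w ! i) * fst (w ! j)) = (\<Sum>j\<in>{1..n}. \<Sum>i\<in>{1..<j}. fst (w' ! i) * fst (w' ! j))"
    by (intro sum.cong refl) auto
qed

lemma r_eq: "r \<rho> n m = tpow_lift (n + 1) m (tpow (n + 1) m)
    (\<lambda>w. \<rho> \<odot>\<^bsub>tpow (n + 1) m\<^esub> msign (tpow (n + 1) m) (\<Sum>j\<in>{1..n}. \<Sum>i\<in>{1..<j}. fst (w ! i) * fst (w ! j))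
      (pure (hd (starw w) # rev (tl (starw w)))))"
  by (simp add: r_def X_def starw_def Let_def)

lemma R_hom: "R \<rho> n m \<in> mod_hom K (tpow (n + 1) m) (tpow (n + 1) m)"
  unfolding R_def[abs_def] X_def r_eq
  by (rule mod_hom_msign_comp[OF module_tpow tpow_lift_hom[OF module_tpow multilinear_r]])

lemma R_ps:
  assumes w: "(q, a) # v \<in> words (n + 1) m"
  shows "R \<rho> n m (ps ((q, a) # v)) =
    \<rho> \<odot>\<^bsub>tpow (n + 1) m\<^esub> msign (tpow (n + 1) m) (int n + e2s v) (ps ((q, star q a) # rev (starw v)))"
proof -
  note One_nat_def [simp del]
  let ?G = "tpow (n + 1) m"
  let ?w = "(q, star q a) # rev (starw v)"
  have n: "n = length v" using w by (simp add: words_iff)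
  have w': "?w \<in> words (n + 1) m" using w by (auto simp: words_iff star_closed)
  have "r \<rho> n m (pure ((q, a) # v)) = \<rho> \<odot>\<^bsub>?G\<^esub> msign ?G (e2 v) (pure ?w)"
    using tpow_lift_pure[OF module_tpow multilinear_r w] tail_sum[of "(q, a) # v" n] n
    by (simp add: r_eq del: One_nat_def)
  then have R: "R \<rho> n m (pure ((q, a) # v)) = \<rho> \<odot>\<^bsub>?G\<^esub> msign ?G (tri (Suc n) + e2 v) (pure ?w)"
    using w' \<rho> pure_closed[OF w'] by (simp add: R_def X_def tri_eq msign_smult[OF module_tpow] msign_msign[OF module_tpow] del: pure_closed)
  have "R \<rho> n m (ps ((q, a) # v)) = \<rho> \<odot>\<^bsub>?G\<^esub> msign ?G (iota ((q, a) # v) + int (n + 1) + 1 + (tri (Suc n) + e2 v)) (pure ?w)"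
    unfolding ps_eq[OF w] mod_hom_msign[OF module_tpow module_tpow R_hom pure_closed[OF w]] R
    using pure_closed[OF w'] \<rho>(1) by (simp add: msign_smult[OF module_tpow] msign_msign[OF module_tpow] del: pure_closed)
  also have "msign ?G (iota ((q, a) # v) + int (n + 1) + 1 + (tri (Suc n) + e2 v)) (pure ?w) =
    msign ?G (int n + e2s v + (iota ?w + int (n + 1) + 1)) (pure ?w)"
  proof (rule msign_cong)
    have "iota ((q, a) # v) + int (n + 1) + 1 + (tri (Suc n) + e2 v) - (int n + e2s v + (iota ?w + int (n + 1) + 1)) =
      2 * (iota v - (int n - 1) * wdeg v)"
      by (simp add: e2s_e2 iota_rev n tri_Suc algebra_simps)
    then show "even (iota ((q, a) # v) + int (n + 1) + 1 + (tri (Suc n) + e2 v) - (int n + e2s v + (iota ?w + int (n + 1) + 1)))"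
      by (metis dvd_triv_left)
  qed
  also have "\<dots> = msign ?G (int n + e2s v) (ps ?w)"
    unfolding ps_eq[OF w'] by (rule msign_msign[OF module_tpow pure_closed[OF w'], symmetric])
  finally show ?thesis .
qed

lemma words_Suc_cases:
  assumes "w \<in> words (n + 1) m" obtains q a v where "w = (q, a) # v" "length v = n" "word v" "a \<in> carrier (A q)"
  using assms that by (cases w) (auto simp: words_iff)

lemma R_R:
  assumes x: "x \<in> carrier (tpow (n + 1) m)"
  shows "R \<rho> n m (R \<rho> n m x) = x"
proof (rule ps_hom_eqI[OF module_tpow mod_hom_comp[OF R_hom R_hom] mod_hom_ident _ x])
  fix w assume w: "w \<in> words (n + 1) m"
  note One_nat_def [simp del]
  let ?G = "tpow (n + 1) m"
  from w obtain q a v where v: "w = (q, a) # v" "length v = n" "word v" "a \<in> carrier (A q)" by (rule words_Suc_cases)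
  have w': "(q, star q a) # rev (starw v) \<in> words (n + 1) m" using w v by (auto simp: words_iff star_closed)
  note pw = ps_closed[OF w[unfolded v(1)]] ps_closed[OF w']
  show "R \<rho> n m (R \<rho> n m (ps w)) = ps w"
    unfolding v(1) R_ps[OF w[unfolded v(1)]]
    using pw \<rho> v(3,4) R_ps[OF w'] star_star[OF v(4)]
    by (simp add: mod_hom_smult[OF R_hom] mod_hom_msign[OF module_tpow module_tpow R_hom] msign_smult[OF module_tpow]
        msign_msign[OF module_tpow] tp.smult_assoc1[symmetric] del: ps_closed)
qed

lemma T_R_T:
  assumes x: "x \<in> carrier (tpow (n + 1) m)"
  shows "T n m (R \<rho> n m (T n m x)) = R \<rho> n m x"
proof (rule ps_hom_eqI[OF module_tpow mod_hom_comp[OF mod_hom_comp[OF T_hom R_hom] T_hom] R_hom _ x])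
  fix w assume w: "w \<in> words (n + 1) m"
  note One_nat_def [simp del]
  let ?G = "tpow (n + 1) m"
  note [simp] = mod_hom_smult[OF R_hom] mod_hom_msign[OF module_tpow module_tpow R_hom] mod_hom_smult[OF T_hom]
    mod_hom_msign[OF module_tpow module_tpow T_hom] msign_smult[OF module_tpow] msign_msign[OF module_tpow] \<rho>
  from w obtain q a v where v: "w = (q, a) # v" "length v = n" "word v" "a \<in> carrier (A q)" by (rule words_Suc_cases)
  show "T n m (R \<rho> n m (T n m (ps w))) = R \<rho> n m (ps w)"
  proof (cases v rule: rev_cases)
    case Nil
    have w0: "[] @ [(q, b)] \<in> words (n + 1) m" if "b \<in> carrier (A q)" for b
      using w that by (auto simp: v Nil words_iff)
    have wa: "[(q, a)] \<in> words (n + 1) m" "[(q, star q a)] \<in> words (n + 1) m" using w0[OF v(4)] w0[OF star_closed[OF v(4)]] by auto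
    note pw = ps_closed[OF wa(1)] ps_closed[OF wa(2)]
    show ?thesis unfolding v(1) Nil
      using T_ps[OF w0[OF v(4)]] T_ps[OF w0[OF star_closed[OF v(4)]]] R_ps[OF wa(1)] pw by (simp del: ps_closed)
  next
    case (snoc v' c)
    obtain q' b where c: "c = (q', b)" by (cases c)
    have b: "b \<in> carrier (A q')" "word v'" "length v' + 1 = n" using v snoc c by auto
    have w1: "((q, a) # v') @ [(q', b)] \<in> words (n + 1) m" using w v snoc c by simp
    have w2: "(q', b) # (q, a) # v' \<in> words (n + 1) m" using w1 by (auto simp: words_iff)
    have w3: "((q', star q' b) # rev (starw v')) @ [(q, star q a)] \<in> words (n + 1) m"
      using w1 by (auto simp: words_iff star_closed)
    have w4: "(q, star q a) # (q', star q' b) # rev (starw v') \<in> words (n + 1) m"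
      using w1 by (auto simp: words_iff star_closed)
    note pw = ps_closed[OF w2] ps_closed[OF w3] ps_closed[OF w4]
    have "T n m (R \<rho> n m (T n m (ps w))) = \<rho> \<odot>\<^bsub>?G\<^esub> msign ?G
      ((q' + 1) * sdeg ((q, a) # v') + (int n + e2s ((q, a) # v') + (q + 1) * sdeg ((q', star q' b) # rev (starw v'))))
      (ps ((q, star q a) # (q', star q' b) # rev (starw v')))"
      using T_ps[OF w1] R_ps[OF w2] T_ps[OF w3] pw by (simp add: v(1) snoc c add.assoc del: ps_closed sdeg_simps e2s.simps)
    also have "\<dots> = \<rho> \<odot>\<^bsub>?G\<^esub> msign ?G (int n + e2s (v' @ [(q', b)])) (ps ((q, star q a) # (q', star q' b) # rev (starw v')))"
    proof (rule arg_cong[of _ _ "\<lambda>y. \<rho> \<odot>\<^bsub>?G\<^esub> y"], rule msign_cong)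
      have "(q' + 1) * sdeg ((q, a) # v') + (int n + e2s ((q, a) # v') + (q + 1) * sdeg ((q', star q' b) # rev (starw v')))
        - (int n + e2s (v' @ [(q', b)])) = 2 * ((q + 1) * (q' + 1) + (q + 1) * sdeg v')"
        by (simp add: e2s_append algebra_simps)
      then show "even ((q' + 1) * sdeg ((q, a) # v') + (int n + e2s ((q, a) # v') + (q + 1) * sdeg ((q', star q' b) # rev (starw v')))
        - (int n + e2s (v' @ [(q', b)])))" by (metis dvd_triv_left)
    qed
    also have "\<dots> = R \<rho> n m (ps w)" using R_ps[of q a "v' @ [(q', b)]" n m] w v snoc c by simp
    finally show ?thesis .
  qed
qed

text \<open>
  Reversal keeps the first letter in its place. The block of the first \<open>k + 1\<close> letters is moved to the
  first and the last \<open>k\<close> letters, and \<open>T\<^sup>k\<close> brings it to the front again, in reversed order.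
\<close>

lemma R_Dk:
  assumes k: "k \<le> n" and x: "x \<in> carrier (tpow (n + 1) m)"
  shows "R \<rho> (n - k) (m + (int k - 1)) (Dk k 0 n m x) = Dk k 0 n m ((T n m ^^ k) (R \<rho> n m x))"
proof -
  note One_nat_def [simp del]
  have nk: "n + 1 - k = (n - k) + 1" using k by simp
  let ?G = "tpow (n + 1) m" and ?H = "tpow (n + 1 - k) (m + (int k - 1))"
  have Dh: "Dk k 0 n m \<in> mod_hom K ?G ?H" using Dk_hom[of 0 k n m] k by simp
  have Rh: "R \<rho> (n - k) (m + (int k - 1)) \<in> mod_hom K ?H ?H" using R_hom[of "n - k"] unfolding nk .
  have Th: "(\<lambda>x. (T n m ^^ i) x) \<in> mod_hom K ?G ?G" for i
  proof (induction i)
    case 0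
    then show ?case by (simp add: mod_hom_ident)
  next
    case (Suc i)
    then show ?case using mod_hom_comp[OF Suc T_hom] by simp
  qed
  note [simp] = mod_hom_smult[OF R_hom] mod_hom_msign[OF module_tpow module_tpow R_hom] mod_hom_smult[OF Th]
    mod_hom_msign[OF module_tpow module_tpow Th] mod_hom_smult[OF Dh] mod_hom_msign[OF module_tpow module_tpow Dh]
    msign_smult[OF module_tpow] msign_msign[OF module_tpow] \<rho>
  show ?thesis
  proof (rule ps_hom_eqI[OF module_tpow mod_hom_comp[OF Dh Rh] mod_hom_comp[OF mod_hom_comp[OF R_hom Th] Dh] _ x])
    fix w assume w: "w \<in> words (n + 1) m"
    from w obtain q a v0 where v0: "w = (q, a) # v0" "length v0 = n" "word v0" "a \<in> carrier (A q)" by (rule words_Suc_cases)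
    define B' v where "B' = take k v0" and "v = drop k v0"
    have s: "w = (q, a) # B' @ v" "length B' = k" "length v = n - k" "word B'" "word v"
      using v0 k by (auto simp: B'_def v_def)
    let ?B = "(q, a) # B'" and ?B2 = "rev (starw B') @ [(q, star q a)]"
    have B: "?B \<in> words (k + 1) (wdeg ?B)" using s v0 by (simp add: words_iff)
    have deg: "wdeg ?B + wdeg v = m" using w s by (simp add: words_iff)
    let ?r = "wdeg ?B + (int k - 1)"
    have mB: "mop k ?B \<in> carrier (A ?r)" by (rule mop_closed[OF B])
    have w1: "(?r, mop k ?B) # v \<in> words ((n - k) + 1) (m + (int k - 1))"
      using mB s deg by (simp add: words_iff)
    have w2: "(q, star q a) # rev (starw v) @ rev (starw B') \<in> words (n + 1) m"
      using w s by (auto simp: words_iff star_closed)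
    have w3: "?B2 @ rev (starw v) \<in> words (n + 1) m" using w s by (auto simp: words_iff star_closed)
    have B2: "?B2 \<in> words (k + 1) (wdeg ?B)" using B by (auto simp: words_iff star_closed)
    have mB2: "mop k ?B2 \<in> carrier (A ?r)" by (rule mop_closed[OF B2])
    have w4: "(?r, mop k ?B2) # rev (starw v) \<in> words (n + 1 - k) (m + (int k - 1))"
      using mB2 s deg k by (simp add: words_iff)
    note pw = ps_closed[OF w1[folded nk]] ps_closed[OF w2] ps_closed[OF w3] ps_closed[OF w4]
    have D1: "Dk k 0 n m (ps w) = ps ((?r, mop k ?B) # v)"
      using Dk_ps[of "[]" ?B v n m 0 k] w s by simp
    have star: "star ?r (mop k ?B) = msign (A ?r) (int k + e2s ?B) (mop k ?B2)"
      using star_mop[OF B] by simp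
    have slot: "ps ((?r, msign (A ?r) e (mop k ?B2)) # rev (starw v)) = msign ?H e (ps ((?r, mop k ?B2) # rev (starw v)))" for e
    proof -
      have e: "length ([] :: (int \<times> 'a) list) + 1 + length (rev (starw v)) = n + 1 - k"
        "wdeg [] + ?r + wdeg (rev (starw v)) = m + (int k - 1)" using s deg k by auto
      have wv: "word []" "word (rev (starw v))" using s by simp_all
      have "ps ([] @ (?r, msign (A ?r) e (mop k ?B2)) # rev (starw v)) = msign ?H e (ps ([] @ (?r, mop k ?B2) # rev (starw v)))"
        using ps_slot_msign[OF wv mB2, of e] unfolding e .
      then show ?thesis by simp
    qed
    have L: "R \<rho> (n - k) (m + (int k - 1)) (Dk k 0 n m (ps w)) =
      \<rho> \<odot>\<^bsub>?H\<^esub> msign ?H (int (n - k) + e2s v + (int k + e2s ?B)) (ps ((?r, mop k ?B2) # rev (starw v)))"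
      unfolding D1 R_ps[OF w1] star nk[symmetric] slot using pw by (simp del: ps_closed e2s.simps)
    have R1: "R \<rho> n m (ps w) = \<rho> \<odot>\<^bsub>?G\<^esub> msign ?G (int n + e2s (B' @ v)) (ps (((q, star q a) # rev (starw v)) @ rev (starw B')))"
      using R_ps[of q a "B' @ v" n m] w s by simp
    have T1: "(T n m ^^ k) (ps (((q, star q a) # rev (starw v)) @ rev (starw B'))) =
      msign ?G (sdeg ((q, star q a) # rev (starw v)) * sdeg B') (ps (?B2 @ rev (starw v)))"
      using T_block[of "(q, star q a) # rev (starw v)" "rev (starw B')" n m] w2 s by simp
    have D2: "Dk k 0 n m (ps (?B2 @ rev (starw v))) = ps ((?r, mop k ?B2) # rev (starw v))"
      using Dk_ps[of "[]" ?B2 "rev (starw v)" n m 0 k] w3 s by (simp add: add_ac)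
    have "Dk k 0 n m ((T n m ^^ k) (R \<rho> n m (ps w))) = \<rho> \<odot>\<^bsub>?H\<^esub> msign ?H
      (int n + e2s (B' @ v) + sdeg ((q, star q a) # rev (starw v)) * sdeg B') (ps ((?r, mop k ?B2) # rev (starw v)))"
      unfolding R1 using T1 D2 pw by (simp del: ps_closed sdeg_simps)
    also have "\<dots> = \<rho> \<odot>\<^bsub>?H\<^esub> msign ?H (int (n - k) + e2s v + (int k + e2s ?B)) (ps ((?r, mop k ?B2) # rev (starw v)))"
    proof (rule arg_cong[of _ _ "\<lambda>y. \<rho> \<odot>\<^bsub>?H\<^esub> y"], rule msign_cong)
      have "int n + e2s (B' @ v) + sdeg ((q, star q a) # rev (starw v)) * sdeg B' - (int (n - k) + e2s v + (int k + e2s ?B))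
        = 2 * (sdeg B' * sdeg v)"
        using k by (simp add: e2s_append of_nat_diff algebra_simps)
      then show "even (int n + e2s (B' @ v) + sdeg ((q, star q a) # rev (starw v)) * sdeg B' - (int (n - k) + e2s v + (int k + e2s ?B)))"
        by (metis dvd_triv_left)
    qed
    finally show "R \<rho> (n - k) (m + (int k - 1)) (Dk k 0 n m (ps w)) = Dk k 0 n m ((T n m ^^ k) (R \<rho> n m (ps w)))"
      using L by simp
  qed
qed

end

section \<open>The operators of the dihedral module\<close>

context dg_module
begin

text \<open>A word of negative degree contains a letter of negative degree, which is zero.\<close>

lemma tpow_negative:
  assumes "p < 0" and x: "x \<in> carrier (tpow l p)"
  shows "x = \<zero>\<^bsub>tpow l p\<^esub>"
proof (rule tpow_hom_eqI[OF module_tpow mod_hom_ident mod_hom_const_zero[OF module_tpow] _ x])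
  fix w assume w: "w \<in> words l p"
  have "\<exists>c\<in>set w. fst c < 0"
  proof (rule ccontr)
    assume "\<not> ?thesis"
    then have nonneg: "0 \<le> fst c" if "c \<in> set w" for c using that by (meson not_less)
    have "0 \<le> wdeg w" unfolding wdeg_def by (rule sum_list_nonneg) (use nonneg in auto)
    then show False using w assms(1) by (simp add: words_iff)
  qed
  then obtain q a where c: "(q, a) \<in> set w" "q < 0" by auto
  then obtain u v where s: "w = u @ (q, a) # v" by (meson split_list)
  have wd: "word u" "word v" "a \<in> carrier (A q)" and l: "l = length u + 1 + length v" and p: "p = wdeg u + q + wdeg v"
    using w by (auto simp: s words_iff)
  have "a = \<zero>\<^bsub>A q\<^esub>" using A_neg[OF c(2)] wd(3) by simp
  then show "pure w = \<zero>\<^bsub>tpow l p\<^esub>"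
    using mod_hom_zero[OF A_module module_tpow slot_hom[OF wd(1,2)], of q] by (simp only: s l p)
qed

end

context A_infinity_algebra
begin

lemma split_word:
  assumes "w \<in> words l m" "i + j \<le> l"
  obtains u B v where "w = u @ B @ v" "length u = i" "length B = j"
  using assms by (intro that[of "take i w" "take j (drop i w)" "drop j (drop i w)"])
    (auto simp: words_iff append_take_drop_id min_def simp del: drop_drop)

text \<open>
  Both orders produce the same word. If the left block is merged first, the right operation passes it
  with the degree lowered by one, whence the opposite sign.
\<close>

lemma disjoint_Dk:
  assumes j: "1 \<le> j" "j + k + l \<le> n" and x: "x \<in> carrier (tpow (n + 1) p)"
  shows "Dk k 0 (n - l) (p + (int l - 1)) (Dk l (j + k) n p x) \<oplus>\<^bsub>tpow (n + 1 - (k + l)) (p + int k + int l - 2)\<^esub>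
    Dk l j (n - k) (p + (int k - 1)) (Dk k 0 n p x) = \<zero>\<^bsub>tpow (n + 1 - (k + l)) (p + int k + int l - 2)\<^esub>"
proof -
  let ?G = "tpow (n + 1 - (k + l)) (p + int k + int l - 2)"
  have nl: "n - l + 1 = n + 1 - l" "n - k + 1 = n + 1 - k" "n - l + 1 - k = n + 1 - (k + l)" "n - k + 1 - l = n + 1 - (k + l)"
    and pp: "p + (int l - 1) + (int k - 1) = p + int k + int l - 2" "p + (int k - 1) + (int l - 1) = p + int k + int l - 2"
    using j by auto
  have h1: "Dk k 0 (n - l) (p + (int l - 1)) \<in> mod_hom K (tpow (n + 1 - l) (p + (int l - 1))) ?G"
    using Dk_hom[of 0 k "n - l" "p + (int l - 1)"] j unfolding nl(3) unfolding nl(1) pp by simp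
  have h2: "Dk l j (n - k) (p + (int k - 1)) \<in> mod_hom K (tpow (n + 1 - k) (p + (int k - 1))) ?G"
    using Dk_hom[of j l "n - k" "p + (int k - 1)"] j unfolding nl(4) unfolding nl(2) pp by simp
  have h3: "Dk l (j + k) n p \<in> mod_hom K (tpow (n + 1) p) (tpow (n + 1 - l) (p + (int l - 1)))"
    using Dk_hom[of "j + k" l n p] j by simp
  have h4: "Dk k 0 n p \<in> mod_hom K (tpow (n + 1) p) (tpow (n + 1 - k) (p + (int k - 1)))"
    using Dk_hom[of 0 k n p] j by simp
  show ?thesis
  proof (rule ps_hom_eqI[OF module_tpow mod_hom_plus[OF module_tpow mod_hom_comp[OF h3 h1] mod_hom_comp[OF h4 h2]]
        mod_hom_const_zero[OF module_tpow] _ x])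
    fix w assume w: "w \<in> words (n + 1) p"
    obtain B u' w2 where s1: "w = B @ u' @ w2" "length B = k + 1" "length u' = j - 1"
      using split_word[OF w, of "k + 1" "j - 1"] j by auto
    obtain B2 v where s2: "w2 = B2 @ v" "length B2 = l + 1"
    proof
      show "w2 = take (l + 1) w2 @ drop (l + 1) w2" by simp
      show "length (take (l + 1) w2) = l + 1" using w s1 j by (auto simp: words_iff)
    qed
    have wd: "word B" "word u'" "word B2" "word v" using w by (auto simp: s1 s2 words_iff)
    have deg: "p = wdeg B + wdeg u' + wdeg B2 + wdeg v" and len: "n = k + j + l + length v"
      using w s1 s2 j by (auto simp: words_iff)
    let ?r1 = "wdeg B + (int k - 1)" and ?r2 = "wdeg B2 + (int l - 1)"
    have m1: "mop k B \<in> carrier (A ?r1)" and m2: "mop l B2 \<in> carrier (A ?r2)"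
      using mop_closed[of B k "wdeg B"] mop_closed[of B2 l "wdeg B2"] s1 s2 wd by (auto simp: words_iff)
    let ?w = "(?r1, mop k B) # u' @ (?r2, mop l B2) # v"
    have w1: "(B @ u') @ (?r2, mop l B2) # v \<in> words (n + 1 - l) (p + (int l - 1))"
      and w2: "((?r1, mop k B) # u') @ B2 @ v \<in> words (n + 1 - k) (p + (int k - 1))"
      and w3: "?w \<in> words (n + 1 - (k + l)) (p + int k + int l - 2)"
      using m1 m2 wd s1 s2 j by (auto simp: words_iff deg len)
    have a1: "Dk l (j + k) n p (ps w) = msign (tpow (n + 1 - l) (p + (int l - 1))) (sdeg (B @ u')) (ps ((B @ u') @ (?r2, mop l B2) # v))"
      using Dk_ps[of "B @ u'" B2 v n p "j + k" l] w s1 s2 j by simp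
    have a2: "Dk k 0 (n - l) (p + (int l - 1)) (ps ((B @ u') @ (?r2, mop l B2) # v)) = ps ?w"
      using Dk_ps[of "[]" B "u' @ (?r2, mop l B2) # v" "n - l" "p + (int l - 1)" 0 k] w1 s1 unfolding nl(1) by simp
    have a3: "Dk k 0 n p (ps w) = ps (((?r1, mop k B) # u') @ B2 @ v)"
      using Dk_ps[of "[]" B "u' @ B2 @ v" n p 0 k] w s1 s2 by simp
    have a4: "Dk l j (n - k) (p + (int k - 1)) (ps (((?r1, mop k B) # u') @ B2 @ v)) = msign ?G (sdeg ((?r1, mop k B) # u')) (ps ?w)"
      using Dk_ps[of "(?r1, mop k B) # u'" B2 v "n - k" "p + (int k - 1)" j l] w2 s1 s2 j unfolding nl(4) pp unfolding nl(2) by simp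
    have d1: "Dk k 0 (n - l) (p + (int l - 1)) (Dk l (j + k) n p (ps w)) = msign ?G (sdeg (B @ u')) (ps ?w)"
      unfolding a1 mod_hom_msign[OF module_tpow module_tpow h1 ps_closed[OF w1]] a2 ..
    have odd: "odd (sdeg (B @ u') + sdeg ((?r1, mop k B) # u'))"
    proof -
      have "sdeg (B @ u') + sdeg ((?r1, mop k B) # u') = 2 * (wdeg B + int k + sdeg u') + 1"
        using s1 by (simp add: sdeg_def)
      then show ?thesis by (metis odd_two_times_div_two_succ even_plus_one_iff dvd_triv_left)
    qed
    show "Dk k 0 (n - l) (p + (int l - 1)) (Dk l (j + k) n p (ps w)) \<oplus>\<^bsub>?G\<^esub>
      Dk l j (n - k) (p + (int k - 1)) (Dk k 0 n p (ps w)) = \<zero>\<^bsub>?G\<^esub>"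
      unfolding d1 a3 a4 by (rule msign_odd_add[OF module_tpow ps_closed[OF w3] odd])
  qed
qed

text \<open>
  Only the first \<open>s + 1\<close> letters are involved, and on these the sum is the relation of the \<open>A\<^sub>\<infinity>\<close>-algebra
  placed in the first slot of the remaining word.
\<close>

lemma nested_Dk:
  assumes s: "s \<le> n" and x: "x \<in> carrier (tpow (n + 1) p)"
  shows "(\<Oplus>\<^bsub>tpow (n + 1 - s) (p + int s - 2)\<^esub>k\<in>{0..s}. \<Oplus>\<^bsub>tpow (n + 1 - s) (p + int s - 2)\<^esub>c\<in>{0..k}.
    Dk k 0 (n - (s - k)) (p + (int (s - k) - 1)) (Dk (s - k) c n p x)) = \<zero>\<^bsub>tpow (n + 1 - s) (p + int s - 2)\<^esub>"
proof -
  note of_nat_diff [simp del] Nat.diff_diff_right [simp del]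
  let ?G = "tpow (n + 1 - s) (p + int s - 2)"
  have G: "module K ?G" by (rule module_tpow)
  have num: "n - (s - k) + 1 = n + 1 - (s - k)" "n - (s - k) + 1 - k = n + 1 - s"
    "p + (int (s - k) - 1) + (int k - 1) = p + int s - 2" if "k \<le> s" for k
    using that s by (auto simp: of_nat_diff)
  have h1: "Dk k 0 (n - (s - k)) (p + (int (s - k) - 1)) \<in> mod_hom K (tpow (n + 1 - (s - k)) (p + (int (s - k) - 1))) ?G"
    if "k \<le> s" for k
    using Dk_hom[of 0 k "n - (s - k)" "p + (int (s - k) - 1)"] that s unfolding num(2)[OF that] unfolding num(1,3)[OF that] by simp
  have h2: "Dk (s - k) c n p \<in> mod_hom K (tpow (n + 1) p) (tpow (n + 1 - (s - k)) (p + (int (s - k) - 1)))"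
    if "c \<le> k" "k \<le> s" for c k
    by (rule Dk_hom) (use that s in auto)
  have hom: "(\<lambda>x. \<Oplus>\<^bsub>?G\<^esub>k\<in>{0..s}. \<Oplus>\<^bsub>?G\<^esub>c\<in>{0..k}. Dk k 0 (n - (s - k)) (p + (int (s - k) - 1)) (Dk (s - k) c n p x))
    \<in> mod_hom K (tpow (n + 1) p) ?G"
    by (intro mod_hom_sum[OF module_tpow G] mod_hom_comp[OF h2 h1]) auto
  show ?thesis
  proof (rule ps_hom_eqI[OF G hom mod_hom_const_zero[OF G] _ x])
    fix w assume w: "w \<in> words (n + 1) p"
    obtain W v where wv: "w = W @ v" "length W = s + 1"
    proof
      show "w = take (s + 1) w @ drop (s + 1) w" by simp
      show "length (take (s + 1) w) = s + 1" using w s by (auto simp: words_iff)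
    qed
    let ?q = "wdeg W"
    have W: "W \<in> words (s + 1) ?q" and wdv: "word v" and deg: "p = ?q + wdeg v" and len: "n = s + length v"
      using w wv by (auto simp: words_iff)
    let ?H = "A (?q + int s - 2)"
    define f where "f a = ps ([] @ (?q + int s - 2, a) # v)" for a
    have f: "f \<in> mod_hom K ?H ?G"
    proof -
      have e: "length ([] :: (int \<times> 'a) list) + 1 + length v = n + 1 - s" "wdeg [] + (?q + int s - 2) + wdeg v = p + int s - 2"
        by (simp_all add: deg len)
      have Suc_n: "Suc n - s = Suc (length v)" using len by simp
      show ?thesis using ps_slot_hom[OF word_simps(1) wdv, of "?q + int s - 2"] unfolding e by (simp add: f_def[abs_def] Suc_n)
    qed
    define M' where "M' k c = mop k (take c W @ (wdeg (take (s - k + 1) (drop c W)) + (int (s - k) - 1), mop (s - k) (take (s - k + 1) (drop c W)))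
          # drop (c + (s - k) + 1) W)" for k c
    have trm: "Dk k 0 (n - (s - k)) (p + (int (s - k) - 1)) (Dk (s - k) c n p (ps w)) = f (msign ?H (sdeg (take c W)) (M' k c))
      \<and> M' k c \<in> carrier ?H"
      if ck: "c \<le> k" "k \<le> s" for k c
    proof -
      let ?l = "s - k"
      obtain u B v' where S: "W = u @ B @ v'" "length u = c" "length B = ?l + 1"
        by (rule split_word[OF W, of c "?l + 1"]) (use ck in auto)
      have v': "length v' = k - c" using S wv ck by auto
      have wd: "word u" "word B" "word v'" using W by (auto simp: S words_iff)
      let ?r = "wdeg B + (int ?l - 1)"
      have mB: "mop ?l B \<in> carrier (A ?r)" using mop_closed[of B ?l "wdeg B"] S wd by (simp add: words_iff)
      let ?V = "u @ (?r, mop ?l B) # v'"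
      have M': "M' k c = mop k ?V" using S by (simp add: M'_def)
      have V: "?V \<in> words (k + 1) (?q + (int ?l - 1))"
        using wd mB v' S ck by (auto simp: words_iff)
      have dV: "?q + (int ?l - 1) + (int k - 1) = ?q + int s - 2" using ck by (simp add: of_nat_diff)
      have Mc: "M' k c \<in> carrier ?H" using mop_closed[OF V] unfolding dV M' .
      have w1: "?V @ v \<in> words (n + 1 - ?l) (p + (int ?l - 1))"
        using V wdv ck by (auto simp: words_iff deg len)
      have a1: "Dk ?l c n p (ps w) = msign (tpow (n + 1 - ?l) (p + (int ?l - 1))) (sdeg u) (ps (?V @ v))"
        using Dk_ps[of u B "v' @ v" n p c ?l] w S wv by simp
      have a2: "Dk k 0 (n - ?l) (p + (int ?l - 1)) (ps (?V @ v)) = f (M' k c)"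
      proof -
        have dq: "wdeg ?V + (int k - 1) = ?q + int s - 2" and lV: "length ?V = k + 1" using V dV unfolding words_iff by auto
        have "Dk k 0 (n - ?l) (p + (int ?l - 1)) (ps ([] @ ?V @ v)) =
          msign (tpow (n - ?l + 1 - k) (p + (int ?l - 1) + (int k - 1))) (sdeg []) (ps ([] @ (wdeg ?V + (int k - 1), mop k ?V) # v))"
          by (rule Dk_ps) (use w1 lV in \<open>simp_all only: num(1)[OF ck(2)] append_Nil list.size(3)\<close>)
        then show ?thesis unfolding dq f_def M' by (simp only: append_Nil sdeg_simps msign_even even_zero)
      qed
      have "Dk k 0 (n - ?l) (p + (int ?l - 1)) (Dk ?l c n p (ps w)) = msign ?G (sdeg u) (f (M' k c))"
        unfolding a1 mod_hom_msign[OF module_tpow module_tpow h1[OF ck(2)] ps_closed[OF w1]] a2 ..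
      also have "\<dots> = f (msign ?H (sdeg u) (M' k c))" by (rule mod_hom_msign[OF A_module G f Mc, symmetric])
      finally show ?thesis using Mc S by simp
    qed
    have c1: "msign ?H (sdeg (take c W)) (M' k c) \<in> carrier ?H" if "c \<le> k" "k \<le> s" for k c
      using trm[OF that] by simp
    have "(\<Oplus>\<^bsub>?G\<^esub>k\<in>{0..s}. \<Oplus>\<^bsub>?G\<^esub>c\<in>{0..k}. Dk k 0 (n - (s - k)) (p + (int (s - k) - 1)) (Dk (s - k) c n p (ps w))) =
      (\<Oplus>\<^bsub>?G\<^esub>k\<in>{0..s}. f (\<Oplus>\<^bsub>?H\<^esub>c\<in>{0..k}. msign ?H (sdeg (take c W)) (M' k c)))"
    proof (rule finsum_congr[OF G])
      fix k assume "k \<in> {0..s}"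
      then have k: "k \<le> s" by simp
      have "(\<Oplus>\<^bsub>?G\<^esub>c\<in>{0..k}. Dk k 0 (n - (s - k)) (p + (int (s - k) - 1)) (Dk (s - k) c n p (ps w))) =
        (\<Oplus>\<^bsub>?G\<^esub>c\<in>{0..k}. f (msign ?H (sdeg (take c W)) (M' k c)))"
      proof (rule finsum_congr[OF G])
        fix c assume "c \<in> {0..k}"
        then have c: "c \<le> k" by simp
        show "Dk k 0 (n - (s - k)) (p + (int (s - k) - 1)) (Dk (s - k) c n p (ps w)) = f (msign ?H (sdeg (take c W)) (M' k c))"
          using trm[OF c k] by (rule conjunct1)
        show "f (msign ?H (sdeg (take c W)) (M' k c)) \<in> carrier ?G" by (rule mod_hom_closed[OF f c1[OF c k]])
      qed
      also have "\<dots> = f (\<Oplus>\<^bsub>?H\<^esub>c\<in>{0..k}. msign ?H (sdeg (take c W)) (M' k c))"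
        by (rule mod_hom_finsum[OF A_module G f, symmetric]) (rule c1, use k in auto)
      finally show "(\<Oplus>\<^bsub>?G\<^esub>c\<in>{0..k}. Dk k 0 (n - (s - k)) (p + (int (s - k) - 1)) (Dk (s - k) c n p (ps w))) =
        f (\<Oplus>\<^bsub>?H\<^esub>c\<in>{0..k}. msign ?H (sdeg (take c W)) (M' k c))" .
      show "f (\<Oplus>\<^bsub>?H\<^esub>c\<in>{0..k}. msign ?H (sdeg (take c W)) (M' k c)) \<in> carrier ?G"
        by (rule mod_hom_closed[OF f], rule finsum_in_carrier[OF A_module], rule c1) (use k in auto)
    qed
    also have "\<dots> = f (\<Oplus>\<^bsub>?H\<^esub>k\<in>{0..s}. \<Oplus>\<^bsub>?H\<^esub>c\<in>{0..k}. msign ?H (sdeg (take c W)) (M' k c))"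
      by (rule mod_hom_finsum[OF A_module G f, symmetric], rule finsum_in_carrier[OF A_module], rule c1) auto
    also have "\<dots> = f \<zero>\<^bsub>?H\<^esub>" using A_infinity_suspended[OF W] unfolding M'_def by simp
    also have "\<dots> = \<zero>\<^bsub>?G\<^esub>" by (rule mod_hom_zero[OF A_module G f])
    finally show "(\<Oplus>\<^bsub>?G\<^esub>k\<in>{0..s}. \<Oplus>\<^bsub>?G\<^esub>c\<in>{0..k}. Dk k 0 (n - (s - k)) (p + (int (s - k) - 1)) (Dk (s - k) c n p (ps w))) = \<zero>\<^bsub>?G\<^esub>" .
  qed
qed

end

context dihedral_sign
begin

lemma T_cyclic:
  assumes x: "x \<in> carrier (tpow (n + 1) m)"
  shows "(T n m ^^ (n + 1)) x = x"
proof -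
  let ?G = "tpow (n + 1) m"
  have Th: "(\<lambda>x. (T n m ^^ i) x) \<in> mod_hom K ?G ?G" for i
  proof (induction i)
    case 0
    then show ?case by (simp add: mod_hom_ident)
  next
    case (Suc i)
    then show ?case using mod_hom_comp[OF Suc T_hom] by simp
  qed
  show ?thesis
  proof (rule ps_hom_eqI[OF module_tpow Th mod_hom_ident _ x])
    fix w assume w: "w \<in> words (n + 1) m"
    then show "(T n m ^^ (n + 1)) (ps w) = ps w" using T_block[of "[]" w n m] by (simp add: words_iff)
  qed
qed

text \<open>
  Rotation moves the block by one place as long as the last letter does not belong to it.
\<close>

lemma T_Dk:
  assumes jk: "j + k < n" and x: "x \<in> carrier (tpow (n + 1) p)"
  shows "T (n - k) (p + (int k - 1)) (Dk k j n p x) = Dk k (Suc j) n p (T n p x)"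
proof -
  let ?G = "tpow (n + 1) p" and ?H = "tpow (n + 1 - k) (p + (int k - 1))"
  have nk: "n - k + 1 = n + 1 - k" using jk by simp
  have Th: "T (n - k) (p + (int k - 1)) \<in> mod_hom K ?H ?H" using T_hom[of "n - k"] unfolding nk .
  have D1: "Dk k j n p \<in> mod_hom K ?G ?H" by (rule Dk_hom) (use jk in simp)
  have D2: "Dk k (Suc j) n p \<in> mod_hom K ?G ?H" by (rule Dk_hom) (use jk in simp)
  show ?thesis
  proof (rule ps_hom_eqI[OF module_tpow mod_hom_comp[OF D1 Th] mod_hom_comp[OF T_hom D2] _ x])
    fix w assume w: "w \<in> words (n + 1) p"
    obtain u B v0 where s0: "w = u @ B @ v0" "length u = j" "length B = k + 1"
      by (rule split_word[OF w, of j "k + 1"]) (use jk in auto)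
    have "v0 \<noteq> []" using w s0 jk by (auto simp: words_iff)
    then obtain v q a where s1: "v0 = v @ [(q, a)]" by (metis prod.collapse rev_exhaust)
    have wd: "word u" "word B" "word v" "a \<in> carrier (A q)" using w by (auto simp: s0 s1 words_iff)
    let ?r = "wdeg B + (int k - 1)"
    have mB: "mop k B \<in> carrier (A ?r)" using mop_closed[of B k "wdeg B"] s0 wd by (simp add: words_iff)
    have w1: "(u @ (?r, mop k B) # v) @ [(q, a)] \<in> words (n + 1 - k) (p + (int k - 1))"
      and w2: "(u @ B @ v) @ [(q, a)] \<in> words (n + 1) p" and w3: "(q, a) # u @ B @ v \<in> words (n + 1) p"
      and w4: "(q, a) # u @ (?r, mop k B) # v \<in> words (n + 1 - k) (p + (int k - 1))"
      using w wd mB by (auto simp: s0 s1 words_iff)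
    note [simp] = mod_hom_msign[OF module_tpow module_tpow Th ps_closed[OF w1]]
      mod_hom_msign[OF module_tpow module_tpow D2 ps_closed[OF w3]] msign_msign[OF module_tpow ps_closed[OF w4]]
    have "T (n - k) (p + (int k - 1)) (Dk k j n p (ps w)) =
      msign ?H (sdeg u) (T (n - k) (p + (int k - 1)) (ps ((u @ (?r, mop k B) # v) @ [(q, a)])))"
      using Dk_ps[of u B v0 n p j k] w s0 s1 mod_hom_msign[OF module_tpow module_tpow Th ps_closed[OF w1]] by simp
    also have "\<dots> = msign ?H (sdeg u + (q + 1) * sdeg (u @ (?r, mop k B) # v)) (ps ((q, a) # u @ (?r, mop k B) # v))"
      using T_ps[of "u @ (?r, mop k B) # v" q a "n - k"] w1 unfolding nk by (simp only: msign_msign[OF module_tpow ps_closed[OF w4]])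
    also have "\<dots> = msign ?H ((q + 1) * sdeg (u @ B @ v) + sdeg ((q, a) # u)) (ps ((q, a) # u @ (?r, mop k B) # v))"
    proof (rule msign_cong)
      have "sdeg u + (q + 1) * sdeg (u @ (?r, mop k B) # v) - ((q + 1) * sdeg (u @ B @ v) + sdeg ((q, a) # u)) = 2 * (- (q + 1))"
        using s0 by (simp add: sdeg_def algebra_simps)
      then show "even (sdeg u + (q + 1) * sdeg (u @ (?r, mop k B) # v) - ((q + 1) * sdeg (u @ B @ v) + sdeg ((q, a) # u)))"
        by (metis dvd_triv_left)
    qed
    also have "\<dots> = msign ?H ((q + 1) * sdeg (u @ B @ v)) (Dk k (Suc j) n p (ps ((q, a) # u @ B @ v)))"
      using Dk_ps[of "(q, a) # u" B v n p "Suc j" k] w3 s0 by (simp only: append_Cons length_Cons msign_msign[OF module_tpow ps_closed[OF w4]])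
    also have "\<dots> = Dk k (Suc j) n p (T n p (ps w))"
      using T_ps[OF w2] s0 s1 mod_hom_msign[OF module_tpow module_tpow D2 ps_closed[OF w3]] by simp
    finally show "T (n - k) (p + (int k - 1)) (Dk k j n p (ps w)) = Dk k (Suc j) n p (T n p (ps w))" .
  qed
qed

abbreviation "Yt e n \<equiv> tpow (n + 1) (e - int n)"

lemma Yt_target: "k \<le> n \<Longrightarrow> Yt (e - 1) (n - k) = tpow (n + 1 - k) (e - int n + (int k - 1))"
  "k \<le> n \<Longrightarrow> e - 1 - int (n - k) = e - int n + (int k - 1)"
  by (simp_all add: Suc_diff_le of_nat_diff algebra_simps)

sublocale ops: dihedral_operators K Yt "\<lambda>e n. T n (e - int n)" "\<lambda>e n. R \<rho> n (e - int n)" "\<lambda>k e n. Dk k 0 n (e - int n)"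
proof (unfold_locales)
  fix k n :: nat and e :: int and x
  show "Dk k 0 n (e - int n) \<in> mod_hom K (Yt e n) (Yt (e - 1) (n - k))" if "k \<le> n"
    unfolding Yt_target(1)[OF that] by (rule Dk_hom) (use that in simp)
  show "R \<rho> (n - k) (e - 1 - int (n - k)) (Dk k 0 n (e - int n) x) = Dk k 0 n (e - int n) ((T n (e - int n) ^^ k) (R \<rho> n (e - int n) x))"
    if "k \<le> n" "x \<in> carrier (Yt e n)"
    unfolding Yt_target(2)[OF that(1)] by (rule R_Dk[OF that])
qed (fact T_hom R_hom T_cyclic R_R T_R_T)+

lemma Dk_Tp:
  "\<lbrakk>j + k \<le> n; x \<in> carrier (Yt e n)\<rbrakk> \<Longrightarrow>
    Dk k j n (e - int n) x = ops.Tp (int j) (e - 1) (n - k) (Dk k 0 n (e - int n) (ops.Tp (- int j) e n x))"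
proof (induction j arbitrary: x)
  case 0
  then show ?case by simp
next
  case (Suc j)
  let ?y = "ops.Tp (- 1) e n x"
  have k: "k \<le> n" using Suc.prems by simp
  have y: "?y \<in> carrier (Yt e n)" using Suc.prems(2) by (rule ops.Tp_closed)
  have Ty: "T n (e - int n) ?y = x"
    using ops.T_eq_Tp[OF y] ops.Tp_Tp[OF Suc.prems(2), of 1 "- 1"] by simp
  have z: "Dk k 0 n (e - int n) (ops.Tp (- int j) e n ?y) \<in> carrier (Yt (e - 1) (n - k))"
    by (rule ops.D_closed[OF k]) (rule ops.Tp_closed[OF y])
  have "Dk k (Suc j) n (e - int n) x = T (n - k) (e - int n + (int k - 1)) (Dk k j n (e - int n) ?y)"
    using T_Dk[of j k n ?y "e - int n"] y Suc.prems(1) unfolding Ty by simp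
  also have "\<dots> = T (n - k) (e - 1 - int (n - k)) (ops.Tp (int j) (e - 1) (n - k) (Dk k 0 n (e - int n) (ops.Tp (- int j) e n ?y)))"
    using Suc.IH[OF _ y] Suc.prems(1) unfolding Yt_target(2)[OF k] by simp
  also have "\<dots> = ops.Tp (1 + int j) (e - 1) (n - k) (Dk k 0 n (e - int n) (ops.Tp (- int j) e n ?y))"
    unfolding ops.T_eq_Tp[OF ops.Tp_closed[OF z]] by (rule ops.Tp_Tp[OF z])
  also have "ops.Tp (- int j) e n ?y = ops.Tp (- int j + - 1) e n x" by (rule ops.Tp_Tp[OF Suc.prems(2)])
  finally show ?case by (simp add: add.commute)
qed

sublocale ops: square_zero_operators K Yt "\<lambda>e n. T n (e - int n)" "\<lambda>e n. R \<rho> n (e - int n)" "\<lambda>k e n. Dk k 0 n (e - int n)"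
proof (unfold_locales)
  fix k l n :: nat and c e :: int and x
  assume c: "int k + 1 \<le> c" "c \<le> int n - int l" and x: "x \<in> carrier (Yt e n)"
  let ?j = "nat c - k"
  have j: "1 \<le> ?j" "?j + k + l \<le> n" "int (?j + k) = c" "int ?j = c - int k" "?j + k + l \<le> n" using c by auto
  have kn: "k \<le> n" "l \<le> n" "l \<le> n - k" using j by auto
  have e1: "Dk l (?j + k) n (e - int n) x = ops.Tp c (e - 1) (n - l) (Dk l 0 n (e - int n) (ops.Tp (- c) e n x))"
    using Dk_Tp[of "?j + k" l n x e] x j(2) unfolding j(3) by simp
  have y: "Dk k 0 n (e - int n) x \<in> carrier (Yt (e - 1) (n - k))" by (rule ops.D_closed[OF kn(1) x])
  have e2: "Dk l ?j (n - k) (e - 1 - int (n - k)) (Dk k 0 n (e - int n) x) =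
    ops.Tp (c - int k) (e - 2) (n - (k + l)) (Dk l 0 (n - k) (e - 1 - int (n - k)) (ops.Tp (int k - c) (e - 1) (n - k) (Dk k 0 n (e - int n) x)))"
  proof -
    have i: "?j + l \<le> n - k" "e - 1 - 1 = e - 2" "n - k - l = n - (k + l)" "- (c - int k) = int k - c" using j by auto
    show ?thesis using Dk_Tp[OF i(1) y] unfolding j(4) i(2-4) .
  qed
  have G: "Yt (e - 2) (n - (k + l)) = tpow (n + 1 - (k + l)) (e - int n + int k + int l - 2)"
    using j(2) by (simp add: Suc_diff_le of_nat_diff algebra_simps)
  show "Dk k 0 (n - l) (e - 1 - int (n - l)) (ops.Tp c (e - 1) (n - l) (Dk l 0 n (e - int n) (ops.Tp (- c) e n x)))
        \<oplus>\<^bsub>Yt (e - 2) (n - (k + l))\<^esub>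
      ops.Tp (c - int k) (e - 2) (n - (k + l)) (Dk l 0 (n - k) (e - 1 - int (n - k)) (ops.Tp (int k - c) (e - 1) (n - k) (Dk k 0 n (e - int n) x)))
      = \<zero>\<^bsub>Yt (e - 2) (n - (k + l))\<^esub>"
    unfolding e1[symmetric] e2[symmetric] G
    unfolding Yt_target(2)[OF kn(1)] Yt_target(2)[OF kn(2)]
    by (rule disjoint_Dk[OF j(1,2) x])
next
  fix s n :: nat and e :: int and x
  assume s: "s \<le> n" and x: "x \<in> carrier (Yt e n)"
  have G: "Yt (e - 2) (n - s) = tpow (n + 1 - s) (e - int n + int s - 2)"
    using s by (simp add: Suc_diff_le of_nat_diff algebra_simps)
  have mG: "module K (Yt (e - 2) (n - s))" by (rule module_tpow)
  let ?F = "\<lambda>k c. Dk k 0 (n - (s - k)) (e - 1 - int (n - (s - k))) (ops.Tp (int c) (e - 1) (n - (s - k)) (Dk (s - k) 0 n (e - int n) (ops.Tp (- int c) e n x)))"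
  have F: "?F k c = Dk k 0 (n - (s - k)) (e - int n + (int (s - k) - 1)) (Dk (s - k) c n (e - int n) x)" if "c \<le> k" "k \<le> s" for k c
  proof -
    have i: "c + (s - k) \<le> n" "s - k \<le> n" using that s by auto
    show ?thesis unfolding Dk_Tp[OF i(1) x] Yt_target(2)[OF i(2)] ..
  qed
  have Fc: "?F k c \<in> carrier (Yt (e - 2) (n - s))" if "k \<le> s" for k c
  proof -
    have i: "n - (s - k) - k = n - s" "k \<le> n - (s - k)" "s - k \<le> n" "e - 1 - 1 = e - 2" using that s by auto
    show ?thesis using ops.D_closed[OF i(2) ops.Tp_closed[OF ops.D_closed[OF i(3) ops.Tp_closed[OF x]]]] unfolding i(1,4) .
  qed
  have "(\<Oplus>\<^bsub>Yt (e - 2) (n - s)\<^esub>k\<in>{0..s}. \<Oplus>\<^bsub>Yt (e - 2) (n - s)\<^esub>c\<in>{0..int k}.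
      Dk k 0 (n - (s - k)) (e - 1 - int (n - (s - k))) (ops.Tp c (e - 1) (n - (s - k)) (Dk (s - k) 0 n (e - int n) (ops.Tp (- c) e n x)))) =
    (\<Oplus>\<^bsub>Yt (e - 2) (n - s)\<^esub>k\<in>{0..s}. \<Oplus>\<^bsub>Yt (e - 2) (n - s)\<^esub>c\<in>{0..k}. ?F k c)"
  proof (rule finsum_congr[OF mG])
    fix k assume "k \<in> {0..s}"
    then have k: "k \<le> s" by simp
    have "bij_betw int {0..k} {0..int k}" by (rule bij_betw_byWitness[where f' = nat]) auto
    then show "(\<Oplus>\<^bsub>Yt (e - 2) (n - s)\<^esub>c\<in>{0..int k}.
      Dk k 0 (n - (s - k)) (e - 1 - int (n - (s - k))) (ops.Tp c (e - 1) (n - (s - k)) (Dk (s - k) 0 n (e - int n) (ops.Tp (- c) e n x)))) =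
      (\<Oplus>\<^bsub>Yt (e - 2) (n - s)\<^esub>c\<in>{0..k}. ?F k c)"
    proof (rule finsum_bij[OF mG])
      fix b assume "b \<in> {0..int k}"
      then show "Dk k 0 (n - (s - k)) (e - 1 - int (n - (s - k))) (ops.Tp b (e - 1) (n - (s - k)) (Dk (s - k) 0 n (e - int n) (ops.Tp (- b) e n x)))
        \<in> carrier (Yt (e - 2) (n - s))" using Fc[OF k, of "nat b"] by simp
    qed
    show "(\<Oplus>\<^bsub>Yt (e - 2) (n - s)\<^esub>c\<in>{0..k}. ?F k c) \<in> carrier (Yt (e - 2) (n - s))"
      by (rule finsum_in_carrier[OF mG Fc[OF k]])
  qed
  also have "\<dots> = (\<Oplus>\<^bsub>Yt (e - 2) (n - s)\<^esub>k\<in>{0..s}. \<Oplus>\<^bsub>Yt (e - 2) (n - s)\<^esub>c\<in>{0..k}.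
      Dk k 0 (n - (s - k)) (e - int n + (int (s - k) - 1)) (Dk (s - k) c n (e - int n) x))"
  proof (intro finsum_congr[OF mG])
    fix k c assume kc: "k \<in> {0..s}" "c \<in> {0..k}"
    then show "?F k c = Dk k 0 (n - (s - k)) (e - int n + (int (s - k) - 1)) (Dk (s - k) c n (e - int n) x)" by (intro F) auto
    show "Dk k 0 (n - (s - k)) (e - int n + (int (s - k) - 1)) (Dk (s - k) c n (e - int n) x) \<in> carrier (Yt (e - 2) (n - s))"
      using kc Fc[of k c] F[of c k] by auto
  next
    fix k assume k: "k \<in> {0..s}"
    show "(\<Oplus>\<^bsub>Yt (e - 2) (n - s)\<^esub>c\<in>{0..k}. Dk k 0 (n - (s - k)) (e - int n + (int (s - k) - 1)) (Dk (s - k) c n (e - int n) x)) \<in> carrier (Yt (e - 2) (n - s))"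
    proof (rule finsum_in_carrier[OF mG])
      fix c assume c: "c \<in> {0..k}"
      then show "Dk k 0 (n - (s - k)) (e - int n + (int (s - k) - 1)) (Dk (s - k) c n (e - int n) x) \<in> carrier (Yt (e - 2) (n - s))"
        using k Fc[of k c] F[of c k] by auto
    qed
  qed
  also have "\<dots> = \<zero>\<^bsub>Yt (e - 2) (n - s)\<^esub>" unfolding G by (rule nested_Dk[OF s x])
  finally show "(\<Oplus>\<^bsub>Yt (e - 2) (n - s)\<^esub>k\<in>{0..s}. \<Oplus>\<^bsub>Yt (e - 2) (n - s)\<^esub>c\<in>{0..int k}.
      Dk k 0 (n - (s - k)) (e - 1 - int (n - (s - k))) (ops.Tp c (e - 1) (n - (s - k)) (Dk (s - k) 0 n (e - int n) (ops.Tp (- c) e n x))))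
      = \<zero>\<^bsub>Yt (e - 2) (n - s)\<^esub>" .
qed

end

section \<open>Bicomplexes from cyclic and reflection operators\<close>

text \<open>
  The relations between the operators on one family of modules under which the periodic bicomplex of
  \<open>1 - T\<close> and \<open>N\<close> with the alternating differentials \<open>b\<close> and \<open>- b'\<close> carries the involution of dihedral
  homology.
\<close>

locale dihedral_complex = cring K for K :: "'k ring" (structure) +
  fixes X :: "nat \<Rightarrow> ('k, 'c) module" and T R N b b' :: "nat \<Rightarrow> 'c \<Rightarrow> 'c" and h :: 'k
  assumes X: "module K (X n)"
    and T: "T n \<in> mod_hom K (X n) (X n)"
    and R: "R n \<in> mod_hom K (X n) (X n)"
    and N: "N n \<in> mod_hom K (X n) (X n)"
    and b: "b (Suc n) \<in> mod_hom K (X (Suc n)) (X n)"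
    and b': "b' (Suc n) \<in> mod_hom K (X (Suc n)) (X n)"
    and R_R: "x \<in> carrier (X n) \<Longrightarrow> R n (R n x) = x"
    and T_R_T: "x \<in> carrier (X n) \<Longrightarrow> T n (R n (T n x)) = R n x"
    and T_N: "x \<in> carrier (X n) \<Longrightarrow> T n (N n x) = N n x"
    and N_T: "x \<in> carrier (X n) \<Longrightarrow> N n (T n x) = N n x"
    and N_R: "x \<in> carrier (X n) \<Longrightarrow> N n (R n x) = R n (N n x)"
    and b_R: "x \<in> carrier (X (Suc n)) \<Longrightarrow> b (Suc n) (R (Suc n) x) = R n (b (Suc n) x)"
    and b'_R_T: "x \<in> carrier (X (Suc n)) \<Longrightarrow> b' (Suc n) (R (Suc n) (T (Suc n) x)) = R n (T n (b' (Suc n) x))"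
    and b_T: "x \<in> carrier (X (Suc n)) \<Longrightarrow>
      b (Suc n) (x \<ominus>\<^bsub>X (Suc n)\<^esub> T (Suc n) x) = b' (Suc n) x \<ominus>\<^bsub>X n\<^esub> T n (b' (Suc n) x)"
    and b'_N: "x \<in> carrier (X (Suc n)) \<Longrightarrow> b' (Suc n) (N (Suc n) x) = N n (b (Suc n) x)"
    and b_b: "x \<in> carrier (X (Suc (Suc n))) \<Longrightarrow> b (Suc n) (b (Suc (Suc n)) x) = \<zero>\<^bsub>X n\<^esub>"
    and b'_b': "x \<in> carrier (X (Suc (Suc n))) \<Longrightarrow> b' (Suc n) (b' (Suc (Suc n)) x) = \<zero>\<^bsub>X n\<^esub>"
    and fixed: "\<lbrakk>x \<in> carrier (X n); T n x = x\<rbrakk> \<Longrightarrow> \<exists>w\<in>carrier (X n). N n w = x"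
    and norm_zero: "\<lbrakk>x \<in> carrier (X n); N n x = \<zero>\<^bsub>X n\<^esub>\<rbrakk> \<Longrightarrow> \<exists>w\<in>carrier (X n). w \<ominus>\<^bsub>X n\<^esub> T n w = x"
    and h: "h \<in> carrier K" "h \<oplus> h = \<one>"
begin

sublocale Mod: module K "X n" for n by (rule X)

lemmas closed [simp] = mod_hom_closed[OF T] mod_hom_closed[OF R] mod_hom_closed[OF N] mod_hom_closed[OF b] mod_hom_closed[OF b']
lemmas uminus [simp] = mod_hom_uminus[OF X X T] mod_hom_uminus[OF X X R] mod_hom_uminus[OF X X N]
  mod_hom_uminus[OF X X b] mod_hom_uminus[OF X X b']
lemmas add [simp] = mod_hom_add[OF T] mod_hom_add[OF R] mod_hom_add[OF N]

definition \<delta>1 :: "nat \<Rightarrow> nat \<Rightarrow> 'c \<Rightarrow> 'c"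
  where "\<delta>1 n m x = (if even m then b n x else \<ominus>\<^bsub>X (n - 1)\<^esub> b' n x)"

definition \<delta>2 :: "nat \<Rightarrow> nat \<Rightarrow> 'c \<Rightarrow> 'c"
  where "\<delta>2 n m x = (if odd m then x \<ominus>\<^bsub>X n\<^esub> T n x else N n x)"

definition \<theta> :: "nat \<Rightarrow> nat \<Rightarrow> 'c \<Rightarrow> 'c"
  where "\<theta> n m x =
    (if even m then msign (X n) (int (m div 2)) (R n x)
     else msign (X n) (int (m div 2) + 1) (R n (T n x)))"

lemma \<delta>1_hom: "\<delta>1 (Suc n) m \<in> mod_hom K (X (Suc n)) (X n)"
proof (cases "even m")
  case True
  then show ?thesis by (intro mod_hom_cong[OF b _ X]) (simp add: \<delta>1_def)
next
  case False
  then show ?thesis by (intro mod_hom_cong[OF mod_hom_neg[OF X b'] _ X]) (simp add: \<delta>1_def)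
qed

lemma \<delta>2_hom: "\<delta>2 n m \<in> mod_hom K (X n) (X n)"
proof (cases "odd m")
  case True
  then show ?thesis by (intro mod_hom_cong[OF mod_hom_minus[OF X mod_hom_ident T] _ X]) (simp add: \<delta>2_def)
next
  case False
  then show ?thesis by (intro mod_hom_cong[OF N _ X]) (simp add: \<delta>2_def)
qed

lemma \<theta>_hom: "\<theta> n m \<in> mod_hom K (X n) (X n)"
proof (cases "even m")
  case True
  then show ?thesis by (intro mod_hom_cong[OF mod_hom_msign_comp[OF X R] _ X]) (simp add: \<theta>_def)
next
  case False
  then show ?thesis by (intro mod_hom_cong[OF mod_hom_msign_comp[OF X mod_hom_comp[OF T R]] _ X]) (simp add: \<theta>_def)
qed

lemma Z2_bicomplex: "Z2_bicomplex K X \<delta>1 \<delta>2 \<theta> h"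
proof (intro Z2_bicomplex.intro Z2_bicomplex_axioms.intro)
  show "cring K" by (rule is_cring)
  show "module K (X n)" for n by (rule X)
  show "\<delta>1 (Suc n) m \<in> mod_hom K (X (Suc n)) (X n)" for n m by (rule \<delta>1_hom)
  show "\<delta>2 n (Suc m) \<in> mod_hom K (X n) (X n)" for n m by (rule \<delta>2_hom)
  show "\<theta> n m \<in> mod_hom K (X n) (X n)" for n m by (rule \<theta>_hom)
  show "\<theta> n m (\<theta> n m x) = x" if x: "x \<in> carrier (X n)" for n m x
    using x by (simp add: \<theta>_def msign_def R_R T_R_T)
  show "\<delta>1 (Suc n) m (\<theta> (Suc n) m x) = \<theta> n m (\<delta>1 (Suc n) m x)" if x: "x \<in> carrier (X (Suc n))" for n m x
    using x by (simp add: \<delta>1_def \<theta>_def msign_def b_R b'_R_T)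
  show "\<delta>2 n (Suc m) (\<theta> n (Suc m) x) = \<theta> n m (\<delta>2 n (Suc m) x)" if x: "x \<in> carrier (X n)" for n m x
    using x by (cases "even m")
      (simp_all add: \<delta>2_def \<theta>_def msign_def a_minus_def T_R_T T_N N_R Mod.M.minus_add Mod.M.a_ac)
  show "\<delta>1 (Suc n) m (\<delta>1 (Suc (Suc n)) m x) = \<zero>\<^bsub>X n\<^esub>" if x: "x \<in> carrier (X (Suc (Suc n)))" for n m x
    using x by (simp add: \<delta>1_def b_b b'_b')
  show "\<delta>2 n (Suc m) (\<delta>2 n (Suc (Suc m)) x) = \<zero>\<^bsub>X n\<^esub>" if x: "x \<in> carrier (X n)" for n m x
    using x by (simp add: \<delta>2_def a_minus_def T_N N_T Mod.M.r_neg)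
  show "\<delta>2 n (Suc m) (\<delta>1 (Suc n) (Suc m) x) = \<ominus>\<^bsub>X n\<^esub> \<delta>1 (Suc n) m (\<delta>2 (Suc n) (Suc m) x)"
    if x: "x \<in> carrier (X (Suc n))" for n m x
    using x by (simp add: \<delta>1_def \<delta>2_def b_T b'_N) (simp add: a_minus_def Mod.M.minus_add)
  show "\<exists>w\<in>carrier (X n). \<delta>2 n (Suc (Suc m)) w = x" if x: "x \<in> carrier (X n)" "\<delta>2 n (Suc m) x = \<zero>\<^bsub>X n\<^esub>" for n m x
  proof (cases "even m")
    case True
    then have "x \<ominus>\<^bsub>X n\<^esub> T n x = \<zero>\<^bsub>X n\<^esub>" using x(2) by (simp add: \<delta>2_def)
    moreover have "x = (x \<ominus>\<^bsub>X n\<^esub> T n x) \<oplus>\<^bsub>X n\<^esub> T n x"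
      using x(1) by (simp add: a_minus_def Mod.M.a_assoc Mod.M.l_neg)
    ultimately have "T n x = x" using x(1) by simp
    then show ?thesis using True fixed[OF x(1)] by (simp add: \<delta>2_def)
  next
    case False
    then show ?thesis using norm_zero[OF x(1)] x(2) by (simp add: \<delta>2_def)
  qed
  show "h \<in> carrier K" "h \<oplus> h = \<one>" by (rule h)+
qed

end

section \<open>The differentials of the dihedral module\<close>

lemma sum_interval: "int (\<Sum>{j..<j + k}) = int k * int j + tri k"
  by (induction k) (simp_all add: tri_Suc algebra_simps)

lemma sum_top:
  assumes "q \<le> n" shows "int (\<Sum>{n - q + 1..n}) = int q * int n - tri q"
  using assms
proof (induction q)
  case (Suc q)
  then have "{n - Suc q + 1..n} = insert (n - q) {n - q + 1..n}" by auto
  then have "\<Sum>{n - Suc q + 1..n} = (n - q) + \<Sum>{n - q + 1..n}" by simp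
  then show ?case using Suc by (simp add: tri_Suc of_nat_diff algebra_simps)
qed simp

lemma tri_double: "2 * tri q = int q * (int q - 1)"
  by (induction q) (simp_all add: tri_Suc algebra_simps)

context dihedral_sign
begin

lemma arc_Dk:
  assumes "j + k \<le> n" "x \<in> carrier (Yt e n)"
  shows "ops.arc k (int j) e n x = Dk k j n (e - int n) x"
  unfolding ops.arc_def Dk_Tp[OF assms] by simp

lemma X_target: "k \<le> n \<Longrightarrow> X (n - k) (e - int n + int k - 1) = Yt (e - 1) (n - k)"
  by (simp add: X_def of_nat_diff algebra_simps)

lemma face_consecutive:
  assumes k: "1 \<le> k" "j + k \<le> n" and x: "x \<in> carrier (Yt e n)"
  shows "msign (Yt (e - 1) (n - k)) (int (\<Sum>{j..<j + k})) (face n (e - int n) {j..<j + k} x) = ops.arc k (int j) e n x"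
proof -
  let ?p = "e - int n"
  let ?G = "X (n - k) (?p + int k - 1)"
  have G: "?G = Yt (e - 1) (n - k)" by (rule X_target) (use k in simp)
  have xX: "x \<in> carrier (X n ?p)" using x by (simp add: X_def)
  have ex: "\<exists>j'. j' + k \<le> n \<and> {j..<j + k} = {j'..<j' + k}" using k by auto
  have the: "(THE j'. j' + k \<le> n \<and> {j..<j + k} = {j'..<j' + k}) = j"
  proof (rule the_equality)
    fix j' assume "j' + k \<le> n \<and> {j..<j + k} = {j'..<j' + k}"
    then show "j' = j" using k by (simp add: atLeastLessThan_eq_iff)
  qed (use k in simp)
  have card: "card {j..<j + k} = k" by simp
  have "face n ?p {j..<j + k} x = msign ?G (int k * (?p - 1)) (one_pi_one k j n ?p x)"
    unfolding face_def Let_def card if_P[OF ex] the ..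
  then have "msign ?G (int (\<Sum>{j..<j + k})) (face n ?p {j..<j + k} x) =
    msign ?G (int k * int j + tri k + int k * (?p - 1)) (one_pi_one k j n ?p x)"
    unfolding sum_interval
    by (simp only: msign_msign[OF module_X mod_hom_closed[OF one_pi_one_eq(2)[OF k xX] xX]])
  then show ?thesis unfolding one_pi_one_eq(1)[OF k xX] G[symmetric] arc_Dk[OF k(2) x] .
qed

lemma funpow_T_t:
  assumes x: "x \<in> carrier (X n m)"
  shows "(T n m ^^ i) x = msign (X n m) (int n * int i) ((t n m ^^ i) x) \<and> (t n m ^^ i) x \<in> carrier (X n m)"
proof (induction i)
  case 0
  then show ?case using x by simp
next
  case (Suc i)
  have th: "t n m \<in> mod_hom K (X n m) (X n m)" using t_hom by (simp add: X_def)
  have c: "(t n m ^^ i) x \<in> carrier (X n m)" using Suc by simp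
  have c': "(t n m ^^ Suc i) x \<in> carrier (X n m)" using mod_hom_closed[OF th c] by simp
  have "(T n m ^^ Suc i) x = T n m (msign (X n m) (int n * int i) ((t n m ^^ i) x))"
    unfolding conjunct1[OF Suc, symmetric] by simp
  also have "\<dots> = msign (X n m) (int n) (t n m (msign (X n m) (int n * int i) ((t n m ^^ i) x)))"
    by (rule T_def)
  also have "\<dots> = msign (X n m) (int n + int n * int i) (t n m ((t n m ^^ i) x))"
    unfolding mod_hom_msign[OF module_X module_X th c] by (rule msign_msign[OF module_X mod_hom_closed[OF th c]])
  finally show ?case using c' by (simp add: algebra_simps)
qed

text \<open>
  The exponents agree because \<open>k (k - 1) / 2\<close>, split along \<open>k = (k - q) + q\<close>, differs from the sum of the
  indices by \<open>q (k - 1)\<close> and the sign \<open>(-1)\<^sup>n\<^sup>q\<close> of \<open>T\<^sup>q\<close>, up to even numbers.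
\<close>

lemma face_cyclic:
  assumes q: "1 \<le> q" "q \<le> k" "k \<le> n" and x: "x \<in> carrier (Yt e n)"
  defines "I \<equiv> {0..<k - q} \<union> {n - q + 1..n}"
  shows "msign (Yt (e - 1) (n - k)) (int (\<Sum>I)) (face n (e - int n) I x) = ops.arc k (- int q) e n x"
proof -
  let ?p = "e - int n"
  let ?G = "X (n - k) (?p + int k - 1)" and ?y = "(t n (e - int n) ^^ q) x"
  have G: "?G = Yt (e - 1) (n - k)" by (rule X_target) (use q in simp)
  have xX: "x \<in> carrier (X n ?p)" using x by (simp add: X_def)
  have y: "?y \<in> carrier (X n ?p)" and Ty: "(T n ?p ^^ q) x = msign (X n ?p) (int n * int q) ?y"
    using funpow_T_t[OF xX] by auto
  have dis: "{0..<k - q} \<inter> {n - q + 1..n} = {}" using q by auto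
  have card: "card I = k" unfolding I_def using q by (subst card_Un_disjoint[OF _ _ dis]) auto
  have nI: "n \<in> I" using q by (auto simp: I_def)
  have nex: "\<not> (\<exists>j. j + k \<le> n \<and> I = {j..<j + k})" using nI by fastforce
  have less: False if "1 \<le> q'" "q' < q''" "q'' \<le> k" "{0..<k - q'} \<union> {n - q' + 1..n} = {0..<k - q''} \<union> {n - q'' + 1..n}" for q' q''
  proof -
    have "k - q'' \<in> {0..<k - q'} \<union> {n - q' + 1..n}" using that by auto
    then show False unfolding that(4) using that q by auto
  qed
  have ex: "\<exists>q'. 1 \<le> q' \<and> q' \<le> k \<and> I = {0..<k - q'} \<union> {n - q' + 1..n}" using q by (auto simp: I_def)
  have the: "(THE q'. 1 \<le> q' \<and> q' \<le> k \<and> I = {0..<k - q'} \<union> {n - q' + 1..n}) = q"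
  proof (rule the_equality)
    fix q' assume a: "1 \<le> q' \<and> q' \<le> k \<and> I = {0..<k - q'} \<union> {n - q' + 1..n}"
    then have eq: "{0..<k - q'} \<union> {n - q' + 1..n} = {0..<k - q} \<union> {n - q + 1..n}" by (simp only: I_def)
    show "q' = q"
      using less[of q' q, OF _ _ _ eq] less[of q q', OF _ _ _ eq[symmetric]] a q by (meson nat_neq_iff)
  qed (use q in \<open>simp add: I_def\<close>)
  have opo: "one_pi_one k 0 n ?p \<in> mod_hom K (X n ?p) ?G" using one_pi_one_eq(2)[of k 0 n] q xX by simp
  have oc: "one_pi_one k 0 n ?p ?y \<in> carrier ?G" by (rule mod_hom_closed[OF opo y])
  have face: "face n ?p I x = msign ?G (int q * (int k - 1)) (msign ?G (int k * (?p - 1)) (one_pi_one k 0 n ?p ?y))"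
    unfolding face_def Let_def card if_not_P[OF nex] if_P[OF ex] the ..
  have sumI: "int (\<Sum>I) = tri (k - q) + (int q * int n - tri q)"
    unfolding I_def using sum_interval[of 0 "k - q"] sum_top[of q n] q
    by (subst sum.union_disjoint[OF _ _ dis]) auto
  have l: "msign ?G (int (\<Sum>I)) (face n ?p I x) =
    msign ?G (tri (k - q) + (int q * int n - tri q) + (int q * (int k - 1) + int k * (?p - 1))) (one_pi_one k 0 n ?p ?y)"
    unfolding face sumI by (simp only: msign_msign[OF module_X oc] add.assoc)
  have "ops.arc k (- int q) e n x = Dk k 0 n ?p ((T n ?p ^^ q) x)"
    unfolding ops.arc_def using ops.funpow_T[OF x, of q] by simp
  also have "\<dots> = Dk k 0 n ?p (msign (X n ?p) (int n * int q) ?y)" unfolding Ty ..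
  also have "\<dots> = msign ?G (int k * int 0 + tri k + int k * (?p - 1)) (one_pi_one k 0 n ?p (msign (X n ?p) (int n * int q) ?y))"
    by (rule one_pi_one_eq(1)[symmetric]) (use q in \<open>simp_all add: msign_closed[OF module_X y]\<close>)
  also have "\<dots> = msign ?G (tri k + int k * (?p - 1) + int n * int q) (one_pi_one k 0 n ?p ?y)"
    unfolding mod_hom_msign[OF module_X module_X opo y] msign_msign[OF module_X oc] by simp
  also have "\<dots> = msign ?G (int (\<Sum>I)) (face n ?p I x)"
    unfolding l
  proof (rule msign_cong)
    have "tri k = tri (k - q) + tri q + int (k - q) * int q" using tri_add[of "k - q" q] q by simp
    then have "tri k + int k * (?p - 1) + int n * int q
        - (tri (k - q) + (int q * int n - tri q) + (int q * (int k - 1) + int k * (?p - 1))) =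
        2 * tri q + int (k - q) * int q - int q * (int k - 1)" by (simp add: algebra_simps)
    also have "\<dots> = 0" unfolding tri_double using q by (simp add: of_nat_diff algebra_simps)
    finally show "even (tri k + int k * (?p - 1) + int n * int q
        - (tri (k - q) + (int q * int n - tri q) + (int q * (int k - 1) + int k * (?p - 1))))" by simp
  qed
  finally show ?thesis unfolding G ..
qed

text \<open>
  The index sets with a nonzero face are in bijection with the arcs: a set of consecutive indices gives
  an arc inside the word, a set that contains \<open>n\<close> and wraps around gives an arc through the first letter.
  The bound \<open>n - 1\<close> on the indices excludes exactly the sets of the second kind.
\<close>

lemma dk_arcs:
  assumes k: "k \<le> n" and q: "q \<in> {0, 1}" and x: "x \<in> carrier (Yt e n)"
  shows "dk q k n (e - int n) x = ops.arcs (q = 0) k e n x"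
proof (cases "k = 0")
  case True
  have bij: "bij_betw int {0..n} {0..int n}" by (rule bij_betw_byWitness[where f' = nat]) auto
  have G: "X n (e - int n - 1) = Yt (e - 1) n" by (simp add: X_def algebra_simps)
  have "ops.arcs (q = 0) 0 e n x = (\<Oplus>\<^bsub>Yt (e - 1) n\<^esub>i\<in>{0..int n}. ops.arc 0 i e n x)"
    unfolding ops.arcs_def ops.low_def by simp
  also have "\<dots> = (\<Oplus>\<^bsub>Yt (e - 1) n\<^esub>i\<in>{0..n}. ops.arc 0 (int i) e n x)"
    by (rule finsum_bij[OF module_tpow bij]) (use ops.arc_closed[OF _ x, of 0] in simp)
  also have "\<dots> = (\<Oplus>\<^bsub>Yt (e - 1) n\<^esub>i\<in>{0..n}. Dk 0 i n (e - int n) x)"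
  proof (rule finsum_congr[OF module_tpow])
    fix i assume "i \<in> {0..n}"
    then have i: "i + 0 \<le> n" by simp
    show "ops.arc 0 (int i) e n x = Dk 0 i n (e - int n) x" by (rule arc_Dk[OF i x])
    then show "Dk 0 i n (e - int n) x \<in> carrier (Yt (e - 1) n)" using ops.arc_closed[OF _ x, of 0 "int i"] by simp
  qed
  also have "\<dots> = dX n (e - int n) x" using dX_eq(1)[of x n "e - int n"] x unfolding G by (simp add: X_def)
  finally show ?thesis using True by (simp add: dk_def)
next
  case False
  then have k1: "1 \<le> k" by simp
  let ?p = "e - int n" and ?G = "Yt (e - 1) (n - k)" and ?J = "{ops.low (q = 0) k..int n - int k}"
  have G: "module K ?G" by (rule module_tpow)
  let ?\<I> = "{I. card I = k \<and> I \<subseteq> {i. i + q \<le> n}}"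
  define \<psi> where "\<psi> i = (if 0 \<le> i then {nat i..<nat i + k} else {0..<k - nat (- i)} \<union> {n - nat (- i) + 1..n})" for i
  define g where "g I = msign ?G (int (\<Sum>I)) (face n ?p I x)" for I
  have val: "g (\<psi> i) = ops.arc k i e n x" if i: "i \<in> ?J" for i
  proof (cases "0 \<le> i")
    case True
    have "nat i + k \<le> n" using i True k by auto
    from face_consecutive[OF k1 this x] show ?thesis using True by (simp add: g_def \<psi>_def)
  next
    case False
    then have "1 \<le> nat (- i)" "nat (- i) \<le> k" using i by (auto simp: ops.low_def split: if_splits)
    from face_cyclic[OF this k x] show ?thesis using False by (simp add: g_def \<psi>_def)
  qed
  have gc: "g (\<psi> i) \<in> carrier ?G" if "i \<in> ?J" for i unfolding val[OF that] by (rule ops.arc_closed[OF k x])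
  have n\<psi>: "n \<in> \<psi> i \<longleftrightarrow> i < 0" if "i \<in> ?J" for i using that k k1 by (auto simp: \<psi>_def)
  have inj: "inj_on \<psi> ?J"
  proof (rule inj_onI)
    fix i i' assume i: "i \<in> ?J" and i': "i' \<in> ?J" and eq: "\<psi> i = \<psi> i'"
    have sgn: "i < 0 \<longleftrightarrow> i' < 0" using n\<psi>[OF i] n\<psi>[OF i'] eq by simp
    show "i = i'"
    proof (cases "i < 0")
      case True
      have less: False if "a \<in> ?J" "b < 0" "a < b" "\<psi> a = \<psi> b" for a b
      proof -
        have a: "- int k \<le> a" using that by (auto simp: ops.low_def split: if_splits)
        have "k - nat (- a) \<in> \<psi> b" using that a by (auto simp: \<psi>_def)
        then have "k - nat (- a) \<in> \<psi> a" using that(4) by simp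
        then show False using that a k by (auto simp: \<psi>_def)
      qed
      show ?thesis using less[OF i _ _ eq] less[OF i' _ _ eq[symmetric]] True sgn
        by (cases i i' rule: linorder_cases) auto
    next
      case False
      then have "{nat i..<nat i + k} = {nat i'..<nat i' + k}" using eq sgn by (simp add: \<psi>_def)
      then show ?thesis using k1 False sgn by (simp add: atLeastLessThan_eq_iff)
    qed
  qed
  have sub: "\<psi> ` ?J \<subseteq> ?\<I>"
  proof
    fix I assume "I \<in> \<psi> ` ?J"
    then obtain i where i: "i \<in> ?J" and I: "I = \<psi> i" by auto
    show "I \<in> ?\<I>"
    proof (cases "0 \<le> i")
      case True
      then have "nat i + k \<le> n" using i by auto
      then show ?thesis using True q unfolding I \<psi>_def by auto
    next
      case False
      then have q0: "q = 0" and r: "nat (- i) \<le> k" "1 \<le> nat (- i)" using i by (auto simp: ops.low_def split: if_splits)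
      have "{0..<k - nat (- i)} \<inter> {n - nat (- i) + 1..n} = {}" using r k by auto
      then have "card (\<psi> i) = k" using False r k by (simp add: \<psi>_def card_Un_disjoint)
      moreover have "\<psi> i \<subseteq> {i. i + q \<le> n}" using False r k q0 by (auto simp: \<psi>_def)
      ultimately show ?thesis by (simp add: I)
    qed
  qed
  have zero: "g I = \<zero>\<^bsub>?G\<^esub>" if I: "I \<in> ?\<I> - \<psi> ` ?J" for I
  proof -
    have card: "card I = k" using I by simp
    have c: "\<not> (\<exists>j. j + k \<le> n \<and> I = {j..<j + k})"
    proof
      assume "\<exists>j. j + k \<le> n \<and> I = {j..<j + k}"
      then obtain j where j: "j + k \<le> n" "I = {j..<j + k}" by blast
      then have "int j \<in> ?J" "I = \<psi> (int j)" by (auto simp: ops.low_def \<psi>_def)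
      then show False using I by blast
    qed
    have y: "\<not> (\<exists>q'. 1 \<le> q' \<and> q' \<le> k \<and> I = {0..<k - q'} \<union> {n - q' + 1..n})"
    proof
      assume "\<exists>q'. 1 \<le> q' \<and> q' \<le> k \<and> I = {0..<k - q'} \<union> {n - q' + 1..n}"
      then obtain q' where q': "1 \<le> q'" "q' \<le> k" "I = {0..<k - q'} \<union> {n - q' + 1..n}" by blast
      have "n \<in> I" using q' k by auto
      then have "q = 0" using I q by auto
      then have "- int q' \<in> ?J" "I = \<psi> (- int q')" using q' k by (auto simp: ops.low_def \<psi>_def)
      then show False using I by blast
    qed
    have "face n ?p I x = \<zero>\<^bsub>X (n - k) (?p + int k - 1)\<^esub>"
      unfolding face_def Let_def card if_not_P[OF c] if_not_P[OF y] ..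
    then show ?thesis unfolding g_def X_target[OF k] by (simp only: msign_zero[OF G])
  qed
  have fin: "finite ?\<I>" by (rule finite_subset[of _ "Pow {0..n}"]) auto
  have "dk q k n ?p x = (\<Oplus>\<^bsub>?G\<^esub>I\<in>?\<I>. g I)"
    using False k by (simp only: dk_def if_False if_True X_target[OF k] g_def)
  also have "?\<I> = \<psi> ` ?J \<union> (?\<I> - \<psi> ` ?J)" using sub by blast
  also have "(\<Oplus>\<^bsub>?G\<^esub>I\<in>\<psi> ` ?J \<union> (?\<I> - \<psi> ` ?J). g I) =
    (\<Oplus>\<^bsub>?G\<^esub>I\<in>\<psi> ` ?J. g I) \<oplus>\<^bsub>?G\<^esub> (\<Oplus>\<^bsub>?G\<^esub>I\<in>?\<I> - \<psi> ` ?J. g I)"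
  proof (rule finsum_split[OF G])
    fix I assume "I \<in> \<psi> ` ?J \<union> (?\<I> - \<psi> ` ?J)"
    then consider "I \<in> \<psi> ` ?J" | "I \<in> ?\<I> - \<psi> ` ?J" by blast
    then show "g I \<in> carrier ?G"
    proof cases
      case 1
      then show ?thesis using gc by blast
    next
      case 2
      show ?thesis unfolding zero[OF 2] by (rule abelian_group.axioms(1)[OF module_abelian_group[OF G], THEN abelian_monoid.zero_closed])
    qed
  qed (use fin in auto)
  also have "(\<Oplus>\<^bsub>?G\<^esub>I\<in>?\<I> - \<psi> ` ?J. g I) = \<zero>\<^bsub>?G\<^esub>" by (rule finsum_zeros[OF G zero])
  also have "(\<Oplus>\<^bsub>?G\<^esub>I\<in>\<psi> ` ?J. g I) = (\<Oplus>\<^bsub>?G\<^esub>i\<in>?J. g (\<psi> i))"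
    by (rule finsum_bij[OF G]) (use inj gc in \<open>auto simp: bij_betw_def\<close>)
  also have "\<dots> = ops.arcs (q = 0) k e n x"
    unfolding ops.arcs_def by (rule finsum_congr[OF G val ops.arc_closed[OF k x]])
  also have "\<dots> \<oplus>\<^bsub>?G\<^esub> \<zero>\<^bsub>?G\<^esub> = \<dots>"
    by (rule abelian_monoid.r_zero[OF abelian_group.axioms(1)[OF module_abelian_group[OF G]] ops.arcs_closed[OF k x]])
  finally show ?thesis .
qed

end

section \<open>The associated complexes\<close>

context dihedral_sign
begin

lemma Xbar_eq: "Xbar n = dsum_module {0..n} (\<lambda>k. Yt (int n) k)"
  by (simp only: Xbar_def X_def)

lemma module_Xbar: "module K (Xbar n)"
  unfolding Xbar_eq by (rule module_dsum[OF is_cring module_tpow])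

lemma Xbar_component: "\<lbrakk>x \<in> carrier (Xbar n); k \<le> n\<rbrakk> \<Longrightarrow> x k \<in> carrier (Yt (int n) k)"
  unfolding Xbar_eq by (rule dsum_component) auto

lemma Xbar_eqI: "\<lbrakk>x \<in> carrier (Xbar n); y \<in> carrier (Xbar n); \<And>k. k \<le> n \<Longrightarrow> x k = y k\<rbrakk> \<Longrightarrow> x = y"
  unfolding Xbar_eq by (rule dsum_eqI) auto

lemma Xbar_closedI: "(\<And>k. k \<le> n \<Longrightarrow> f k \<in> carrier (Yt (int n) k)) \<Longrightarrow> (\<lambda>k\<in>{0..n}. f k) \<in> carrier (Xbar n)"
  unfolding Xbar_eq dsum_simps by auto

lemma Xbar_zero: "\<zero>\<^bsub>Xbar n\<^esub> = (\<lambda>k\<in>{0..n}. \<zero>\<^bsub>Yt (int n) k\<^esub>)"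
  unfolding Xbar_eq dsum_simps ..

lemma Xbar_minus:
  assumes "x \<in> carrier (Xbar n)" "\<And>k. k \<le> n \<Longrightarrow> f k \<in> carrier (Yt (int n) k)"
  shows "x \<ominus>\<^bsub>Xbar n\<^esub> (\<lambda>k\<in>{0..n}. f k) = (\<lambda>k\<in>{0..n}. x k \<ominus>\<^bsub>Yt (int n) k\<^esub> f k)"
  using dsum_minus[OF is_cring module_tpow assms(1)[unfolded Xbar_eq] Xbar_closedI[OF assms(2), unfolded Xbar_eq]]
  unfolding Xbar_eq by (auto intro: restrict_ext)

lemma Xbar_hom:
  assumes "\<And>k. k \<le> n \<Longrightarrow> F k \<in> mod_hom K (Yt (int n) k) (Yt (int n) k)"
  shows "(\<lambda>x. \<lambda>k\<in>{0..n}. F k (x k)) \<in> mod_hom K (Xbar n) (Xbar n)"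
proof -
  have "(\<lambda>x. F k (x k)) \<in> mod_hom K (Xbar n) (Yt (int n) k)" if "k \<in> {0..n}" for k
    using mod_hom_comp[OF dsum_component_hom[OF that, of K "\<lambda>k. Yt (int n) k"] assms[of k]] that by (simp add: Xbar_eq)
  then show ?thesis unfolding Xbar_eq by (intro dsum_hom module_Xbar[unfolded Xbar_eq])
qed

lemma N_norm: "N n (e - int n) x = ops.norm e n x"
  by (simp only: N_def ops.norm_def X_def)

lemma Tbar_hom: "Tbar n \<in> mod_hom K (Xbar n) (Xbar n)"
  using Xbar_hom[of n "\<lambda>k. T k (int n - int k)"] T_hom by (simp add: Tbar_def[abs_def])

lemma Rbar_hom: "Rbar \<rho> n \<in> mod_hom K (Xbar n) (Xbar n)"
  using Xbar_hom[of n "\<lambda>k. R \<rho> k (int n - int k)"] R_hom by (simp add: Rbar_def[abs_def])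

lemma Nbar_norm: "Nbar n x = (\<lambda>k\<in>{0..n}. ops.norm (int n) k (x k))"
  by (simp only: Nbar_def N_norm)

lemma Nbar_hom: "Nbar n \<in> mod_hom K (Xbar n) (Xbar n)"
  using Xbar_hom[of n "\<lambda>k. ops.norm (int n) k"] ops.norm_hom by (simp add: Nbar_norm[abs_def])

text \<open>
  The differential \<open>b\<close> is \<open>total_arcs True\<close>, and \<open>b'\<close> is \<open>total_arcs False\<close>.
\<close>

definition total_arcs :: "bool \<Rightarrow> nat \<Rightarrow> (nat \<Rightarrow> ('k, 'a) tens) \<Rightarrow> nat \<Rightarrow> ('k, 'a) tens"
  where "total_arcs w n x =
    (\<lambda>j\<in>{0..n}. \<Oplus>\<^bsub>Yt (int n) j\<^esub>i\<in>{0..Suc n - j}. ops.arcs w i (int (Suc n)) (j + i) (x (j + i)))"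

lemma arcs_component: "ops.arcs w i (int (Suc n)) (j + i) \<in> mod_hom K (Yt (int (Suc n)) (j + i)) (Yt (int n) j)"
proof -
  have e: "int (Suc n) - 1 = int n" "j + i - i = j" by simp_all
  show ?thesis using ops.arcs_hom[of i "j + i" w "int (Suc n)"] unfolding e by simp
qed

lemma b_diff_total:
  assumes q: "q \<in> {0, 1}" and x: "x \<in> carrier (Xbar (Suc n))"
  shows "b_diff q (Suc n) x = total_arcs (q = 0) n x"
proof -
  have e: "Suc n - 1 = n" "\<And>j. X j (int (Suc n) - 1 - int j) = Yt (int n) j" by (simp_all add: X_def)
  show ?thesis
    unfolding b_diff_def total_arcs_def e
  proof (intro restrict_ext finsum_congr[OF module_tpow])
    fix j i assume j: "j \<in> {0..n}" and i: "i \<in> {0..Suc n - j}"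
    then have ji: "j + i \<le> Suc n" by auto
    note xc = Xbar_component[OF x ji]
    show "dk q i (j + i) (int (Suc n) - int (j + i)) (x (j + i)) = ops.arcs (q = 0) i (int (Suc n)) (j + i) (x (j + i))"
      by (rule dk_arcs[OF le_add2 q xc])
    show "ops.arcs (q = 0) i (int (Suc n)) (j + i) (x (j + i)) \<in> carrier (Yt (int n) j)"
      by (rule mod_hom_closed[OF arcs_component xc])
  qed
qed

lemma total_hom: "total_arcs w n \<in> mod_hom K (Xbar (Suc n)) (Xbar n)"
proof -
  have "(\<lambda>x. \<Oplus>\<^bsub>Yt (int n) j\<^esub>i\<in>{0..Suc n - j}. ops.arcs w i (int (Suc n)) (j + i) (x (j + i))) \<in> mod_hom K (Xbar (Suc n)) (Yt (int n) j)"
    if j: "j \<in> {0..n}" for j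
  proof (rule mod_hom_sum[OF module_Xbar module_tpow])
    fix i assume "i \<in> {0..Suc n - j}"
    then have ji: "j + i \<in> {0..Suc n}" using j by auto
    show "(\<lambda>x. ops.arcs w i (int (Suc n)) (j + i) (x (j + i))) \<in> mod_hom K (Xbar (Suc n)) (Yt (int n) j)"
      unfolding Xbar_eq by (rule mod_hom_comp[OF dsum_component_hom[OF ji, of K "\<lambda>k. Yt (int (Suc n)) k"] arcs_component])
  qed
  from dsum_hom[OF module_Xbar this] show ?thesis unfolding total_arcs_def[abs_def] Xbar_eq[of n] .
qed

text \<open>
  An operator that acts on each summand commutes with the total differential if it commutes with the
  sums over arcs of each length.
\<close>

lemma total_commute:
  assumes x: "x \<in> carrier (Xbar (Suc n))"
    and F': "\<And>j. F' j \<in> mod_hom K (Yt (int n) j) (Yt (int n) j)"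
    and eq: "\<And>i k y. \<lbrakk>i \<le> k; y \<in> carrier (Yt (int (Suc n)) k)\<rbrakk> \<Longrightarrow>
      ops.arcs w i (int (Suc n)) k (F k y) = F' (k - i) (ops.arcs w' i (int (Suc n)) k y)"
  shows "total_arcs w n (\<lambda>k\<in>{0..Suc n}. F k (x k)) = (\<lambda>j\<in>{0..n}. F' j (total_arcs w' n x j))"
  unfolding total_arcs_def
proof (rule restrict_ext)
  fix j assume j: "j \<in> {0..n}"
  let ?G = "Yt (int n) j"
  have xc: "x (j + i) \<in> carrier (Yt (int (Suc n)) (j + i))" if "i \<in> {0..Suc n - j}" for i
    by (rule Xbar_component[OF x]) (use that j in auto)
  have ac: "ops.arcs w' i (int (Suc n)) (j + i) (x (j + i)) \<in> carrier ?G" if "i \<in> {0..Suc n - j}" for i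
    by (rule mod_hom_closed[OF arcs_component xc[OF that]])
  have "(\<Oplus>\<^bsub>?G\<^esub>i\<in>{0..Suc n - j}. ops.arcs w i (int (Suc n)) (j + i) ((\<lambda>k\<in>{0..Suc n}. F k (x k)) (j + i))) =
    (\<Oplus>\<^bsub>?G\<^esub>i\<in>{0..Suc n - j}. F' j (ops.arcs w' i (int (Suc n)) (j + i) (x (j + i))))"
  proof (rule finsum_congr[OF module_tpow])
    fix i assume i: "i \<in> {0..Suc n - j}"
    then have r: "(\<lambda>k\<in>{0..Suc n}. F k (x k)) (j + i) = F (j + i) (x (j + i))" using j by auto
    show "ops.arcs w i (int (Suc n)) (j + i) ((\<lambda>k\<in>{0..Suc n}. F k (x k)) (j + i)) =
      F' j (ops.arcs w' i (int (Suc n)) (j + i) (x (j + i)))"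
      unfolding r using eq[OF le_add2 xc[OF i]] by simp
    show "F' j (ops.arcs w' i (int (Suc n)) (j + i) (x (j + i))) \<in> carrier ?G"
      by (rule mod_hom_closed[OF F' ac[OF i]])
  qed
  also have "\<dots> = F' j (\<Oplus>\<^bsub>?G\<^esub>i\<in>{0..Suc n - j}. ops.arcs w' i (int (Suc n)) (j + i) (x (j + i)))"
    by (rule mod_hom_finsum[OF module_tpow module_tpow F' ac, symmetric])
  finally show "(\<Oplus>\<^bsub>?G\<^esub>i\<in>{0..Suc n - j}. ops.arcs w i (int (Suc n)) (j + i) ((\<lambda>k\<in>{0..Suc n}. F k (x k)) (j + i))) =
    F' j ((\<lambda>j\<in>{0..n}. \<Oplus>\<^bsub>Yt (int n) j\<^esub>i\<in>{0..Suc n - j}. ops.arcs w' i (int (Suc n)) (j + i) (x (j + i))) j)"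
    using j by simp
qed

text \<open>
  The pairs of arcs which contribute to the component \<open>j\<close> are grouped by the number \<open>s\<close> of letters which
  they remove, and \<open>arcs_arcs\<close> applies to each group. The group of the largest \<open>s\<close> lacks one summand, in
  which the differential of \<open>A\<close> is applied to the longest words; it is zero for reasons of degree.
\<close>

lemma total_total:
  assumes x: "x \<in> carrier (Xbar (Suc (Suc n)))"
  shows "total_arcs w n (total_arcs w (Suc n) x) = \<zero>\<^bsub>Xbar n\<^esub>"
  unfolding Xbar_zero total_arcs_def[of w n]
proof (rule restrict_ext)
  note One_nat_def [simp del]
  fix j assume "j \<in> {0..n}"
  then have j: "j \<le> n" by simp
  let ?G = "Yt (int n) j" and ?N = "int (Suc (Suc n))"
  have G: "module K ?G" by (rule module_tpow)
  define m where "m = Suc n - j"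
  have jm: "j + Suc m = Suc (Suc n)" using j by (simp add: m_def)
  define Z where "Z i i' = ops.arcs w i (int (Suc n)) (j + i) (ops.arcs w i' ?N (j + i + i') (x (j + i + i')))" for i i'
  have h1: "ops.arcs w i (int (Suc n)) (j + i) \<in> mod_hom K (Yt (int (Suc n)) (j + i)) ?G" for i
    by (rule arcs_component)
  have xc: "x (j + i + i') \<in> carrier (Yt ?N (j + i + i'))" if "i + i' \<le> Suc m" for i i'
    by (rule Xbar_component[OF x]) (use that jm in auto)
  have ac: "ops.arcs w i' ?N (j + i + i') (x (j + i + i')) \<in> carrier (Yt (int (Suc n)) (j + i))" if "i + i' \<le> Suc m" for i i'
    by (rule mod_hom_closed[OF arcs_component xc[OF that]])
  have Zc: "Z i i' \<in> carrier ?G" if "i + i' \<le> Suc m" for i i'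
    unfolding Z_def by (rule mod_hom_closed[OF h1 ac[OF that]])
  \<comment> \<open>the longest words of \<open>Xbar (n + 2)\<close> have degree zero, so the differential of \<open>A\<close> leads to degree \<open>-1\<close>\<close>
  have last: "Z (Suc m) 0 = \<zero>\<^bsub>?G\<^esub>"
  proof -
    have c: "ops.arcs w 0 ?N (j + Suc m + 0) (x (j + Suc m + 0)) \<in> carrier (Yt (int (Suc n)) (j + Suc m))" by (rule ac) simp
    have "ops.arcs w 0 ?N (j + Suc m + 0) (x (j + Suc m + 0)) = \<zero>\<^bsub>Yt (int (Suc n)) (j + Suc m)\<^esub>"
      by (rule tpow_negative[OF _ c]) (use jm in linarith)
    then show ?thesis unfolding Z_def by (simp only: mod_hom_zero[OF module_tpow G h1])
  qed
  have "(\<Oplus>\<^bsub>?G\<^esub>i\<in>{0..Suc n - j}. ops.arcs w i (int (Suc n)) (j + i) (total_arcs w (Suc n) x (j + i))) =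
    (\<Oplus>\<^bsub>?G\<^esub>i\<in>{0..m}. \<Oplus>\<^bsub>?G\<^esub>i'\<in>{0..Suc m - i}. Z i i')"
    unfolding m_def[symmetric]
  proof (rule finsum_congr[OF G])
    fix i assume "i \<in> {0..m}"
    then have i: "i \<le> m" by simp
    have ii: "i + i' \<le> Suc m" if "i' \<in> {0..Suc m - i}" for i' using that i by auto
    have ind: "Suc (Suc n) - (j + i) = Suc m - i" "j + i \<in> {0..Suc n}" using i jm by auto
    have "total_arcs w (Suc n) x (j + i) = (\<Oplus>\<^bsub>Yt (int (Suc n)) (j + i)\<^esub>i'\<in>{0..Suc m - i}. ops.arcs w i' ?N (j + i + i') (x (j + i + i')))"
      unfolding total_arcs_def restrict_def if_P[OF ind(2)] ind(1) ..
    then show "ops.arcs w i (int (Suc n)) (j + i) (total_arcs w (Suc n) x (j + i)) = (\<Oplus>\<^bsub>?G\<^esub>i'\<in>{0..Suc m - i}. Z i i')"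
      unfolding Z_def by (simp only: mod_hom_finsum[OF module_tpow G h1 ac[OF ii]])
    show "(\<Oplus>\<^bsub>?G\<^esub>i'\<in>{0..Suc m - i}. Z i i') \<in> carrier ?G" by (rule finsum_in_carrier[OF G Zc[OF ii]])
  qed
  also have "\<dots> = (\<Oplus>\<^bsub>?G\<^esub>i\<in>{0..m} \<union> {Suc m}. \<Oplus>\<^bsub>?G\<^esub>i'\<in>{0..Suc m - i}. Z i i')"
  proof -
    have c: "(\<Oplus>\<^bsub>?G\<^esub>i'\<in>{0..Suc m - i}. Z i i') \<in> carrier ?G" if "i \<in> {0..m} \<union> {Suc m}" for i
      by (rule finsum_in_carrier[OF G Zc]) (use that in auto)
    have z: "(\<Oplus>\<^bsub>?G\<^esub>i\<in>{Suc m}. \<Oplus>\<^bsub>?G\<^esub>i'\<in>{0..Suc m - i}. Z i i') = \<zero>\<^bsub>?G\<^esub>"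
      by (intro finsum_zeros[OF G]) (simp add: last)
    have "(\<Oplus>\<^bsub>?G\<^esub>i\<in>{0..m} \<union> {Suc m}. \<Oplus>\<^bsub>?G\<^esub>i'\<in>{0..Suc m - i}. Z i i') =
      (\<Oplus>\<^bsub>?G\<^esub>i\<in>{0..m}. \<Oplus>\<^bsub>?G\<^esub>i'\<in>{0..Suc m - i}. Z i i') \<oplus>\<^bsub>?G\<^esub> (\<Oplus>\<^bsub>?G\<^esub>i\<in>{Suc m}. \<Oplus>\<^bsub>?G\<^esub>i'\<in>{0..Suc m - i}. Z i i')"
      by (rule finsum_split[OF G _ _ _ c]) auto
    also have "\<dots> = (\<Oplus>\<^bsub>?G\<^esub>i\<in>{0..m}. \<Oplus>\<^bsub>?G\<^esub>i'\<in>{0..Suc m - i}. Z i i')"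
      unfolding z
      by (rule abelian_monoid.r_zero[OF abelian_group.axioms(1)[OF module_abelian_group[OF G]]], rule finsum_in_carrier[OF G c]) simp
    finally show ?thesis by (rule sym)
  qed
  also have "{0..m} \<union> {Suc m} = {0..Suc m}" by auto
  also have "(\<Oplus>\<^bsub>?G\<^esub>i\<in>{0..Suc m}. \<Oplus>\<^bsub>?G\<^esub>i'\<in>{0..Suc m - i}. Z i i') =
    (\<Oplus>\<^bsub>?G\<^esub>p\<in>Sigma {0..Suc m} (\<lambda>i. {0..Suc m - i}). Z (fst p) (snd p))"
    by (rule finsum_Sigma[OF G]) (auto intro!: Zc)
  also have "\<dots> = (\<Oplus>\<^bsub>?G\<^esub>p\<in>Sigma {0..Suc m} (\<lambda>s. {0..s}). Z (fst (snd p, fst p - snd p)) (snd (snd p, fst p - snd p)))"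
  proof (rule finsum_bij[OF G])
    show "bij_betw (\<lambda>p. (snd p, fst p - snd p)) (Sigma {0..Suc m} (\<lambda>s. {0..s})) (Sigma {0..Suc m} (\<lambda>i. {0..Suc m - i}))"
      by (rule bij_betw_byWitness[where f' = "\<lambda>p. (fst p + snd p, fst p)"]) auto
  qed (auto intro!: Zc)
  also have "\<dots> = (\<Oplus>\<^bsub>?G\<^esub>s\<in>{0..Suc m}. \<Oplus>\<^bsub>?G\<^esub>k\<in>{0..s}. Z k (s - k))"
    unfolding fst_conv snd_conv by (rule finsum_Sigma[OF G, symmetric]) (auto intro!: Zc)
  also have "\<dots> = \<zero>\<^bsub>?G\<^esub>"
  proof (rule finsum_zeros[OF G])
    fix s assume "s \<in> {0..Suc m}"
    then have s: "s \<le> Suc m" by simp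
    have e: "?N - 2 = int n" "?N - 1 = int (Suc n)" "j + s - s = j" by simp_all
    have xs: "x (j + s) \<in> carrier (Yt ?N (j + s))" using xc[of 0 s] s by simp
    have "(\<Oplus>\<^bsub>?G\<^esub>k\<in>{0..s}. Z k (s - k)) =
      (\<Oplus>\<^bsub>?G\<^esub>k\<in>{0..s}. ops.arcs w k (int (Suc n)) (j + s - (s - k)) (ops.arcs w (s - k) ?N (j + s) (x (j + s))))"
    proof (rule finsum_congr[OF G])
      fix k assume "k \<in> {0..s}"
      then have k: "j + s - (s - k) = j + k" "j + k + (s - k) = j + s" "k + (s - k) \<le> Suc m" using s by auto
      show eq: "Z k (s - k) = ops.arcs w k (int (Suc n)) (j + s - (s - k)) (ops.arcs w (s - k) ?N (j + s) (x (j + s)))"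
        unfolding Z_def k(1,2) ..
      show "ops.arcs w k (int (Suc n)) (j + s - (s - k)) (ops.arcs w (s - k) ?N (j + s) (x (j + s))) \<in> carrier ?G"
        unfolding eq[symmetric] by (rule Zc[OF k(3)])
    qed
    also have "\<dots> = \<zero>\<^bsub>?G\<^esub>" using ops.arcs_arcs[OF le_add2 xs, of w] unfolding e .
    finally show "(\<Oplus>\<^bsub>?G\<^esub>k\<in>{0..s}. Z k (s - k)) = \<zero>\<^bsub>?G\<^esub>" .
  qed
  finally show "(\<Oplus>\<^bsub>?G\<^esub>i\<in>{0..Suc n - j}. ops.arcs w i (int (Suc n)) (j + i) (total_arcs w (Suc n) x (j + i))) = \<zero>\<^bsub>?G\<^esub>" .
qed

end

lemma (in cyclic_operators) norm_R:
  assumes x: "x \<in> carrier (Y N n)"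
  shows "norm N n (R N n x) = R N n (norm N n x)"
proof -
  have "R N n (norm N n x) = R N n (\<Oplus>\<^bsub>Y N n\<^esub>i\<in>{0..int n}. Tp i N n x)"
    by (subst norm_interval[OF x]) simp_all
  also have "\<dots> = (\<Oplus>\<^bsub>Y N n\<^esub>i\<in>{0..int n}. R N n (Tp i N n x))"
    by (rule mod_hom_finsum[OF Y Y R_hom]) (rule Tp_closed[OF x])
  also have "\<dots> = (\<Oplus>\<^bsub>Y N n\<^esub>i\<in>{0..int n}. Tp (- i) N n (R N n x))" by (simp only: R_Tp[OF x])
  also have "\<dots> = (\<Oplus>\<^bsub>Y N n\<^esub>i\<in>{- int n..0}. Tp i N n (R N n x))"
  proof (rule finsum_bij[OF Y, symmetric])
    show "bij_betw uminus {0..int n} {- int n..0}" by (rule bij_betw_byWitness[where f' = uminus]) auto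
  qed (use x in simp)
  also have "\<dots> = norm N n (R N n x)" by (rule norm_interval) (use x in simp_all)
  finally show ?thesis ..
qed

section \<open>Dihedral homology in characteristic zero\<close>

context dihedral_sign
begin

lemma dihedral_complex:
  assumes inv: "\<And>n. \<exists>r\<in>carrier K. r \<otimes> ([Suc n] \<cdot>\<^bsub>K\<^esub> \<one>) = \<one>"
    and h: "h \<in> carrier K" "h \<oplus> h = \<one>"
  shows "dihedral_complex K Xbar Tbar (Rbar \<rho>) Nbar (b_diff 0) (b_diff 1) h"
proof -
  have e: "int (Suc n) - 1 = int n" for n by simp
  have q: "(0::nat) \<in> {0, 1}" "(1::nat) \<in> {0, 1}" "((0::nat) = 0) = True" "((1::nat) = 0) = False" by simp_all
  note b0 = b_diff_total[OF q(1), unfolded q(3)] and b1 = b_diff_total[OF q(2), unfolded q(4)]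
  have b: "b_diff 0 (Suc n) \<in> mod_hom K (Xbar (Suc n)) (Xbar n)" for n
    by (rule mod_hom_cong[OF total_hom b0 module_Xbar])
  have b': "b_diff 1 (Suc n) \<in> mod_hom K (Xbar (Suc n)) (Xbar n)" for n
    by (rule mod_hom_cong[OF total_hom b1 module_Xbar])
  note Tc = mod_hom_closed[OF Tbar_hom] and Rc = mod_hom_closed[OF Rbar_hom] and Nc = mod_hom_closed[OF Nbar_hom]
    and bc = mod_hom_closed[OF b] and b'c = mod_hom_closed[OF b']
  note comp = Xbar_component
  have Tk: "T k (int n - int k) \<in> mod_hom K (Yt (int n) k) (Yt (int n) k)" for n k by (rule T_hom)
  have Rk: "R \<rho> k (int n - int k) \<in> mod_hom K (Yt (int n) k) (Yt (int n) k)" for n k by (rule R_hom)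
  have minus_T: "x \<ominus>\<^bsub>Xbar n\<^esub> Tbar n x = (\<lambda>k\<in>{0..n}. x k \<ominus>\<^bsub>Yt (int n) k\<^esub> T k (int n - int k) (x k))"
    if x: "x \<in> carrier (Xbar n)" for n x
    unfolding Tbar_def by (rule Xbar_minus[OF x]) (rule mod_hom_closed[OF Tk comp[OF x]])
  show ?thesis
  proof (intro dihedral_complex.intro dihedral_complex_axioms.intro)
    show "cring K" by (rule is_cring)
    show "module K (Xbar n)" for n by (rule module_Xbar)
    show "Tbar n \<in> mod_hom K (Xbar n) (Xbar n)" for n by (rule Tbar_hom)
    show "Rbar \<rho> n \<in> mod_hom K (Xbar n) (Xbar n)" for n by (rule Rbar_hom)
    show "Nbar n \<in> mod_hom K (Xbar n) (Xbar n)" for n by (rule Nbar_hom)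
    show "b_diff 0 (Suc n) \<in> mod_hom K (Xbar (Suc n)) (Xbar n)" for n by (rule b)
    show "b_diff 1 (Suc n) \<in> mod_hom K (Xbar (Suc n)) (Xbar n)" for n by (rule b')
    show "Rbar \<rho> n (Rbar \<rho> n x) = x" if x: "x \<in> carrier (Xbar n)" for n x
      by (rule Xbar_eqI[OF Rc[OF Rc[OF x]] x]) (simp add: Rbar_def R_R[OF comp[OF x]])
    show "Tbar n (Rbar \<rho> n (Tbar n x)) = Rbar \<rho> n x" if x: "x \<in> carrier (Xbar n)" for n x
      by (rule Xbar_eqI[OF Tc[OF Rc[OF Tc[OF x]]] Rc[OF x]]) (simp add: Rbar_def Tbar_def T_R_T[OF comp[OF x]])
    show "Tbar n (Nbar n x) = Nbar n x" if x: "x \<in> carrier (Xbar n)" for n x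
    proof (rule Xbar_eqI[OF Tc[OF Nc[OF x]] Nc[OF x]])
      fix k assume k: "k \<le> n"
      have "T k (int n - int k) (ops.norm (int n) k (x k)) = ops.norm (int n) k (x k)"
        unfolding ops.T_eq_Tp[OF mod_hom_closed[OF ops.norm_hom comp[OF x k]]] by (rule ops.Tp_norm(1)[OF comp[OF x k]])
      then show "Tbar n (Nbar n x) k = Nbar n x k" using k by (simp add: Tbar_def Nbar_norm)
    qed
    show "Nbar n (Tbar n x) = Nbar n x" if x: "x \<in> carrier (Xbar n)" for n x
    proof (rule Xbar_eqI[OF Nc[OF Tc[OF x]] Nc[OF x]])
      fix k assume k: "k \<le> n"
      from ops.norm_T[OF comp[OF x k]] show "Nbar n (Tbar n x) k = Nbar n x k" using k by (simp add: Tbar_def Nbar_norm)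
    qed
    show "Nbar n (Rbar \<rho> n x) = Rbar \<rho> n (Nbar n x)" if x: "x \<in> carrier (Xbar n)" for n x
    proof (rule Xbar_eqI[OF Nc[OF Rc[OF x]] Rc[OF Nc[OF x]]])
      fix k assume k: "k \<le> n"
      from ops.norm_R[OF comp[OF x k]] show "Nbar n (Rbar \<rho> n x) k = Rbar \<rho> n (Nbar n x) k" using k by (simp add: Rbar_def Nbar_norm)
    qed
    show "b_diff 0 (Suc n) (Rbar \<rho> (Suc n) x) = Rbar \<rho> n (b_diff 0 (Suc n) x)" if x: "x \<in> carrier (Xbar (Suc n))" for n x
      unfolding b0[OF x] b0[OF Rc[OF x]] unfolding Rbar_def
      by (rule total_commute[OF x Rk]) (rule ops.arcs_R[where N = "int (Suc n)", unfolded e])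
    show "b_diff 1 (Suc n) (Rbar \<rho> (Suc n) (Tbar (Suc n) x)) = Rbar \<rho> n (Tbar n (b_diff 1 (Suc n) x))"
      if x: "x \<in> carrier (Xbar (Suc n))" for n x
    proof -
      have RT: "Rbar \<rho> m (Tbar m y) = (\<lambda>k\<in>{0..m}. R \<rho> k (int m - int k) (T k (int m - int k) (y k)))" for m y
        by (auto simp: Rbar_def Tbar_def intro!: restrict_ext)
      show ?thesis
        unfolding b1[OF x] b1[OF Rc[OF Tc[OF x]]] unfolding RT
        by (rule total_commute[OF x mod_hom_comp[OF Tk Rk]]) (rule ops.arcs_R_T[where N = "int (Suc n)", unfolded e])
    qed
    show "b_diff 0 (Suc n) (x \<ominus>\<^bsub>Xbar (Suc n)\<^esub> Tbar (Suc n) x) = b_diff 1 (Suc n) x \<ominus>\<^bsub>Xbar n\<^esub> Tbar n (b_diff 1 (Suc n) x)"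
      if x: "x \<in> carrier (Xbar (Suc n))" for n x
    proof -
      interpret Xb: module K "Xbar (Suc n)" by (rule module_Xbar)
      have c: "x \<ominus>\<^bsub>Xbar (Suc n)\<^esub> Tbar (Suc n) x \<in> carrier (Xbar (Suc n))" by (rule Xb.M.minus_closed[OF x Tc[OF x]])
      show ?thesis
        unfolding b0[OF c] unfolding minus_T[OF x] minus_T[OF b'c[OF x]] unfolding b1[OF x]
        by (rule total_commute[OF x mod_hom_minus[OF module_tpow mod_hom_ident Tk]])
          (rule ops.arcs_one_minus_T[where N = "int (Suc n)", unfolded e])
    qed
    show "b_diff 1 (Suc n) (Nbar (Suc n) x) = Nbar n (b_diff 0 (Suc n) x)" if x: "x \<in> carrier (Xbar (Suc n))" for n x
      unfolding b0[OF x] b1[OF Nc[OF x]] unfolding Nbar_norm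
      by (rule total_commute[OF x ops.norm_hom]) (rule ops.arcs_norm[where N = "int (Suc n)", unfolded e])
    show "b_diff 0 (Suc n) (b_diff 0 (Suc (Suc n)) x) = \<zero>\<^bsub>Xbar n\<^esub>" if x: "x \<in> carrier (Xbar (Suc (Suc n)))" for n x
      unfolding b0[OF bc[OF x]] unfolding b0[OF x] by (rule total_total[OF x])
    show "b_diff 1 (Suc n) (b_diff 1 (Suc (Suc n)) x) = \<zero>\<^bsub>Xbar n\<^esub>" if x: "x \<in> carrier (Xbar (Suc (Suc n)))" for n x
      unfolding b1[OF b'c[OF x]] unfolding b1[OF x] by (rule total_total[OF x])
    show "\<exists>w\<in>carrier (Xbar n). Nbar n w = x" if x: "x \<in> carrier (Xbar n)" and Tx: "Tbar n x = x" for n x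
    proof -
      obtain r where r: "\<And>k. r k \<in> carrier K" "\<And>k. r k \<otimes> ([Suc k] \<cdot>\<^bsub>K\<^esub> \<one>) = \<one>" using inv by metis
      let ?w = "\<lambda>k\<in>{0..n}. r k \<odot>\<^bsub>Yt (int n) k\<^esub> x k"
      have w: "?w \<in> carrier (Xbar n)"
        by (rule Xbar_closedI, rule module.smult_closed[OF module_tpow r(1) comp[OF x]])
      have "Nbar n ?w = x"
      proof (rule Xbar_eqI[OF Nc[OF w] x])
        fix k assume k: "k \<le> n"
        have "T k (int n - int k) (x k) = x k" using fun_cong[OF Tx, of k] k by (simp add: Tbar_def)
        from ops.fixed_point_norm[OF comp[OF x k] this r] show "Nbar n ?w k = x k" using k by (simp add: Nbar_norm)
      qed
      then show ?thesis using w by blast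
    qed
    show "\<exists>w\<in>carrier (Xbar n). w \<ominus>\<^bsub>Xbar n\<^esub> Tbar n w = x"
      if x: "x \<in> carrier (Xbar n)" and Nx: "Nbar n x = \<zero>\<^bsub>Xbar n\<^esub>" for n x
    proof -
      have "\<exists>y. y \<in> carrier (Yt (int n) k) \<and> y \<ominus>\<^bsub>Yt (int n) k\<^esub> T k (int n - int k) y = x k" if k: "k \<le> n" for k
      proof -
        obtain r where r: "r \<in> carrier K" "r \<otimes> ([Suc k] \<cdot>\<^bsub>K\<^esub> \<one>) = \<one>" using inv by blast
        have "ops.norm (int n) k (x k) = \<zero>\<^bsub>Yt (int n) k\<^esub>"
          using fun_cong[OF Nx, of k] k unfolding Xbar_zero Nbar_norm by simp
        from ops.norm_zero_preimage[OF comp[OF x k] this r] show ?thesis by blast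
      qed
      then obtain y where y: "\<And>k. k \<le> n \<Longrightarrow> y k \<in> carrier (Yt (int n) k)"
        "\<And>k. k \<le> n \<Longrightarrow> y k \<ominus>\<^bsub>Yt (int n) k\<^esub> T k (int n - int k) (y k) = x k" by metis
      interpret Xb: module K "Xbar n" by (rule module_Xbar)
      let ?w = "\<lambda>k\<in>{0..n}. y k"
      have w: "?w \<in> carrier (Xbar n)" by (rule Xbar_closedI[OF y(1)])
      have "?w \<ominus>\<^bsub>Xbar n\<^esub> Tbar n ?w = x"
      proof (rule Xbar_eqI[OF Xb.M.minus_closed[OF w Tc[OF w]] x])
        fix k assume k: "k \<le> n"
        then show "(?w \<ominus>\<^bsub>Xbar n\<^esub> Tbar n ?w) k = x k" unfolding minus_T[OF w] using y(2)[OF k] by simp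
      qed
      then show ?thesis using w by blast
    qed
    show "h \<in> carrier K" "h \<oplus> h = \<one>" by (rule h)+
  qed
qed

lemma dihedral_homology_iso:
  assumes "\<And>n. \<exists>r\<in>carrier K. r \<otimes> ([Suc n] \<cdot>\<^bsub>K\<^esub> \<one>) = \<one>" "h \<in> carrier K" "h \<oplus> h = \<one>"
    and P: "projective_resolution (Z2_ring K) (Z2_trivial K) P dP"
  shows "mod_isomorphic K (HD \<rho> P dP n) (homology (M \<rho>) (M_diff \<rho>) n)"
proof -
  interpret D: dihedral_complex K Xbar Tbar "Rbar \<rho>" Nbar "b_diff 0" "b_diff 1" h
    by (rule dihedral_complex[OF assms(1-3)])
  interpret Z: Z2_bicomplex K Xbar D.\<delta>1 D.\<delta>2 D.\<theta> h by (rule D.Z2_bicomplex)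
  have d1: "D.\<delta>1 = delta1" by (intro ext) (simp only: D.\<delta>1_def delta1_def)
  have d2: "D.\<delta>2 = delta2" by (intro ext) (simp only: D.\<delta>2_def delta2_def)
  have th: "D.\<theta> = theta \<rho>" by (intro ext) (simp only: D.\<theta>_def theta_def)
  have C: "(\<lambda>n m. Z2_module (Xbar n) (theta \<rho> n m)) = C \<rho>" by (simp add: fun_eq_iff C_def)
  have den: "Z.den n = M_denom \<rho> n" for n
    unfolding Z.den_def unfolding M_denom_def d2 th by (simp add: delta2_def theta_def)
  have M: "(\<lambda>n. quot_module (Xbar n) (Z.den n)) = M \<rho>" by (simp add: fun_eq_iff M_def den)
  have d1_0: "delta1 n 0 = b_diff 0 n" for n by (simp add: fun_eq_iff delta1_def)
  have q: "Z.q = M_diff \<rho>" unfolding Z.q_def unfolding M_diff_def[abs_def] den d1 d1_0 ..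
  show ?thesis
    using Z.hyperhomology_iso[OF P, of n] unfolding M q unfolding d1 d2 th C HD_def .
qed

end

theorem corollary2p1:
  fixes K :: "'k ring"
    and A :: "int \<Rightarrow> ('k, 'a) module" and d :: "int \<Rightarrow> 'a \<Rightarrow> 'a"
    and pi :: "nat \<Rightarrow> int \<Rightarrow> ('k, 'a) tens \<Rightarrow> 'a" and star :: "int \<Rightarrow> 'a \<Rightarrow> 'a"
    and \<rho> :: 'k
    and P :: "nat \<Rightarrow> ('k \<times> 'k, 'p) module" and dP :: "nat \<Rightarrow> 'p \<Rightarrow> 'p"
  assumes "field K"
    and char_zero: "\<And>n::nat. n > 0 \<Longrightarrow> [n] \<cdot>\<^bsub>K\<^esub> \<one>\<^bsub>K\<^esub> \<noteq> \<zero>\<^bsub>K\<^esub>"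
    and "involutive_A_infinity_algebra K A d pi star"
    and "\<rho> \<in> {\<one>\<^bsub>K\<^esub>, \<ominus>\<^bsub>K\<^esub> \<one>\<^bsub>K\<^esub>}"
    and "projective_resolution (Z2_ring K) (Z2_trivial K) P dP"
  shows "\<forall>n. mod_isomorphic K
    (involutive_A_infinity_algebra.HD K A d pi star \<rho> P dP n)
    (homology (involutive_A_infinity_algebra.M K A star \<rho>)
              (involutive_A_infinity_algebra.M_diff K A d pi star \<rho>) n)"
proof -
  interpret K: field K by fact
  have "\<rho> \<in> carrier K" "\<rho> \<otimes>\<^bsub>K\<^esub> \<rho> = \<one>\<^bsub>K\<^esub>" using assms(4) by (auto simp: K.l_minus K.r_minus)
  then have D: "dihedral_sign K A d pi star \<rho>"
    by (intro dihedral_sign.intro dihedral_sign_axioms.intro assms(3))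
  have inv: "\<exists>r\<in>carrier K. r \<otimes>\<^bsub>K\<^esub> ([Suc n] \<cdot>\<^bsub>K\<^esub> \<one>\<^bsub>K\<^esub>) = \<one>\<^bsub>K\<^esub>" for n
  proof -
    have "[Suc n] \<cdot>\<^bsub>K\<^esub> \<one>\<^bsub>K\<^esub> \<in> Units K" unfolding K.field_Units using char_zero[of "Suc n"] K.add.nat_pow_closed[of "\<one>\<^bsub>K\<^esub>" "Suc n"] by auto
    then show ?thesis using K.Units_l_inv K.Units_inv_closed by blast
  qed
  obtain h where h: "h \<in> carrier K" "h \<otimes>\<^bsub>K\<^esub> ([Suc 1] \<cdot>\<^bsub>K\<^esub> \<one>\<^bsub>K\<^esub>) = \<one>\<^bsub>K\<^esub>" using inv by blast
  have "h \<oplus>\<^bsub>K\<^esub> h = \<one>\<^bsub>K\<^esub>" using h by (simp add: K.r_distr)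
  then show ?thesis using dihedral_sign.dihedral_homology_iso[OF D inv h(1) _ assms(5)] by blast
qed

end
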